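(* Set $r=4$. For each $a>0$, the deformation functions at $\Omega_*$ of all dynamically isospectral $C^1$ families $\{\Omega_\tau\}_{|\tau|\le 1}$ in $\mathcal M^r$ with $\Omega_0=\Omega_*$ span a finite-dimensional space (of real functions on $S$).
   Context: For $a>0$, $\Omega_*\subset\mathbb R^2$ is the circular Bunimovich stadium: the convex domain bounded by the two flat edges $E_{\mathrm{top}}=[-a/2,a/2]\times\{1\}$, $E_{\mathrm{bot}}=[-a/2,a/2]\times\{-1\}$ and by the left and right unit semicircles centred at $(-a/2,0)$ and $(a/2,0)$. Class $\mathcal M^r$: a planar domain $\Omega$ belongs to $\mathcal M^r$ if (M1) $\partial\Omega=E_{\mathrm{top}}\cup E_{\mathrm{bot}}\cup\Gamma_1\cup\Gamma_2$, where $\Gamma_1,\Gamma_2$ are simple $C^r$ arcs of positive curvature joining respectively $(-a/2,1)$ to $(-a/2,-1)$ on the left and $(a/2,1)$ to $(a/2,-1)$ on the right, and $\Omega$ is convex; (M2) at each of the four junction points $(\pm a/2,\pm1)$ the arc meets the adjacent flat edge with $C^1$ tangency; (M3) $\Omega$ is symmetric under reflection across the horizontal axis $\{y=0\}$. $C^1$ family: for $\{\Omega_\tau\}_{|\tau|\le1}\subset\mathcal M^r$ and $i\in\{1,2\}$, put $S_i=[-\pi/2,\pi/2]$ and let $\gamma_{i,\tau}:S_i\to\partial\Omega_\tau$ be the constant-speed parametrization of the $i$-th arc ($i=1$ left, $i=2$ right) of $\Omega_\tau$, with $\gamma_{i,\tau}(-\pi/2)$ and $\gamma_{i,\tau}(\pi/2)$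 the junction points on $E_{\mathrm{bot}}$ and $E_{\mathrm{top}}$ respectively. The family is $C^1$ if $\tau\mapsto\gamma_{i,\tau}$ is $C^1$ with values in $C^r(S_i,\mathbb R^2)$ for $i=1,2$. Deformation function at $\Omega_*=\Omega_0$: the function $\mathbf n$ on the disjoint union $S=S_1\sqcup S_2$ given on $S_i$ by $\mathbf n_i(s_i)=\langle\partial_\tau\gamma_{i,\tau}(s_i)|_{\tau=0},N_{i,0}(s_i)\rangle$, where $N_{i,0}$ is the inward unit normal along $\gamma_{i,0}$ (the flat edges do not move, so the deformation function is zero there). Length spectrum: a closed billiard trajectory in a convex planar domain $\Omega$ with $C^1$ boundary is a closed polygon with finitely many ($\ge2$) vertices on $\partial\Omega$, with open sides inside $\Omega$, obeying the law of reflection (equal angles with the tangent line) at each vertex; its length is its perimeter, traversed once. $\mathcal L(\Omega)$ is the set of lengths of all closed billiard trajectories in $\Omega$. The family is dynamically isospectral if $\mathcal L(\Omega_\tau)=\mathcal L(\Omega_0)$ for every $\tau\in[-1,1]$. *)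

theory Defs
  imports "HOL-Analysis.Analysis" "HOL-Library.Function_Algebras"
begin

section \<open>Real functions as a real vector space\<close>

instantiation "fun" :: (type, real_vector) real_vector
begin

definition scaleR_fun :: "real \<Rightarrow> ('a \<Rightarrow> 'b) \<Rightarrow> 'a \<Rightarrow> 'b" where
  "scaleR_fun c f = (\<lambda>x. c *\<^sub>R f x)"

instance
  by standard (auto simp: scaleR_fun_def fun_eq_iff scaleR_right_distrib scaleR_left_distrib)

end


section \<open>Curves of class \<open>C\<^sup>r\<close> on an interval\<close>

text \<open>On a compact interval the derivatives at the end points are the one-sided ones.\<close>

definition nderiv :: "nat \<Rightarrow> real set \<Rightarrow> (real \<Rightarrow> 'a::real_normed_vector) \<Rightarrow> real \<Rightarrow> 'a" where
  "nderiv k S f = ((\<lambda>g s. vector_derivative g (at s within S)) ^^ k) f"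

definition Cr_on :: "nat \<Rightarrow> real set \<Rightarrow> (real \<Rightarrow> 'a::real_normed_vector) \<Rightarrow> bool" where
  "Cr_on r S f \<longleftrightarrow>
     (\<forall>k<r. \<forall>s\<in>S. (nderiv k S f has_vector_derivative nderiv (Suc k) S f s) (at s within S)) \<and>
     continuous_on S (nderiv r S f)"

definition Cr_norm :: "nat \<Rightarrow> real set \<Rightarrow> (real \<Rightarrow> 'a::real_normed_vector) \<Rightarrow> real" where
  "Cr_norm r S f = (\<Sum>k\<le>r. SUP s\<in>S. norm (nderiv k S f s))"

text \<open>The map \<open>\<tau> \<mapsto> \<gamma> \<tau>\<close>, for \<open>\<tau>\<close> in \<open>T\<close>, is continuously differentiable as a map into
  the Banach space \<open>C\<^sup>r(S)\<close>; \<open>\<gamma>'\<close> is its derivative.\<close>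

definition C1_into_Cr ::
  "nat \<Rightarrow> real set \<Rightarrow> real set \<Rightarrow> (real \<Rightarrow> real \<Rightarrow> 'a::real_normed_vector) \<Rightarrow> bool" where
  "C1_into_Cr r T S \<gamma> \<longleftrightarrow>
     (\<forall>\<tau>\<in>T. Cr_on r S (\<gamma> \<tau>)) \<and>
     (\<exists>\<gamma>'. \<forall>t\<in>T.
        Cr_on r S (\<gamma>' t) \<and>
        ((\<lambda>\<tau>. Cr_norm r S (\<lambda>s. (\<gamma> \<tau> s - \<gamma> t s) /\<^sub>R (\<tau> - t) - \<gamma>' t s)) \<longlongrightarrow> 0) (at t within T) \<and>
        ((\<lambda>\<tau>. Cr_norm r S (\<lambda>s. \<gamma>' \<tau> s - \<gamma>' t s)) \<longlongrightarrow> 0) (at t within T))"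


section \<open>The stadium and the class \<open>\<M>\<^sup>r\<close>\<close>

type_synonym point = "real \<times> real"

definition E_top :: "real \<Rightarrow> point set" where
  "E_top a = {-a/2..a/2} \<times> {1}"

definition E_bot :: "real \<Rightarrow> point set" where
  "E_bot a = {-a/2..a/2} \<times> {-1}"

definition left_semicircle :: "real \<Rightarrow> point set" where
  "left_semicircle a = {p \<in> sphere (-a/2, 0) 1. fst p \<le> -a/2}"

definition right_semicircle :: "real \<Rightarrow> point set" where
  "right_semicircle a = {p \<in> sphere (a/2, 0) 1. fst p \<ge> a/2}"

definition stadium :: "real \<Rightarrow> point set" where
  "stadium a = {-a/2..a/2} \<times> {-1<..<1} \<union> ball (-a/2, 0) 1 \<union> ball (a/2, 0) 1"

text \<open>Signed curvature \<open>det (g', g'') / \<bar>g'\<bar>\<^sup>3\<close> of a regular curve on \<open>[0, 1]\<close>.\<close>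

definition curvature :: "(real \<Rightarrow> point) \<Rightarrow> real \<Rightarrow> real" where
  "curvature g s =
     (let v = nderiv 1 {0..1} g s; w = nderiv 2 {0..1} g s
      in (fst v * snd w - snd v * fst w) / norm v ^ 3)"

text \<open>\<open>\<Gamma>\<close> is a simple \<open>C\<^sup>r\<close> arc of positive curvature from \<open>P\<close> to \<open>Q\<close>, with unit tangent
  vectors \<open>u\<close> at \<open>P\<close> and \<open>v\<close> at \<open>Q\<close>.\<close>

definition positive_Cr_arc ::
  "nat \<Rightarrow> point \<Rightarrow> point \<Rightarrow> point \<Rightarrow> point \<Rightarrow> point set \<Rightarrow> bool" where
  "positive_Cr_arc r P u Q v \<Gamma> \<longleftrightarrow>
     (\<exists>g. arc g \<and> path_image g = \<Gamma> \<and> pathstart g = P \<and> pathfinish g = Q \<and>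
          Cr_on r {0..1} g \<and>
          (\<forall>s\<in>{0..1}. nderiv 1 {0..1} g s \<noteq> 0 \<and> curvature g s > 0) \<and>
          sgn (nderiv 1 {0..1} g 0) = u \<and> sgn (nderiv 1 {0..1} g 1) = v)"

text \<open>\<open>\<Omega>\<close> is in the class \<open>\<M>\<^sup>r\<close>, with left arc \<open>\<Gamma>1\<close> and right arc \<open>\<Gamma>2\<close>. Both arcs are
  traversed counterclockwise, the orientation for which the signed curvature of the boundary
  of a convex domain is nonnegative. \<open>C\<^sup>1\<close> tangency at a junction means that the unit tangent
  of the arc there is that of the adjacent flat edge, which in this orientation is \<open>(-1, 0)\<close>
  on the top edge and \<open>(1, 0)\<close> on the bottom edge.\<close>

definition M_class_arcs :: "nat \<Rightarrow> real \<Rightarrow> point set \<Rightarrow> point set \<Rightarrow> point set \<Rightarrow> bool" where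
  "M_class_arcs r a \<Omega> \<Gamma>1 \<Gamma>2 \<longleftrightarrow>
     open \<Omega> \<and> \<Omega> \<noteq> {} \<and> convex \<Omega> \<and>
     frontier \<Omega> = E_top a \<union> E_bot a \<union> \<Gamma>1 \<union> \<Gamma>2 \<and>
     positive_Cr_arc r (-a/2, 1) (-1, 0) (-a/2, -1) (1, 0) \<Gamma>1 \<and>
     positive_Cr_arc r (a/2, -1) (1, 0) (a/2, 1) (-1, 0) \<Gamma>2 \<and>
     (\<forall>p\<in>\<Gamma>1. fst p \<le> -a/2) \<and> (\<forall>p\<in>\<Gamma>2. fst p \<ge> a/2) \<and>
     (\<lambda>(x, y). (x, - y)) ` \<Omega> = \<Omega>"

definition M_class :: "nat \<Rightarrow> real \<Rightarrow> point set set" where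
  "M_class r a = {\<Omega>. \<exists>\<Gamma>1 \<Gamma>2. M_class_arcs r a \<Omega> \<Gamma>1 \<Gamma>2}"


section \<open>\<open>C\<^sup>1\<close> families and deformation functions\<close>

definition S_int :: "real set" where
  "S_int = {-pi/2..pi/2}"

definition constant_speed_param :: "point \<Rightarrow> point \<Rightarrow> point set \<Rightarrow> (real \<Rightarrow> point) \<Rightarrow> bool" where
  "constant_speed_param P Q \<Gamma> \<gamma> \<longleftrightarrow>
     Cr_on 1 S_int \<gamma> \<and> inj_on \<gamma> S_int \<and> \<gamma> ` S_int = \<Gamma> \<and> \<gamma> (-pi/2) = P \<and> \<gamma> (pi/2) = Q \<and>
     (\<exists>c. \<forall>s\<in>S_int. norm (nderiv 1 S_int \<gamma> s) = c)"

text \<open>\<open>\<gamma>1 \<tau>\<close> and \<open>\<gamma>2 \<tau>\<close> are the constant-speed parametrizations of the left and the right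
  arc of \<open>\<Omega> \<tau>\<close>. Only parameters \<open>\<tau>\<close> in \<open>[-1, 1]\<close> matter.\<close>

definition C1_family ::
  "nat \<Rightarrow> real \<Rightarrow> (real \<Rightarrow> point set) \<Rightarrow> (real \<Rightarrow> real \<Rightarrow> point) \<Rightarrow> (real \<Rightarrow> real \<Rightarrow> point) \<Rightarrow> bool"
  where
  "C1_family r a \<Omega> \<gamma>1 \<gamma>2 \<longleftrightarrow>
     (\<forall>\<tau>\<in>{-1..1}. \<Omega> \<tau> \<in> M_class r a \<and>
        (\<exists>\<Gamma>1 \<Gamma>2. M_class_arcs r a (\<Omega> \<tau>) \<Gamma>1 \<Gamma>2 \<and>
           constant_speed_param (-a/2, -1) (-a/2, 1) \<Gamma>1 (\<gamma>1 \<tau>) \<and>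
           constant_speed_param (a/2, -1) (a/2, 1) \<Gamma>2 (\<gamma>2 \<tau>))) \<and>
     C1_into_Cr r {-1..1} S_int \<gamma>1 \<and> C1_into_Cr r {-1..1} S_int \<gamma>2"

definition inward_normal :: "point set \<Rightarrow> (real \<Rightarrow> point) \<Rightarrow> real \<Rightarrow> point" where
  "inward_normal \<Omega> \<gamma> s =
     (THE n. norm n = 1 \<and> n \<bullet> nderiv 1 S_int \<gamma> s = 0 \<and>
             (\<exists>\<epsilon>>0. \<forall>t\<in>{0<..<\<epsilon>}. \<gamma> s + t *\<^sub>R n \<in> \<Omega>))"

text \<open>A real function on the disjoint union \<open>S_int <+> S_int\<close> is identified with its extension
  by zero to the type \<^typ>\<open>real + real\<close>.\<close>

definition deformation ::
  "(real \<Rightarrow> point set) \<Rightarrow> (real \<Rightarrow> real \<Rightarrow> point) \<Rightarrow> (real \<Rightarrow> real \<Rightarrow> point) \<Rightarrow> real + real \<Rightarrow> real" where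
  "deformation \<Omega> \<gamma>1 \<gamma>2 z =
     (if z \<in> S_int <+> S_int then
        (case z of
           Inl s \<Rightarrow> vector_derivative (\<lambda>\<tau>. \<gamma>1 \<tau> s) (at 0) \<bullet> inward_normal (\<Omega> 0) (\<gamma>1 0) s
         | Inr s \<Rightarrow> vector_derivative (\<lambda>\<tau>. \<gamma>2 \<tau> s) (at 0) \<bullet> inward_normal (\<Omega> 0) (\<gamma>2 0) s)
      else 0)"


section \<open>Billiards and the length spectrum\<close>

text \<open>For a \<open>C\<^sup>1\<close> curve \<open>F\<close> the tangent line at \<open>p\<close> is \<open>p + tangent_space F p\<close>.\<close>

definition tangent_space :: "point set \<Rightarrow> point \<Rightarrow> point set" where
  "tangent_space F p =
     {u. \<exists>c. c C1_differentiable_on {-1<..<1} \<and> c ` {-1<..<1} \<subseteq> F \<and> c 0 = p \<and>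
             (c has_vector_derivative u) (at 0)}"

text \<open>A side arriving at \<open>p\<close> from \<open>q\<close> and leaving towards \<open>q'\<close>: the angle from \<open>-u\<close> to
  \<open>q - p\<close> is the angle from \<open>u\<close> to \<open>q' - p\<close>, for every tangent vector \<open>u\<close>.\<close>

definition reflection_law :: "point set \<Rightarrow> point \<Rightarrow> point \<Rightarrow> point \<Rightarrow> bool" where
  "reflection_law \<Omega> q p q' \<longleftrightarrow>
     (\<forall>u\<in>tangent_space (frontier \<Omega>) p. sgn (q - p) \<bullet> (- u) = sgn (q' - p) \<bullet> u)"

text \<open>The vertices of a closed trajectory are listed as a periodic sequence. Its number of
  vertices \<open>n\<close> is the least period, so that the trajectory is traversed once.\<close>

definition closed_billiard_trajectory :: "point set \<Rightarrow> nat \<Rightarrow> (nat \<Rightarrow> point) \<Rightarrow> bool" where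
  "closed_billiard_trajectory \<Omega> n p \<longleftrightarrow>
     n \<ge> 2 \<and> (\<forall>i. p (i + n) = p i) \<and>
     (\<forall>d. 0 < d \<and> d < n \<longrightarrow> (\<exists>i. p (i + d) \<noteq> p i)) \<and>
     (\<forall>i. p i \<in> frontier \<Omega> \<and> p i \<noteq> p (Suc i) \<and> open_segment (p i) (p (Suc i)) \<subseteq> \<Omega> \<and>
          reflection_law \<Omega> (p i) (p (Suc i)) (p (Suc (Suc i))))"

definition length_spectrum :: "point set \<Rightarrow> real set" where
  "length_spectrum \<Omega> =
     {\<Sum>i<n. dist (p i) (p (Suc i)) | n p. closed_billiard_trajectory \<Omega> n p}"

definition dynamically_isospectral :: "(real \<Rightarrow> point set) \<Rightarrow> bool" where
  "dynamically_isospectral \<Omega> \<longleftrightarrow>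
     (\<forall>\<tau>\<in>{-1..1}. length_spectrum (\<Omega> \<tau>) = length_spectrum (\<Omega> 0))"

end

theory Submission
  imports Defs "HOL-Real_Asymp.Real_Asymp"
begin

text \<open>For \<open>\<beta> \<ge> 0\<close> a billiard polygon of the stadium with \<open>m\<^sub>1\<close> vertices on the left
  semicircle and \<open>m\<^sub>2\<close> on the right one, whose long sides are tilted by \<open>\<beta>\<close>, is a strict local maximum
  of the perimeter, so in a nearby domain a local maximum of the perimeter is again a closed trajectory.
  Along an isospectral family its length lies in the length spectrum of the stadium. That set contains
  no interval: a derivation of the reals that kills \<open>a\<close> moves the vertices of a trajectory
  tangentially, so by the law of reflection it kills the length, whereas a nonzero derivation vanishes on no interval. The
  maximal length is therefore constant, and its first variation vanishes, which says that a weighted sum of values of the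
  deformation function over the vertices is zero. Expanded in the Fourier cosine series of the two arcs, these
  identities form a system that becomes diagonally dominant, in a suitable weight, beyond finitely many modes;
  the decay of the coefficients of a \<open>C\<^sup>4\<close> function suffices, because the normal
  deformation is even and vanishes with its derivative at the junctions. So finitely many low modes determine the
  deformation function.\<close>


section \<open>Derivations of the real field\<close>

text \<open>Two families of orbits are used. With m vertices on each arc and \<beta> = 0 only the
  sum of the two deformation functions is seen; these rows vanish off the multiples of m, and the
  sum is settled first. Once it is zero, orbits with m vertices on the left and 2m on the right
  isolate one function. There the tilt is the obstacle: \<beta> is of order 1/m^2, and a low mode k
  enters the row with coefficient -2 \<beta> (-1)^k up to a smaller error, whereas the weight k^4
  available for a C^4 function tolerates only 1/m^4 against a diagonal entry of size 1. Adding 2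
  \<beta> times the cosine series of h(pi/2) = 0 cancels exactly this leading term and leaves
  k^2/m^4. The absence of intervals in the length spectrum is proved by algebra, where a Sard
  argument would have to cope with junctions at which the boundary is not twice differentiable.
  Strict maxima, unlike general critical points, persist by compactness alone: neither a
  nondegenerate Hessian nor a smooth continuation of the orbit in the parameter is required.\<close>

definition derivation_on :: "real set \<Rightarrow> (real \<Rightarrow> real) \<Rightarrow> bool" where
  "derivation_on R D \<longleftrightarrow> 1 \<in> R \<and>
     (\<forall>x\<in>R. \<forall>y\<in>R. x + y \<in> R \<and> - x \<in> R \<and> x * y \<in> R \<and>
        D (x + y) = D x + D y \<and> D (x * y) = D x * y + x * D y)"

lemma derivation_onD:
  assumes "derivation_on R D"
  shows "1 \<in> R" "0 \<in> R" "x \<in> R \<Longrightarrow> - x \<in> R"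
    "x \<in> R \<Longrightarrow> y \<in> R \<Longrightarrow> x + y \<in> R" "x \<in> R \<Longrightarrow> y \<in> R \<Longrightarrow> x * y \<in> R"
    "x \<in> R \<Longrightarrow> y \<in> R \<Longrightarrow> D (x + y) = D x + D y"
    "x \<in> R \<Longrightarrow> y \<in> R \<Longrightarrow> D (x * y) = D x * y + x * D y"
    "D 0 = 0" "D 1 = 0" "x \<in> R \<Longrightarrow> D (- x) = - D x"
proof -
  note d = assms[unfolded derivation_on_def]
  show one: "1 \<in> R" and neg: "x \<in> R \<Longrightarrow> - x \<in> R" for x using d by auto
  show "x \<in> R \<Longrightarrow> y \<in> R \<Longrightarrow> x + y \<in> R" "x \<in> R \<Longrightarrow> y \<in> R \<Longrightarrow> x * y \<in> R" using d by auto
  show add: "x \<in> R \<Longrightarrow> y \<in> R \<Longrightarrow> D (x + y) = D x + D y" for x y using d by auto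
  show "x \<in> R \<Longrightarrow> y \<in> R \<Longrightarrow> D (x * y) = D x * y + x * D y" using d by auto
  have "1 + (- 1) \<in> R" using d by blast
  then show zero: "0 \<in> R" by simp
  show z: "D 0 = 0" using add[OF zero zero] by simp
  have "D (1 * 1) = D 1 * 1 + 1 * D 1" using d by blast
  then show "D 1 = 0" by simp
  show "x \<in> R \<Longrightarrow> D (- x) = - D x" using add[of x "- x"] neg[of x] z by auto
qed

lemma derivation_on_sum:
  assumes "derivation_on R D" "finite A" "\<And>i. i \<in> A \<Longrightarrow> f i \<in> R"
  shows "sum f A \<in> R \<and> D (sum f A) = (\<Sum>i\<in>A. D (f i))"
  using assms(2,3)
  by (induction A rule: finite_induct) (auto simp: derivation_onD[OF assms(1)])

definition polys_over :: "real set \<Rightarrow> real poly set" where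
  "polys_over R = {p. \<forall>i. coeff p i \<in> R}"

text \<open>The value at p(x) of an extension of \<open>D\<close> that sends x to \<open>v\<close>,
  as dictated by the Leibniz rule: differentiate the coefficients, then the argument. It is attached
  to the polynomial, not to its value, until well-definedness is known.\<close>

definition ext_deriv :: "(real \<Rightarrow> real) \<Rightarrow> real \<Rightarrow> real \<Rightarrow> real poly \<Rightarrow> real" where
  "ext_deriv D x v p = poly (map_poly D p) x + poly (pderiv p) x * v"

context
  fixes R D assumes der: "derivation_on R D"
begin

lemma polys_over_ring:
  assumes "p \<in> polys_over R" "q \<in> polys_over R"
  shows "p + q \<in> polys_over R" "- p \<in> polys_over R" "p * q \<in> polys_over R"
    "p - q \<in> polys_over R"
proof -
  note d = derivation_onD[OF der]
  have c: "coeff p i \<in> R" "coeff q i \<in> R" for i using assms by (auto simp: polys_over_def)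
  show "p + q \<in> polys_over R" "- p \<in> polys_over R" by (auto simp: polys_over_def d c)
  show "p - q \<in> polys_over R"
    using d(4)[OF c(1) d(3)[OF c(2)]] by (auto simp: polys_over_def)
  have "(\<Sum>j\<le>i. coeff p j * coeff q (i - j)) \<in> R" for i
    using derivation_on_sum[OF der, of "{..i}" "\<lambda>j. coeff p j * coeff q (i - j)"]
    by (simp add: c d(5))
  then show "p * q \<in> polys_over R" by (simp add: polys_over_def coeff_mult)
qed

lemma polys_over_monom: "c \<in> R \<Longrightarrow> monom c n \<in> polys_over R"
  using derivation_onD[OF der] by (auto simp: polys_over_def)

lemma map_poly_derivation:
  assumes "p \<in> polys_over R" "q \<in> polys_over R"
  shows "map_poly D (p + q) = map_poly D p + map_poly D q"
    "map_poly D (p * q) = map_poly D p * q + p * map_poly D q"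
    "map_poly D (- p) = - map_poly D p"
proof -
  note d = derivation_onD[OF der]
  have c: "coeff p i \<in> R" "coeff q i \<in> R" for i using assms by (auto simp: polys_over_def)
  show "map_poly D (p + q) = map_poly D p + map_poly D q"
    by (intro poly_eqI) (simp add: coeff_map_poly d c)
  show "map_poly D (- p) = - map_poly D p"
    by (intro poly_eqI) (simp add: coeff_map_poly d c)
  show "map_poly D (p * q) = map_poly D p * q + p * map_poly D q"
  proof (intro poly_eqI)
    fix n
    have "coeff (map_poly D (p * q)) n = (\<Sum>i\<le>n. D (coeff p i * coeff q (n - i)))"
      using derivation_on_sum[OF der, of "{..n}" "\<lambda>i. coeff p i * coeff q (n - i)"]
      by (simp add: coeff_map_poly d c coeff_mult)
    also have "\<dots> = (\<Sum>i\<le>n. D (coeff p i) * coeff q (n - i) + coeff p i * D (coeff q (n - i)))"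
      by (intro sum.cong) (simp_all add: d c)
    finally show "coeff (map_poly D (p * q)) n = coeff (map_poly D p * q + p * map_poly D q) n"
      by (simp add: coeff_mult coeff_map_poly d sum.distrib)
  qed
qed

lemma ext_deriv_rules:
  assumes "p \<in> polys_over R" "q \<in> polys_over R"
  shows "ext_deriv D x v (p + q) = ext_deriv D x v p + ext_deriv D x v q"
    "ext_deriv D x v (- p) = - ext_deriv D x v p"
    "ext_deriv D x v (p * q) = ext_deriv D x v p * poly q x + poly p x * ext_deriv D x v q"
  using assms
  unfolding ext_deriv_def
  by (simp_all add: map_poly_derivation pderiv_add pderiv_mult pderiv_minus algebra_simps)

text \<open>If x satisfies no equation over \<open>R\<close>, every \<open>v\<close> is consistent
  and 1 is chosen; otherwise \<open>v\<close> is forced by an equation of least degree. The boolean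
  \<open>transc\<close> lets one statement serve two uses: set to true it demands transcendence and
  returns \<open>v = 1\<close>, set to false it demands nothing.\<close>

lemma ext_deriv_exists:
  assumes tr: "transc \<longrightarrow> (\<forall>p\<in>polys_over R. poly p x = 0 \<longrightarrow> p = 0)"
  obtains v where "\<And>p. p \<in> polys_over R \<Longrightarrow> poly p x = 0 \<Longrightarrow> ext_deriv D x v p = 0"
    "transc \<Longrightarrow> v = 1"
proof (cases "\<forall>p\<in>polys_over R. poly p x = 0 \<longrightarrow> p = 0")
  case True
  then show ?thesis by (intro that[of 1]) (auto simp: ext_deriv_def)
next
  case False
  define Q where "Q = (\<lambda>p. p \<in> polys_over R \<and> poly p x = 0 \<and> p \<noteq> 0)"
  obtain \<mu> where mu: "Q \<mu>" and min: "\<And>p. Q p \<Longrightarrow> degree \<mu> \<le> degree p"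
    using ex_has_least_nat[of Q _ degree] False unfolding Q_def by blast
  have muR: "\<mu> \<in> polys_over R" and mu0: "poly \<mu> x = 0" "\<mu> \<noteq> 0" using mu by (auto simp: Q_def)
  note d = derivation_onD[OF der]
  have deg: "degree \<mu> \<noteq> 0"
  proof
    assume "degree \<mu> = 0"
    then obtain c where "\<mu> = [:c:]" by (rule degree_eq_zeroE)
    then show False using mu0 by simp
  qed
  have of_natR: "of_nat n \<in> R" for n by (induction n) (auto simp: d)
  have pdR: "pderiv \<mu> \<in> polys_over R"
    using muR of_natR d by (auto simp: polys_over_def coeff_pderiv simp del: of_nat_Suc)
  \<comment> \<open>A common root with the derivative would contradict the least degree, since in
    characteristic zero the derivative of a nonconstant polynomial is nonzero. This permits the
    division in \<open>v\<close>.\<close>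
  have "poly (pderiv \<mu>) x \<noteq> 0"
  proof
    assume "poly (pderiv \<mu>) x = 0"
    moreover have "pderiv \<mu> \<noteq> 0" using deg by (simp add: pderiv_eq_0_iff)
    ultimately have "degree \<mu> \<le> degree (pderiv \<mu>)" using min pdR by (auto simp: Q_def)
    then show False using deg by (simp add: degree_pderiv)
  qed
  define v where "v = - poly (map_poly D \<mu>) x / poly (pderiv \<mu>) x"
  have ev: "ext_deriv D x v \<mu> = 0"
    using \<open>poly (pderiv \<mu>) x \<noteq> 0\<close> by (simp add: ext_deriv_def v_def)
  have "ext_deriv D x v p = 0" if "p \<in> polys_over R" "poly p x = 0" for p
    using that
  proof (induction "degree p" arbitrary: p rule: less_induct)
    case less
    show ?case
    proof (cases "p = 0")
      case False
      then have le: "degree \<mu> \<le> degree p" using less.prems min by (auto simp: Q_def)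
      define k where "k = degree p - degree \<mu>"
      \<comment> \<open>Pseudo-division: \<open>R\<close> is only a ring, so \<open>p\<close> is
        multiplied by the leading coefficient of \<mu> before its top term is cancelled. The factor
        \<open>poly A x\<close> is a nonzero real and is divided out at the end.\<close>
      define A where "A = monom (lead_coeff \<mu>) 0"
      define B where "B = monom (lead_coeff p) k"
      define p1 where "p1 = A * p + (- (B * \<mu>))"
      have AR: "A \<in> polys_over R" "B \<in> polys_over R"
        using muR less.prems unfolding A_def B_def
        by (intro polys_over_monom; simp add: polys_over_def)+
      have p1R: "p1 \<in> polys_over R" unfolding p1_def
        using AR muR less.prems polys_over_ring by auto
      have p1x: "poly p1 x = 0" using mu0 less.prems by (simp add: p1_def)
      have "ext_deriv D x v p1 = 0"
      proof (cases "p1 = 0")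
        case True then show ?thesis by (simp add: ext_deriv_def)
      next
        case False
        have "degree p1 \<le> degree p"
        proof -
          have "degree (A * p) \<le> degree p" unfolding A_def
            by (rule order_trans[OF degree_mult_le]) (simp add: degree_monom_le monom_0)
          moreover have "degree (B * \<mu>) \<le> degree p"
            using le degree_monom_le[of "lead_coeff p" k] unfolding B_def k_def
            by (intro order_trans[OF degree_mult_le]) linarith
          ultimately show ?thesis unfolding p1_def by (intro degree_add_le) auto
        qed
        moreover have "coeff p1 (degree p) = 0"
          using le by (simp add: p1_def A_def B_def k_def monom_0 coeff_monom_mult)
        moreover have "degree p \<noteq> 0" using deg le by simp
        ultimately have "degree p1 < degree p"
          using False by (metis le_neq_implies_less leading_coeff_0_iff)
        then show ?thesis using less.hyps p1R p1x by blast
      qed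
      moreover have "ext_deriv D x v p1 = poly A x * ext_deriv D x v p"
        unfolding p1_def
        using ext_deriv_rules(1)[OF polys_over_ring(3)[OF AR(1) less.prems(1)]
            polys_over_ring(2)[OF polys_over_ring(3)[OF AR(2) muR] muR]]
          ext_deriv_rules(2)[OF polys_over_ring(3)[OF AR(2) muR] muR]
          ext_deriv_rules(3)[OF AR(1) less.prems(1)] ext_deriv_rules(3)[OF AR(2) muR]
          less.prems mu0 ev by simp
      moreover have "poly A x \<noteq> 0" using mu0 by (simp add: A_def monom_0)
      ultimately show ?thesis by simp
    qed (simp add: ext_deriv_def)
  qed
  then show ?thesis using that False tr by blast
qed

text \<open>The new ring consists of the values at \<open>x\<close> of polynomials over
  \<open>R\<close>. Two polynomials with equal value differ by one that vanishes at
  \<open>x\<close>, so \<open>ext_deriv\<close> descends to values. Rings, not fields, are extended,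
  so no inverses have to be adjoined.\<close>

lemma derivation_on_extend:
  assumes tr: "transc \<longrightarrow> (\<forall>p\<in>polys_over R. poly p x = 0 \<longrightarrow> p = 0)"
  obtains R' D' where "derivation_on R' D'" "R \<subseteq> R'" "x \<in> R'" "\<And>y. y \<in> R \<Longrightarrow> D' y = D y"
    "transc \<Longrightarrow> D' x = 1"
proof -
  obtain v where v: "\<And>p. p \<in> polys_over R \<Longrightarrow> poly p x = 0 \<Longrightarrow> ext_deriv D x v p = 0"
    "transc \<Longrightarrow> v = 1"
    by (rule ext_deriv_exists[OF tr]) auto
  note d = derivation_onD[OF der]
  define R' where "R' = (\<lambda>p. poly p x) ` polys_over R"
  define D' where "D' = (\<lambda>y. ext_deriv D x v (SOME p. p \<in> polys_over R \<and> poly p x = y))"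
  have D': "D' (poly p x) = ext_deriv D x v p" if p: "p \<in> polys_over R" for p
  proof -
    define q where "q = (SOME q. q \<in> polys_over R \<and> poly q x = poly p x)"
    have q: "q \<in> polys_over R" "poly q x = poly p x"
      using someI[of "\<lambda>q. q \<in> polys_over R \<and> poly q x = poly p x" p] p unfolding q_def by auto
    have "ext_deriv D x v (q + - p) = 0"
      using q p polys_over_ring(1)[OF q(1) polys_over_ring(2)[OF p p]] by (intro v) auto
    then show ?thesis
      unfolding D'_def q_def[symmetric] using p q ext_deriv_rules(1)[OF q(1) polys_over_ring(2)[OF p p]]
      ext_deriv_rules(2)[OF p p] by simp
  qed
  have const: "poly (monom c 0) x = c" "monom c 0 \<in> polys_over R" if "c \<in> R" for c
    using polys_over_monom[OF that, of 0] by (auto simp: monom_0)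
  have "derivation_on R' D'"
    unfolding derivation_on_def R'_def
  proof (intro conjI ballI)
    show "1 \<in> (\<lambda>p. poly p x) ` polys_over R" using const[of 1] d by force
    fix y z assume "y \<in> (\<lambda>p. poly p x) ` polys_over R" "z \<in> (\<lambda>p. poly p x) ` polys_over R"
    then obtain p q where pq: "p \<in> polys_over R" "q \<in> polys_over R" "y = poly p x" "z = poly q x"
      by blast
    note r = polys_over_ring[OF pq(1,2)]
    have e: "y + z = poly (p + q) x" "- y = poly (- p) x" "y * z = poly (p * q) x" using pq by auto
    show "y + z \<in> (\<lambda>p. poly p x) ` polys_over R" "- y \<in> (\<lambda>p. poly p x) ` polys_over R"
      "y * z \<in> (\<lambda>p. poly p x) ` polys_over R" using e r by blast+
    show "D' (y + z) = D' y + D' z" "D' (y * z) = D' y * z + y * D' z"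
      unfolding e D'[OF r(1)] D'[OF r(3)] using pq D' by (auto simp: ext_deriv_rules)
  qed
  moreover have "R \<subseteq> R'" using const unfolding R'_def by force
  moreover have X: "monom 1 1 \<in> polys_over R" using d polys_over_monom by auto
  have "x \<in> R'" using X unfolding R'_def by (force simp: poly_monom)
  moreover have "D' y = D y" if "y \<in> R" for y
    using D'[of "monom y 0"] const[OF that] d
    by (simp add: ext_deriv_def map_poly_pCons monom_0 pderiv_pCons)
  moreover have "D' x = v"
    using D'[OF X] d by (simp add: ext_deriv_def map_poly_monom poly_monom pderiv_monom)
  ultimately show ?thesis using that v(2) by blast
qed

end

text \<open>Zorn's lemma on graphs: as sets of pairs, derivations on subrings are ordered by
  inclusion, and the union of a chain is again such a graph. A maximal one is defined everywhere,
  since a missing real could be adjoined.\<close>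

lemma derivation_extends_to_reals:
  assumes der: "derivation_on R0 D0"
  obtains D where "derivation_on UNIV D" "\<And>x. x \<in> R0 \<Longrightarrow> D x = D0 x"
proof -
  define gr where "gr = (\<lambda>R D. (\<lambda>x::real. (x, D x :: real)) ` R)"
  define \<A> where "\<A> = {gr R D | R D. derivation_on R D \<and> gr R0 D0 \<subseteq> gr R D}"
  have "\<exists>M\<in>\<A>. \<forall>X\<in>\<A>. M \<subseteq> X \<longrightarrow> X = M"
  proof (rule subset_Zorn_nonempty)
    show "\<A> \<noteq> {}" using der unfolding \<A>_def by blast
    fix \<C> assume ne: "\<C> \<noteq> {}" and ch: "subset.chain \<A> \<C>"
    have CA: "\<C> \<subseteq> \<A>" and lin: "\<And>X Y. X \<in> \<C> \<Longrightarrow> Y \<in> \<C> \<Longrightarrow> X \<subseteq> Y \<or> Y \<subseteq> X"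
      using ch by (auto simp: subset_chain_def)
    define U where "U = \<Union>\<C>"
    \<comment> \<open>Single-valuedness and the rules of a derivation involve at most two points of
      the union, and any two lie in one member of the chain.\<close>
    have two: "\<exists>R D. derivation_on R D \<and> gr R D \<subseteq> U \<and> p \<in> gr R D \<and> q \<in> gr R D"
      if pq: "p \<in> U" "q \<in> U" for p q
    proof -
      obtain X Y where XY: "X \<in> \<C>" "Y \<in> \<C>" "p \<in> X" "q \<in> Y" using pq unfolding U_def by blast
      then obtain Z where Z: "Z \<in> \<C>" "p \<in> Z" "q \<in> Z" using lin[OF XY(1,2)] by blast
      then have "Z \<in> \<A>" using CA by blast
      then obtain R D where "derivation_on R D" "Z = gr R D" unfolding \<A>_def by blast
      then show ?thesis using Z unfolding U_def by blast
    qed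
    have sv: "y = z" if "(x, y) \<in> U" "(x, z) \<in> U" for x y z
      using two[OF that] unfolding gr_def by auto
    define R where "R = fst ` U"
    define D where "D = (\<lambda>x. THE y. (x, y) \<in> U)"
    have Deq: "D x = y" if "(x, y) \<in> U" for x y
      unfolding D_def using that sv by blast
    have U: "U = gr R D"
      unfolding gr_def R_def using Deq by force
    have "derivation_on R D"
      unfolding derivation_on_def
    proof (intro conjI ballI)
      obtain X where "X \<in> \<C>" using ne by blast
      then obtain R1 D1 where "derivation_on R1 D1" "gr R1 D1 \<subseteq> U"
        using CA unfolding \<A>_def U_def by blast
      then show "1 \<in> R" unfolding R_def gr_def using derivation_onD(1) by force
      fix x y assume "x \<in> R" "y \<in> R"
      then have "(x, D x) \<in> U" "(y, D y) \<in> U" unfolding R_def using Deq by force+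
      then obtain R1 D1 where 1: "derivation_on R1 D1" "gr R1 D1 \<subseteq> U"
        "(x, D x) \<in> gr R1 D1" "(y, D y) \<in> gr R1 D1" using two by blast
      then have e: "x \<in> R1" "y \<in> R1" "D x = D1 x" "D y = D1 y" unfolding gr_def by auto
      have in_U: "(z, D1 z) \<in> U" if "z \<in> R1" for z using that 1(2) unfolding gr_def by blast
      note d = derivation_onD[OF 1(1)]
      have m: "x + y \<in> R1" "- x \<in> R1" "x * y \<in> R1" using e d by auto
      show "x + y \<in> R" "- x \<in> R" "x * y \<in> R" using in_U m unfolding R_def by force+
      show "D (x + y) = D x + D y" "D (x * y) = D x * y + x * D y"
        using Deq[OF in_U] m e d by auto
    qed
    moreover have "gr R0 D0 \<subseteq> U" using CA ne unfolding \<A>_def U_def by blast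
    ultimately show "\<Union>\<C> \<in> \<A>" using U unfolding \<A>_def U_def by blast
  qed
  then obtain M where M': "M \<in> \<A>" "\<And>X. X \<in> \<A> \<Longrightarrow> M \<subseteq> X \<Longrightarrow> X = M" by blast
  then obtain R D where MRD: "M = gr R D" and M: "derivation_on R D" "gr R0 D0 \<subseteq> gr R D"
    unfolding \<A>_def by blast
  note max = M'(2)[unfolded MRD]
  have "x \<in> R" for x
  proof -
    obtain R' D' where R': "derivation_on R' D'" "R \<subseteq> R'" "x \<in> R'" "\<And>y. y \<in> R \<Longrightarrow> D' y = D y"
      by (rule derivation_on_extend[OF M(1), of False x]) auto
    have sub: "gr R D \<subseteq> gr R' D'" using R'(2,4) unfolding gr_def by force
    have "gr R' D' \<in> \<A>" using order_trans[OF M(2) sub] R'(1) unfolding \<A>_def by blast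
    then have "gr R' D' = gr R D" using sub by (rule max)
    moreover have "(x, D' x) \<in> gr R' D'" using R'(3) unfolding gr_def by blast
    ultimately show "x \<in> R" unfolding gr_def by auto
  qed
  then have "R = UNIV" by blast
  moreover have "D x = D0 x" if "x \<in> R0" for x using M(2) that unfolding gr_def by auto
  ultimately show ?thesis using that M(1) by blast
qed

text \<open>The ring of integer polynomials in \<open>a\<close> is countable, so some real
  \<open>t\<close> is transcendental over it. The zero derivation on that ring extends with
  \<open>t\<close> sent to 1, and then to all reals.\<close>

lemma nonzero_derivation_exists:
  obtains D t where "derivation_on UNIV D" "D a = 0" "D t \<noteq> 0"
proof -
  define Z where "Z = (\<lambda>p. poly p a) ` range (map_poly real_of_int)"
  have mp: "map_poly real_of_int (p + q) = map_poly real_of_int p + map_poly real_of_int q"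
    "map_poly real_of_int (- p) = - map_poly real_of_int p"
    "map_poly real_of_int (p * q) = map_poly real_of_int p * map_poly real_of_int q" for p q
    by (intro poly_eqI; simp add: coeff_map_poly coeff_mult)+
  have "derivation_on Z (\<lambda>_. 0)"
    unfolding derivation_on_def Z_def
  proof (intro conjI ballI)
    show "1 \<in> (\<lambda>p. poly p a) ` range (map_poly real_of_int)"
      by (intro image_eqI[of _ _ 1] range_eqI[of _ _ 1]) (auto simp: one_pCons map_poly_pCons)
    fix x y assume "x \<in> (\<lambda>p. poly p a) ` range (map_poly real_of_int)"
      "y \<in> (\<lambda>p. poly p a) ` range (map_poly real_of_int)"
    then obtain p q where "x = poly (map_poly real_of_int p) a" "y = poly (map_poly real_of_int q) a"
      by blast
    then have e: "x + y = poly (map_poly real_of_int (p + q)) a"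
      "- x = poly (map_poly real_of_int (- p)) a"
      "x * y = poly (map_poly real_of_int (p * q)) a" unfolding mp by auto
    show "x + y \<in> (\<lambda>p. poly p a) ` range (map_poly real_of_int)"
      "- x \<in> (\<lambda>p. poly p a) ` range (map_poly real_of_int)"
      "x * y \<in> (\<lambda>p. poly p a) ` range (map_poly real_of_int)" unfolding e by blast+
  qed auto
  then have Zd: "derivation_on Z (\<lambda>_. 0)" .
  have countable_polys: "countable (polys_over C)" if "countable C" for C :: "real set"
  proof (rule countable_subset)
    show "polys_over C \<subseteq> Poly ` lists C"
    proof
      fix p assume p: "p \<in> polys_over C"
      have "set (coeffs p) \<subseteq> C" using p by (auto simp: polys_over_def coeffs_def)
      then show "p \<in> Poly ` lists C" by (intro image_eqI[of _ _ "coeffs p"]) (auto simp: lists_eq_set)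
    qed
  qed (use that in auto)
  have "countable (range (map_poly real_of_int))"
  proof (rule countable_subset)
    show "range (map_poly real_of_int) \<subseteq> polys_over (range real_of_int)"
      by (auto simp: polys_over_def coeff_map_poly)
  qed (simp add: countable_polys)
  then have cZ: "countable Z" unfolding Z_def by simp
  have "countable (\<Union>p\<in>polys_over Z - {0}. {x. poly p x = 0})"
    using countable_polys[OF cZ]
    by (intro countable_UN) (auto intro!: countable_finite poly_roots_finite)
  then obtain t where t: "t \<notin> (\<Union>p\<in>polys_over Z - {0}. {x. poly p x = 0})"
    using uncountable_UNIV_real by (metis UNIV_eq_I)
  then have "True \<longrightarrow> (\<forall>p\<in>polys_over Z. poly p t = 0 \<longrightarrow> p = 0)" by auto
  then obtain R' D' where R': "derivation_on R' D'" "Z \<subseteq> R'" "t \<in> R'"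
    "\<And>y. y \<in> Z \<Longrightarrow> D' y = 0" "D' t = 1"
    by (rule derivation_on_extend[OF Zd, of True t]) auto
  obtain D where D: "derivation_on UNIV D" "\<And>x. x \<in> R' \<Longrightarrow> D x = D' x"
    by (rule derivation_extends_to_reals[OF R'(1)]) auto
  have aZ: "a \<in> Z" unfolding Z_def
    by (intro image_eqI[of _ _ "monom 1 1"] range_eqI[of _ _ "monom 1 1"])
       (auto simp: poly_monom map_poly_monom)
  show ?thesis using that[OF D(1), of t] D(2) R' aZ by (metis in_mono zero_neq_one)
qed


section \<open>The stadium and its length spectrum\<close>

text \<open>The squared distance from \<open>p\<close> to the segment from (-a/2, 0) to (a/2, 0);
  the stadium is the open neighbourhood of radius 1 of that segment.\<close>

definition stadium_fn :: "real \<Rightarrow> point \<Rightarrow> real" where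
  "stadium_fn a p = (max (\<bar>fst p\<bar> - a/2) 0)\<^sup>2 + (snd p)\<^sup>2"

lemma dist_less_1_iff: "dist (c, 0) (x, y) < 1 \<longleftrightarrow> (x - c)\<^sup>2 + y\<^sup>2 < (1::real)"
  by (simp add: dist_Pair_Pair dist_real_def power2_commute)

lemma stadium_eq:
  assumes "a > 0"
  shows "stadium a = {p. stadium_fn a p < 1}"
proof -
  have "(x, y) \<in> stadium a \<longleftrightarrow> stadium_fn a (x, y) < 1" for x y
  proof -
    consider "\<bar>x\<bar> \<le> a/2" | "x > a/2" | "x < -a/2" by linarith
    then show ?thesis
    proof cases
      case 1
      have "stadium_fn a (x, y) = y\<^sup>2" using 1 by (simp add: stadium_fn_def max_def)
      moreover have "y\<^sup>2 < 1 \<longleftrightarrow> -1 < y \<and> y < 1" using abs_square_less_1[of y] by (auto simp: abs_less_iff)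
      moreover have "y\<^sup>2 < 1" if "(x - a/2)\<^sup>2 + y\<^sup>2 < 1 \<or> (x + a/2)\<^sup>2 + y\<^sup>2 < 1"
        using that zero_le_power2[of "x - a/2"] zero_le_power2[of "x + a/2"] by linarith
      ultimately show ?thesis using 1
        by (auto simp: stadium_def mem_ball dist_less_1_iff)
    next
      case 2
      have "stadium_fn a (x, y) = (x - a/2)\<^sup>2 + y\<^sup>2" using 2 assms by (simp add: stadium_fn_def max_def)
      moreover have "(x - a/2)\<^sup>2 \<le> (x - -a/2)\<^sup>2" using 2 assms by (intro power_mono) auto
      ultimately show ?thesis using 2
        by (auto simp: stadium_def mem_ball dist_less_1_iff)
    next
      case 3
      have "stadium_fn a (x, y) = (- x - a/2)\<^sup>2 + y\<^sup>2" using 3 assms by (simp add: stadium_fn_def max_def)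
      moreover have "(- x - a/2)\<^sup>2 = (x - -a/2)\<^sup>2" by (simp add: power2_eq_square algebra_simps)
      moreover have "(- x - a/2)\<^sup>2 \<le> (a/2 - x)\<^sup>2" using 3 assms by (intro power_mono) auto
      moreover have "(a/2 - x)\<^sup>2 = (x - a/2)\<^sup>2" by (simp add: power2_commute)
      ultimately show ?thesis using 3
        by (auto simp: stadium_def mem_ball dist_less_1_iff)
    qed
  qed
  then show ?thesis by auto
qed

lemma continuous_on_stadium_fn: "continuous_on S (stadium_fn a)"
  unfolding stadium_fn_def by (intro continuous_intros)

lemma open_stadium: "a > 0 \<Longrightarrow> open (stadium a)"
  unfolding stadium_eq by (intro open_Collect_less continuous_on_stadium_fn continuous_intros)

text \<open>Continuity of \<open>stadium_fn\<close> bounds the closure. Conversely a point at level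
  1 is the limit of its multiples t p with t < 1, where the function is at most t^2: the stadium is
  star-shaped about the origin.\<close>

lemma frontier_stadium_fn:
  assumes "a > 0"
  shows "frontier (stadium a) = {p. stadium_fn a p = 1}"
proof (intro set_eqI iffI)
  fix p assume p: "p \<in> frontier (stadium a)"
  have "closed {p. stadium_fn a p \<le> 1}"
    by (intro closed_Collect_le continuous_on_stadium_fn continuous_intros)
  then have "closure (stadium a) \<subseteq> {p. stadium_fn a p \<le> 1}"
    by (intro closure_minimal) (auto simp: stadium_eq assms)
  moreover have "p \<notin> stadium a" using p open_stadium[OF assms] by (auto simp: frontier_def interior_open)
  ultimately show "p \<in> {p. stadium_fn a p = 1}" using p by (auto simp: frontier_def stadium_eq assms)
next
  fix p assume "p \<in> {p. stadium_fn a p = 1}"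
  then have p: "stadium_fn a p = 1" by simp
  have lt: "t *\<^sub>R p \<in> stadium a" if t: "0 < t" "t < 1" for t
  proof -
    have "max (t * \<bar>fst p\<bar> - a/2) 0 \<le> t * max (\<bar>fst p\<bar> - a/2) 0"
    proof -
      have "t * a \<le> 1 * a" using t assms by (intro mult_right_mono) auto
      moreover have "t * \<bar>fst p\<bar> \<le> t * max (\<bar>fst p\<bar>) (a/2)" using t by simp
      moreover have "t * max (\<bar>fst p\<bar> - a/2) 0 = t * max \<bar>fst p\<bar> (a/2) - t * a / 2"
        by (simp add: max_def algebra_simps)
      moreover have "0 \<le> t * max (\<bar>fst p\<bar> - a/2) 0" using t by simp
      ultimately show ?thesis by simp
    qed
    then have "(max (t * \<bar>fst p\<bar> - a/2) 0)\<^sup>2 \<le> (t * max (\<bar>fst p\<bar> - a/2) 0)\<^sup>2"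
      by (intro power_mono) auto
    then have "stadium_fn a (t *\<^sub>R p) \<le> t\<^sup>2 * stadium_fn a p"
      using t by (simp add: stadium_fn_def abs_mult power_mult_distrib algebra_simps)
    also have "\<dots> < 1" using t p by (simp add: power_less_one_iff)
    finally show ?thesis by (simp add: stadium_eq assms)
  qed
  have "(\<lambda>n. (1 - 1 / real (n + 2)) *\<^sub>R p) \<longlonglongrightarrow> (1 - 0) *\<^sub>R p"
    by (intro tendsto_intros LIMSEQ_ignore_initial_segment lim_1_over_n)
  moreover have "(1 - 1 / real (n + 2)) *\<^sub>R p \<in> stadium a" for n by (intro lt) auto
  ultimately have "p \<in> closure (stadium a)" unfolding closure_sequential by (intro exI conjI) auto
  moreover have "p \<notin> stadium a" using p by (simp add: stadium_eq assms)
  ultimately show "p \<in> frontier (stadium a)"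
    using open_stadium[OF assms] by (simp add: frontier_def interior_open)
qed

lemma frontier_stadium_cases:
  assumes "a > 0"
  shows "(x, y) \<in> frontier (stadium a) \<longleftrightarrow>
     \<bar>x\<bar> \<le> a/2 \<and> \<bar>y\<bar> = 1 \<or> x > a/2 \<and> (x - a/2)\<^sup>2 + y\<^sup>2 = 1 \<or> x < -a/2 \<and> (x + a/2)\<^sup>2 + y\<^sup>2 = 1"
proof -
  have y: "y\<^sup>2 = 1 \<longleftrightarrow> \<bar>y\<bar> = 1" by (metis abs_1 power2_eq_iff_nonneg abs_ge_zero power2_abs power_one zero_le_one)
  have e: "(- x - a/2)\<^sup>2 = (x + a/2)\<^sup>2" by (simp add: power2_eq_square algebra_simps)
  consider "\<bar>x\<bar> \<le> a/2" | "x > a/2" | "x < -a/2" by linarith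
  then show ?thesis
    by cases (use assms y e in \<open>auto simp: frontier_stadium_fn stadium_fn_def max_def\<close>)
qed

text \<open>Tangent vectors are defined through curves on all of (-1, 1). The angular speed
  \<epsilon> is the distance of \<theta> from the ends of the arc, so the curve stays on the open
  semicircle. The sign \<sigma> selects the right arc (1) or the left arc (-1).\<close>

lemma arc_curve_tangent:
  assumes "a > 0" "\<sigma> = 1 \<or> \<sigma> = -1" "\<bar>\<theta>\<bar> < pi/2"
  shows "\<exists>\<epsilon>>0. \<epsilon> *\<^sub>R (- \<sigma> * sin \<theta>, cos \<theta>) \<in>
    tangent_space (frontier (stadium a)) (\<sigma> * (a/2 + cos \<theta>), sin \<theta>)"
proof -
  define \<epsilon> where "\<epsilon> = pi/2 - \<bar>\<theta>\<bar>"
  have e: "\<epsilon> > 0" using assms by (simp add: \<epsilon>_def)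
  define c where "c = (\<lambda>t. (\<sigma> * (a/2 + cos (\<theta> + \<epsilon> * t)), sin (\<theta> + \<epsilon> * t)))"
  have d: "(c has_vector_derivative \<epsilon> *\<^sub>R (- \<sigma> * sin (\<theta> + \<epsilon> * t), cos (\<theta> + \<epsilon> * t))) (at t)" for t
    unfolding c_def
    by (auto intro!: derivative_eq_intros has_vector_derivative_Pair
        simp: has_real_derivative_iff_has_vector_derivative[symmetric])
  have "c t \<in> frontier (stadium a)" if t: "t \<in> {-1<..<1}" for t
  proof -
    have "\<bar>\<epsilon> * t\<bar> < \<epsilon> * 1" using t e by (auto simp: abs_mult)
    then have "\<bar>\<theta> + \<epsilon> * t\<bar> < pi/2" using \<epsilon>_def by linarith
    then have "cos (\<theta> + \<epsilon> * t) > 0" by (intro cos_gt_zero_pi) linarith+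
    moreover have "(cos (\<theta> + \<epsilon> * t))\<^sup>2 + (sin (\<theta> + \<epsilon> * t))\<^sup>2 = 1" by simp
    ultimately show ?thesis
      using assms by (auto simp: c_def frontier_stadium_cases simp del: sin_cos_squared_add sin_cos_squared_add2)
  qed
  moreover have "c C1_differentiable_on {-1<..<1}"
    unfolding C1_differentiable_on_def using d by (intro exI conjI ballI) (auto intro!: continuous_intros)
  ultimately show ?thesis
    using e d[of 0] unfolding tangent_space_def by (intro exI[of _ \<epsilon>]) (auto intro!: exI[of _ c] simp: c_def)
qed

lemma edge_curve_tangent:
  assumes "a > 0" "\<bar>x\<bar> < a/2" "\<bar>y\<bar> = 1"
  shows "\<exists>\<epsilon>>0. \<epsilon> *\<^sub>R (1, 0) \<in> tangent_space (frontier (stadium a)) (x, y)"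
proof -
  define \<epsilon> where "\<epsilon> = a/2 - \<bar>x\<bar>"
  have e: "\<epsilon> > 0" using assms by (simp add: \<epsilon>_def)
  define c where "c = (\<lambda>t. (x + \<epsilon> * t, y))"
  have d: "(c has_vector_derivative \<epsilon> *\<^sub>R (1, 0)) (at t)" for t
    unfolding c_def
    by (auto intro!: derivative_eq_intros has_vector_derivative_Pair
        simp: has_real_derivative_iff_has_vector_derivative[symmetric])
  have "c t \<in> frontier (stadium a)" if t: "t \<in> {-1<..<1}" for t
  proof -
    have "\<bar>\<epsilon> * t\<bar> < \<epsilon> * 1" using t e by (auto simp: abs_mult)
    then have "\<bar>x + \<epsilon> * t\<bar> \<le> a/2" using \<epsilon>_def by linarith
    then show ?thesis using assms by (auto simp: c_def frontier_stadium_cases)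
  qed
  moreover have "c C1_differentiable_on {-1<..<1}"
    unfolding C1_differentiable_on_def using d by (intro exI conjI ballI) (auto intro!: continuous_intros)
  ultimately show ?thesis
    using e d[of 0] unfolding tangent_space_def by (intro exI[of _ \<epsilon>]) (auto intro!: exI[of _ c] simp: c_def)
qed

section \<open>Derivations and the lengths of trajectories\<close>

context
  fixes D :: "real \<Rightarrow> real" and a :: real
  assumes der: "derivation_on UNIV D" and Da: "D a = 0" and a: "a > 0"
begin

lemma derivation_rules:
  "D (x + y) = D x + D y" "D (x - y) = D x - D y" "D (- x) = - D x"
  "D (x * y) = D x * y + x * D y" "D (x\<^sup>2) = 2 * x * D x" "D 0 = 0" "D 1 = 0" "D (a/2) = 0"
proof -
  note d = derivation_onD[OF der]
  show "D (x + y) = D x + D y" "D (- x) = - D x" "D (x * y) = D x * y + x * D y" "D 0 = 0" "D 1 = 0"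
    using d by auto
  show "D (x - y) = D x - D y" using d(6)[of x "- y"] d(10)[of y] by simp
  show "D (x\<^sup>2) = 2 * x * D x" using d(7)[of x x] by (simp add: power2_eq_square)
  show "D (a/2) = 0" using d(6)[of "a/2" "a/2"] Da by simp
qed

text \<open>The formal velocity of a vertex: \<open>D\<close> acts like a time derivative under
  which the stadium stands still.\<close>

definition Dpt :: "point \<Rightarrow> point" where "Dpt p = (D (fst p), D (snd p))"

text \<open>Applying \<open>D\<close> to the polynomial identity for the squared distance, and
  dividing by twice the distance, gives the formula known from calculus.\<close>

lemma derivation_dist:
  assumes "p \<noteq> q"
  shows "D (dist p q) = sgn (p - q) \<bullet> (Dpt p - Dpt q)"
proof -
  have "(dist p q)\<^sup>2 = (fst p - fst q)\<^sup>2 + (snd p - snd q)\<^sup>2"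
    by (simp add: dist_prod_def dist_real_def)
  then have "D ((dist p q)\<^sup>2) = D ((fst p - fst q)\<^sup>2 + (snd p - snd q)\<^sup>2)" by simp
  then have "dist p q * D (dist p q) = (p - q) \<bullet> (Dpt p - Dpt q)"
    by (simp add: derivation_rules Dpt_def inner_prod_def algebra_simps)
  then have "D (dist p q) = ((p - q) \<bullet> (Dpt p - Dpt q)) / norm (p - q)"
    using assms by (simp add: dist_norm eq_divide_eq mult.commute)
  then show ?thesis by (simp add: sgn_div_norm divide_inverse_commute)
qed

text \<open>The boundary is given piecewise by polynomial equations whose coefficients
  \<open>D\<close> kills, and applying \<open>D\<close> to such an equation linearizes it. The
  vector 0 is inserted for the junction points, whose coordinates are killed outright.\<close>

lemma Dpt_tangent:
  assumes "p \<in> frontier (stadium a)"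
  shows "\<exists>c. \<exists>u\<in>insert 0 (tangent_space (frontier (stadium a)) p). Dpt p = c *\<^sub>R u"
proof -
  obtain x y where p: "p = (x, y)" by (cases p)
  have arc: ?thesis if s: "\<sigma> = 1 \<or> \<sigma> = -1" and x: "\<sigma> * x > a/2" and eq: "(\<sigma> * x - a/2)\<^sup>2 + y\<^sup>2 = 1" for \<sigma>
  proof -
    define \<theta> where "\<theta> = arcsin y"
    have y1: "y\<^sup>2 < 1" using eq x by (smt (verit) zero_less_power2)
    then have yb: "-1 < y" "y < 1" using abs_square_less_1[of y] by auto
    have sy: "sin \<theta> = y" using yb by (simp add: \<theta>_def)
    have th: "\<bar>\<theta>\<bar> < pi/2" using yb arcsin_lt_bounded[of y] by (auto simp: \<theta>_def)
    have cp: "cos \<theta> > 0" using th by (intro cos_gt_zero_pi) auto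
    have "(cos \<theta>)\<^sup>2 = (\<sigma> * x - a/2)\<^sup>2" using eq sy by (simp add: cos_squared_eq)
    then have cx: "cos \<theta> = \<sigma> * x - a/2" using cp x by (simp add: power2_eq_iff_nonneg)
    then have px: "(\<sigma> * (a/2 + cos \<theta>), sin \<theta>) = p" using s sy p by auto
    obtain \<epsilon> where e: "\<epsilon> > 0"
      "\<epsilon> *\<^sub>R (- \<sigma> * sin \<theta>, cos \<theta>) \<in> tangent_space (frontier (stadium a)) p"
      using arc_curve_tangent[OF a s th] unfolding px by blast
    have "D ((\<sigma> * x - a/2)\<^sup>2 + y\<^sup>2) = 0" unfolding eq by (simp add: derivation_rules)
    moreover have "D (\<sigma> * x - a/2) = \<sigma> * D x"
      using s derivation_rules(2,3,8) by auto
    ultimately have "2 * (\<sigma> * x - a/2) * (\<sigma> * D x) + 2 * y * D y = 0"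
      by (simp only: derivation_rules(1,5))
    then have "cos \<theta> * \<sigma> * D x + sin \<theta> * D y = 0"
      by (simp add: cx sy algebra_simps)
    then have h1: "cos \<theta> * \<sigma> * D x = - sin \<theta> * D y" by linarith
    then have "D x = - \<sigma> * sin \<theta> * (D y / cos \<theta>)"
      using cp s by (auto simp: field_simps)
    then have "Dpt p = (D y / cos \<theta> / \<epsilon>) *\<^sub>R (\<epsilon> *\<^sub>R (- \<sigma> * sin \<theta>, cos \<theta>))"
      using cp e by (simp add: Dpt_def p)
    then show ?thesis using e by blast
  qed
  have "\<bar>x\<bar> \<le> a/2 \<and> \<bar>y\<bar> = 1 \<or> x > a/2 \<and> (x - a/2)\<^sup>2 + y\<^sup>2 = 1 \<or> x < -a/2 \<and> (x + a/2)\<^sup>2 + y\<^sup>2 = 1"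
    using assms frontier_stadium_cases[OF a] p by simp
  moreover have "(- x - a/2)\<^sup>2 = (x + a/2)\<^sup>2" by (simp add: power2_eq_square algebra_simps)
  ultimately have cs: "\<bar>x\<bar> < a/2 \<and> \<bar>y\<bar> = 1 \<or> \<bar>x\<bar> = a/2 \<and> \<bar>y\<bar> = 1 \<or> x > a/2 \<and> (x - a/2)\<^sup>2 + y\<^sup>2 = 1
    \<or> - x > a/2 \<and> (- x - a/2)\<^sup>2 + y\<^sup>2 = 1"
    by auto
  have D1: "D y = 0" if "\<bar>y\<bar> = 1"
  proof -
    have "y = 1 \<or> y = - 1" using that by linarith
    then show ?thesis using derivation_rules(3)[of 1] derivation_rules(7) by auto
  qed
  from cs consider "\<bar>x\<bar> < a/2" "\<bar>y\<bar> = 1" | "\<bar>x\<bar> = a/2" "\<bar>y\<bar> = 1" | "x > a/2" "(x - a/2)\<^sup>2 + y\<^sup>2 = 1"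
    | "- x > a/2" "(- x - a/2)\<^sup>2 + y\<^sup>2 = 1"
    by argo
  then show ?thesis
  proof cases
    case 1
    have "D y = 0" using D1 1 by blast
    moreover obtain \<epsilon> where "\<epsilon> > 0" "\<epsilon> *\<^sub>R (1, 0) \<in> tangent_space (frontier (stadium a)) p"
      using edge_curve_tangent[OF a 1] p by blast
    moreover from this have "Dpt p = (D x / \<epsilon>) *\<^sub>R (\<epsilon> *\<^sub>R (1, 0))"
      using \<open>D y = 0\<close> by (simp add: Dpt_def p)
    ultimately show ?thesis by blast
  next
    case 2
    have "D y = 0" using D1 2 by blast
    moreover have "x = a/2 \<or> x = - (a/2)" using 2 by linarith
    then have "D x = 0" using derivation_rules(3)[of "a/2"] derivation_rules(8) by auto
    ultimately have "Dpt p = 0 *\<^sub>R 0" by (simp add: Dpt_def p zero_prod_def)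
    then show ?thesis by blast
  next
    case 3 then show ?thesis by (intro arc[of 1]) auto
  next
    case 4 then show ?thesis by (intro arc[of "-1"]) auto
  qed
qed

text \<open>By the law of reflection consecutive unit side vectors have equal inner products with
  tangent vectors, hence with the formal velocity of the common vertex. The derivatives of the sides
  therefore telescope around the polygon.\<close>

lemma derivation_length:
  assumes "closed_billiard_trajectory (stadium a) n p"
  shows "D (\<Sum>i<n. dist (p i) (p (Suc i))) = 0"
proof -
  have per: "p (i + n) = p i" and fr: "p i \<in> frontier (stadium a)" and ne: "p i \<noteq> p (Suc i)"
    and rl: "reflection_law (stadium a) (p i) (p (Suc i)) (p (Suc (Suc i)))" for i
    using assms unfolding closed_billiard_trajectory_def by blast+
  define A where "A = (\<lambda>i. sgn (p i - p (Suc i)))"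
  define g where "g = (\<lambda>i. A i \<bullet> Dpt (p i))"
  have "A i \<bullet> u = A (Suc i) \<bullet> u" if "u \<in> tangent_space (frontier (stadium a)) (p (Suc i))" for i u
  proof -
    have "A i \<bullet> (- u) = sgn (p (Suc (Suc i)) - p (Suc i)) \<bullet> u"
      using rl that unfolding reflection_law_def A_def by blast
    moreover have "sgn (p (Suc (Suc i)) - p (Suc i)) = - A (Suc i)"
      unfolding A_def by (simp add: sgn_minus[symmetric])
    ultimately show ?thesis by simp
  qed
  moreover have "\<exists>c. \<exists>u\<in>insert 0 (tangent_space (frontier (stadium a)) (p (Suc i))).
    Dpt (p (Suc i)) = c *\<^sub>R u" for i by (rule Dpt_tangent[OF fr])
  ultimately have eq: "A i \<bullet> Dpt (p (Suc i)) = g (Suc i)" for i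
    unfolding g_def by (metis (no_types, lifting) inner_scaleR_right inner_zero_right insert_iff)
  have "D (dist (p i) (p (Suc i))) = g i - g (Suc i)" for i
    using derivation_dist[OF ne[of i]] eq[of i] by (simp add: g_def A_def inner_diff_right)
  then have "D (\<Sum>i<n. dist (p i) (p (Suc i))) = (\<Sum>i<n. g i - g (Suc i))"
    using derivation_on_sum[OF der, of "{..<n}" "\<lambda>i. dist (p i) (p (Suc i))"] by simp
  also have "\<dots> = g 0 - g n" by (rule sum_lessThan_telescope')
  also have "\<dots> = 0" using per[of 0] per[of 1] by (simp add: g_def A_def)
  finally show ?thesis .
qed

end

text \<open>If \<open>D\<close> vanished on an interval it would vanish on all differences up to the
  length of the interval, and by additivity on all integer multiples of these, that is on every
  real.\<close>

lemma length_spectrum_no_interval: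
  assumes a: "a > 0" and lr: "l < r" "{l..r} \<subseteq> length_spectrum (stadium a)"
  shows False
proof -
  obtain D t where D: "derivation_on UNIV D" "D a = 0" "D t \<noteq> 0"
    by (rule nonzero_derivation_exists)
  note d = derivation_onD[OF D(1)]
  have z: "D x = 0" if "x \<in> {l..r}" for x
  proof -
    have "x \<in> length_spectrum (stadium a)" using that lr by blast
    then show ?thesis unfolding length_spectrum_def using derivation_length[OF D(1,2) a] by auto
  qed
  obtain N where N: "real N > \<bar>t\<bar> / (r - l)" using reals_Archimedean2 by blast
  then have Np: "real N > 0" using lr(1) by (smt (verit) divide_nonneg_pos)
  define s where "s = \<bar>t\<bar> / real N"
  have s: "0 \<le> s" "s \<le> r - l" using N Np lr(1) by (auto simp: s_def field_simps)
  have "D (l + s) = D l + D s" using d by auto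
  then have "D s = 0" using z[of l] z[of "l + s"] s by auto
  have "D (real k * s) = real k * D s" for k
    using d by (induction k) (auto simp: algebra_simps)
  moreover have "\<bar>t\<bar> = real N * s" using Np by (simp add: s_def)
  ultimately have "D \<bar>t\<bar> = 0" using \<open>D s = 0\<close> by simp
  then show False using D(3) d(10)[of t] by (auto simp: abs_if split: if_splits)
qed


section \<open>Separating functionals\<close>

text \<open>Linearity is demanded on \<open>V\<close> only, because the intended functionals are
  integrals, additive on integrable functions. The induction passes to the kernel of the last
  functional, which has codimension at most 1 in \<open>V\<close>.\<close>

lemma finite_spanning_set_of_separating_functionals:
  fixes V :: "'v::real_vector set" and \<phi> :: "nat \<Rightarrow> 'v \<Rightarrow> real"
  assumes "subspace V"
    and "\<And>k x y. k < M \<Longrightarrow> x \<in> V \<Longrightarrow> y \<in> V \<Longrightarrow> \<phi> k (x + y) = \<phi> k x + \<phi> k y"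
    and "\<And>k c x. k < M \<Longrightarrow> x \<in> V \<Longrightarrow> \<phi> k (c *\<^sub>R x) = c * \<phi> k x"
    and "\<And>x. x \<in> V \<Longrightarrow> (\<And>k. k < M \<Longrightarrow> \<phi> k x = 0) \<Longrightarrow> x = 0"
  shows "\<exists>B. finite B \<and> V \<subseteq> span B"
  using assms
proof (induction M arbitrary: V)
  case 0
  then show ?case by (intro exI[of _ "{}"]) auto
next
  case (Suc M)
  define W where "W = {x \<in> V. \<phi> M x = 0}"
  have "subspace W"
    unfolding W_def using Suc.prems(1) Suc.prems(2,3)[of M] Suc.prems(3)[of M 0 0]
    by (auto simp: subspace_def)
  moreover have "x = 0" if "x \<in> W" "\<And>k. k < M \<Longrightarrow> \<phi> k x = 0" for x
    using that Suc.prems(4)[of x] by (auto simp: W_def less_Suc_eq)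
  ultimately have "\<exists>B. finite B \<and> W \<subseteq> span B"
    using Suc.prems(2,3) by (intro Suc.IH) (auto simp: W_def)
  then obtain B where B: "finite B" "W \<subseteq> span B" by blast
  show ?case
  proof (cases "W = V")
    case False
    then obtain v where v: "v \<in> V" "\<phi> M v \<noteq> 0" by (auto simp: W_def)
    have "x \<in> span (insert v B)" if x: "x \<in> V" for x
    proof -
      define c where "c = \<phi> M x / \<phi> M v"
      have cv: "(- c) *\<^sub>R v \<in> V" using subspace_scale[OF Suc.prems(1) v(1)] .
      have "\<phi> M (x + (- c) *\<^sub>R v) = 0"
        using Suc.prems(2)[of M, OF _ x cv] Suc.prems(3)[of M v "- c"] v by (simp add: c_def)
      moreover have "x + (- c) *\<^sub>R v \<in> V" using subspace_add[OF Suc.prems(1) x cv] .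
      ultimately have "x + (- c) *\<^sub>R v \<in> span B" using B(2) by (auto simp: W_def)
      then show ?thesis unfolding span_breakdown_eq by (intro exI[of _ c]) simp
    qed
    then show ?thesis using B(1) by (intro exI[of _ "insert v B"]) auto
  qed (use B in blast)
qed

text \<open>Turns containment in a finitely spanned space into equality with one, the form in which
  the theorem expresses finite dimension.\<close>

lemma span_subset_finite_span:
  fixes A :: "'v::real_vector set"
  assumes "finite B" "A \<subseteq> span B"
  shows "\<exists>B'. finite B' \<and> span A = span B'"
proof -
  obtain C where C: "C \<subseteq> A" "independent C" "A \<subseteq> span C"
    using maximal_independent_subset by blast
  have "finite C" using independent_span_bound[OF assms(1) C(2)] C(1) assms(2) by blast
  moreover have "span A = span C"
    using C span_mono[OF C(1)] span_minimal[OF C(3) subspace_span] by blast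
  ultimately show ?thesis by blast
qed


section \<open>Fourier cosine series\<close>

lemma S_int_eq: "S_int = {-(pi/2)..pi/2}" by (simp add: S_int_def)

lemma S_int_mem: "s \<in> S_int \<longleftrightarrow> \<bar>s\<bar> \<le> pi/2" by (auto simp: S_int_eq abs_le_iff)

lemma continuous_on_S_int_bounded:
  fixes f :: "real \<Rightarrow> real"
  assumes "continuous_on S_int f"
  shows "\<exists>B. \<forall>s\<in>S_int. \<bar>f s\<bar> \<le> B"
proof -
  have "compact S_int" by (simp add: S_int_eq)
  then have "bounded (f ` S_int)" using assms by (intro compact_imp_bounded compact_continuous_image)
  then show ?thesis by (auto simp: bounded_iff)
qed

text \<open>Membership in C^n of the interval. Each level only asserts that some derivative exists,
  so closure under sums and products is an induction without any formula for iterated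
  derivatives.\<close>

primrec diff_times :: "nat \<Rightarrow> (real \<Rightarrow> real) \<Rightarrow> bool" where
  "diff_times 0 f \<longleftrightarrow> continuous_on S_int f"
| "diff_times (Suc n) f \<longleftrightarrow>
     (\<exists>f'. (\<forall>s\<in>S_int. (f has_real_derivative f' s) (at s within S_int)) \<and> diff_times n f')"

lemma diff_times_continuous: "diff_times n f \<Longrightarrow> continuous_on S_int f"
  by (cases n) (auto intro: DERIV_continuous_on)

lemma diff_times_Suc: "diff_times (Suc n) f \<Longrightarrow> diff_times n f"
proof (induction n arbitrary: f)
  case 0 then show ?case by (meson diff_times_continuous diff_times.simps(1))
next
  case (Suc n) then show ?case by (metis diff_times.simps(2))
qed

lemma diff_times_cong:
  assumes "\<And>s. s \<in> S_int \<Longrightarrow> f s = g s" "diff_times n f"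
  shows "diff_times n g"
proof (cases n)
  case 0 then show ?thesis using assms by (simp cong: continuous_on_cong)
next
  case (Suc m)
  then obtain f' where "\<forall>s\<in>S_int. (f has_real_derivative f' s) (at s within S_int)" "diff_times m f'"
    using assms by auto
  then show ?thesis unfolding Suc using assms(1)
    by (auto intro!: exI[of _ f'] elim!: has_field_derivative_transform_within[OF _ zero_less_one])
qed

lemma diff_times_add: "diff_times n f \<Longrightarrow> diff_times n g \<Longrightarrow> diff_times n (\<lambda>s. f s + g s)"
proof (induction n arbitrary: f g)
  case 0 then show ?case by (auto intro: continuous_intros)
next
  case (Suc n)
  then obtain f' g' where
    "\<forall>s\<in>S_int. (f has_real_derivative f' s) (at s within S_int)" "diff_times n f'"
    "\<forall>s\<in>S_int. (g has_real_derivative g' s) (at s within S_int)" "diff_times n g'" by auto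
  then show ?case using Suc.IH by (auto intro!: exI[of _ "\<lambda>s. f' s + g' s"] derivative_intros)
qed

lemma diff_times_mult: "diff_times n f \<Longrightarrow> diff_times n g \<Longrightarrow> diff_times n (\<lambda>s. f s * g s)"
proof (induction n arbitrary: f g)
  case 0 then show ?case by (auto intro: continuous_intros)
next
  case (Suc n)
  then obtain f' g' where
    d: "\<forall>s\<in>S_int. (f has_real_derivative f' s) (at s within S_int)" "diff_times n f'"
    "\<forall>s\<in>S_int. (g has_real_derivative g' s) (at s within S_int)" "diff_times n g'" by auto
  have "diff_times n (\<lambda>s. f' s * g s + f s * g' s)"
    using Suc.prems d Suc.IH diff_times_Suc by (intro diff_times_add) auto
  then show ?case using d by (auto intro!: exI[of _ "\<lambda>s. f' s * g s + f s * g' s"] derivative_eq_intros)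
qed

lemma diff_times_sin_cos: "diff_times n (\<lambda>s. A * sin s + B * cos s)"
proof (induction n arbitrary: A B)
  case 0 then show ?case by (auto intro!: continuous_intros)
next
  case (Suc n)
  have "diff_times n (\<lambda>s. A * cos s - B * sin s)" using Suc.IH[of "- B" A] by (simp add: algebra_simps)
  then show ?case by (auto intro!: exI[of _ "\<lambda>s. A * cos s - B * sin s"] derivative_eq_intros)
qed

lemma diff_times_const: "diff_times n (\<lambda>s. c)"
  by (induction n arbitrary: c) (auto intro!: exI[of _ "\<lambda>_. 0"])

lemma sin_cos_half_pi_multiple:
  "sin (2 * real k * (pi/2)) = 0" "cos (2 * real k * (pi/2)) = (-1) ^ k"
  "sin (2 * real k * (- (pi/2))) = 0" "cos (2 * real k * (- (pi/2))) = (-1) ^ k"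
  by (simp_all add: cos_npi sin_npi)

text \<open>At both ends sin(2ks) vanishes and cos(2ks) equals (-1)^k, so only the sine integral
  produces a boundary term.\<close>

lemma integral_by_parts_cos:
  assumes "\<And>s. s \<in> S_int \<Longrightarrow> (f has_real_derivative f' s) (at s within S_int)" "continuous_on S_int f'"
  shows "2 * real k * integral S_int (\<lambda>s. f s * cos (2 * real k * s)) =
    - integral S_int (\<lambda>s. f' s * sin (2 * real k * s))"
    "2 * real k * integral S_int (\<lambda>s. f s * sin (2 * real k * s)) =
    - ((-1) ^ k * (f (pi/2) - f (-(pi/2)))) + integral S_int (\<lambda>s. f' s * cos (2 * real k * s))"
proof -
  have c: "continuous_on S_int f" using assms(1) by (rule DERIV_continuous_on)
  have i: "(\<lambda>s. g s * cos (2 * real k * s)) integrable_on S_int"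
    "(\<lambda>s. g s * sin (2 * real k * s)) integrable_on S_int" if "continuous_on S_int g" for g
    using that unfolding S_int_eq by (auto intro!: integrable_continuous_real continuous_intros)
  have "((\<lambda>s. f' s * sin (2 * real k * s) + f s * (2 * real k * cos (2 * real k * s)))
      has_integral f (pi/2) * sin (2 * real k * (pi/2)) - f (-(pi/2)) * sin (2 * real k * (- (pi/2)))) S_int"
    unfolding S_int_eq
    by (intro fundamental_theorem_of_calculus)
       (auto simp: has_real_derivative_iff_has_vector_derivative[symmetric]
          intro!: derivative_eq_intros assms(1)[unfolded S_int_eq])
  then have "integral S_int (\<lambda>s. f' s * sin (2 * real k * s) + 2 * real k * (f s * cos (2 * real k * s))) = 0"
    unfolding sin_cos_half_pi_multiple by (simp add: integral_unique algebra_simps)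
  then show "2 * real k * integral S_int (\<lambda>s. f s * cos (2 * real k * s)) =
    - integral S_int (\<lambda>s. f' s * sin (2 * real k * s))"
    by (subst (asm) integral_add) (auto intro!: i assms(2) c integrable_on_mult_right)
  have "((\<lambda>s. f' s * cos (2 * real k * s) - f s * (2 * real k * sin (2 * real k * s)))
      has_integral f (pi/2) * cos (2 * real k * (pi/2)) - f (-(pi/2)) * cos (2 * real k * (- (pi/2)))) S_int"
    unfolding S_int_eq
    by (intro fundamental_theorem_of_calculus)
       (auto simp: has_real_derivative_iff_has_vector_derivative[symmetric]
          intro!: derivative_eq_intros assms(1)[unfolded S_int_eq])
  then have "integral S_int (\<lambda>s. f' s * cos (2 * real k * s) - 2 * real k * (f s * sin (2 * real k * s)))
      = (-1) ^ k * (f (pi/2) - f (-(pi/2)))"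
    unfolding sin_cos_half_pi_multiple by (simp add: integral_unique algebra_simps)
  then show "2 * real k * integral S_int (\<lambda>s. f s * sin (2 * real k * s)) =
    - ((-1) ^ k * (f (pi/2) - f (-(pi/2)))) + integral S_int (\<lambda>s. f' s * cos (2 * real k * s))"
    by (subst (asm) integral_diff) (auto intro!: i assms(2) c integrable_on_mult_right)
qed

text \<open>An even function on an interval of length pi is expanded in the modes cos(2ks), which
  are orthogonal there; with this normalization the numbers are the coefficients of the series
  itself.\<close>

definition fcos :: "(real \<Rightarrow> real) \<Rightarrow> nat \<Rightarrow> real" where
  "fcos h k = (if k = 0 then 1 else 2) / pi * integral S_int (\<lambda>s. h s * cos (2 * real k * s))"

text \<open>Four integrations by parts. The second leaves the values of h' at the ends, which vanish
  by hypothesis; the fourth leaves values of h''', which are merely bounded but already carry the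
  full factor (2k)^4.\<close>

lemma fcos_decay:
  assumes "diff_times 4 h" "\<And>s h'. s \<in> {-(pi/2), pi/2} \<Longrightarrow>
      (h has_real_derivative h') (at s within S_int) \<Longrightarrow> h' = 0"
  shows "\<exists>N. \<forall>k. real k ^ 4 * \<bar>fcos h k\<bar> \<le> N"
proof -
  obtain h1 h2 h3 h4 where
    d1: "\<And>s. s \<in> S_int \<Longrightarrow> (h has_real_derivative h1 s) (at s within S_int)" and
    d2: "\<And>s. s \<in> S_int \<Longrightarrow> (h1 has_real_derivative h2 s) (at s within S_int)" and
    d3: "\<And>s. s \<in> S_int \<Longrightarrow> (h2 has_real_derivative h3 s) (at s within S_int)" and
    d4: "\<And>s. s \<in> S_int \<Longrightarrow> (h3 has_real_derivative h4 s) (at s within S_int)" and c4: "continuous_on S_int h4"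
  proof -
    have "diff_times (Suc (Suc (Suc (Suc 0)))) h"
      using assms(1) by (simp add: eval_nat_numeral del: diff_times.simps)
    then show thesis using that unfolding diff_times.simps by blast
  qed
  have c: "continuous_on S_int h1" "continuous_on S_int h2" "continuous_on S_int h3"
    using d2 d3 d4 by (auto intro!: DERIV_continuous_on)
  have h1: "h1 (pi/2) = 0" "h1 (-(pi/2)) = 0"    using assms(2)[OF _ d1, of "pi/2"] assms(2)[OF _ d1, of "-(pi/2)"] by (auto simp: S_int_mem)
  obtain B3 where B3: "\<And>s. s \<in> S_int \<Longrightarrow> \<bar>h3 s\<bar> \<le> B3"
    using continuous_on_S_int_bounded[OF c(3)] by blast
  obtain B4 where B4: "\<And>s. s \<in> S_int \<Longrightarrow> \<bar>h4 s\<bar> \<le> B4"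
    using continuous_on_S_int_bounded[OF c4] by blast
  have "real k ^ 4 * \<bar>fcos h k\<bar> \<le> 2 / pi * (2 * B3 + B4 * pi)" for k
  proof -
    define x where "x = 2 * real k"
    have B3p: "B3 \<ge> 0" using B3[of 0] by (auto simp: S_int_mem)
    define I where "I = integral S_int (\<lambda>s. h s * cos (x * s))"
    note p1 = integral_by_parts_cos(1)[OF d1 c(1), of k, folded x_def]
    note p2 = integral_by_parts_cos(2)[OF d2 c(2), of k, folded x_def]
    note p3 = integral_by_parts_cos(1)[OF d3 c(3), of k, folded x_def]
    note p4 = integral_by_parts_cos(2)[OF d4 c4, of k, folded x_def]
    have "x ^ 4 * I = x * (x * (x * (x * I)))" by (simp add: power4_eq_xxxx)
    also have "x * I = - integral S_int (\<lambda>s. h1 s * sin (x * s))" using p1 by (simp add: I_def)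
    also have "x * (x * (x * - integral S_int (\<lambda>s. h1 s * sin (x * s)))) =
      - x * (x * (x * integral S_int (\<lambda>s. h1 s * sin (x * s))))" by simp
    also have "x * integral S_int (\<lambda>s. h1 s * sin (x * s)) = integral S_int (\<lambda>s. h2 s * cos (x * s))"
      using p2 h1 by simp
    also have "x * integral S_int (\<lambda>s. h2 s * cos (x * s)) = - integral S_int (\<lambda>s. h3 s * sin (x * s))"
      using p3 .
    also have "- x * - integral S_int (\<lambda>s. h3 s * sin (x * s)) = x * integral S_int (\<lambda>s. h3 s * sin (x * s))"
      by simp
    also have "\<dots> = - ((-1) ^ k * (h3 (pi/2) - h3 (-(pi/2)))) + integral S_int (\<lambda>s. h4 s * cos (x * s))"
      using p4 .
    finally have e: "x ^ 4 * I = - ((-1) ^ k * (h3 (pi/2) - h3 (-(pi/2)))) + integral S_int (\<lambda>s. h4 s * cos (x * s))" .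
    have "\<bar>integral S_int (\<lambda>s. h4 s * cos (x * s))\<bar> \<le> B4 * (pi/2 - - (pi/2))"
    proof -
      have "\<bar>h4 s * cos (x * s)\<bar> \<le> B4 * 1" if "s \<in> S_int" for s
        unfolding abs_mult using B4[OF that] by (intro mult_mono) auto
      then have "norm (integral {-(pi/2)..pi/2} (\<lambda>s. h4 s * cos (x * s))) \<le> B4 * (pi/2 - - (pi/2))"
        using c4 unfolding S_int_eq by (intro integral_bound) (auto intro!: continuous_intros)
      then show ?thesis by (simp add: S_int_eq)
    qed
    moreover have "\<bar>- ((-1) ^ k * (h3 (pi/2) - h3 (-(pi/2))))\<bar> \<le> 2 * B3"
      using B3[of "pi/2"] B3[of "-(pi/2)"] by (simp add: abs_mult power_abs S_int_mem)
    ultimately have "\<bar>x ^ 4 * I\<bar> \<le> 2 * B3 + B4 * pi" unfolding e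
      by (intro order_trans[OF abs_triangle_ineq]) (simp add: algebra_simps)
    moreover have "real k ^ 4 * \<bar>I\<bar> \<le> \<bar>x ^ 4 * I\<bar>"
      by (simp add: x_def power_mult_distrib abs_mult mult_right_mono)
    ultimately have "real k ^ 4 * \<bar>I\<bar> \<le> 2 * B3 + B4 * pi" by linarith
    moreover have "real k ^ 4 * \<bar>fcos h k\<bar> \<le> 2 / pi * (real k ^ 4 * \<bar>I\<bar>)"
      by (simp add: fcos_def I_def x_def abs_mult algebra_simps)
    ultimately show ?thesis by (smt (verit, ccfv_SIG) divide_pos_pos mult_left_mono pi_gt_zero)
  qed
  then show ?thesis by blast
qed

lemma integral_cos_even: "integral S_int (\<lambda>s. cos (2 * real k * s)) = (if k = 0 then pi else 0)"
proof (cases "k = 0")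
  case True then show ?thesis by (simp add: S_int_eq)
next
  case False
  then show ?thesis using integral_by_parts_cos(1)[of "\<lambda>_. 1" "\<lambda>_. 0" k] by simp
qed

lemma fcos_orthogonal: "integral S_int (\<lambda>s. cos (2 * real j * s) * cos (2 * real k * s)) =
    (if j = k then if k = 0 then pi else pi/2 else 0)"
proof -
  define d where "d = (if j \<le> k then k - j else j - k)"
  have "cos (2 * real j * s) * cos (2 * real k * s) =
      1/2 * cos (2 * real d * s) + 1/2 * cos (2 * real (j + k) * s)" for s
  proof -
    have "cos (2 * real d * s) = cos (2 * real j * s - 2 * real k * s)"
    proof (cases "j \<le> k")
      case True
      then have "2 * real d * s = - (2 * real j * s - 2 * real k * s)" by (simp add: d_def of_nat_diff algebra_simps)
      then show ?thesis by (metis cos_minus)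
    next
      case False
      then have "2 * real d * s = (2 * real j * s - 2 * real k * s)" by (simp add: d_def of_nat_diff algebra_simps)
      then show ?thesis by metis
    qed
    moreover have "cos (2 * real (j + k) * s) = cos (2 * real j * s + 2 * real k * s)" by (simp add: algebra_simps)
    ultimately show ?thesis by (simp add: cos_add cos_diff field_simps)
  qed
  then have "integral S_int (\<lambda>s. cos (2 * real j * s) * cos (2 * real k * s)) =
    integral S_int (\<lambda>s. 1/2 * cos (2 * real d * s) + 1/2 * cos (2 * real (j + k) * s))" by simp
  also have "\<dots> = 1/2 * integral S_int (\<lambda>s. cos (2 * real d * s))
     + 1/2 * integral S_int (\<lambda>s. cos (2 * real (j + k) * s))"
    unfolding S_int_eq
    by (subst integral_add) (auto intro!: integrable_continuous_real continuous_intros)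
  finally show ?thesis unfolding integral_cos_even by (auto simp: d_def)
qed

text \<open>Completeness of the cosines among even functions. Such a function is a continuous
  function \<open>G\<close> of (cos s)^2; orthogonality to the modes gives orthogonality to all
  powers of (cos s)^2, and Bernstein polynomials approximate \<open>G\<close>, so the integral of
  g^2 vanishes.\<close>

lemma even_function_zero_of_fcos:
  assumes cont: "continuous_on S_int g" and even: "\<And>s. s \<in> S_int \<Longrightarrow> g (- s) = g s"
    and zero: "\<And>k. integral S_int (\<lambda>s. g s * cos (2 * real k * s)) = 0" and s: "s \<in> S_int"
  shows "g s = 0"
proof -
  have ig: "(\<lambda>s. g s * f s) integrable_on S_int" if "continuous_on S_int f" for f
    using cont that unfolding S_int_eq by (auto intro!: integrable_continuous_real continuous_intros)
  have pow: "integral S_int (\<lambda>s. g s * ((cos s)\<^sup>2) ^ j * cos (2 * real k * s)) = 0" for j k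
  proof (induction j arbitrary: k)
    case 0 then show ?case using zero by simp
  next
    case (Suc j)
    \<comment> \<open>Multiplication by (cos s)^2 couples mode k to the modes k + 1 and k - 1; mode
      -1 is mode 1 because the cosine is even.\<close>
    define k' where "k' = (if k = 0 then 1 else k - 1)"
    have k': "cos (2 * real k' * s) = cos (2 * real k * s - 2 * s)" for s
    proof (cases "k = 0")
      case False
      then have "2 * real k' * s = 2 * real k * s - 2 * s" by (simp add: k'_def of_nat_diff algebra_simps)
      then show ?thesis by metis
    qed (simp add: k'_def)
    have k'': "cos (2 * real (Suc k) * s) = cos (2 * real k * s + 2 * s)" for s by (simp add: algebra_simps)
    have "(cos s)\<^sup>2 * cos (2 * real k * s) =
       1/2 * cos (2 * real k * s) + 1/4 * cos (2 * real (Suc k) * s) + 1/4 * cos (2 * real k' * s)" for s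
    proof -
      have e: "(cos s)\<^sup>2 = (1 + cos (2 * s)) / 2" using cos_double_cos[of s] by simp
      show ?thesis unfolding k' k'' cos_add cos_diff e by (simp add: field_simps)
    qed
    then have "g s * ((cos s)\<^sup>2) ^ Suc j * cos (2 * real k * s) =
       1/2 * (g s * ((cos s)\<^sup>2) ^ j * cos (2 * real k * s)) + 1/4 * (g s * ((cos s)\<^sup>2) ^ j * cos (2 * real (Suc k) * s))
       + 1/4 * (g s * ((cos s)\<^sup>2) ^ j * cos (2 * real k' * s))" for s
      by (simp only: power_Suc mult.assoc mult.left_commute[of "(cos s)\<^sup>2"]) (simp add: algebra_simps)
    then have "integral S_int (\<lambda>s. g s * ((cos s)\<^sup>2) ^ Suc j * cos (2 * real k * s)) =
      integral S_int (\<lambda>s. 1/2 * (g s * ((cos s)\<^sup>2) ^ j * cos (2 * real k * s)) + 1/4 * (g s * ((cos s)\<^sup>2) ^ j * cos (2 * real (Suc k) * s))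
       + 1/4 * (g s * ((cos s)\<^sup>2) ^ j * cos (2 * real k' * s)))" by simp
    also have "\<dots> = 1/2 * integral S_int (\<lambda>s. (g s * ((cos s)\<^sup>2) ^ j * cos (2 * real k * s))) +
       1/4 * integral S_int (\<lambda>s. (g s * ((cos s)\<^sup>2) ^ j * cos (2 * real (Suc k) * s)))
       + 1/4 * integral S_int (\<lambda>s. (g s * ((cos s)\<^sup>2) ^ j * cos (2 * real k' * s)))"
    proof -
      have i: "(\<lambda>s. c * (g s * ((cos s)\<^sup>2) ^ j * cos (2 * real n * s))) integrable_on S_int" for n c
        using cont unfolding S_int_eq by (auto intro!: integrable_continuous_real continuous_intros)
      show ?thesis
        unfolding integral_add[OF integrable_add[OF i i] i] integral_add[OF i i] integral_mult_right ..
    qed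
    finally show ?case unfolding Suc.IH by simp
  qed
  define G where "G = (\<lambda>u. g (arccos (sqrt u)))"
  have Gg: "G ((cos s)\<^sup>2) = g s" if "s \<in> S_int" for s
  proof -
    have "cos s \<ge> 0" using that by (intro cos_ge_zero) (auto simp: S_int_eq)
    then have "sqrt ((cos s)\<^sup>2) = cos \<bar>s\<bar>" by simp
    moreover have "arccos (cos \<bar>s\<bar>) = \<bar>s\<bar>" using that pi_gt_zero by (intro arccos_cos) (auto simp: S_int_mem)
    ultimately show ?thesis using even[OF that] by (auto simp: G_def abs_if)
  qed
  have "continuous_on {0..1} (g \<circ> (\<lambda>u. arccos (sqrt u)))"
  proof (intro continuous_on_compose continuous_on_subset[OF cont])
    show "continuous_on {0..1} (\<lambda>u. arccos (sqrt u))"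
      by (intro continuous_on_arccos continuous_intros) (auto intro: order_trans[OF _ real_sqrt_ge_zero])
    show "(\<lambda>u. arccos (sqrt u)) ` {0..1} \<subseteq> S_int"
    proof clarify
      fix u :: real assume u: "u \<in> {0..1}"
      then have "-1 \<le> sqrt u" "0 \<le> sqrt u" "sqrt u \<le> 1"
        using real_sqrt_ge_zero[of u] by (auto simp del: real_sqrt_ge_0_iff)
      then have "0 \<le> arccos (sqrt u)" "arccos (sqrt u) \<le> pi/2"
        using arccos_lbound[of "sqrt u"] arccos_le_pi2[of "sqrt u"] by blast+
      then show "arccos (sqrt u) \<in> S_int" by (auto simp: S_int_mem)
    qed
  qed
  then have contG: "continuous_on {0..1} G" by (simp add: G_def o_def)
  obtain B where B: "\<And>s. s \<in> S_int \<Longrightarrow> \<bar>g s\<bar> \<le> B"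
    using continuous_on_S_int_bounded[OF cont] by blast
  have Bp: "B \<ge> 0" using B[of 0] by (auto simp: S_int_mem)
  have "integral S_int (\<lambda>s. g s * g s) \<le> \<epsilon> * (B * pi)" if e: "\<epsilon> > 0" for \<epsilon>
  proof -
    obtain n where n: "\<And>u. u \<in> {0..1} \<Longrightarrow> \<bar>G u - (\<Sum>k\<le>n. G (k/n) * Bernstein n k u)\<bar> < \<epsilon>"
      using Bernstein_Weierstrass[OF contG e] by blast
    define P where "P = (\<lambda>u. \<Sum>k\<le>n. G (k/n) * Bernstein n k u)"
    obtain p where p: "\<And>u. P u = poly p u"
    proof
      show "P u = poly (\<Sum>k\<le>n. smult (G (k/n) * real (n choose k)) ([:0,1:] ^ k * [:1,-1:] ^ (n-k))) u" for u
        by (simp add: P_def Bernstein_def poly_sum algebra_simps)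
    qed
    have z: "integral S_int (\<lambda>s. g s * P ((cos s)\<^sup>2)) = 0"
    proof -
      have "integral S_int (\<lambda>s. g s * P ((cos s)\<^sup>2)) =
         integral S_int (\<lambda>s. \<Sum>i\<le>degree p. coeff p i * (g s * ((cos s)\<^sup>2) ^ i))"
        by (simp add: p poly_altdef sum_distrib_left algebra_simps)
      also have "\<dots> = (\<Sum>i\<le>degree p. integral S_int (\<lambda>s. coeff p i * (g s * ((cos s)\<^sup>2) ^ i)))"
        by (intro integral_sum) (use cont in \<open>auto simp: S_int_eq intro!: integrable_continuous_real continuous_intros\<close>)
      also have "\<dots> = 0" using pow[of _ 0] by simp
      finally show ?thesis .
    qed
    have contP: "continuous_on S_int (\<lambda>s. P ((cos s)\<^sup>2))" unfolding p by (intro continuous_intros)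
    have "integral S_int (\<lambda>s. g s * g s) = integral S_int (\<lambda>s. g s * g s) - integral S_int (\<lambda>s. g s * P ((cos s)\<^sup>2))"
      using z by simp
    also have "\<dots> = integral S_int (\<lambda>s. g s * g s - g s * P ((cos s)\<^sup>2))"
      by (intro integral_diff[symmetric] ig contP cont)
    also have "\<dots> \<le> norm \<dots>" by simp
    also have "\<dots> \<le> (\<epsilon> * B) * (pi/2 - - (pi/2))"
      unfolding S_int_eq
    proof (rule integral_bound)
      show "continuous_on {-(pi/2)..pi/2} (\<lambda>s. g s * g s - g s * P ((cos s)\<^sup>2))"
        using cont contP unfolding S_int_eq by (intro continuous_intros)
      fix t assume "t \<in> {-(pi/2)..pi/2}"
      then have t: "t \<in> S_int" by (simp add: S_int_eq)
      have "\<bar>G ((cos t)\<^sup>2) - P ((cos t)\<^sup>2)\<bar> < \<epsilon>"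
        unfolding P_def by (rule n) (simp add: abs_square_le_1)
      then have "\<bar>g t - P ((cos t)\<^sup>2)\<bar> \<le> \<epsilon>" using Gg[OF t] by simp
      then have "\<bar>g t - P ((cos t)\<^sup>2)\<bar> * \<bar>g t\<bar> \<le> \<epsilon> * B" using B[OF t] e by (intro mult_mono) auto
      moreover have "g t * g t - g t * P ((cos t)\<^sup>2) = (g t - P ((cos t)\<^sup>2)) * g t" by (simp add: algebra_simps)
      ultimately show "norm (g t * g t - g t * P ((cos t)\<^sup>2)) \<le> \<epsilon> * B" by (simp add: abs_mult)
    qed simp
    finally show ?thesis by (simp add: algebra_simps)
  qed
  then have le: "integral S_int (\<lambda>s. g s * g s) \<le> 0 + \<epsilon>" if "\<epsilon> > 0" for \<epsilon>
  proof -
    have "integral S_int (\<lambda>s. g s * g s) \<le> \<epsilon> / (B * pi + 1) * (B * pi)"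
      using that Bp by (intro \<open>\<And>\<epsilon>. \<epsilon> > 0 \<Longrightarrow> _ \<le> _\<close>) (auto intro!: divide_pos_pos add_nonneg_pos)
    also have "\<dots> \<le> \<epsilon>"
    proof -
      have "0 < B * pi + 1" using Bp by (intro add_nonneg_pos) auto
      then show ?thesis using that by (simp add: pos_divide_le_eq algebra_simps)
    qed
    finally show ?thesis by simp
  qed
  have "integral S_int (\<lambda>s. g s * g s) \<le> 0" using le by (rule field_le_epsilon)
  moreover have "integral S_int (\<lambda>s. g s * g s) \<ge> 0" by (intro integral_nonneg ig cont) auto
  ultimately have "integral S_int (\<lambda>s. g s * g s) = 0" by simp
  moreover have "continuous_on S_int (\<lambda>s. g s * g s)" by (intro continuous_intros cont)
  ultimately have "\<forall>s\<in>S_int. g s * g s = 0"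
    unfolding S_int_eq by (subst (asm) integral_eq_0_iff) auto
  then show ?thesis using s by simp
qed

text \<open>Absolute summability makes the series converge uniformly, so it may be integrated term
  by term and has the same coefficients as \<open>h\<close>; completeness does the rest.\<close>

lemma fcos_series:
  assumes cont: "continuous_on S_int h" and even: "\<And>s. s \<in> S_int \<Longrightarrow> h (- s) = h s"
    and summ: "summable (\<lambda>k. \<bar>fcos h k\<bar>)" and s: "s \<in> S_int"
  shows "(\<lambda>k. fcos h k * cos (2 * real k * s)) sums h s"
proof -
  define F where "F = (\<lambda>s. \<Sum>k. fcos h k * cos (2 * real k * s))"
  have bd: "norm (fcos h k * cos (2 * real k * t)) \<le> \<bar>fcos h k\<bar>" for k t
    by (simp add: abs_mult mult_left_le)
  have sm: "summable (\<lambda>k. fcos h k * cos (2 * real k * t))" for t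
    by (rule summable_comparison_test'[OF summ bd])
  have ul: "uniform_limit S_int (\<lambda>n t. \<Sum>k<n. fcos h k * cos (2 * real k * t)) F sequentially"
    unfolding F_def by (rule Weierstrass_m_test[OF _ summ]) (rule bd)
  have contF: "continuous_on S_int F"
    by (rule uniform_limit_theorem[OF _ ul]) (auto intro!: continuous_intros always_eventually)
  have coef: "integral S_int (\<lambda>t. F t * cos (2 * real j * t)) = integral S_int (\<lambda>t. h t * cos (2 * real j * t))" for j
  proof -
    have "uniform_limit S_int (\<lambda>n t. \<Sum>k<n. fcos h k * cos (2 * real k * t) * cos (2 * real j * t))
      (\<lambda>t. \<Sum>k. fcos h k * cos (2 * real k * t) * cos (2 * real j * t)) sequentially"
    proof (rule Weierstrass_m_test[OF _ summ])
      fix k t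
      have "\<bar>fcos h k * cos (2 * real k * t)\<bar> * \<bar>cos (2 * real j * t)\<bar> \<le> \<bar>fcos h k\<bar> * 1"
        using bd by (intro mult_mono) auto
      then show "norm (fcos h k * cos (2 * real k * t) * cos (2 * real j * t)) \<le> \<bar>fcos h k\<bar>"
        by (simp add: abs_mult)
    qed
    moreover have "(\<Sum>k. fcos h k * cos (2 * real k * t) * cos (2 * real j * t)) = F t * cos (2 * real j * t)" for t
      unfolding F_def by (rule suminf_mult2[OF sm, symmetric])
    ultimately have "uniform_limit {-(pi/2)..pi/2} (\<lambda>n t. \<Sum>k<n. fcos h k * cos (2 * real k * t) * cos (2 * real j * t))
      (\<lambda>t. F t * cos (2 * real j * t)) sequentially" by (simp add: S_int_eq)
    then obtain I J where IJ: "\<And>n. ((\<lambda>t. \<Sum>k<n. fcos h k * cos (2 * real k * t) * cos (2 * real j * t)) has_integral I n) {-(pi/2)..pi/2}"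
      "((\<lambda>t. F t * cos (2 * real j * t)) has_integral J) {-(pi/2)..pi/2}" "I \<longlonglongrightarrow> J"
      by (rule uniform_limit_integral) (auto intro!: continuous_intros)
    have "I n = integral S_int (\<lambda>t. h t * cos (2 * real j * t))" if "n > j" for n
    proof -
      have "I n = integral S_int (\<lambda>t. \<Sum>k<n. fcos h k * (cos (2 * real k * t) * cos (2 * real j * t)))"
        using IJ(1)[of n] by (simp add: integral_unique S_int_eq mult.assoc)
      also have "\<dots> = (\<Sum>k<n. integral S_int (\<lambda>t. fcos h k * (cos (2 * real k * t) * cos (2 * real j * t))))"
        by (intro integral_sum) (auto simp: S_int_eq intro!: integrable_continuous_real continuous_intros)
      also have "\<dots> = (\<Sum>k<n. if k = j then fcos h j * (if j = 0 then pi else pi/2) else 0)"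
        by (intro sum.cong) (auto simp: fcos_orthogonal)
      also have "\<dots> = fcos h j * (if j = 0 then pi else pi/2)" using that by simp
      also have "\<dots> = integral S_int (\<lambda>t. h t * cos (2 * real j * t))" by (simp add: fcos_def)
      finally show ?thesis .
    qed
    then have "I \<longlonglongrightarrow> integral S_int (\<lambda>t. h t * cos (2 * real j * t))"
      by (intro tendsto_eventually eventually_mono[OF eventually_gt_at_top[of j]]) auto
    then have "J = integral S_int (\<lambda>t. h t * cos (2 * real j * t))" using IJ(3) LIMSEQ_unique by blast
    then show ?thesis using IJ(2) by (simp add: S_int_eq integral_unique)
  qed
  have "h s - F s = 0"
  proof (rule even_function_zero_of_fcos[of "\<lambda>s. h s - F s", OF _ _ _ s])
    show "continuous_on S_int (\<lambda>s. h s - F s)" by (intro continuous_intros cont contF)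
    show "h (- t) - F (- t) = h t - F t" if "t \<in> S_int" for t using even[OF that] by (simp add: F_def)
    show "integral S_int (\<lambda>s. (h s - F s) * cos (2 * real k * s)) = 0" for k
    proof -
      have "integral S_int (\<lambda>s. h s * cos (2 * real k * s) - F s * cos (2 * real k * s)) = 0"
        by (subst integral_diff)
           (use cont contF coef in \<open>auto simp: S_int_eq intro!: integrable_continuous_real continuous_intros\<close>)
      then show ?thesis by (simp add: algebra_simps)
    qed
  qed
  then show ?thesis using summable_sums[OF sm, of s] by (simp add: F_def)
qed


section \<open>Weighted diagonal dominance\<close>

lemma cos_ge_quadratic: "1 - x\<^sup>2/2 \<le> cos (x::real)"
proof -
  have "(sin (x/2))\<^sup>2 \<le> (x/2)\<^sup>2" using abs_sin_x_le_abs_x[of "x/2"] by (metis abs_le_square_iff)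
  then show ?thesis using cos_double_sin[of "x/2"] by (simp add: power_divide)
qed

lemma sin_ge_cubic: "x - x ^ 3/6 \<le> sin x" if "0 \<le> (x::real)"
proof -
  have "(\<lambda>x. sin x - (x - x ^ 3/6)) 0 \<le> (\<lambda>x. sin x - (x - x ^ 3/6)) x"
  proof (rule DERIV_nonneg_imp_nondecreasing[OF that])
    fix y :: real
    have "((\<lambda>x. sin x - (x - x ^ 3/6)) has_real_derivative cos y - (1 - y\<^sup>2/2)) (at y)"
      by (auto intro!: derivative_eq_intros simp: power2_eq_square)
    then show "\<exists>D. ((\<lambda>x. sin x - (x - x ^ 3/6)) has_real_derivative D) (at y) \<and> 0 \<le> D"
      using cos_ge_quadratic[of y] by auto
  qed
  then show ?thesis by simp
qed

lemma sin_ge_half: "x/2 \<le> sin x" if "0 \<le> (x::real)" "x \<le> pi/2"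
proof -
  have "x \<le> 1.7" using that pi_less_4 pi_approx(2) by simp
  then have "x * x \<le> 1.7 * 1.7" using that by (intro mult_mono) auto
  then have "x * (x * x) \<le> x * 3" using that by (intro mult_left_mono) auto
  then show ?thesis using sin_ge_cubic[OF that(1)] by (simp add: power3_eq_cube)
qed

lemma abs_sin_add_pi_multiple: "\<bar>sin (x + real q * pi)\<bar> = \<bar>sin x\<bar>"
  by (simp add: sin_add cos_npi sin_npi abs_mult power_abs)

text \<open>A Dirichlet-type kernel, equal to sin(m \<phi>) / sin \<phi> where the denominator is
  not zero. It sums one mode over the vertices on an arc: \<open>m\<close> vertices spaced by 2
  \<alpha>, symmetric about the axis, give \<open>ker m (2 * real k * \<alpha>)\<close>.\<close>

definition ker :: "nat \<Rightarrow> real \<Rightarrow> real" where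
  "ker m \<phi> = (\<Sum>j<m. cos ((2 * real j + 1 - real m) * \<phi>))"

lemma abs_ker_le: "\<bar>ker m \<phi>\<bar> \<le> real m"
proof -
  have "\<bar>ker m \<phi>\<bar> \<le> (\<Sum>j<m. 1)" unfolding ker_def
    by (rule order_trans[OF sum_abs]) (intro sum_mono abs_cos_le_one)
  then show ?thesis by simp
qed

lemma sin_mult_ker: "sin \<phi> * ker m \<phi> = sin (real m * \<phi>)"
proof -
  define f where "f = (\<lambda>j. sin ((2 * real j - real m) * \<phi>) / 2)"
  have "sin \<phi> * cos ((2 * real j + 1 - real m) * \<phi>) = f (Suc j) - f j" for j
  proof -
    have "f (Suc j) = sin ((2 * real j + 1 - real m) * \<phi> + \<phi>) / 2"
      "f j = sin ((2 * real j + 1 - real m) * \<phi> - \<phi>) / 2" by (simp_all add: f_def algebra_simps)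
    then show ?thesis unfolding sin_add sin_diff by (simp add: field_simps)
  qed
  then have "sin \<phi> * ker m \<phi> = (\<Sum>j<m. f (Suc j) - f j)" by (simp add: ker_def sum_distrib_left)
  also have "\<dots> = f m - f 0" by (rule sum_lessThan_telescope)
  also have "\<dots> = sin (real m * \<phi>)" by (simp add: f_def)
  finally show ?thesis .
qed

lemma sum_cos_series_eq_ker:
  assumes "\<And>j. j < m \<Longrightarrow> (\<lambda>k. b k * cos (2 * real k * ((2 * real j + 1 - real m) * \<alpha>))) sums h ((2 * real j + 1 - real m) * \<alpha>)"
  shows "(\<lambda>k. b k * ker m (2 * real k * \<alpha>)) sums (\<Sum>j<m. h ((2 * real j + 1 - real m) * \<alpha>))"
proof -
  have "(\<lambda>k. \<Sum>j<m. b k * cos (2 * real k * ((2 * real j + 1 - real m) * \<alpha>))) sums (\<Sum>j<m. h ((2 * real j + 1 - real m) * \<alpha>))"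
    using assms by (intro sums_sum) auto
  moreover have "(\<Sum>j<m. b k * cos (2 * real k * ((2 * real j + 1 - real m) * \<alpha>))) = b k * ker m (2 * real k * \<alpha>)" for k
    by (simp add: ker_def sum_distrib_left algebra_simps)
  ultimately show ?thesis by simp
qed

text \<open>With N0 the supremum of k^4 |b k|, row \<open>m\<close> gives m^4 |b m| \<le> \<theta>
  N0, hence N0 \<le> \<theta> N0 and N0 = 0. The a priori bound \<open>N\<close>, which makes N0
  finite, is where the decay of the coefficients enters. The majorant \<open>g\<close> absorbs the
  weight, and a bound on its partial sums controls the off-diagonal part of the row.\<close>

lemma weighted_diagonal_dominance:
  fixes b :: "nat \<Rightarrow> real"
  assumes N: "\<And>k. real k ^ 4 * \<bar>b k\<bar> \<le> N" and low: "\<And>k. k \<le> K \<Longrightarrow> b k = 0" and th: "\<theta> < 1"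
    and row: "\<And>m. m > K \<Longrightarrow> \<exists>R g. 1 \<le> \<bar>R m\<bar> \<and> (\<lambda>k. b k * R k) sums 0 \<and>
      (\<forall>k. 0 \<le> g k) \<and> (\<forall>k>K. k \<noteq> m \<longrightarrow> \<bar>R k\<bar> \<le> real k ^ 4 * g k) \<and> (\<forall>n. (\<Sum>k<n. g k) \<le> \<theta> / real m ^ 4)"
  shows "b k = 0"
proof -
  define N0 where "N0 = (SUP k. real k ^ 4 * \<bar>b k\<bar>)"
  have bdd: "bdd_above (range (\<lambda>k. real k ^ 4 * \<bar>b k\<bar>))" using N by (auto intro!: bdd_aboveI)
  have N0: "real k ^ 4 * \<bar>b k\<bar> \<le> N0" for k unfolding N0_def by (rule cSUP_upper[OF _ bdd]) simp
  have N0p: "0 \<le> N0" using N0[of 0] by simp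
  have "real m ^ 4 * \<bar>b m\<bar> \<le> \<theta> * N0" if m: "m > K" for m
  proof -
    obtain R g where R: "1 \<le> \<bar>R m\<bar>" "(\<lambda>k. b k * R k) sums 0" and g: "\<And>k. 0 \<le> g k"
      "\<And>k. k > K \<Longrightarrow> k \<noteq> m \<Longrightarrow> \<bar>R k\<bar> \<le> real k ^ 4 * g k" "\<And>n. (\<Sum>k<n. g k) \<le> \<theta> / real m ^ 4"
      using row[OF m] by blast
    have tm: "\<bar>b k * R k\<bar> \<le> N0 * g k" if "k \<noteq> m" for k
    proof (cases "k > K")
      case True
      have "\<bar>b k * R k\<bar> \<le> \<bar>b k\<bar> * (real k ^ 4 * g k)"
        unfolding abs_mult by (intro mult_left_mono g that True) auto
      also have "\<dots> = (real k ^ 4 * \<bar>b k\<bar>) * g k" by simp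
      also have "\<dots> \<le> N0 * g k" by (intro mult_right_mono N0 g)
      finally show ?thesis .
    qed (use low N0p g in auto)
    have "\<bar>b m * R m - (\<Sum>k<n. b k * R k)\<bar> \<le> N0 * (\<theta> / real m ^ 4)" if "n > m" for n
    proof -
      have "(\<Sum>k<n. b k * R k) = b m * R m + (\<Sum>k\<in>{..<n}-{m}. b k * R k)"
        using that by (simp add: sum.remove[of "{..<n}" m])
      then have "\<bar>b m * R m - (\<Sum>k<n. b k * R k)\<bar> = \<bar>\<Sum>k\<in>{..<n}-{m}. b k * R k\<bar>" by simp
      also have "\<dots> \<le> (\<Sum>k\<in>{..<n}-{m}. N0 * g k)"
        by (rule order_trans[OF sum_abs]) (intro sum_mono tm; simp)
      also have "\<dots> \<le> (\<Sum>k<n. N0 * g k)" using N0p g by (intro sum_mono2) auto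
      also have "\<dots> \<le> N0 * (\<theta> / real m ^ 4)"
        unfolding sum_distrib_left[symmetric] by (intro mult_left_mono g N0p)
      finally show ?thesis .
    qed
    moreover have "(\<lambda>n. \<bar>b m * R m - (\<Sum>k<n. b k * R k)\<bar>) \<longlonglongrightarrow> \<bar>b m * R m - 0\<bar>"
      using R(2) unfolding sums_def by (intro tendsto_intros)
    ultimately have "\<bar>b m * R m - 0\<bar> \<le> N0 * (\<theta> / real m ^ 4)"
      by (intro LIMSEQ_le_const2[of _ "\<bar>b m * R m - 0\<bar>"]) (auto intro!: exI[of _ "Suc m"])
    moreover have "\<bar>b m\<bar> * 1 \<le> \<bar>b m\<bar> * \<bar>R m\<bar>" using R(1) by (intro mult_left_mono) auto
    ultimately have "\<bar>b m\<bar> \<le> N0 * (\<theta> / real m ^ 4)" by (simp add: abs_mult)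
    then show ?thesis using m by (simp add: field_simps)
  qed
  then have a: "real k ^ 4 * \<bar>b k\<bar> \<le> max 0 (\<theta> * N0)" for k
    using low[of k] by (cases "k > K") (auto simp: le_max_iff_disj)
  have "N0 \<le> max 0 (\<theta> * N0)" unfolding N0_def[of] by (rule cSUP_least) (use a N0_def in auto)
  then have "N0 = 0" using th N0p by (smt (verit) mult_le_cancel_right1)
  moreover have "0 \<le> real k ^ 4 * \<bar>b k\<bar>" by simp
  ultimately have "real k ^ 4 * \<bar>b k\<bar> = 0" using N0[of k] by linarith
  \<comment> \<open>The weight vanishes at k = 0, where \<open>low\<close> is used instead.\<close>
  then show ?thesis using low[of 0] by (cases "k = 0") auto
qed

section \<open>Sums over modes, grouped modulo m\<close>

lemma sum_inverse_squares: "(\<Sum>j<n. 1 / (real j + 1)\<^sup>2) \<le> 2"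
proof -
  have "(\<Sum>j<Suc n. 1 / (real j + 1)\<^sup>2) \<le> 2 - 1 / (real n + 1)" for n
  proof (induction n)
    case (Suc n)
    have "1 / (real (Suc n) + 1)\<^sup>2 \<le> 1 / ((real n + 1) * (real n + 2))"
      by (intro divide_left_mono) (auto simp: power2_eq_square intro!: mult_mono)
    also have "\<dots> = 1 / (real n + 1) - 1 / (real (Suc n) + 1)" by (simp add: field_simps)
    finally show ?case using Suc.IH by simp
  qed simp
  moreover have "(\<Sum>j<n. 1 / (real j + 1)\<^sup>2) \<le> (\<Sum>j<Suc n. 1 / (real j + 1)\<^sup>2)" by simp
  ultimately show ?thesis by (smt (verit) divide_nonneg_nonneg of_nat_0_le_iff)
qed

lemma sum_inverse_squares_tail:
  assumes "K > 0"
  shows "(\<Sum>k<n. if k > K then 1 / (real k)\<^sup>2 else 0) \<le> 1 / real K"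
proof -
  have "(\<Sum>k<Suc n. if k > K then 1 / (real k)\<^sup>2 else 0) \<le> 1 / real K - 1 / real (max K n)" for n
  proof (induction n)
    case (Suc n)
    show ?case
    proof (cases "Suc n > K")
      case True
      then have "max K n = n" "n > 0" using assms by auto
      have "1 / (real (Suc n))\<^sup>2 \<le> 1 / (real n * real (Suc n))"
        using \<open>n > 0\<close> by (intro divide_left_mono) (auto simp: power2_eq_square intro!: mult_mono)
      also have "\<dots> = 1 / real n - 1 / real (Suc n)" using \<open>n > 0\<close> by (simp add: field_simps)
      finally show ?thesis using Suc.IH True \<open>max K n = n\<close> by simp
    next
      case False then show ?thesis using Suc.IH by simp
    qed
  qed (use assms in simp)
  moreover have "(\<Sum>k<n. if k > K then 1 / (real k)\<^sup>2 else 0) \<le> (\<Sum>k<Suc n. if k > K then 1 / (real k)\<^sup>2 else 0)"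
    by simp
  ultimately show ?thesis by (smt (verit) divide_nonneg_nonneg of_nat_0_le_iff)
qed

text \<open>From (n+2)^3 \<ge> 8 (n+1) the terms are dominated by a telescoping sum. The constant
  matters: in \<open>row_majorant\<close> the multiples of \<open>m\<close> carry a factor 4, so
  they cost 1/2 out of the 4/5 allowed there.\<close>

lemma sum_inverse_fourth_from_two: "(\<Sum>q<n. if q \<ge> 2 then 1 / real q ^ 4 else 0) \<le> 1/8"
proof -
  have "(\<Sum>q<n+2. if q \<ge> 2 then 1 / real q ^ 4 else 0) \<le> 1/8 * (1 - 1 / (real n + 1))" for n
  proof (induction n)
    case (Suc n)
    have "8 * ((real n + 1) * (real n + 2)) \<le> (real n + 2) ^ 4"
    proof -
      have "8 * (real n + 1) \<le> (real n + 2) ^ 3" by (simp add: power3_eq_cube algebra_simps)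
      then have "8 * (real n + 1) * (real n + 2) \<le> (real n + 2) ^ 3 * (real n + 2)" by (intro mult_right_mono) auto
      then show ?thesis by (simp add: power4_eq_xxxx power3_eq_cube algebra_simps)
    qed
    then have "1 / (real n + 2) ^ 4 \<le> 1 / (8 * ((real n + 1) * (real n + 2)))"
      by (intro divide_left_mono) auto
    also have "\<dots> = 1/8 * (1 / (real n + 1) - 1 / (real n + 2))" by (simp add: field_simps)
    finally show ?case using Suc.IH by (simp add: algebra_simps)
  qed (simp add: numeral_2_eq_2)
  moreover have "(\<Sum>q<n. if q \<ge> 2 then 1 / real q ^ 4 else 0) \<le> (\<Sum>q<n+2. if q \<ge> 2 then 1 / real q ^ 4 else 0)"
    by (intro sum_mono2) auto
  moreover have "1/8 * (1 - 1 / (real n + 1)) \<le> (1/8::real)" by simp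
  ultimately show ?thesis by (smt (verit))
qed

text \<open>A block of \<open>m\<close> consecutive modes runs once through the residues modulo
  \<open>m\<close>, on which the size of a row entry depends.\<close>

lemma sum_le_of_block_sums:
  fixes g :: "nat \<Rightarrow> real"
  assumes "m > 0" "\<And>k. 0 \<le> g k" "\<And>J. (\<Sum>j<J. \<Sum>k\<in>{j*m..<j*m+m}. g k) \<le> G"
  shows "(\<Sum>k<n. g k) \<le> G"
proof -
  have "(\<Sum>k<n. g k) \<le> (\<Sum>k<n*m. g k)" using assms(1,2) by (intro sum_mono2) auto
  then show ?thesis using assms(3)[of n] by (simp add: sum.nat_group)
qed

lemma sum_over_multiples:
  assumes m: "m > 0"
  shows "(\<Sum>k<n. if m dvd k \<and> 2 * m \<le> k then 1 / real k ^ 4 else 0) \<le> 1 / (8 * real m ^ 4)"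
proof (rule sum_le_of_block_sums[OF m])
  fix J
  have "(\<Sum>k\<in>{j*m..<j*m+m}. if m dvd k \<and> 2 * m \<le> k then 1 / real k ^ 4 else 0)
     = (if j \<ge> 2 then 1 / real j ^ 4 else 0) / real m ^ 4" for j
  proof -
    have "m dvd k \<longleftrightarrow> k = j * m" if "k \<in> {j*m..<j*m+m}" for k
    proof
      assume "m dvd k"
      then have "m dvd k - j * m" by simp
      moreover have "k - j * m < m" using that m by auto
      ultimately show "k = j * m" using that by (auto dest: nat_dvd_not_less)
    qed simp
    then have "(\<Sum>k\<in>{j*m..<j*m+m}. if m dvd k \<and> 2 * m \<le> k then 1 / real k ^ 4 else 0)
       = (\<Sum>k\<in>{j*m..<j*m+m}. if k = j * m then (if 2 * m \<le> k then 1 / real k ^ 4 else 0) else 0)"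
      by (intro sum.cong) auto
    also have "\<dots> = (if 2 * m \<le> j * m then 1 / real (j * m) ^ 4 else 0)" using m by simp
    finally show ?thesis using m by (simp add: power_mult_distrib)
  qed
  then have "(\<Sum>j<J. \<Sum>k\<in>{j*m..<j*m+m}. if m dvd k \<and> 2 * m \<le> k then 1 / real k ^ 4 else 0)
     = (\<Sum>j<J. if j \<ge> 2 then 1 / real j ^ 4 else 0) / real m ^ 4"
    by (simp add: sum_divide_distrib)
  also have "\<dots> \<le> (1/8) / real m ^ 4" by (intro divide_right_mono sum_inverse_fourth_from_two) auto
  finally show "(\<Sum>j<J. \<Sum>k\<in>{j*m..<j*m+m}. if m dvd k \<and> 2 * m \<le> k then 1 / real k ^ 4 else 0)
     \<le> 1 / (8 * real m ^ 4)" by simp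
qed auto

text \<open>Off the multiples of \<open>m\<close> this is, up to a factor 2, the reciprocal of the
  distance from k to the nearest multiple; adding both one-sided reciprocals replaces a minimum by
  terms whose block sum is harmonic. At a multiple of \<open>m\<close> the first summand is 1/0 = 0;
  those modes are treated apart.\<close>

definition gap_weight :: "nat \<Rightarrow> nat \<Rightarrow> real" where
  "gap_weight m k = 1 / real (k mod m) + 1 / real (m - k mod m)"

lemma gap_weight_nonneg: "0 \<le> gap_weight m k" by (simp add: gap_weight_def)

text \<open>Modulo pi and up to a supplement the argument is r pi / m, with r the distance to the
  nearest multiple of \<open>m\<close>. Then sin x \<ge> x/2 and pi \<ge> 3 give the factor
  1.5.\<close>

lemma sin_away_from_resonance:
  assumes m: "m > 0" and nd: "\<not> m dvd k"
  obtains r where "r \<ge> 1" "1/r \<le> gap_weight m k" "1.5 * r / real m \<le> \<bar>sin (real k * pi / real m)\<bar>"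
proof -
  define j where "j = k mod m"
  have j: "0 < j" "j < m" using m nd by (auto simp: j_def dvd_eq_mod_eq_0)
  have "real k = real j + real (k div m) * real m"
    unfolding j_def by (metis add.commute div_mult_mod_eq of_nat_add of_nat_mult)
  then have e: "real k * pi / real m = real j * pi / real m + real (k div m) * pi"
    using m by (simp add: field_simps)
  have s: "\<bar>sin (real k * pi / real m)\<bar> = \<bar>sin (real j * pi / real m)\<bar>"
    unfolding e by (rule abs_sin_add_pi_multiple)
  have main: "1.5 * real i / real m \<le> sin (real i * pi / real m)" if "2 * i \<le> m" for i
  proof -
    have "1.5 * real i / real m \<le> (real i * pi / real m) / 2"
      using m pi_approx(1) mult_left_mono[of 3 pi "real i"] by (simp add: field_simps)
    also have "\<dots> \<le> sin (real i * pi / real m)"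
    proof (rule sin_ge_half)
      have "real i * 2 \<le> real m" using that by linarith
      then show "real i * pi / real m \<le> pi/2" using m by (simp add: field_simps)
    qed auto
    finally show ?thesis .
  qed
  show ?thesis
  proof (cases "2 * j \<le> m")
    case True
    show ?thesis
      by (rule that[of "real j"]) (use j main[OF True] s in \<open>auto simp: gap_weight_def j_def[symmetric]\<close>)
  next
    case False
    then have "2 * (m - j) \<le> m" by simp
    note mj = main[OF this]
    have "real (m - j) * pi / real m = pi - real j * pi / real m"
      using j by (simp add: field_simps of_nat_diff)
    then have "sin (real (m - j) * pi / real m) = sin (real j * pi / real m)" by simp
    then show ?thesis
      by (intro that[of "real (m - j)"]) (use j mj s in \<open>auto simp: gap_weight_def j_def[symmetric]\<close>)
  qed
qed

text \<open>The sine is Lipschitz with constant 1; in this form a lower bound for a sine survives a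
  smaller change of the argument.\<close>

lemma abs_sin_diff_le: "\<bar>sin x\<bar> - \<bar>y\<bar> \<le> \<bar>sin (x + (y::real))\<bar>"
proof -
  have "sin x - sin (x + y) = 2 * sin (- y / 2) * cos (x + y / 2)"
    by (simp add: sin_diff_sin field_simps)
  then have "\<bar>sin x - sin (x + y)\<bar> = 2 * \<bar>sin (y/2)\<bar> * \<bar>cos (x + y/2)\<bar>" by (simp add: abs_mult)
  also have "\<dots> \<le> 2 * \<bar>y/2\<bar> * 1"
    by (intro mult_mono abs_sin_x_le_abs_x) auto
  finally show ?thesis by simp
qed


text \<open>The coefficient of mode k in the identity of the orbit with \<open>m\<close> vertices on
  the left and \<open>2 * m\<close> on the right, when the right deformation function is minus the
  left one. With equal numbers of vertices and \<beta> = 0 the two contributions would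
  cancel.\<close>

definition row_entry :: "nat \<Rightarrow> real \<Rightarrow> nat \<Rightarrow> real" where
  "row_entry m \<beta> k = sin ((pi/2 - \<beta>) / m) * ker m (2 * real k * ((pi/2 - \<beta>) / m))
     - sin ((pi/2 + \<beta>) / real (2 * m)) * ker (2 * m) (2 * real k * ((pi/2 + \<beta>) / real (2 * m)))"

section \<open>Size of the row entries: generic, off resonance, low and diagonal\<close>

context
  fixes m :: nat and \<beta> :: real
  assumes m1: "m \<ge> 1" and be: "0 \<le> \<beta>" "\<beta> \<le> 1/20"
begin

definition "\<alpha>\<^sub>1 = (pi/2 - \<beta>) / m"
definition "\<alpha>\<^sub>2 = (pi/2 + \<beta>) / real (2 * m)"

lemma al: "0 < \<alpha>\<^sub>1" "0 < \<alpha>\<^sub>2" "\<alpha>\<^sub>1 \<le> 2 / m" "\<alpha>\<^sub>2 \<le> 2 / m"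
  "real m * \<alpha>\<^sub>1 = pi/2 - \<beta>" "real (2 * m) * \<alpha>\<^sub>2 = pi/2 + \<beta>" "sin \<alpha>\<^sub>1 \<ge> 0" "sin \<alpha>\<^sub>2 \<ge> 0"
proof -
  have p: "3 < pi" "pi < 3.15" using pi_approx by auto
  show a: "0 < \<alpha>\<^sub>1" "0 < \<alpha>\<^sub>2" using m1 be p by (auto simp: \<alpha>\<^sub>1_def \<alpha>\<^sub>2_def)
  show "\<alpha>\<^sub>1 \<le> 2 / m" using m1 be p unfolding \<alpha>\<^sub>1_def by (intro divide_right_mono) auto
  have "(pi/2 + \<beta>) / 2 \<le> 2" using be p by auto
  then have "(pi/2 + \<beta>) / 2 / m \<le> 2 / m" using m1 by (intro divide_right_mono) auto
  then show "\<alpha>\<^sub>2 \<le> 2 / m" by (simp add: \<alpha>\<^sub>2_def)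
  show "real m * \<alpha>\<^sub>1 = pi/2 - \<beta>" "real (2 * m) * \<alpha>\<^sub>2 = pi/2 + \<beta>" using m1 by (auto simp: \<alpha>\<^sub>1_def \<alpha>\<^sub>2_def)
  have "\<alpha>\<^sub>1 \<le> pi/2" "\<alpha>\<^sub>2 \<le> pi"
  proof -
    have "\<alpha>\<^sub>1 \<le> (pi/2 - \<beta>) / 1" unfolding \<alpha>\<^sub>1_def using m1 be p by (intro divide_left_mono) auto
    then show "\<alpha>\<^sub>1 \<le> pi/2" using be by simp
    have "\<alpha>\<^sub>2 \<le> (pi/2 + \<beta>) / 1" unfolding \<alpha>\<^sub>2_def using m1 be p by (intro divide_left_mono) auto
    then show "\<alpha>\<^sub>2 \<le> pi" using be p by simp
  qed
  then show "sin \<alpha>\<^sub>1 \<ge> 0" "sin \<alpha>\<^sub>2 \<ge> 0" using a p by (auto intro!: sin_ge_zero)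
qed

lemma row_entry_eq: "row_entry m \<beta> k = sin \<alpha>\<^sub>1 * ker m (2 * real k * \<alpha>\<^sub>1) - sin \<alpha>\<^sub>2 * ker (2 * m) (2 * real k * \<alpha>\<^sub>2)"
  by (simp add: row_entry_def \<alpha>\<^sub>1_def \<alpha>\<^sub>2_def)

text \<open>The angles satisfy m (2k \<open>\<alpha>\<^sub>1\<close>) = k pi - 2k \<beta> and 2m (2k
  \<open>\<alpha>\<^sub>2\<close>) = k pi + 2k \<beta>, so both numerators have the size of sin(2k
  \<beta>), with opposite signs.\<close>

lemma sin_ker_products:
  "sin (2 * real k * \<alpha>\<^sub>1) * ker m (2 * real k * \<alpha>\<^sub>1) = - ((-1) ^ k * sin (2 * real k * \<beta>))"
  "sin (2 * real k * \<alpha>\<^sub>2) * ker (2 * m) (2 * real k * \<alpha>\<^sub>2) = (-1) ^ k * sin (2 * real k * \<beta>)"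
proof -
  have "real m * (2 * real k * \<alpha>\<^sub>1) = 2 * real k * (real m * \<alpha>\<^sub>1)" by simp
  then have 1: "real m * (2 * real k * \<alpha>\<^sub>1) = real k * pi - 2 * real k * \<beta>"
    unfolding al(5) by (simp add: algebra_simps)
  have "real (2 * m) * (2 * real k * \<alpha>\<^sub>2) = 2 * real k * (real (2 * m) * \<alpha>\<^sub>2)" by simp
  then have 2: "real (2 * m) * (2 * real k * \<alpha>\<^sub>2) = real k * pi + 2 * real k * \<beta>"
    unfolding al(6) by (simp add: algebra_simps)
  show "sin (2 * real k * \<alpha>\<^sub>1) * ker m (2 * real k * \<alpha>\<^sub>1) = - ((-1) ^ k * sin (2 * real k * \<beta>))"
    unfolding sin_mult_ker 1 by (simp add: sin_diff cos_npi sin_npi)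
  show "sin (2 * real k * \<alpha>\<^sub>2) * ker (2 * m) (2 * real k * \<alpha>\<^sub>2) = (-1) ^ k * sin (2 * real k * \<beta>)"
    unfolding sin_mult_ker 2 by (simp add: sin_add cos_npi sin_npi)
qed

lemma abs_row_entry_le: "\<bar>row_entry m \<beta> k\<bar> \<le> pi"
proof -
  have "\<bar>row_entry m \<beta> k\<bar> \<le> \<bar>sin \<alpha>\<^sub>1\<bar> * \<bar>ker m (2 * real k * \<alpha>\<^sub>1)\<bar> + \<bar>sin \<alpha>\<^sub>2\<bar> * \<bar>ker (2 * m) (2 * real k * \<alpha>\<^sub>2)\<bar>"
    unfolding row_entry_eq abs_mult[symmetric] by linarith
  also have "\<dots> \<le> \<alpha>\<^sub>1 * real m + \<alpha>\<^sub>2 * real (2 * m)"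
    using al(1,2) abs_sin_x_le_abs_x[of \<alpha>\<^sub>1] abs_sin_x_le_abs_x[of \<alpha>\<^sub>2]
    by (intro add_mono mult_mono abs_ker_le) auto
  also have "\<dots> = pi" using al(5,6) by (simp add: algebra_simps)
  finally show ?thesis .
qed

text \<open>The numerators are at most 2k \<beta>, while the sines in the denominators are at least
  of order r/m, where r is the distance from k to the multiples of \<open>m\<close>. As long as 2k
  \<beta> \<le> 1 the tilt shifts the sine arguments by too little to spoil this; for larger k the
  quadratic term alone exceeds the trivial bound pi.\<close>

lemma row_entry_nonresonant:
  assumes nd: "\<not> m dvd k"
  shows "\<bar>row_entry m \<beta> k\<bar> \<le> 24 * real k * \<beta> * gap_weight m k + 16 * (real k)\<^sup>2 * \<beta>\<^sup>2"
proof (cases "2 * real k * \<beta> \<le> 1")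
  case False
  then have "1 * 1 \<le> (2 * real k * \<beta>) * (2 * real k * \<beta>)" using be by (intro mult_mono) auto
  then have "1 \<le> 4 * ((real k)\<^sup>2 * \<beta>\<^sup>2)" by (simp add: power2_eq_square algebra_simps)
  then have "pi \<le> 16 * (real k)\<^sup>2 * \<beta>\<^sup>2" using pi_less_4 by linarith
  moreover have "0 \<le> 24 * real k * \<beta> * gap_weight m k" using be gap_weight_nonneg by simp
  ultimately show ?thesis using abs_row_entry_le[of k] by linarith
next
  case True
  have m: "m > 0" using m1 by simp
  obtain r where r: "r \<ge> 1" "1/r \<le> gap_weight m k" "1.5 * r / real m \<le> \<bar>sin (real k * pi / real m)\<bar>"
    using sin_away_from_resonance[OF m nd] by auto
  have kb: "0 \<le> real k * \<beta>" using be by simp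
  have rm: "1 / real m \<le> r / real m" using r m by (intro divide_right_mono) auto
  have s1: "0.5 * r / real m \<le> \<bar>sin (2 * real k * \<alpha>\<^sub>1)\<bar>"
  proof -
    have e: "2 * real k * \<alpha>\<^sub>1 = real k * pi / real m + (- (2 * real k * \<beta> / real m))"
      by (simp add: \<alpha>\<^sub>1_def diff_divide_distrib algebra_simps)
    have "\<bar>- (2 * real k * \<beta> / real m)\<bar> \<le> 1 / real m"
      using True kb by (simp add: divide_right_mono)
    then have "\<bar>- (2 * real k * \<beta> / real m)\<bar> \<le> r / real m" using rm by linarith
    then show ?thesis unfolding e
      using abs_sin_diff_le[of "real k * pi / real m" "- (2 * real k * \<beta> / real m)"] r(3) by (simp add: field_simps)
  qed
  have s2: "0.25 * r / real m \<le> \<bar>sin (2 * real k * \<alpha>\<^sub>2)\<bar>"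
  proof -
    \<comment> \<open>The right arc involves half the angle. Doubling an angle at most doubles the
      sine, so the lower bound drops from 1.5 to 0.75.\<close>
    define y where "y = real k * pi / (2 * real m)"
    have e: "2 * real k * \<alpha>\<^sub>2 = y + real k * \<beta> / real m"
      by (simp add: \<alpha>\<^sub>2_def y_def add_divide_distrib algebra_simps)
    have "real k * pi / real m = 2 * y" by (simp add: y_def)
    then have "\<bar>sin (real k * pi / real m)\<bar> = 2 * \<bar>sin y\<bar> * \<bar>cos y\<bar>" by (simp add: sin_double abs_mult)
    also have "\<dots> \<le> 2 * \<bar>sin y\<bar> * 1" by (intro mult_left_mono) auto
    finally have "0.75 * r / real m \<le> \<bar>sin y\<bar>" using r(3) by simp
    moreover have "\<bar>real k * \<beta> / real m\<bar> \<le> (1/2) / real m"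
      using True kb m by (simp add: field_simps)
    then have "\<bar>real k * \<beta> / real m\<bar> \<le> 0.5 * r / real m" using rm by simp
    ultimately show ?thesis unfolding e using abs_sin_diff_le[of y "real k * \<beta> / real m"] by simp
  qed
  have sb: "\<bar>sin (2 * real k * \<beta>)\<bar> \<le> 2 * real k * \<beta>" using abs_sin_x_le_abs_x[of "2 * real k * \<beta>"] kb by simp
  have k1: "\<bar>ker m (2 * real k * \<alpha>\<^sub>1)\<bar> \<le> 4 * real k * \<beta> * real m * (1/r)"
  proof -
    have "0.5 * r / real m * \<bar>ker m (2 * real k * \<alpha>\<^sub>1)\<bar> \<le> \<bar>sin (2 * real k * \<alpha>\<^sub>1)\<bar> * \<bar>ker m (2 * real k * \<alpha>\<^sub>1)\<bar>"
      using s1 by (intro mult_right_mono) auto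
    also have "\<dots> \<le> 2 * real k * \<beta>" using sb by (simp add: abs_mult[symmetric] sin_ker_products) (simp add: abs_mult power_abs)
    finally show ?thesis using r(1) m by (simp add: field_simps)
  qed
  have k2: "\<bar>ker (2 * m) (2 * real k * \<alpha>\<^sub>2)\<bar> \<le> 8 * real k * \<beta> * real m * (1/r)"
  proof -
    have "0.25 * r / real m * \<bar>ker (2 * m) (2 * real k * \<alpha>\<^sub>2)\<bar> \<le> \<bar>sin (2 * real k * \<alpha>\<^sub>2)\<bar> * \<bar>ker (2 * m) (2 * real k * \<alpha>\<^sub>2)\<bar>"
      using s2 by (intro mult_right_mono) auto
    also have "\<dots> \<le> 2 * real k * \<beta>" using sb by (simp add: abs_mult[symmetric] sin_ker_products) (simp add: abs_mult power_abs)
    finally show ?thesis using r(1) m by (simp add: field_simps)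
  qed
  have "\<bar>row_entry m \<beta> k\<bar> \<le> \<bar>sin \<alpha>\<^sub>1\<bar> * \<bar>ker m (2 * real k * \<alpha>\<^sub>1)\<bar> + \<bar>sin \<alpha>\<^sub>2\<bar> * \<bar>ker (2 * m) (2 * real k * \<alpha>\<^sub>2)\<bar>"
    unfolding row_entry_eq abs_mult[symmetric] by linarith
  also have "\<dots> \<le> 2 / m * (4 * real k * \<beta> * real m * (1/r)) + 2 / m * (8 * real k * \<beta> * real m * (1/r))"
    using al(1-4) abs_sin_x_le_abs_x[of \<alpha>\<^sub>1] abs_sin_x_le_abs_x[of \<alpha>\<^sub>2]
    by (intro add_mono mult_mono k1 k2) auto
  also have "\<dots> = 24 * real k * \<beta> * (1/r)" using m by (simp add: field_simps)
  also have "\<dots> \<le> 24 * real k * \<beta> * gap_weight m k" using kb r(2) by (intro mult_left_mono) (auto simp: mult.commute)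
  finally show ?thesis by (simp add: add_increasing2)
qed

text \<open>Both sines are replaced by their arguments, whose quotient is 1/(2k), at the cost of
  cubic errors.\<close>

lemma sine_quotient_bound:
  assumes k: "k \<ge> 1" and a: "0 < \<alpha>" "2 * real k * \<alpha> \<le> pi/2"
  shows "\<bar>sin \<alpha> / sin (2 * real k * \<alpha>) - 1 / (2 * real k)\<bar> \<le> real k * \<alpha>\<^sup>2"
proof -
  define x where "x = 2 * real k * \<alpha>"
  have x: "0 < x" "x \<le> pi/2" using assms by (auto simp: x_def)
  have sx: "x/2 \<le> sin x" "x - x ^ 3 / 6 \<le> sin x" "sin x \<le> x"
    using sin_ge_half sin_ge_cubic sin_x_le_x x by auto
  have sa: "\<alpha> - \<alpha> ^ 3 / 6 \<le> sin \<alpha>" "sin \<alpha> \<le> \<alpha>" using sin_ge_cubic sin_x_le_x a by auto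
  have "2 * real k * (\<alpha> - \<alpha> ^ 3 / 6) \<le> 2 * real k * sin \<alpha>" "2 * real k * sin \<alpha> \<le> x"
    using sa k unfolding x_def by (auto intro!: mult_left_mono)
  then have "x - (2 * real k * \<alpha> ^ 3) / 6 \<le> 2 * real k * sin \<alpha>" "2 * real k * sin \<alpha> \<le> x"
    by (auto simp: x_def algebra_simps)
  moreover have "2 * real k * \<alpha> ^ 3 \<le> x ^ 3"
  proof -
    have "(2 * real k) ^ 1 \<le> (2 * real k) ^ 3" using k by (intro power_increasing) auto
    then show ?thesis using a by (simp add: x_def power_mult_distrib)
  qed
  ultimately have num: "\<bar>2 * real k * sin \<alpha> - sin x\<bar> \<le> x ^ 3 / 6"
    using sx by linarith
  have sp: "sin x > 0" using sx x by linarith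
  have "\<bar>sin \<alpha> / sin x - 1 / (2 * real k)\<bar> = \<bar>2 * real k * sin \<alpha> - sin x\<bar> / (2 * real k * sin x)"
  proof -
    have "sin \<alpha> / sin x - 1 / (2 * real k) = (2 * real k * sin \<alpha> - sin x) / (2 * real k * sin x)"
      using sp k by (simp add: field_simps)
    then show ?thesis using sp k by (simp add: abs_mult)
  qed
  also have "\<dots> \<le> (x ^ 3 / 6) / (2 * real k * (x/2))"
    using num sx sp k x by (intro frac_le mult_left_mono) auto
  also have "\<dots> = (2/3) * (real k * \<alpha>\<^sup>2)" using k a by (simp add: x_def power2_eq_square power3_eq_cube)
  also have "\<dots> \<le> real k * \<alpha>\<^sup>2" by (simp add: mult_left_le_one_le)
  finally show ?thesis by (simp add: x_def)
qed

text \<open>The sine quotients of the two arcs add up to about 1/k, and sin(2k \<beta>) is about 2k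
  \<beta>, so the entry is -2 \<beta> (-1)^k to first order. The term added in the statement is the
  one that the boundary series supplies. The remainder is quadratic in k and, for \<beta> of order
  1/m^2, of size m^-4.\<close>

lemma row_entry_low:
  assumes k: "k \<ge> 1" "2 * k < m"
  shows "\<bar>row_entry m \<beta> k + 2 * \<beta> * (-1) ^ k\<bar> \<le> (real k)\<^sup>2 * (2 * \<beta> ^ 3 + 16 * \<beta> / (real m)\<^sup>2)"
proof -
  have m: "m > 0" using k by simp
  define S where "S = sin \<alpha>\<^sub>1 / sin (2 * real k * \<alpha>\<^sub>1) + sin \<alpha>\<^sub>2 / sin (2 * real k * \<alpha>\<^sub>2)"
  define s where "s = sin (2 * real k * \<beta>)"
  have p: "3 < pi" using pi_approx by auto
  have km: "2 * real k \<le> real m" using k by linarith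
  have b1: "2 * real k * \<alpha>\<^sub>1 \<le> pi/2"
  proof -
    have "2 * real k * \<alpha>\<^sub>1 \<le> real m * \<alpha>\<^sub>1" using km al(1) by (intro mult_right_mono) auto
    then show ?thesis using al(5) be by linarith
  qed
  have b2: "2 * real k * \<alpha>\<^sub>2 \<le> pi/2"
  proof -
    have "2 * real k * \<alpha>\<^sub>2 \<le> real m * \<alpha>\<^sub>2" using km al(2) by (intro mult_right_mono) auto
    then show ?thesis using al(6) be p by simp
  qed
  have sp: "sin (2 * real k * \<alpha>\<^sub>1) > 0" "sin (2 * real k * \<alpha>\<^sub>2) > 0"
    using b1 b2 al k p by (auto intro!: sin_gt_zero)
  have kr: "ker m (2 * real k * \<alpha>\<^sub>1) = - ((-1) ^ k * s) / sin (2 * real k * \<alpha>\<^sub>1)"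
    "ker (2 * m) (2 * real k * \<alpha>\<^sub>2) = ((-1) ^ k * s) / sin (2 * real k * \<alpha>\<^sub>2)"
    using sin_ker_products[of k] sp by (auto simp: s_def field_simps)
  have "row_entry m \<beta> k + 2 * \<beta> * (-1) ^ k = (-1) ^ k * (2 * \<beta> - s * S)"
    unfolding row_entry_eq kr S_def by (simp add: algebra_simps)
  then have e: "\<bar>row_entry m \<beta> k + 2 * \<beta> * (-1) ^ k\<bar> = \<bar>2 * \<beta> - s * S\<bar>"
    by (simp add: abs_mult power_abs)
  have "\<alpha>\<^sub>1\<^sup>2 \<le> (2 / m)\<^sup>2" "\<alpha>\<^sub>2\<^sup>2 \<le> (2 / m)\<^sup>2" using al by (auto intro!: power_mono)
  then have "real k * \<alpha>\<^sub>1\<^sup>2 \<le> real k * (2 / m)\<^sup>2" "real k * \<alpha>\<^sub>2\<^sup>2 \<le> real k * (2 / m)\<^sup>2"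
    by (auto intro!: mult_left_mono simp del: power_divide)
  moreover have "8 * real k / (real m)\<^sup>2 = 2 * (real k * (2 / m)\<^sup>2)" by (simp add: power_divide)
  moreover have "1 / real k = 1 / (2 * real k) + 1 / (2 * real k)" using k by simp
  ultimately have Sb: "\<bar>S - 1 / real k\<bar> \<le> 8 * real k / (real m)\<^sup>2"
    using sine_quotient_bound[OF k(1) al(1) b1] sine_quotient_bound[OF k(1) al(2) b2] k(1)
    unfolding S_def by linarith
  have sb: "\<bar>s\<bar> \<le> 2 * real k * \<beta>" using abs_sin_x_le_abs_x[of "2 * real k * \<beta>"] be by (simp add: s_def)
  have "2 * real k * \<beta> - (2 * real k * \<beta>) ^ 3 / 6 \<le> s" "s \<le> 2 * real k * \<beta>"
    unfolding s_def using be by (auto intro!: sin_ge_cubic sin_x_le_x)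
  then have "\<bar>2 * real k * \<beta> - s\<bar> \<le> (2 * real k * \<beta>) ^ 3 / 6" by simp
  then have "\<bar>2 * real k * \<beta> - s\<bar> / real k \<le> ((2 * real k * \<beta>) ^ 3 / 6) / real k"
    by (intro divide_right_mono) auto
  also have "\<dots> = 4/3 * ((real k)\<^sup>2 * \<beta> ^ 3)" using k by (simp add: power2_eq_square power3_eq_cube)
  also have "\<dots> \<le> (real k)\<^sup>2 * (2 * \<beta> ^ 3)" using be by (simp add: mult_left_mono)
  finally have t0: "\<bar>2 * real k * \<beta> - s\<bar> / real k \<le> (real k)\<^sup>2 * (2 * \<beta> ^ 3)" .
  have t1: "\<bar>2 * \<beta> - s / real k\<bar> \<le> (real k)\<^sup>2 * (2 * \<beta> ^ 3)"
  proof -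
    have "2 * \<beta> - s / real k = (2 * real k * \<beta> - s) / real k" using k by (simp add: field_simps)
    then show ?thesis using t0 by (simp add: abs_divide)
  qed
  have "\<bar>s * (S - 1 / real k)\<bar> \<le> 2 * real k * \<beta> * (8 * real k / (real m)\<^sup>2)"
    unfolding abs_mult using sb Sb be by (intro mult_mono) auto
  also have "\<dots> = (real k)\<^sup>2 * (16 * \<beta> / (real m)\<^sup>2)" by (simp add: power2_eq_square)
  finally have t2: "\<bar>s * (S - 1 / real k)\<bar> \<le> (real k)\<^sup>2 * (16 * \<beta> / (real m)\<^sup>2)" .
  have "2 * \<beta> - s * S = (2 * \<beta> - s / real k) - s * (S - 1 / real k)" by (simp add: algebra_simps)
  then have "\<bar>2 * \<beta> - s * S\<bar> \<le> (real k)\<^sup>2 * (2 * \<beta> ^ 3) + (real k)\<^sup>2 * (16 * \<beta> / (real m)\<^sup>2)"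
    using t1 t2 by linarith
  then show ?thesis unfolding e by (simp add: algebra_simps)
qed

text \<open>At k = m the left arc is in resonance: the kernel argument pi - 2 \<beta> is close to
  pi, all terms are nearly equal, and the product with sin \<open>\<alpha>\<^sub>1\<close> is near
  pi/2 in absolute value. The right arc, with resonances at the multiples of 2m, sits at pi/2 +
  \<beta> and contributes at most 4 \<beta>. With \<beta> \<le> 1/20 the value 148/100 - 6 \<beta>
  exceeds 1.\<close>

lemma row_entry_diagonal:
  assumes mm: "m \<ge> 10" and mb: "200 * (real m * \<beta>)\<^sup>2 \<le> 1"
  shows "1 \<le> \<bar>row_entry m \<beta> m + 2 * \<beta> * (-1) ^ m\<bar>"
proof -
  have p: "3.14 < pi" "pi < 3.15" using pi_approx by auto
  have e1: "2 * real m * \<alpha>\<^sub>1 = pi - 2 * \<beta>" using al(5) by (simp add: algebra_simps)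
  have e2: "2 * real m * \<alpha>\<^sub>2 = pi/2 + \<beta>" using al(6) by (simp add: algebra_simps)
  have k1: "(99/100) * real m \<le> \<bar>ker m (pi - 2 * \<beta>)\<bar>"
  proof -
    have "cos ((2 * real j + 1 - real m) * (pi - 2 * \<beta>)) = (-1) ^ (m + 1) * cos ((2 * real j + 1 - real m) * (2 * \<beta>))" for j
    proof -
      define d where "d = 2 * real j + 1 - real m"
      have "d * pi = real (2 * j + 1) * pi - real m * pi" by (simp add: d_def algebra_simps)
      then have "cos (d * pi) = (-1) ^ (m + 1)" "sin (d * pi) = 0"
        by (simp_all only: cos_diff sin_diff cos_npi sin_npi) simp_all
      moreover have "d * (pi - 2 * \<beta>) = d * pi - d * (2 * \<beta>)" by (simp add: algebra_simps)
      ultimately show ?thesis unfolding d_def[symmetric] by (simp add: cos_diff)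
    qed
    then have "ker m (pi - 2 * \<beta>) = (-1) ^ (m + 1) * ker m (2 * \<beta>)"
      by (simp add: ker_def sum_distrib_left)
    then have "\<bar>ker m (pi - 2 * \<beta>)\<bar> = \<bar>ker m (2 * \<beta>)\<bar>" by (simp add: abs_mult power_abs)
    moreover have "(\<Sum>j<m. (99/100)) \<le> ker m (2 * \<beta>)" unfolding ker_def
    proof (rule sum_mono)
      fix j assume "j \<in> {..<m}"
      then have "\<bar>2 * real j + 1 - real m\<bar> \<le> real m" by auto
      then have "\<bar>(2 * real j + 1 - real m) * (2 * \<beta>)\<bar> \<le> real m * (2 * \<beta>)"
        unfolding abs_mult using be by (intro mult_mono) auto
      then have "((2 * real j + 1 - real m) * (2 * \<beta>))\<^sup>2 \<le> (real m * (2 * \<beta>))\<^sup>2"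
        by (metis abs_ge_zero power2_abs power_mono)
      also have "\<dots> = 4 * (real m * \<beta>)\<^sup>2" by (simp add: power_mult_distrib)
      finally show "(99/100) \<le> cos ((2 * real j + 1 - real m) * (2 * \<beta>))"
        using cos_ge_quadratic[of "(2 * real j + 1 - real m) * (2 * \<beta>)"] mb by linarith
    qed
    ultimately show ?thesis by simp
  qed
  have s1: "1.5 / real m \<le> sin \<alpha>\<^sub>1"
  proof -
    have "2 / real m \<le> 2 / 10" using mm by (intro frac_le) auto
    then have "\<alpha>\<^sub>1 \<le> 2 / 10" using al(3) by linarith
    then have "\<alpha>\<^sub>1 * \<alpha>\<^sub>1 \<le> (2/10) * (2/10)" using al(1) by (intro mult_mono) auto
    then have "\<alpha>\<^sub>1 * (\<alpha>\<^sub>1 * \<alpha>\<^sub>1) \<le> \<alpha>\<^sub>1 * (4/100)" using al(1) by (intro mult_left_mono) auto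
    then have "\<alpha>\<^sub>1 ^ 3 \<le> \<alpha>\<^sub>1 * (4/100)" by (simp only: power3_eq_cube mult.assoc)
    then have "(99/100) * \<alpha>\<^sub>1 \<le> sin \<alpha>\<^sub>1" using sin_ge_cubic[of \<alpha>\<^sub>1] al(1) by linarith
    moreover have "(152/100) / real m \<le> \<alpha>\<^sub>1" unfolding \<alpha>\<^sub>1_def using be p by (intro divide_right_mono) auto
    moreover have "1.5 / real m \<le> (99/100) * ((152/100) / real m)" using mm by (simp add: field_simps)
    ultimately show ?thesis by linarith
  qed
  have "(1.5 / real m) * ((99/100) * real m) \<le> sin \<alpha>\<^sub>1 * \<bar>ker m (pi - 2 * \<beta>)\<bar>"
    using s1 k1 al(7) by (intro mult_mono) auto
  then have A: "(148/100) \<le> sin \<alpha>\<^sub>1 * \<bar>ker m (pi - 2 * \<beta>)\<bar>" using mm by simp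
  have cb: "1/2 \<le> cos \<beta>"
  proof -
    have "\<beta> * \<beta> \<le> 1 * 1" using be by (intro mult_mono) auto
    then show ?thesis using cos_ge_quadratic[of \<beta>] by (simp add: power2_eq_square)
  qed
  have "\<bar>ker (2 * m) (pi/2 + \<beta>)\<bar> * (1/2) \<le> \<bar>ker (2 * m) (pi/2 + \<beta>)\<bar> * cos \<beta>"
    using cb by (intro mult_left_mono) auto
  also have "\<dots> = \<bar>sin (pi/2 + \<beta>) * ker (2 * m) (pi/2 + \<beta>)\<bar>"
    using cb by (simp add: sin_add abs_mult)
  also have "\<dots> = \<bar>sin (2 * real m * \<beta> + real m * pi)\<bar>"
    unfolding sin_mult_ker by (simp add: algebra_simps)
  also have "\<dots> \<le> 2 * real m * \<beta>"
    unfolding abs_sin_add_pi_multiple using abs_sin_x_le_abs_x[of "2 * real m * \<beta>"] be by simp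
  finally have "\<bar>ker (2 * m) (pi/2 + \<beta>)\<bar> \<le> 4 * real m * \<beta>" by simp
  then have "sin \<alpha>\<^sub>2 * \<bar>ker (2 * m) (pi/2 + \<beta>)\<bar> \<le> (1 / real m) * (4 * real m * \<beta>)"
  proof (intro mult_mono)
    have "(pi/2 + \<beta>) / real (2 * m) \<le> 2 / real (2 * m)" using be p by (intro divide_right_mono) auto
    then have "\<alpha>\<^sub>2 \<le> 1 / m" by (simp add: \<alpha>\<^sub>2_def)
    then show "sin \<alpha>\<^sub>2 \<le> 1 / real m" using sin_x_le_x[of \<alpha>\<^sub>2] al(2) by linarith
  qed (use be in auto)
  then have B: "sin \<alpha>\<^sub>2 * \<bar>ker (2 * m) (pi/2 + \<beta>)\<bar> \<le> 4 * \<beta>" using mm by simp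
  have "row_entry m \<beta> m = sin \<alpha>\<^sub>1 * ker m (pi - 2 * \<beta>) - sin \<alpha>\<^sub>2 * ker (2 * m) (pi/2 + \<beta>)"
    unfolding row_entry_eq e1 e2 ..
  then have "\<bar>row_entry m \<beta> m\<bar> \<ge> \<bar>sin \<alpha>\<^sub>1 * ker m (pi - 2 * \<beta>)\<bar> - \<bar>sin \<alpha>\<^sub>2 * ker (2 * m) (pi/2 + \<beta>)\<bar>"
    by linarith
  then have "\<bar>row_entry m \<beta> m\<bar> \<ge> (148/100) - 4 * \<beta>" using A B al(7,8) by (simp add: abs_mult)
  moreover have "\<bar>2 * \<beta> * (-1) ^ m\<bar> = 2 * \<beta>" using be by (simp add: abs_mult power_abs)
  ultimately show ?thesis using be by linarith
qed

end


section \<open>Majorants for whole rows\<close>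

lemma harmonic_le_sqrt: "(\<Sum>i=1..<m. 1 / real i) \<le> 3 * sqrt (real m)"
proof (induction m)
  case (Suc m)
  show ?case
  proof (cases "m = 0")
    case False
    define u v where "u = sqrt (real (Suc m))" and "v = sqrt (real m)"
    have "u \<le> real m + 1" "v \<le> real m"
      using False unfolding u_def v_def by (auto intro!: real_le_lsqrt simp: power2_eq_square algebra_simps)
    then have uv: "u + v \<le> 3 * real m" using False by linarith
    have pos: "v \<le> u" "(u + v) * (u - v) = 1" "real m > 0"
      using False by (auto simp: u_def v_def algebra_simps)
    have "1 \<le> 3 * real m * (u - v)" using mult_right_mono[OF uv, of "u - v"] pos by simp
    then have "1 / real m \<le> 3 * (u - v)" using pos(3) by (simp add: field_simps)
    then show ?thesis using Suc.IH False by (simp add: u_def v_def)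
  qed simp
qed simp

text \<open>Each summand of the weight runs through 1/1, ..., 1/(m-1), which gives twice a harmonic
  sum. The bound by sqrt m is crude, but any order smaller than m serves the purpose.\<close>

lemma sum_gap_weight: "(\<Sum>k\<in>{j*m..<j*m+m}. if m dvd k then 0 else gap_weight m k) \<le> 6 * sqrt (real m)"
proof (cases "m = 0")
  case False
  have "(\<Sum>k\<in>{j*m..<j*m+m}. if m dvd k then 0 else gap_weight m k)
      = (\<Sum>i=0..<m. if m dvd (i + j*m) then 0 else gap_weight m (i + j*m))"
    using sum.shift_bounds_nat_ivl[of "\<lambda>k. if m dvd k then 0 else gap_weight m k" 0 "j*m" m] by (simp add: add.commute)
  also have "\<dots> = (\<Sum>i=1..<m. 1 / real i + 1 / real (m - i))"
  proof -
    have "(\<Sum>i=0..<m. if m dvd (i + j*m) then 0 else gap_weight m (i + j*m))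
      = (\<Sum>i\<in>{0..<m}. if i = 0 then 0 else 1 / real i + 1 / real (m - i))"
      by (intro sum.cong) (auto simp: gap_weight_def dvd_add_left_iff dest: nat_dvd_not_less)
    also have "\<dots> = (\<Sum>i=1..<m. 1 / real i + 1 / real (m - i))"
      using False by (simp add: sum.atLeast_Suc_lessThan)
    finally show ?thesis .
  qed
  also have "\<dots> = (\<Sum>i=1..<m. 1 / real i) + (\<Sum>i=1..<m. 1 / real (m - i))" by (rule sum.distrib)
  also have "(\<Sum>i=1..<m. 1 / real (m - i)) = (\<Sum>i=1..<m. 1 / real i)"
    by (rule sum.reindex_bij_witness[of _ "\<lambda>i. m - i" "\<lambda>i. m - i"]) auto
  finally show ?thesis using harmonic_le_sqrt[of m] by simp
qed simp

text \<open>The intermediate value theorem on [0, pi/2]: at 0 the right side is nonnegative because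
  the angle on the right is half of that on the left. The difference of cosines is at most x^2/2
  with x \<le> 1.6/m, and sin \<beta> \<ge> \<beta>/2, so the tilt is at most (3/a)/m^2.\<close>

lemma exists_tilt:
  fixes a :: real
  assumes a: "a > 0" and m: "m \<ge> 1"
  obtains \<beta> where "0 \<le> \<beta>" "\<beta> < pi/2" "a * sin \<beta> = cos ((pi/2 + \<beta>) / real (2 * m)) - cos ((pi/2 - \<beta>) / m)"
    "\<beta> \<le> 3 / a / (real m)\<^sup>2"
proof -
  define F where "F = (\<lambda>\<beta>. a * sin \<beta> - cos ((pi/2 + \<beta>) / real (2 * m)) + cos ((pi/2 - \<beta>) / m))"
  have p: "3 < pi" "pi < 3.15" using pi_approx by auto
  have F0: "F 0 \<le> 0"
  proof -
    have "pi / 2 / (2 * real m) \<le> pi / 2 / real m" "pi / 2 / real m \<le> pi / 1"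
      using m p by (auto intro!: frac_le simp: field_simps)
    then have "cos (pi / 2 / real m) \<le> cos (pi / 2 / (2 * real m))"
      by (intro cos_monotone_0_pi_le) auto
    then show ?thesis by (simp add: F_def)
  qed
  have Fp: "F (pi/2) > 0"
  proof -
    have "F (pi/2) = a + (1 - cos ((pi/2 + pi/2) / real (2 * m)))" by (simp add: F_def)
    then show ?thesis using a cos_le_one[of "(pi/2 + pi/2) / real (2 * m)"] by linarith
  qed
  have "\<exists>\<beta>\<ge>0. \<beta> \<le> pi/2 \<and> F \<beta> = 0"
    using F0 Fp p m unfolding F_def by (intro IVT') (auto intro!: continuous_intros)
  then obtain \<beta> where b: "0 \<le> \<beta>" "\<beta> \<le> pi/2" "F \<beta> = 0" by blast
  have eq: "a * sin \<beta> = cos ((pi/2 + \<beta>) / real (2 * m)) - cos ((pi/2 - \<beta>) / m)" using b(3) by (simp add: F_def)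
  have "\<beta> \<noteq> pi/2" using Fp b(3) by (metis less_irrefl)
  define x where "x = (pi/2 - \<beta>) / m"
  have "x \<le> 1.6 / m" unfolding x_def using b p by (intro divide_right_mono) auto
  moreover have "0 \<le> x" using b by (simp add: x_def)
  ultimately have "x\<^sup>2 \<le> (1.6 / m)\<^sup>2" by (intro power_mono)
  then have x2: "x\<^sup>2 \<le> 3 / (real m)\<^sup>2"
  proof (rule order_trans)
    have "(1.6 / real m)\<^sup>2 = 2.56 / (real m)\<^sup>2" by (simp add: power2_eq_square)
    also have "\<dots> \<le> 3 / (real m)\<^sup>2" by (intro divide_right_mono) auto
    finally show "(1.6 / real m)\<^sup>2 \<le> 3 / (real m)\<^sup>2" .
  qed
  have "\<beta> / 2 \<le> sin \<beta>" using b by (intro sin_ge_half)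
  then have "a * (\<beta> / 2) \<le> a * sin \<beta>" using a by (intro mult_left_mono) auto
  also have "\<dots> \<le> x\<^sup>2/2"
    using eq cos_le_one[of "(pi/2 + \<beta>) / real (2 * m)"] cos_ge_quadratic[of x] unfolding x_def by linarith
  also have "\<dots> \<le> 3 / (real m)\<^sup>2 / 2" using x2 by simp
  finally have "\<beta> \<le> 3 / a / (real m)\<^sup>2" using a m by (simp add: field_simps)
  then show ?thesis using that[OF b(1) _ eq] b \<open>\<beta> \<noteq> pi/2\<close> by auto
qed

text \<open>Three kinds of modes share the budget 4/5: modes with k < m/2 take 1/10, by the choice
  of \<open>K\<close>; multiples of \<open>m\<close> from 2m on take 1/2; all others take 1/5, since
  relative to 1/m^4 their total is of order sqrt m / m. The constant \<open>B\<close> bounds m^2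
  \<beta>.\<close>

lemma row_majorant:
  fixes B :: real and K :: nat
  assumes m: "m \<ge> 1" and be: "0 \<le> \<beta>" "\<beta> \<le> 1/20" "\<beta> \<le> B / (real m)\<^sup>2" and B: "B \<ge> 0" and K: "K > 0"
    and sm: "(2 * B ^ 3 + 16 * B) / K \<le> 1/10" "(2304 * B * sqrt m + 64 * B\<^sup>2 + 32 * B) / m \<le> 1/10"
  shows "\<exists>g. (\<forall>k. 0 \<le> g k) \<and>
      (\<forall>k>K. k \<noteq> m \<longrightarrow> \<bar>row_entry m \<beta> k + 2 * \<beta> * (-1) ^ k\<bar> \<le> real k ^ 4 * g k) \<and>
      (\<forall>n. (\<Sum>k<n. g k) \<le> (4/5) / real m ^ 4)"
proof -
  have mp: "real m > 0" using m by simp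
  define C where "C = 2 * B ^ 3 + 16 * B"
  have Cp: "C \<ge> 0" using B by (simp add: C_def)
  define gL where "gL = (\<lambda>k. C / real m ^ 4 * (if k > K then 1 / (real k)\<^sup>2 else 0))"
  define gM where "gM = (\<lambda>k. 4 * (if m dvd k \<and> 2 * m \<le> k then 1 / real k ^ 4 else 0))"
  define gH where "gH = (\<lambda>k. if \<not> m dvd k \<and> m \<le> 2 * k then
     (24 * real k * \<beta> * gap_weight m k + 16 * (real k)\<^sup>2 * \<beta>\<^sup>2 + 2 * \<beta>) / real k ^ 4 else 0)"
  have nn: "0 \<le> gL k" "0 \<le> gM k" "0 \<le> gH k" for k
    using Cp be gap_weight_nonneg[of m k] by (auto simp: gL_def gM_def gH_def)
  have ab: "\<bar>2 * \<beta> * (-1) ^ k\<bar> = 2 * \<beta>" for k using be by (simp add: abs_mult power_abs)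
  have dom: "\<bar>row_entry m \<beta> k + 2 * \<beta> * (-1) ^ k\<bar> \<le> real k ^ 4 * (gL k + gM k + gH k)" if k: "k > K" "k \<noteq> m" for k
  proof -
    have kp: "real k > 0" using k by simp
    have mono: "real k ^ 4 * x \<le> real k ^ 4 * (gL k + gM k + gH k)" if "x \<le> gL k \<or> x \<le> gM k \<or> x \<le> gH k" for x
      using that nn[of k] by (intro mult_left_mono) auto
    consider "2 * k < m" | "m \<le> 2 * k" "\<not> m dvd k" | "m dvd k" by linarith
    then show ?thesis
    proof cases
      case 1
      have "\<beta> ^ 3 \<le> (B / (real m)\<^sup>2) ^ 3" using be by (intro power_mono) auto
      also have "\<dots> = B ^ 3 / real m ^ 6" by (simp add: power_divide)
      also have "\<dots> \<le> B ^ 3 / real m ^ 4" using B m by (intro divide_left_mono power_increasing) auto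
      finally have b3: "\<beta> ^ 3 \<le> B ^ 3 / real m ^ 4" .
      have "\<beta> / (real m)\<^sup>2 \<le> (B / (real m)\<^sup>2) / (real m)\<^sup>2" using be by (intro divide_right_mono) auto
      also have "\<dots> = B / real m ^ 4" by (simp add: power4_eq_xxxx power2_eq_square)
      finally have "2 * \<beta> ^ 3 + 16 * \<beta> / (real m)\<^sup>2 \<le> C / real m ^ 4"
        using b3 by (simp add: C_def add_divide_distrib)
      then have "(real k)\<^sup>2 * (2 * \<beta> ^ 3 + 16 * \<beta> / (real m)\<^sup>2) \<le> (real k)\<^sup>2 * (C / real m ^ 4)"
        by (intro mult_left_mono) auto
      also have "\<dots> = real k ^ 4 * gL k" using k kp by (simp add: gL_def power4_eq_xxxx power2_eq_square)
      finally show ?thesis using row_entry_low[OF m be(1,2) _ 1] kp mono[of "gL k"] by linarith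
    next
      case 2
      have "\<bar>row_entry m \<beta> k + 2 * \<beta> * (-1) ^ k\<bar> \<le> 24 * real k * \<beta> * gap_weight m k + 16 * (real k)\<^sup>2 * \<beta>\<^sup>2 + 2 * \<beta>"
        using row_entry_nonresonant[OF m be(1,2) 2(2)] ab[of k] by linarith
      also have "\<dots> = real k ^ 4 * gH k" using 2 kp by (simp add: gH_def)
      finally show ?thesis using mono[of "gH k"] by linarith
    next
      case 3
      then obtain q where q: "k = m * q" by blast
      with k have "q \<ge> 2" by (cases q rule: nat.exhaust) (auto simp: not_less_eq_eq numeral_2_eq_2 Suc_le_eq)
      then have "2 * m \<le> k" using q by simp
      \<comment> \<open>Here 4 = 3.9 + 2/20 bounds pi + 2 \<beta>; it is the factor in
        \<open>gM\<close>.\<close>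
      have "\<bar>row_entry m \<beta> k + 2 * \<beta> * (-1) ^ k\<bar> \<le> 4"
      proof -
        have "pi \<le> 3.9" using pi_approx by simp
        then show ?thesis using abs_row_entry_le[OF m be(1,2), of k] ab[of k] be by linarith
      qed
      also have "4 = real k ^ 4 * gM k" using 3 \<open>2 * m \<le> k\<close> kp by (simp add: gM_def)
      finally show ?thesis using mono[of "gM k"] by linarith
    qed
  qed
  have sL: "(\<Sum>k<n. gL k) \<le> (1/10) / real m ^ 4" for n
  proof -
    have "(\<Sum>k<n. gL k) \<le> C / real m ^ 4 * (1 / real K)"
      unfolding gL_def sum_distrib_left[symmetric] using Cp
      by (intro mult_left_mono sum_inverse_squares_tail K) auto
    also have "\<dots> = (C / K) / real m ^ 4" by simp
    also have "\<dots> \<le> (1/10) / real m ^ 4" using sm(1) unfolding C_def by (intro divide_right_mono) auto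
    finally show ?thesis .
  qed
  have sM: "(\<Sum>k<n. gM k) \<le> (1/2) / real m ^ 4" for n
    using sum_over_multiples[of m n] m unfolding gM_def sum_distrib_left[symmetric] by simp
  have sH: "(\<Sum>k<n. gH k) \<le> (1/5) / real m ^ 4" for n
  proof (rule sum_le_of_block_sums[of m])
    show "m > 0" using m by simp
    show "0 \<le> gH k" for k using nn by simp
    fix J
    define y where "y = (2304 * B * sqrt m + 64 * B\<^sup>2 + 32 * B) / m"
    have block: "(\<Sum>k\<in>{j*m..<j*m+m}. gH k) \<le> y / real m ^ 4 * (1 / (real j + 1)\<^sup>2)" for j
    proof -
      define u where "u = real j + 1"
      have u: "u \<ge> 1" by (simp add: u_def)
      define b where "b = B / (real m)\<^sup>2"
      have b: "0 \<le> b" "\<beta> \<le> b" using be B by (auto simp: b_def)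
      have tm: "gH k \<le> (192 * b / real m ^ 3 * (if m dvd k then 0 else gap_weight m k) + (64 * b\<^sup>2 / (real m)\<^sup>2 + 32 * b / real m ^ 4)) / u\<^sup>2"
        if k: "k \<in> {j*m..<j*m+m}" for k
      proof (cases "\<not> m dvd k \<and> m \<le> 2 * k")
        case False
        then have "gH k = 0" by (auto simp: gH_def)
        then show ?thesis using b gap_weight_nonneg[of m k] by auto
      next
        case True
        define w where "w = gap_weight m k"
        have w: "w \<ge> 0" by (simp add: w_def gap_weight_nonneg)
        \<comment> \<open>In block j one has k \<ge> (j + 1) m / 2: for j = 0 by the case
          assumption, for j > 0 from k \<ge> j m.\<close>
        have "(j + 1) * m \<le> 2 * k"
        proof (cases "j = 0")
          case False
          then have "(j + 1) * m \<le> (2 * j) * m" by (intro mult_right_mono) auto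
          also have "\<dots> = 2 * (j * m)" by simp
          also have "\<dots> \<le> 2 * k" using k by simp
          finally show ?thesis .
        qed (use True in simp)
        then have "real ((j + 1) * m) \<le> real (2 * k)" by (rule of_nat_mono)
        then have x: "u * real m / 2 \<le> real k" by (simp add: u_def algebra_simps)
        have kp: "real k > 0" using x u mp by (smt (verit) half_gt_zero mult_pos_pos)
        \<comment> \<open>Of the powers of \<open>u\<close> only the square is kept, which is enough
          to sum over the blocks; the full power of \<open>m\<close> must be retained.\<close>
        have pw: "1 / real k ^ i \<le> 2 ^ i / (u\<^sup>2 * real m ^ i)" if "i \<ge> 2" for i
        proof -
          have "u ^ 2 * real m ^ i \<le> u ^ i * real m ^ i" using u that by (intro mult_right_mono power_increasing) auto
          also have "\<dots> = 2 ^ i * (u * real m / 2) ^ i" by (simp add: power_mult_distrib power_divide)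
          also have "\<dots> \<le> 2 ^ i * real k ^ i" using x u by (intro mult_left_mono power_mono) auto
          finally show ?thesis using kp u mp by (simp add: field_simps)
        qed
        have "gH k = 24 * \<beta> * w * (1 / real k ^ 3) + 16 * \<beta>\<^sup>2 * (1 / real k ^ 2) + 2 * \<beta> * (1 / real k ^ 4)"
          using True kp by (simp add: gH_def w_def field_simps power4_eq_xxxx power3_eq_cube power2_eq_square)
        also have "\<dots> \<le> 24 * b * w * (2 ^ 3 / (u\<^sup>2 * real m ^ 3)) + 16 * b\<^sup>2 * (2 ^ 2 / (u\<^sup>2 * real m ^ 2)) + 2 * b * (2 ^ 4 / (u\<^sup>2 * real m ^ 4))"
          using b be w kp by (intro add_mono mult_mono pw power_mono) auto
        also have "\<dots> = (192 * b / real m ^ 3 * w + (64 * b\<^sup>2 / (real m)\<^sup>2 + 32 * b / real m ^ 4)) / u\<^sup>2"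
          using mp u by (simp add: field_simps)
        finally show ?thesis using True by (simp add: w_def)
      qed
      have "(\<Sum>k\<in>{j*m..<j*m+m}. gH k) \<le>
        (\<Sum>k\<in>{j*m..<j*m+m}. (192 * b / real m ^ 3 * (if m dvd k then 0 else gap_weight m k) + (64 * b\<^sup>2 / (real m)\<^sup>2 + 32 * b / real m ^ 4)) / u\<^sup>2)"
        by (intro sum_mono tm)
      also have "\<dots> = (192 * b / real m ^ 3 * (\<Sum>k\<in>{j*m..<j*m+m}. if m dvd k then 0 else gap_weight m k)
          + real m * (64 * b\<^sup>2 / (real m)\<^sup>2 + 32 * b / real m ^ 4)) / u\<^sup>2"
        by (simp only: sum_divide_distrib[symmetric] sum.distrib sum_distrib_left[symmetric])
           (simp add: distrib_left mult.left_commute)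
      also have "\<dots> \<le> (192 * b / real m ^ 3 * (6 * sqrt m) + real m * (64 * b\<^sup>2 / (real m)\<^sup>2 + 32 * b / real m ^ 4)) / u\<^sup>2"
        using b by (intro divide_right_mono add_right_mono mult_left_mono sum_gap_weight) auto
      also have "192 * b / real m ^ 3 * (6 * sqrt m) = (1152 * B * sqrt m / m) / real m ^ 4"
        using mp by (simp add: b_def field_simps power4_eq_xxxx power3_eq_cube power2_eq_square)
      also have "real m * (64 * b\<^sup>2 / (real m)\<^sup>2 + 32 * b / real m ^ 4) = (64 * B\<^sup>2 / m + 32 * B / m) / real m ^ 4"
        using mp by (simp add: b_def field_simps power4_eq_xxxx power3_eq_cube power2_eq_square)
      also have "((1152 * B * sqrt m / m) / real m ^ 4 + (64 * B\<^sup>2 / m + 32 * B / m) / real m ^ 4) / u\<^sup>2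
         \<le> (y / real m ^ 4) / u\<^sup>2"
      proof (intro divide_right_mono)
        have "1152 * B * sqrt m / m \<le> 2304 * B * sqrt m / m" using B by (intro divide_right_mono) auto
        then show "(1152 * B * sqrt m / m) / real m ^ 4 + (64 * B\<^sup>2 / m + 32 * B / m) / real m ^ 4 \<le> y / real m ^ 4"
          unfolding add_divide_distrib[symmetric] y_def
            using B by (intro divide_right_mono) (auto simp: add_divide_distrib)
      qed auto
      finally show ?thesis by (simp add: u_def)
    qed
    have "(\<Sum>j<J. \<Sum>k\<in>{j*m..<j*m+m}. gH k) \<le> (\<Sum>j<J. y / real m ^ 4 * (1 / (real j + 1)\<^sup>2))"
      by (intro sum_mono block)
    also have "\<dots> \<le> y / real m ^ 4 * 2"
      unfolding sum_distrib_left[symmetric] using B by (intro mult_left_mono sum_inverse_squares) (auto simp: y_def)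
    also have "\<dots> \<le> (1/10) / real m ^ 4 * 2" using sm(2) unfolding y_def by (intro mult_right_mono divide_right_mono) auto
    finally show "(\<Sum>j<J. \<Sum>k\<in>{j*m..<j*m+m}. gH k) \<le> (1/5) / real m ^ 4" by simp
  qed
  show ?thesis
  proof (intro exI[of _ "\<lambda>k. gL k + gM k + gH k"] conjI allI impI)
    show "0 \<le> gL k + gM k + gH k" for k using nn by simp
    show "\<bar>row_entry m \<beta> k + 2 * \<beta> * (-1) ^ k\<bar> \<le> real k ^ 4 * (gL k + gM k + gH k)" if "k > K" "k \<noteq> m" for k
      using dom that by blast
    show "(\<Sum>k<n. gL k + gM k + gH k) \<le> (4/5) / real m ^ 4" for n
      using sL[of n] sM[of n] sH[of n] by (simp add: sum.distrib)
  qed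
qed

text \<open>With B = 3/a from the tilt bound all smallness conditions of \<open>row_majorant\<close>
  and \<open>row_entry_diagonal\<close> hold for large \<open>m\<close>. One threshold
  \<open>K\<close> serves both as the last mode set aside and as the start of the rows.\<close>

lemma exists_dominant_rows:
  fixes a :: real
  assumes a: "a > 0"
  shows "\<exists>K>0. \<forall>m>K. \<exists>\<beta> g. 0 \<le> \<beta> \<and> \<beta> < pi/2 \<and>
      a * sin \<beta> = cos ((pi/2 + \<beta>) / real (2 * m)) - cos ((pi/2 - \<beta>) / m) \<and> \<beta> < (pi/2 + \<beta>) / real (2 * m) \<and>
      1 \<le> \<bar>row_entry m \<beta> m + 2 * \<beta> * (-1) ^ m\<bar> \<and> (\<forall>k. 0 \<le> g k) \<and>
      (\<forall>k>K. k \<noteq> m \<longrightarrow> \<bar>row_entry m \<beta> k + 2 * \<beta> * (-1) ^ k\<bar> \<le> real k ^ 4 * g k) \<and>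
      (\<forall>n. (\<Sum>k<n. g k) \<le> (4/5) / real m ^ 4)"
proof -
  define B where "B = 3 / a"
  have B: "B > 0" using a by (simp add: B_def)
  have "((\<lambda>m. B / (real m)\<^sup>2) \<longlongrightarrow> 0) at_top" "((\<lambda>m. (2 * B ^ 3 + 16 * B) / real m) \<longlongrightarrow> 0) at_top"
    "((\<lambda>m. (2304 * B * sqrt (real m) + 64 * B\<^sup>2 + 32 * B) / real m) \<longlongrightarrow> 0) at_top"
    "((\<lambda>m. B / real m) \<longlongrightarrow> 0) at_top"
    by real_asymp+
  note lims = this
  have "\<forall>\<^sub>F m in at_top. B / (real m)\<^sup>2 < 1/20 \<and> (2 * B ^ 3 + 16 * B) / real m < 1/10
    \<and> (2304 * B * sqrt (real m) + 64 * B\<^sup>2 + 32 * B) / real m < 1/10 \<and> B / real m < 1/20 \<and> m \<ge> 10"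
    by (intro eventually_conj order_tendstoD(2)[OF lims(1)] order_tendstoD(2)[OF lims(2)] order_tendstoD(2)[OF lims(3)]
        order_tendstoD(2)[OF lims(4)] eventually_ge_at_top) auto
  then obtain K where K: "\<And>m. m \<ge> K \<Longrightarrow> B / (real m)\<^sup>2 < 1/20 \<and> (2 * B ^ 3 + 16 * B) / real m < 1/10
    \<and> (2304 * B * sqrt (real m) + 64 * B\<^sup>2 + 32 * B) / real m < 1/10 \<and> B / real m < 1/20 \<and> m \<ge> 10"
    unfolding eventually_at_top_linorder by blast
  show ?thesis
  proof (intro exI[of _ K] conjI allI impI)
    show K0: "K > 0" using K[of K] by simp
    fix m assume "m > K"
    then have m: "m \<ge> K" by simp
    note Km = K[OF m]
    have m1: "m \<ge> 1" using Km by simp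
    obtain \<beta> where b: "0 \<le> \<beta>" "\<beta> < pi/2" "a * sin \<beta> = cos ((pi/2 + \<beta>) / real (2 * m)) - cos ((pi/2 - \<beta>) / m)"
      "\<beta> \<le> B / (real m)\<^sup>2"
      unfolding B_def by (rule exists_tilt[OF a m1])
    have b20: "\<beta> \<le> 1/20" using b Km by linarith
    have mb: "real m * \<beta> \<le> B / real m"
    proof -
      have "real m * \<beta> \<le> real m * (B / (real m)\<^sup>2)" using b by (intro mult_left_mono) auto
      then show ?thesis using m1 by (simp add: power2_eq_square)
    qed
    have "\<beta> < (pi/2 + \<beta>) / real (2 * m)"
    proof -
      have "2 * real m * \<beta> < pi/2" using mb Km pi_approx by simp
      then have "\<beta> * (2 * real m) < pi/2 + \<beta>" using b by (simp add: algebra_simps)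
      then show ?thesis using m1 by (simp add: pos_less_divide_eq)
    qed
    moreover have "1 \<le> \<bar>row_entry m \<beta> m + 2 * \<beta> * (-1) ^ m\<bar>"
    proof (rule row_entry_diagonal[OF m1 b(1) b20])
      have "real m * \<beta> \<le> 1/20" using mb Km by linarith
      then have "(real m * \<beta>)\<^sup>2 \<le> (1/20)\<^sup>2" using b by (intro power_mono) auto
      then show "200 * (real m * \<beta>)\<^sup>2 \<le> 1" by (simp add: power2_eq_square)
    qed (use Km in simp)
    moreover have "\<exists>g. (\<forall>k. 0 \<le> g k) \<and>
      (\<forall>k>K. k \<noteq> m \<longrightarrow> \<bar>row_entry m \<beta> k + 2 * \<beta> * (-1) ^ k\<bar> \<le> real k ^ 4 * g k) \<and>
      (\<forall>n. (\<Sum>k<n. g k) \<le> (4/5) / real m ^ 4)"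
      by (rule row_majorant[OF m1 b(1) b20 b(4)]) (use B K0 Km K[of K] in auto)
    ultimately show "\<exists>\<beta> g. 0 \<le> \<beta> \<and> \<beta> < pi/2 \<and>
      a * sin \<beta> = cos ((pi/2 + \<beta>) / real (2 * m)) - cos ((pi/2 - \<beta>) / m) \<and> \<beta> < (pi/2 + \<beta>) / real (2 * m) \<and>
      1 \<le> \<bar>row_entry m \<beta> m + 2 * \<beta> * (-1) ^ m\<bar> \<and> (\<forall>k. 0 \<le> g k) \<and>
      (\<forall>k>K. k \<noteq> m \<longrightarrow> \<bar>row_entry m \<beta> k + 2 * \<beta> * (-1) ^ k\<bar> \<le> real k ^ 4 * g k) \<and>
      (\<forall>n. (\<Sum>k<n. g k) \<le> (4/5) / real m ^ 4)"
      using b by blast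
  qed
qed


section \<open>Persistence of strict maxima and first variation\<close>

text \<open>Vertex i moves on its own curve \<open>V i\<close> with its own parameter, so that the
  same function applies to the stadium and to the deformed domains; only the first \<open>n\<close>
  entries of \<open>c\<close> count.\<close>

definition perimeter :: "nat \<Rightarrow> (nat \<Rightarrow> real \<Rightarrow> point) \<Rightarrow> (nat \<Rightarrow> real) \<Rightarrow> real" where
  "perimeter n V c = (\<Sum>i<n. dist (V i (c i)) (V (Suc i mod n) (c (Suc i mod n))))"

lemma sum_cyclic_shift:
  fixes f :: "nat \<Rightarrow> 'b::comm_monoid_add"
  assumes "n > 0"
  shows "(\<Sum>i<n. f (Suc i mod n)) = (\<Sum>i<n. f i)"
proof -
  obtain m where n: "n = Suc m" using assms gr0_implies_Suc by blast
  have "(\<Sum>i<n. f (Suc i mod n)) = (\<Sum>i<m. f (Suc i mod n)) + f 0" by (simp add: n)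
  also have "(\<Sum>i<m. f (Suc i mod n)) = (\<Sum>i<m. f (Suc i))" by (intro sum.cong) (auto simp: n)
  also have "\<dots> + f 0 = (\<Sum>i<n. f i)" unfolding n sum.lessThan_Suc_shift by (simp add: add.commute)
  finally show ?thesis .
qed

lemma perimeter_diff_le:
  assumes "n > 0" "\<And>i. i < n \<Longrightarrow> dist (V i (c i)) (W i (c i)) \<le> \<epsilon>"
  shows "\<bar>perimeter n V c - perimeter n W c\<bar> \<le> 2 * real n * \<epsilon>"
proof -
  have "\<bar>perimeter n V c - perimeter n W c\<bar> \<le> (\<Sum>i<n. 2 * \<epsilon>)"
    unfolding perimeter_def sum_subtractf[symmetric]
  proof (rule order_trans[OF sum_abs sum_mono])
    fix i assume "i \<in> {..<n}"
    then have "dist (V i (c i)) (W i (c i)) \<le> \<epsilon>"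
      "dist (V (Suc i mod n) (c (Suc i mod n))) (W (Suc i mod n) (c (Suc i mod n))) \<le> \<epsilon>"
      using assms by auto
    then show "\<bar>dist (V i (c i)) (V (Suc i mod n) (c (Suc i mod n))) - dist (W i (c i)) (W (Suc i mod n) (c (Suc i mod n)))\<bar> \<le> 2 * \<epsilon>"
      by (smt (verit) dist_commute dist_triangle)
  qed
  then show ?thesis by simp
qed

text \<open>The maximum M(\<tau>) over a box of parameters is continuous in \<tau>, and for small
  \<tau> it is attained in the interior of the box, where it belongs to \<open>L\<close>. A
  continuous function on an interval with values in a set without intervals is constant, so the
  fixed polygon \<open>c0\<close> never exceeds its perimeter at \<tau> = 0.\<close>

lemma strict_max_persists:
  fixes V :: "real \<Rightarrow> nat \<Rightarrow> real \<Rightarrow> point" and c0 :: "nat \<Rightarrow> real"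
  assumes n: "n > 0" and \<rho>: "\<rho> > 0"
    and cont: "\<And>\<tau> i. \<bar>\<tau>\<bar> \<le> 1 \<Longrightarrow> i < n \<Longrightarrow> continuous_on {c0 i - \<rho>..c0 i + \<rho>} (V \<tau> i)"
    and unif: "\<And>t \<epsilon>. \<bar>t\<bar> \<le> 1 \<Longrightarrow> \<epsilon> > 0 \<Longrightarrow> \<exists>\<delta>>0. \<forall>\<tau>. \<bar>\<tau>\<bar> \<le> 1 \<longrightarrow> \<bar>\<tau> - t\<bar> < \<delta> \<longrightarrow>
        (\<forall>i<n. \<forall>s\<in>{c0 i - \<rho>..c0 i + \<rho>}. dist (V \<tau> i s) (V t i s) \<le> \<epsilon>)"
    and strict: "\<And>c. (\<And>i. i < n \<Longrightarrow> \<bar>c i - c0 i\<bar> \<le> \<rho>) \<Longrightarrow> perimeter n (V 0) c \<ge> perimeter n (V 0) c0 \<Longrightarrow>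
        (\<forall>i<n. c i = c0 i)"
    and crit: "\<tau>\<^sub>1 > 0" "\<And>\<tau> c. \<bar>\<tau>\<bar> \<le> \<tau>\<^sub>1 \<Longrightarrow> (\<And>i. i < n \<Longrightarrow> \<bar>c i - c0 i\<bar> < \<rho>) \<Longrightarrow>
        (\<And>d. (\<And>i. i < n \<Longrightarrow> \<bar>d i - c0 i\<bar> \<le> \<rho>) \<Longrightarrow> perimeter n (V \<tau>) d \<le> perimeter n (V \<tau>) c) \<Longrightarrow>
        perimeter n (V \<tau>) c \<in> L"
    and L: "\<And>l r. l < r \<Longrightarrow> \<not> {l..r} \<subseteq> L"
  shows "\<exists>\<tau>\<^sub>0>0. \<forall>\<tau>. \<bar>\<tau>\<bar> \<le> \<tau>\<^sub>0 \<longrightarrow> perimeter n (V \<tau>) c0 \<le> perimeter n (V 0) c0"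
proof -
  \<comment> \<open>The box lives in the product over all natural indices, where it is compact by
    Tychonoff; coordinates from \<open>n\<close> on do not affect the perimeter.\<close>
  define K where "K = PiE UNIV (\<lambda>i. {c0 i - \<rho>..c0 i + \<rho>})"
  have Kmem: "c \<in> K \<longleftrightarrow> (\<forall>i. \<bar>c i - c0 i\<bar> \<le> \<rho>)" for c by (auto simp: K_def abs_le_iff PiE_iff algebra_simps)
  have Kc: "compact K"
  proof -
    have "compactin (product_topology (\<lambda>i. euclidean) UNIV) K"
      unfolding K_def compactin_PiE by auto
    then show ?thesis unfolding euclidean_product_topology by simp
  qed
  have c0K: "c0 \<in> K" using \<rho> by (simp add: Kmem)
  have ci: "continuous_on K (\<lambda>c. c i)" for i :: nat
    by (rule continuous_on_subset[OF continuous_on_product_coordinates]) auto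
  have contP: "continuous_on K (perimeter n (V \<tau>))" if "\<bar>\<tau>\<bar> \<le> 1" for \<tau>
    unfolding perimeter_def
  proof (intro continuous_on_sum continuous_on_dist)
    fix i assume "i \<in> {..<n}"
    then have i: "i < n" "Suc i mod n < n" using n by auto
    have "continuous_on K (\<lambda>c. V \<tau> j (c j))" if "j < n" for j
      by (rule continuous_on_compose2[OF cont[OF \<open>\<bar>\<tau>\<bar> \<le> 1\<close> that] ci]) (auto simp: K_def)
    then show "continuous_on K (\<lambda>c. V \<tau> i (c i))" "continuous_on K (\<lambda>c. V \<tau> (Suc i mod n) (c (Suc i mod n)))"
      using i by blast+
  qed
  have "\<exists>c\<in>K. \<forall>d\<in>K. perimeter n (V \<tau>) d \<le> perimeter n (V \<tau>) c" if "\<bar>\<tau>\<bar> \<le> 1" for \<tau>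
    using continuous_attains_sup[OF Kc _ contP[OF that]] c0K by blast
  then obtain cm where cm: "\<And>\<tau>. \<bar>\<tau>\<bar> \<le> 1 \<Longrightarrow> cm \<tau> \<in> K"
    "\<And>\<tau> d. \<bar>\<tau>\<bar> \<le> 1 \<Longrightarrow> d \<in> K \<Longrightarrow> perimeter n (V \<tau>) d \<le> perimeter n (V \<tau>) (cm \<tau>)"
    by metis
  define M where "M = (\<lambda>\<tau>. perimeter n (V \<tau>) (cm \<tau>))"
  have near: "\<exists>\<delta>>0. \<forall>\<tau>. \<bar>\<tau>\<bar> \<le> 1 \<longrightarrow> \<bar>\<tau> - t\<bar> < \<delta> \<longrightarrow> (\<forall>c\<in>K. \<bar>perimeter n (V \<tau>) c - perimeter n (V t) c\<bar> \<le> \<epsilon>)"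
    if t: "\<bar>t\<bar> \<le> 1" and e: "\<epsilon> > 0" for t \<epsilon>
  proof -
    have "\<epsilon> / (2 * real n) > 0" using e n by simp
    from unif[OF t this] obtain \<delta> where d: "\<delta> > 0" "\<And>\<tau>. \<bar>\<tau>\<bar> \<le> 1 \<Longrightarrow> \<bar>\<tau> - t\<bar> < \<delta> \<Longrightarrow>
        (\<forall>i<n. \<forall>s\<in>{c0 i - \<rho>..c0 i + \<rho>}. dist (V \<tau> i s) (V t i s) \<le> \<epsilon> / (2 * real n))" by blast
    show ?thesis
    proof (intro exI[of _ \<delta>] conjI allI impI ballI)
      fix \<tau> c assume tau: "\<bar>\<tau>\<bar> \<le> 1" "\<bar>\<tau> - t\<bar> < \<delta>" and c: "c \<in> K"
      have "\<bar>perimeter n (V \<tau>) c - perimeter n (V t) c\<bar> \<le> 2 * real n * (\<epsilon> / (2 * real n))"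
        using d(2)[OF tau] c by (intro perimeter_diff_le n) (auto simp: K_def)
      then show "\<bar>perimeter n (V \<tau>) c - perimeter n (V t) c\<bar> \<le> \<epsilon>" using n by simp
    qed (rule d(1))
  qed
  have Mcont: "continuous_on {-1..1} M"
    unfolding continuous_on_iff
  proof (intro ballI allI impI)
    fix t \<epsilon> :: real assume "t \<in> {-1..1}" and e: "\<epsilon> > 0"
    then have t: "\<bar>t\<bar> \<le> 1" by auto
    obtain \<delta> where d: "\<delta> > 0" "\<And>\<tau> c. \<bar>\<tau>\<bar> \<le> 1 \<Longrightarrow> \<bar>\<tau> - t\<bar> < \<delta> \<Longrightarrow> c \<in> K \<Longrightarrow> \<bar>perimeter n (V \<tau>) c - perimeter n (V t) c\<bar> \<le> \<epsilon>/2"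
      using near[OF t, of "\<epsilon>/2"] e by (auto simp del: divide_le_eq_numeral1)
    have "dist (M \<tau>) (M t) < \<epsilon>" if "\<tau> \<in> {-1..1}" "dist \<tau> t < \<delta>" for \<tau>
    proof -
      have tau: "\<bar>\<tau>\<bar> \<le> 1" "\<bar>\<tau> - t\<bar> < \<delta>" using that by (auto simp: dist_real_def)
      have "\<bar>perimeter n (V \<tau>) (cm \<tau>) - perimeter n (V t) (cm \<tau>)\<bar> \<le> \<epsilon>/2"
        "\<bar>perimeter n (V \<tau>) (cm t) - perimeter n (V t) (cm t)\<bar> \<le> \<epsilon>/2"
        using d(2)[OF tau] cm(1) tau t by blast+
      moreover have "perimeter n (V \<tau>) (cm t) \<le> M \<tau>" "perimeter n (V t) (cm \<tau>) \<le> M t"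
        unfolding M_def using cm tau t by blast+
      ultimately have "\<bar>M \<tau> - M t\<bar> \<le> \<epsilon>/2" unfolding M_def by linarith
      then show ?thesis using e by (simp add: dist_real_def)
    qed
    then show "\<exists>d>0. \<forall>x'\<in>{-1..1}. dist x' t < d \<longrightarrow> dist (M x') (M t) < \<epsilon>" using d(1) by blast
  qed
  define K' where "K' = K \<inter> (\<Union>i\<in>{..<n}. {c. \<bar>c i - c0 i\<bar> = \<rho>})"
  have "compact K'"
    unfolding K'_def
  proof (intro compact_Int_closed[OF Kc] closed_UN[OF finite_lessThan] ballI)
    fix i :: nat
    have "continuous_on UNIV (\<lambda>c::nat \<Rightarrow> real. \<bar>c i - c0 i\<bar>)"
      by (intro continuous_intros continuous_on_product_coordinates)
    then show "closed {c::nat \<Rightarrow> real. \<bar>c i - c0 i\<bar> = \<rho>}" by (intro closed_Collect_eq continuous_on_const)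
  qed
  have K'lt: "perimeter n (V 0) c < perimeter n (V 0) c0" if "c \<in> K'" for c
  proof (rule ccontr)
    assume "\<not> perimeter n (V 0) c < perimeter n (V 0) c0"
    moreover have "\<bar>c i - c0 i\<bar> \<le> \<rho>" for i using that by (auto simp: K'_def Kmem)
    ultimately have "\<forall>i<n. c i = c0 i" by (intro strict) auto
    then show False using that \<rho> by (auto simp: K'_def)
  qed
  \<comment> \<open>On the compact boundary part \<open>K'\<close> of the box the perimeter stays
    below the value at the centre by a margin. The factor 3 leaves room for two perturbations by
    \<eta>, one at the centre and one at the maximizer.\<close>
  obtain \<eta> where eta: "\<eta> > 0" "\<And>c. c \<in> K' \<Longrightarrow> perimeter n (V 0) c + 3 * \<eta> \<le> perimeter n (V 0) c0"
  proof (cases "K' = {}")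
    case True then show ?thesis using that[of 1] by simp
  next
    case False
    have "continuous_on K' (perimeter n (V 0))"
      using contP[of 0] by (rule continuous_on_subset) (auto simp: K'_def)
    then obtain x where x: "x \<in> K'" "\<And>c. c \<in> K' \<Longrightarrow> perimeter n (V 0) c \<le> perimeter n (V 0) x"
      using continuous_attains_sup[OF \<open>compact K'\<close> False] by blast
    show ?thesis
    proof (rule that[of "(perimeter n (V 0) c0 - perimeter n (V 0) x) / 3"])
      show "(perimeter n (V 0) c0 - perimeter n (V 0) x) / 3 > 0" using K'lt[OF x(1)] by simp
      show "perimeter n (V 0) c + 3 * ((perimeter n (V 0) c0 - perimeter n (V 0) x) / 3) \<le> perimeter n (V 0) c0"
        if "c \<in> K'" for c using x(2)[OF that] by (simp add: field_simps)
    qed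
  qed
  obtain \<delta> where d: "\<delta> > 0" "\<And>\<tau> c. \<bar>\<tau>\<bar> \<le> 1 \<Longrightarrow> \<bar>\<tau> - 0\<bar> < \<delta> \<Longrightarrow> c \<in> K \<Longrightarrow> \<bar>perimeter n (V \<tau>) c - perimeter n (V 0) c\<bar> \<le> \<eta>"
    using near[of 0 \<eta>] eta(1) by auto
  define \<tau>\<^sub>0 where "\<tau>\<^sub>0 = min (min 1 \<tau>\<^sub>1) (\<delta>/2)"
  have t0: "\<tau>\<^sub>0 > 0" "\<tau>\<^sub>0 \<le> 1" "\<tau>\<^sub>0 \<le> \<tau>\<^sub>1" "\<tau>\<^sub>0 < \<delta>" using d(1) crit(1) by (auto simp: \<tau>\<^sub>0_def)
  have M_in_L: "M \<tau> \<in> L" if "\<bar>\<tau>\<bar> \<le> \<tau>\<^sub>0" for \<tau>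
  proof -
    have tau: "\<bar>\<tau>\<bar> \<le> 1" "\<bar>\<tau> - 0\<bar> < \<delta>" "\<bar>\<tau>\<bar> \<le> \<tau>\<^sub>1" using that t0 by auto
    have cK: "cm \<tau> \<in> K" using cm tau by blast
    have "cm \<tau> \<notin> K'"
    proof
      assume K': "cm \<tau> \<in> K'"
      have "perimeter n (V \<tau>) c0 \<le> perimeter n (V \<tau>) (cm \<tau>)" using cm tau c0K by blast
      moreover have "\<bar>perimeter n (V \<tau>) (cm \<tau>) - perimeter n (V 0) (cm \<tau>)\<bar> \<le> \<eta>"
        "\<bar>perimeter n (V \<tau>) c0 - perimeter n (V 0) c0\<bar> \<le> \<eta>" using d(2) tau cK c0K by blast+
      ultimately show False using eta(2)[OF K'] eta(1) by linarith
    qed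
    then have inside: "\<bar>cm \<tau> i - c0 i\<bar> < \<rho>" if "i < n" for i
    proof -
      have "\<bar>cm \<tau> i - c0 i\<bar> \<noteq> \<rho>" using \<open>cm \<tau> \<notin> K'\<close> cK that unfolding K'_def by blast
      moreover have "\<bar>cm \<tau> i - c0 i\<bar> \<le> \<rho>" using cK unfolding Kmem by blast
      ultimately show ?thesis by simp
    qed
    show ?thesis unfolding M_def
    proof (rule crit(2)[OF tau(3) inside])
      fix e assume e: "\<And>i. i < n \<Longrightarrow> \<bar>e i - c0 i\<bar> \<le> \<rho>"
      \<comment> \<open>Coordinates from \<open>n\<close> on are reset, so that the competitor lies
        in \<open>K\<close>.\<close>
      define e' where "e' = (\<lambda>i. if i < n then e i else c0 i)"
      have "e' \<in> K" using e \<rho> by (auto simp: Kmem e'_def)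
      moreover have "perimeter n (V \<tau>) e' = perimeter n (V \<tau>) e"
        unfolding perimeter_def using n by (intro sum.cong) (auto simp: e'_def)
      ultimately show "perimeter n (V \<tau>) e \<le> perimeter n (V \<tau>) (cm \<tau>)" using cm(2)[OF tau(1)] by metis
    qed
  qed
  have Mconst: "M \<tau> = M 0" if "\<bar>\<tau>\<bar> \<le> \<tau>\<^sub>0" for \<tau>
  proof (rule ccontr)
    assume ne: "M \<tau> \<noteq> M 0"
    have "connected (M ` {-\<tau>\<^sub>0..\<tau>\<^sub>0})"
      using t0 by (intro connected_continuous_image continuous_on_subset[OF Mcont]) auto
    moreover have "M \<tau> \<in> M ` {-\<tau>\<^sub>0..\<tau>\<^sub>0}" "M 0 \<in> M ` {-\<tau>\<^sub>0..\<tau>\<^sub>0}" using that t0 by (auto simp: abs_le_iff)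
    ultimately have "{min (M \<tau>) (M 0)..max (M \<tau>) (M 0)} \<subseteq> M ` {-\<tau>\<^sub>0..\<tau>\<^sub>0}"
      by (intro connected_contains_Icc) (auto simp: min_def max_def)
    also have "\<dots> \<subseteq> L" using M_in_L by (auto simp: abs_le_iff)
    finally show False using L[of "min (M \<tau>) (M 0)" "max (M \<tau>) (M 0)"] ne by (auto simp: min_def max_def split: if_splits)
  qed
  have M0: "M 0 = perimeter n (V 0) c0"
  proof -
    have "perimeter n (V 0) c0 \<le> perimeter n (V 0) (cm 0)" using cm[of 0] c0K by auto
    moreover have "\<bar>cm 0 i - c0 i\<bar> \<le> \<rho>" for i using cm(1)[of 0] by (auto simp: Kmem)
    ultimately have "\<forall>i<n. cm 0 i = c0 i" by (intro strict) auto
    then show ?thesis unfolding M_def perimeter_def using n by (intro sum.cong) auto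
  qed
  show ?thesis
  proof (intro exI[of _ \<tau>\<^sub>0] conjI allI impI)
    fix \<tau> assume tau: "\<bar>\<tau>\<bar> \<le> \<tau>\<^sub>0"
    then have "perimeter n (V \<tau>) c0 \<le> M \<tau>" unfolding M_def using cm c0K t0 by (meson order_trans)
    then show "perimeter n (V \<tau>) c0 \<le> perimeter n (V 0) c0" using Mconst[OF tau] M0 by simp
  qed (rule t0(1))
qed

lemma has_derivative_dist_moving:
  fixes p q :: "real \<Rightarrow> point"
  assumes "(p has_vector_derivative u) (at t)" "(q has_vector_derivative w) (at t)" "p t \<noteq> q t"
  shows "((\<lambda>\<tau>. dist (p \<tau>) (q \<tau>)) has_real_derivative sgn (p t - q t) \<bullet> (u - w)) (at t)"
proof -
  have "((\<lambda>\<tau>. p \<tau> - q \<tau>) has_vector_derivative u - w) (at t)"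
    using assms by (intro has_vector_derivative_diff)
  then have 1: "((\<lambda>\<tau>. p \<tau> - q \<tau>) has_derivative (\<lambda>h. h *\<^sub>R (u - w))) (at t)"
    by (simp add: has_vector_derivative_def)
  have 2: "(norm has_derivative (\<lambda>h. sgn (p t - q t) \<bullet> h)) (at (p t - q t))"
    using assms(3) by (intro has_derivative_norm[THEN has_derivative_eq_rhs]) (auto simp: fun_eq_iff inner_commute)
  have "((\<lambda>\<tau>. norm (p \<tau> - q \<tau>)) has_derivative (\<lambda>h. sgn (p t - q t) \<bullet> (h *\<^sub>R (u - w)))) (at t)"
    by (rule has_derivative_compose[OF 1 2])
  then show ?thesis
    unfolding has_field_derivative_def dist_norm by (rule has_derivative_eq_rhs) (auto simp: fun_eq_iff)
qed

text \<open>The perimeter of the fixed polygon is maximal at \<tau> = 0, so its derivative vanishes.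
  Regrouped by vertices instead of sides, each velocity \<open>w i\<close> is paired with the jump
  \<open>F i\<close> of the unit side vector at that vertex.\<close>

lemma first_variation_zero:
  fixes V :: "real \<Rightarrow> nat \<Rightarrow> real \<Rightarrow> point"
  assumes n: "n > 0" and t0: "\<tau>\<^sub>0 > 0" "\<And>\<tau>. \<bar>\<tau>\<bar> \<le> \<tau>\<^sub>0 \<Longrightarrow> perimeter n (V \<tau>) c \<le> perimeter n (V 0) c"
    and d: "\<And>i. i < n \<Longrightarrow> ((\<lambda>\<tau>. V \<tau> i (c i)) has_vector_derivative w i) (at 0)"
    and ne: "\<And>i. i < n \<Longrightarrow> V 0 i (c i) \<noteq> V 0 (Suc i mod n) (c (Suc i mod n))"
    and E: "\<And>i. i < n \<Longrightarrow> sgn (V 0 (Suc i mod n) (c (Suc i mod n)) - V 0 i (c i)) = E i"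
    and F: "\<And>i. i < n \<Longrightarrow> E i - E (Suc i mod n) = F (Suc i mod n)"
  shows "(\<Sum>i<n. w i \<bullet> F i) = 0"
proof -
  have nx: "Suc i mod n < n" for i using n by simp
  have "((\<lambda>\<tau>. perimeter n (V \<tau>) c) has_real_derivative (\<Sum>i<n. (- E i) \<bullet> (w i - w (Suc i mod n)))) (at 0)"
    unfolding perimeter_def
  proof (rule DERIV_sum)
    fix i assume "i \<in> {..<n}"
    then have i: "i < n" by simp
    have "sgn (V 0 i (c i) - V 0 (Suc i mod n) (c (Suc i mod n))) = - E i"
      using E[OF i] by (metis minus_diff_eq sgn_minus)
    then show "((\<lambda>\<tau>. dist (V \<tau> i (c i)) (V \<tau> (Suc i mod n) (c (Suc i mod n)))) has_real_derivative (- E i) \<bullet> (w i - w (Suc i mod n))) (at 0)"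
      using has_derivative_dist_moving[OF d[OF i] d[OF nx] ne[OF i]] by simp
  qed
  then have "(\<Sum>i<n. (- E i) \<bullet> (w i - w (Suc i mod n))) = 0"
    by (rule DERIV_local_max[OF _ t0(1)]) (auto intro!: t0(2))
  moreover have "(\<Sum>i<n. (- E i) \<bullet> (w i - w (Suc i mod n))) = (\<Sum>i<n. E i \<bullet> w (Suc i mod n)) - (\<Sum>i<n. E i \<bullet> w i)"
    by (simp add: inner_diff_right sum_subtractf sum_negf)
  moreover have "(\<Sum>i<n. E i \<bullet> w i) = (\<Sum>i<n. E (Suc i mod n) \<bullet> w (Suc i mod n))"
    by (rule sum_cyclic_shift[OF n, symmetric])
  moreover have "(\<Sum>i<n. E i \<bullet> w (Suc i mod n)) - (\<Sum>i<n. E (Suc i mod n) \<bullet> w (Suc i mod n)) = (\<Sum>i<n. w (Suc i mod n) \<bullet> F (Suc i mod n))"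
    unfolding sum_subtractf[symmetric]
    by (intro sum.cong) (auto simp: F[symmetric] inner_diff_right inner_commute)
  ultimately show ?thesis using sum_cyclic_shift[OF n, of "\<lambda>i. w i \<bullet> F i"] by simp
qed


section \<open>Orbits of the stadium\<close>

definition unit_vec :: "real \<Rightarrow> point" where "unit_vec t = (cos t, sin t)"
definition unit_vec' :: "real \<Rightarrow> point" where "unit_vec' t = (- sin t, cos t)"

lemma frame_norm: "norm (x *\<^sub>R unit_vec t + y *\<^sub>R unit_vec' t) = sqrt (x\<^sup>2 + y\<^sup>2)"
proof -
  have "(x * cos t + - (y * sin t))\<^sup>2 + (x * sin t + y * cos t)\<^sup>2 = (x\<^sup>2 + y\<^sup>2) * ((sin t)\<^sup>2 + (cos t)\<^sup>2)"
    by (simp add: power2_eq_square algebra_simps del: sin_cos_squared_add sin_cos_squared_add2 sin_cos_squared_add3)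
  then show ?thesis by (simp add: unit_vec_def unit_vec'_def norm_Pair real_sqrt_abs)
qed

lemma unit_vec_add: "unit_vec (t + u) = cos u *\<^sub>R unit_vec t + sin u *\<^sub>R unit_vec' t"
  by (simp add: unit_vec_def unit_vec'_def cos_add sin_add algebra_simps)

lemma unit_vec_diff: "unit_vec (t - u) = cos u *\<^sub>R unit_vec t - sin u *\<^sub>R unit_vec' t"
  using unit_vec_add[of t "- u"] by simp

lemma unit_vec'_diff_symmetric: "unit_vec' (t - u) - unit_vec' (t + u) = (2 * sin u) *\<^sub>R unit_vec t"
  by (simp add: unit_vec_def unit_vec'_def cos_add sin_add cos_diff sin_diff algebra_simps)

lemma strict_local_min_second_derivative:
  fixes f :: "real \<Rightarrow> real"
  assumes d: "\<And>y. (f has_real_derivative f' y) (at y)" "\<And>y. (f' has_real_derivative f'' y) (at y)"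
    and c: "isCont f'' 0" and 0: "f' 0 = 0" "f'' 0 > 0"
  shows "\<exists>\<rho>>0. \<forall>y. \<bar>y\<bar> \<le> \<rho> \<longrightarrow> y \<noteq> 0 \<longrightarrow> f 0 < f y"
proof -
  have "\<forall>\<^sub>F y in nhds 0. f'' y > 0"
    using c 0(2) unfolding isCont_def by (intro order_tendstoD(1)[of f'' "f'' 0"]) (auto simp: filterlim_at_within_not_equal tendsto_nhds_iff)
  then obtain \<delta> where "\<delta> > 0" and d2: "\<And>y. \<bar>y\<bar> < \<delta> \<Longrightarrow> f'' y > 0"
    by (auto simp: eventually_nhds_metric dist_real_def)
  show ?thesis
  proof (intro exI[of _ "\<delta>/2"] conjI allI impI)
    show "\<delta>/2 > 0" using \<open>\<delta> > 0\<close> by simp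
    have pos: "f' y > 0" if "0 < y" "y < \<delta>" for y
    proof -
      have "f' 0 < f' y"
        by (rule DERIV_pos_imp_increasing[OF that(1)]) (use that d(2) d2 in \<open>auto intro!: exI[of _ "f'' _"]\<close>)
      then show ?thesis using 0 by simp
    qed
    have neg: "f' y < 0" if "y < 0" "- y < \<delta>" for y
    proof -
      have "f' y < f' 0"
        by (rule DERIV_pos_imp_increasing[OF that(1)]) (use that d(2) d2 in \<open>auto intro!: exI[of _ "f'' _"]\<close>)
      then show ?thesis using 0 by simp
    qed
    fix y :: real assume y: "\<bar>y\<bar> \<le> \<delta>/2" "y \<noteq> 0"
    then have yd: "\<bar>y\<bar> < \<delta>" using \<open>\<delta> > 0\<close> by simp
    show "f 0 < f y"
    proof (cases "y > 0")
      case True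
      obtain z where z: "0 < z" "z < y" "f y - f 0 = (y - 0) * f' z"
        using MVT2[OF True, of f f'] d(1) by blast
      have "f' z > 0" using pos[of z] z yd by simp
      then have "0 < y * f' z" by (rule mult_pos_pos[OF True])
      with z(3) show ?thesis by simp
    next
      case False
      then have "y < 0" using y by simp
      obtain z where z: "y < z" "z < 0" "f 0 - f y = (0 - y) * f' z"
        using MVT2[OF \<open>y < 0\<close>, of f f'] d(1) by blast
      have "f' z < 0" using neg[of z] z yd by simp
      then have "0 < y * f' z" by (rule mult_neg_neg[OF \<open>y < 0\<close>])
      with z(3) show ?thesis by simp
    qed
  qed
qed

text \<open>A point on a unit circle seen from a point at distance \<open>\<kappa>\<close> behind the foot of the centre on the side.\<close>

lemma half_side_bound:
  assumes a: "0 < \<alpha>" "\<alpha> < pi/2" and k: "\<kappa> > 0"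
  shows "\<exists>\<rho>>0. \<forall>u. \<bar>u\<bar> \<le> \<rho> \<longrightarrow>
    sqrt ((cos (\<alpha> + u) - cos \<alpha>)\<^sup>2 + (sin (\<alpha> + u) + \<kappa>)\<^sup>2) \<le> sin \<alpha> + \<kappa> + u * cos \<alpha> \<and>
    (sqrt ((cos (\<alpha> + u) - cos \<alpha>)\<^sup>2 + (sin (\<alpha> + u) + \<kappa>)\<^sup>2) = sin \<alpha> + \<kappa> + u * cos \<alpha> \<longrightarrow> u = 0)"
proof -
  \<comment> \<open>The difference of the squares of the two sides of the claim. It vanishes at 0
    together with its first derivative, and its second derivative there is 2 \<kappa> sin \<alpha> >
    0.\<close>
  define F where "F = (\<lambda>u. (sin \<alpha> + \<kappa> + u * cos \<alpha>)\<^sup>2 - (cos (\<alpha> + u) - cos \<alpha>)\<^sup>2 - (sin (\<alpha> + u) + \<kappa>)\<^sup>2)"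
  define F' where "F' = (\<lambda>u. 2 * cos \<alpha> * (sin \<alpha> + \<kappa> + u * cos \<alpha>) - 2 * cos \<alpha> * sin (\<alpha> + u) - 2 * \<kappa> * cos (\<alpha> + u))"
  define F'' where "F'' = (\<lambda>u. 2 * cos \<alpha> * cos \<alpha> - 2 * cos \<alpha> * cos (\<alpha> + u) + 2 * \<kappa> * sin (\<alpha> + u))"
  have s: "sin \<alpha> > 0" "cos \<alpha> > 0" using a by (auto intro!: sin_gt_zero cos_gt_zero_pi)
  have "\<exists>\<rho>>0. \<forall>y. \<bar>y\<bar> \<le> \<rho> \<longrightarrow> y \<noteq> 0 \<longrightarrow> F 0 < F y"
  proof (rule strict_local_min_second_derivative[of F F' F''])
    show "(F has_real_derivative F' y) (at y)" for y
      unfolding F_def F'_def by (auto intro!: derivative_eq_intros simp: algebra_simps)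
    show "(F' has_real_derivative F'' y) (at y)" for y
      unfolding F'_def F''_def by (auto intro!: derivative_eq_intros)
    show "isCont F'' 0" unfolding F''_def by (intro continuous_intros)
    show "F' 0 = 0" by (simp add: F'_def algebra_simps)
    show "F'' 0 > 0" using s k by (simp add: F''_def)
  qed
  then obtain \<rho> where r: "\<rho> > 0" "\<And>y. \<bar>y\<bar> \<le> \<rho> \<Longrightarrow> y \<noteq> 0 \<Longrightarrow> F 0 < F y" by blast
  have F0: "F 0 = 0" by (simp add: F_def)
  define \<rho>' where "\<rho>' = min \<rho> \<kappa>"
  show ?thesis
  proof (intro exI[of _ \<rho>'] conjI allI impI)
    show "\<rho>' > 0" using r k by (simp add: \<rho>'_def)
    fix u assume u: "\<bar>u\<bar> \<le> \<rho>'"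
    have "\<bar>u * cos \<alpha>\<bar> \<le> \<kappa> * 1" unfolding abs_mult using u k by (intro mult_mono) (auto simp: \<rho>'_def)
    then have pos: "sin \<alpha> + \<kappa> + u * cos \<alpha> > 0" using s by linarith
    define E where "E = (cos (\<alpha> + u) - cos \<alpha>)\<^sup>2 + (sin (\<alpha> + u) + \<kappa>)\<^sup>2"
    have FE: "F u = (sin \<alpha> + \<kappa> + u * cos \<alpha>)\<^sup>2 - E" by (simp add: F_def E_def)
    have lt: "sqrt E < sin \<alpha> + \<kappa> + u * cos \<alpha>" if "u \<noteq> 0"
      using r(2)[of u] that u pos F0 FE by (intro real_less_lsqrt) (auto simp: \<rho>'_def)
    have eq: "sqrt E = sin \<alpha> + \<kappa> + u * cos \<alpha>" if "u = 0" using that pos by (simp add: E_def)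
    show "sqrt E \<le> sin \<alpha> + \<kappa> + u * cos \<alpha>" using lt eq by (cases "u = 0") auto
    show "u = 0" if "sqrt E = sin \<alpha> + \<kappa> + u * cos \<alpha>" using lt that by auto
  qed
qed

text \<open>The point \<open>G\<close> splits the undisturbed side: it lies on its line, l/2 past
  the foot of one centre and l/2 before the foot of the other. The triangle inequality through
  \<open>G\<close> separates the two endpoints, and each half is strict by itself, so equality
  forces both displacements to be 0.\<close>

lemma long_side_bound:
  assumes a: "0 < \<alpha>" "\<alpha> < pi/2" "0 < \<alpha>'" "\<alpha>' < pi/2" and lp: "l > 0"
    and qq: "q' - q = (cos \<alpha> - cos \<alpha>') *\<^sub>R unit_vec \<nu> + l *\<^sub>R unit_vec' \<nu>"
  shows "\<exists>\<rho>>0. \<forall>x x'. \<bar>x\<bar> \<le> \<rho> \<longrightarrow> \<bar>x'\<bar> \<le> \<rho> \<longrightarrow>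
    dist (q + unit_vec (\<nu> - \<alpha> + x)) (q' + unit_vec (\<nu> + \<alpha>' + x')) \<le> l + sin \<alpha> + sin \<alpha>' - cos \<alpha> * x + cos \<alpha>' * x' \<and>
    (dist (q + unit_vec (\<nu> - \<alpha> + x)) (q' + unit_vec (\<nu> + \<alpha>' + x')) = l + sin \<alpha> + sin \<alpha>' - cos \<alpha> * x + cos \<alpha>' * x' \<longrightarrow>
      x = x' \<and> x' = 0)"
proof -
  define \<kappa> where "\<kappa> = l / 2"
  have k: "\<kappa> > 0" "l = \<kappa> + \<kappa>" using lp by (auto simp: \<kappa>_def)
  define E where "E = (\<lambda>\<alpha> u. sqrt ((cos (\<alpha> + u) - cos \<alpha>)\<^sup>2 + (sin (\<alpha> + u) + \<kappa>)\<^sup>2))"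
  obtain r1 where r1: "r1 > 0" "\<And>u. \<bar>u\<bar> \<le> r1 \<Longrightarrow> E \<alpha> u \<le> sin \<alpha> + \<kappa> + u * cos \<alpha>"
    "\<And>u. \<bar>u\<bar> \<le> r1 \<Longrightarrow> E \<alpha> u = sin \<alpha> + \<kappa> + u * cos \<alpha> \<Longrightarrow> u = 0"
    using half_side_bound[OF a(1,2) k(1)] unfolding E_def by blast
  obtain r2 where r2: "r2 > 0" "\<And>u. \<bar>u\<bar> \<le> r2 \<Longrightarrow> E \<alpha>' u \<le> sin \<alpha>' + \<kappa> + u * cos \<alpha>'"
    "\<And>u. \<bar>u\<bar> \<le> r2 \<Longrightarrow> E \<alpha>' u = sin \<alpha>' + \<kappa> + u * cos \<alpha>' \<Longrightarrow> u = 0"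
    using half_side_bound[OF a(3,4) k(1)] unfolding E_def by blast
  define G where "G = q + cos \<alpha> *\<^sub>R unit_vec \<nu> + \<kappa> *\<^sub>R unit_vec' \<nu>"
  have G': "G = q' + cos \<alpha>' *\<^sub>R unit_vec \<nu> - \<kappa> *\<^sub>R unit_vec' \<nu>"
  proof -
    have "q' = q + ((cos \<alpha> - cos \<alpha>') *\<^sub>R unit_vec \<nu> + l *\<^sub>R unit_vec' \<nu>)" using qq by (simp add: algebra_simps)
    moreover have "l *\<^sub>R unit_vec' \<nu> = \<kappa> *\<^sub>R unit_vec' \<nu> + \<kappa> *\<^sub>R unit_vec' \<nu>"
      unfolding k(2) by (rule scaleR_add_left)
    ultimately show ?thesis by (simp add: G_def scaleR_diff_left)
  qed
  show ?thesis
  proof (rule exI[of _ "min r1 r2"], intro conjI[OF _ allI[OF allI]] impI)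
    show "min r1 r2 > 0" using r1 r2 by simp
    fix x x' assume x: "\<bar>x\<bar> \<le> min r1 r2" "\<bar>x'\<bar> \<le> min r1 r2"
    define p where "p = q + unit_vec (\<nu> - \<alpha> + x)"
    define p' where "p' = q' + unit_vec (\<nu> + \<alpha>' + x')"
    have "p - G = (cos (\<alpha> + - x) - cos \<alpha>) *\<^sub>R unit_vec \<nu> + (- (sin (\<alpha> + - x) + \<kappa>)) *\<^sub>R unit_vec' \<nu>"
      using unit_vec_diff[of \<nu> "\<alpha> - x"] by (simp add: p_def G_def algebra_simps)
    then have d1: "dist p G = E \<alpha> (- x)" unfolding dist_norm by (simp only: frame_norm E_def power2_minus)
    have "p' - G = (cos (\<alpha>' + x') - cos \<alpha>') *\<^sub>R unit_vec \<nu> + (sin (\<alpha>' + x') + \<kappa>) *\<^sub>R unit_vec' \<nu>"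
      using unit_vec_add[of \<nu> "\<alpha>' + x'"] by (simp add: p'_def G' algebra_simps)
    then have d2: "dist p' G = E \<alpha>' x'" unfolding dist_norm by (simp only: frame_norm E_def)
    have b: "dist p p' \<le> E \<alpha> (- x) + E \<alpha>' x'" using dist_triangle2[of p p' G] d1 d2 by simp
    have e: "E \<alpha> (- x) \<le> sin \<alpha> + \<kappa> + - x * cos \<alpha>" "E \<alpha>' x' \<le> sin \<alpha>' + \<kappa> + x' * cos \<alpha>'"
      using r1(2)[of "- x"] r2(2)[of x'] x by auto
    have D: "l + sin \<alpha> + sin \<alpha>' - cos \<alpha> * x + cos \<alpha>' * x' = (sin \<alpha> + \<kappa> + - x * cos \<alpha>) + (sin \<alpha>' + \<kappa> + x' * cos \<alpha>')"
      using k(2) by (simp add: algebra_simps)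
    have eq: "x = x' \<and> x' = 0" if "dist p p' = l + sin \<alpha> + sin \<alpha>' - cos \<alpha> * x + cos \<alpha>' * x'"
    proof -
      have "E \<alpha> (- x) = sin \<alpha> + \<kappa> + - x * cos \<alpha>" "E \<alpha>' x' = sin \<alpha>' + \<kappa> + x' * cos \<alpha>'"
        using that b e D by linarith+
      then have "- x = 0" "x' = 0" using r1(3)[of "- x"] r2(3)[of x'] x by auto
      then show ?thesis by simp
    qed
    show "dist p p' \<le> l + sin \<alpha> + sin \<alpha>' - cos \<alpha> * x + cos \<alpha>' * x' \<and>
      (dist p p' = l + sin \<alpha> + sin \<alpha>' - cos \<alpha> * x + cos \<alpha>' * x' \<longrightarrow> x = x' \<and> x' = 0)"
      using b e D eq by linarith
  qed
qed

lemma dist_unit_vec: "dist (q + unit_vec s) (q + unit_vec t) = 2 * \<bar>sin ((t - s) / 2)\<bar>"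
proof -
  have "dist (q + unit_vec s) (q + unit_vec t) = sqrt ((cos s - cos t)\<^sup>2 + (sin s - sin t)\<^sup>2)"
    by (simp add: unit_vec_def dist_norm norm_Pair)
  also have "(cos s - cos t)\<^sup>2 + (sin s - sin t)\<^sup>2 = 2 - 2 * cos (t - s)"
  proof -
    have "(cos s - cos t)\<^sup>2 + (sin s - sin t)\<^sup>2 = ((sin s)\<^sup>2 + (cos s)\<^sup>2) + ((sin t)\<^sup>2 + (cos t)\<^sup>2) - 2 * (cos t * cos s + sin t * sin s)"
      by (simp add: power2_eq_square algebra_simps del: sin_cos_squared_add sin_cos_squared_add2)
    then show ?thesis by (simp add: cos_diff)
  qed
  also have "\<dots> = (2 * sin ((t - s) / 2))\<^sup>2"  proof -
    have "2 * ((t - s) / 2) = t - s" by simp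
    then show ?thesis using cos_double_sin[of "(t - s) / 2"] by (simp only: power_mult_distrib) simp
  qed
  finally show ?thesis by (simp only: real_sqrt_abs abs_mult abs_numeral)
qed

text \<open>Rotating both endpoints together does not change a chord, so equality can yield only x =
  x'. Otherwise the length 2 sin(\<alpha> + y) with y = (x' - x)/2 lies strictly below its tangent
  line at y = 0.\<close>

lemma chord_side_bound:
  assumes a: "0 < \<alpha>" "\<alpha> < pi/2"
  shows "\<exists>\<rho>>0. \<forall>x x'. \<bar>x\<bar> \<le> \<rho> \<longrightarrow> \<bar>x'\<bar> \<le> \<rho> \<longrightarrow>
    dist (q + unit_vec (\<nu> - \<alpha> + x)) (q + unit_vec (\<nu> + \<alpha> + x')) \<le> 2 * sin \<alpha> - cos \<alpha> * x + cos \<alpha> * x' \<and>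
    (dist (q + unit_vec (\<nu> - \<alpha> + x)) (q + unit_vec (\<nu> + \<alpha> + x')) = 2 * sin \<alpha> - cos \<alpha> * x + cos \<alpha> * x' \<longrightarrow> x = x')"
proof -
  have s: "sin \<alpha> > 0" using a by (intro sin_gt_zero) auto
  have "\<exists>\<rho>>0. \<forall>y. \<bar>y\<bar> \<le> \<rho> \<longrightarrow> y \<noteq> 0 \<longrightarrow> (\<lambda>y. y * cos \<alpha> - sin (\<alpha> + y)) 0 < (\<lambda>y. y * cos \<alpha> - sin (\<alpha> + y)) y"
    by (rule strict_local_min_second_derivative[of _ "\<lambda>y. cos \<alpha> - cos (\<alpha> + y)" "\<lambda>y. sin (\<alpha> + y)"])
       (use s in \<open>auto intro!: derivative_eq_intros continuous_intros\<close>)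
  then obtain r where r: "r > 0" "\<And>y. \<bar>y\<bar> \<le> r \<Longrightarrow> y \<noteq> 0 \<Longrightarrow> sin (\<alpha> + y) < sin \<alpha> + y * cos \<alpha>" by force
  define \<rho> where "\<rho> = min r \<alpha>"
  show ?thesis
  proof (rule exI[of _ \<rho>], intro conjI[OF _ allI[OF allI]] impI)
    show "\<rho> > 0" using r a by (simp add: \<rho>_def)
    fix x x' assume x: "\<bar>x\<bar> \<le> \<rho>" "\<bar>x'\<bar> \<le> \<rho>"
    define y where "y = (x' - x) / 2"
    have y: "\<bar>y\<bar> \<le> r" "\<bar>y\<bar> \<le> \<alpha>" using x by (auto simp: y_def \<rho>_def)
    have "sin (\<alpha> + y) \<ge> 0" using y a by (intro sin_ge_zero) auto
    moreover have h: "(\<nu> + \<alpha> + x' - (\<nu> - \<alpha> + x)) / 2 = \<alpha> + y" by (simp add: y_def field_simps)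
    ultimately have d: "dist (q + unit_vec (\<nu> - \<alpha> + x)) (q + unit_vec (\<nu> + \<alpha> + x')) = 2 * sin (\<alpha> + y)"
      unfolding dist_unit_vec h by simp
    have e: "2 * sin \<alpha> - cos \<alpha> * x + cos \<alpha> * x' = 2 * (sin \<alpha> + y * cos \<alpha>)" by (simp add: y_def field_simps)
    show "dist (q + unit_vec (\<nu> - \<alpha> + x)) (q + unit_vec (\<nu> + \<alpha> + x')) \<le> 2 * sin \<alpha> - cos \<alpha> * x + cos \<alpha> * x' \<and>
     (dist (q + unit_vec (\<nu> - \<alpha> + x)) (q + unit_vec (\<nu> + \<alpha> + x')) = 2 * sin \<alpha> - cos \<alpha> * x + cos \<alpha> * x' \<longrightarrow> x = x')"
      unfolding d e
    proof (cases "y = 0")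
      case False then show "2 * sin (\<alpha> + y) \<le> 2 * (sin \<alpha> + y * cos \<alpha>) \<and> (2 * sin (\<alpha> + y) = 2 * (sin \<alpha> + y * cos \<alpha>) \<longrightarrow> x = x')"
        using r(2)[of y] y by auto
    next
      case True then show "2 * sin (\<alpha> + y) \<le> 2 * (sin \<alpha> + y * cos \<alpha>) \<and> (2 * sin (\<alpha> + y) = 2 * (sin \<alpha> + y * cos \<alpha>) \<longrightarrow> x = x')"
        by (auto simp: y_def)
    qed
  qed
qed

text \<open>The vertices on each semicircle are equally spaced, and a long side has distance cos
  \<alpha> from the centre of an arc, where 2 \<alpha> is the spacing on that arc. Projecting the
  vector between the two centres to the normal of a long side gives \<open>tilt\<close>. The upper
  bound of \<beta> in terms of \<open>m\<^sub>2\<close> keeps the extreme vertices on the right off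
  the junctions.\<close>

locale stadium_orbit =
  fixes a \<beta> :: real and m\<^sub>1 m\<^sub>2 :: nat
  assumes a: "a > 0" and m: "m\<^sub>1 \<ge> 2" "m\<^sub>2 \<ge> 2" and beta: "0 \<le> \<beta>" "\<beta> < pi/2" "\<beta> < (pi/2 + \<beta>) / real m\<^sub>2"
    and tilt: "a * sin \<beta> = cos ((pi/2 + \<beta>) / real m\<^sub>2) - cos ((pi/2 - \<beta>) / real m\<^sub>1)"
begin

definition al1 :: real where "al1 = (pi/2 - \<beta>) / real m\<^sub>1"
definition al2 :: real where "al2 = (pi/2 + \<beta>) / real m\<^sub>2"
definition n :: nat where "n = m\<^sub>1 + m\<^sub>2"
text \<open>Half the angle between neighbouring vertices on the arc, which is also the angle between
  a side and the tangent line at its vertex.\<close>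

definition graze :: "nat \<Rightarrow> real" where "graze i = (if i < m\<^sub>2 then al2 else al1)"
text \<open>Counterclockwise about the centre of the respective arc: indices below
  \<open>m\<^sub>2\<close> run up the right arc, the others run down the left arc through the angle
  pi.\<close>

definition angle :: "nat \<Rightarrow> real" where
  "angle i = (if i < m\<^sub>2 then (2 * real i + 1 - real m\<^sub>2) * al2 else pi/2 + \<beta> + (2 * (real i - real m\<^sub>2) + 1) * al1)"
definition centre :: "nat \<Rightarrow> point" where "centre i = (if i < m\<^sub>2 then (a/2, 0) else (-a/2, 0))"
text \<open>The polar angle of the outward normal of the side that leaves vertex i;
  \<open>unit_vec'\<close> at the same angle is the direction of that side.\<close>

definition side_normal :: "nat \<Rightarrow> real" where "side_normal i = angle i + graze i"
definition long_side :: "nat \<Rightarrow> bool" where "long_side i \<longleftrightarrow> Suc i = m\<^sub>2 \<or> Suc i = n"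
text \<open>The distance, along the side, between the feet of the perpendiculars from the two
  centres involved.\<close>

definition shift :: "nat \<Rightarrow> real" where "shift i = (if long_side i then a * cos \<beta> else 0)"
definition on_circle :: "nat \<Rightarrow> real \<Rightarrow> point" where "on_circle i s = centre i + unit_vec s"

lemma al_mult: "real m\<^sub>1 * al1 = pi/2 - \<beta>" "real m\<^sub>2 * al2 = pi/2 + \<beta>"
  using m by (auto simp: al1_def al2_def)

lemma al_bounds: "0 < al1" "al1 < pi/2" "0 < al2" "al2 < pi/2" "\<beta> < al2" "\<beta> < pi/2"
proof -
  show "0 < al1" "0 < al2" "\<beta> < al2" "\<beta> < pi/2" using m beta by (auto simp: al1_def al2_def)
  then have "2 * al1 \<le> real m\<^sub>1 * al1" "2 * al2 \<le> real m\<^sub>2 * al2" using m by (auto intro!: mult_right_mono)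
  then show "al1 < pi/2" "al2 < pi/2" using al_mult beta pi_gt_zero by linarith+
qed

lemma graze_bounds: "0 < graze i" "graze i < pi/2"
  using al_bounds by (auto simp: graze_def)

lemma cos_beta: "cos \<beta> > 0" using beta by (intro cos_gt_zero_pi) auto

lemma n_pos: "n > 0" "Suc i mod n < n" using m by (auto simp: n_def)

lemma side_cases:
  assumes "i < n"
  obtains (right) "Suc i < m\<^sub>2" "Suc i mod n = Suc i" "\<not> long_side i"
  | (top) "Suc i = m\<^sub>2" "Suc i mod n = m\<^sub>2" "long_side i"
  | (left) "m\<^sub>2 \<le> i" "Suc i < n" "Suc i mod n = Suc i" "\<not> long_side i"
  | (bottom) "Suc i = n" "m\<^sub>2 \<le> i" "Suc i mod n = 0" "long_side i"
proof -
  have "m\<^sub>2 < n" "m\<^sub>2 > 0" using m by (auto simp: n_def)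
  then consider "Suc i < m\<^sub>2" | "Suc i = m\<^sub>2" | "m\<^sub>2 \<le> i" "Suc i < n" | "Suc i = n" "m\<^sub>2 \<le> i"
    using assms by linarith
  then show ?thesis
    by cases (use \<open>m\<^sub>2 < n\<close> that in \<open>auto simp: long_side_def\<close>)
qed

lemma long_side_normal:
  assumes "i < n"
  shows "Suc i = m\<^sub>2 \<Longrightarrow> side_normal i = pi/2 + \<beta>" "Suc i = n \<Longrightarrow> side_normal i = 2 * pi - (pi/2 + \<beta>)"
proof -
  assume "Suc i = m\<^sub>2"
  then have i: "real i = real m\<^sub>2 - 1" "i < m\<^sub>2" by auto
  have "(2 * (real m\<^sub>2 - 1) + 1 - real m\<^sub>2) * al2 + al2 = real m\<^sub>2 * al2" by (simp add: algebra_simps)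
  then show "side_normal i = pi/2 + \<beta>" using i al_mult by (simp add: side_normal_def angle_def graze_def)
next
  assume "Suc i = n"
  then have i: "real i = real m\<^sub>1 + real m\<^sub>2 - 1" "\<not> i < m\<^sub>2" using m by (auto simp: n_def)
  have "(2 * ((real m\<^sub>1 + real m\<^sub>2 - 1) - real m\<^sub>2) + 1) * al1 + al1 = 2 * (real m\<^sub>1 * al1)" by (simp add: algebra_simps)
  then have "side_normal i = pi/2 + \<beta> + 2 * (real m\<^sub>1 * al1)"
    unfolding side_normal_def angle_def graze_def i(1) using i(2) by simp
  then show "side_normal i = 2 * pi - (pi/2 + \<beta>)" unfolding al_mult by (simp add: algebra_simps)
qed

text \<open>The angle grows by the two grazing angles at the ends of the side; a full turn is
  subtracted only at the step from the last vertex to vertex 0.\<close>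

lemma next_angle:
  assumes "i < n"
  shows "\<exists>k\<in>{0, 1}. angle (Suc i mod n) = side_normal i + graze (Suc i mod n) - 2 * pi * k"
  using assms
proof (cases rule: side_cases)
  case right
  then show ?thesis by (auto simp: angle_def side_normal_def graze_def algebra_simps)
next
  case top
  then show ?thesis using long_side_normal(1)[OF assms] by (simp add: angle_def graze_def)
next
  case left
  then show ?thesis by (auto simp: angle_def side_normal_def graze_def algebra_simps)
next
  case bottom
  have "angle 0 = al2 - real m\<^sub>2 * al2" using m by (simp add: angle_def algebra_simps)
  then show ?thesis using long_side_normal(2)[OF assms] al_mult bottom m by (simp add: graze_def algebra_simps)
qed

lemma unit_vec_periodic: "k \<in> {0, 1} \<Longrightarrow> unit_vec (x - 2 * pi * k) = unit_vec x"
  "k \<in> {0, 1} \<Longrightarrow> unit_vec' (x - 2 * pi * k) = unit_vec' x"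
  by (auto simp: unit_vec_def unit_vec'_def cos_diff sin_diff)

lemma unit_vec_next_angle:
  assumes "i < n"
  shows "unit_vec (angle (Suc i mod n) + x) = unit_vec (side_normal i + graze (Suc i mod n) + x)"
proof -
  obtain k where k: "k \<in> {0, 1}" "angle (Suc i mod n) = side_normal i + graze (Suc i mod n) - 2 * pi * k"
    using next_angle[OF assms] by blast
  have "angle (Suc i mod n) + x = side_normal i + graze (Suc i mod n) + x - 2 * pi * k" using k(2) by simp
  then show ?thesis by (metis unit_vec_periodic(1)[OF k(1)])
qed

text \<open>The jump of the unit side vector at a vertex is radial, which is the law of reflection;
  its length is the weight of that vertex in the first variation.\<close>

lemma unit_vec'_turn:
  assumes "i < n"
  shows "unit_vec' (side_normal i) - unit_vec' (side_normal (Suc i mod n)) =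
    (2 * sin (graze (Suc i mod n))) *\<^sub>R unit_vec (angle (Suc i mod n))"
proof -
  obtain k where k: "k \<in> {0, 1}" "angle (Suc i mod n) = side_normal i + graze (Suc i mod n) - 2 * pi * k"
    using next_angle[OF assms] by blast
  have "side_normal i - 2 * pi * k = angle (Suc i mod n) - graze (Suc i mod n)" using k(2) by simp
  then have "unit_vec' (side_normal i) = unit_vec' (angle (Suc i mod n) - graze (Suc i mod n))"
    using unit_vec_periodic(2)[OF k(1), of "side_normal i"] by simp
  then show ?thesis
    using unit_vec'_diff_symmetric[of "angle (Suc i mod n)" "graze (Suc i mod n)"] by (simp add: side_normal_def)
qed

text \<open>For the two long sides the normal component is \<open>tilt\<close> and the component
  along the side is a cos \<beta>; for all other sides both centres and both grazing angles
  coincide.\<close>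

lemma centre_next:
  assumes "i < n"
  shows "centre (Suc i mod n) - centre i =
    (cos (graze i) - cos (graze (Suc i mod n))) *\<^sub>R unit_vec (side_normal i) + shift i *\<^sub>R unit_vec' (side_normal i)"
  using assms
proof (cases rule: side_cases)
  case right
  then show ?thesis by (simp add: centre_def graze_def shift_def zero_prod_def)
next
  case top
  have i: "real i = real m\<^sub>2 - 1" "i < m\<^sub>2" using top by auto
  have nu: "side_normal i = pi/2 + \<beta>" using long_side_normal(1)[OF assms] top by blast
  have t: "cos al2 - cos al1 = a * sin \<beta>" using tilt by (simp add: al1_def al2_def)
  have sc: "a * (sin \<beta>)\<^sup>2 + a * (cos \<beta>)\<^sup>2 = a" by (metis distrib_left mult.right_neutral sin_cos_squared_add)
  show ?thesis using top i t sc unfolding nu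
    by (simp add: centre_def graze_def shift_def unit_vec_def unit_vec'_def cos_add sin_add power2_eq_square algebra_simps)
next
  case left
  then show ?thesis by (simp add: centre_def graze_def shift_def zero_prod_def)
next
  case bottom
  have i: "real i = real m\<^sub>1 + real m\<^sub>2 - 1" "\<not> i < m\<^sub>2" "m\<^sub>2 > 0" using bottom m by (auto simp: n_def)
  have nu: "side_normal i = 2 * pi - (pi/2 + \<beta>)" using long_side_normal(2)[OF assms] bottom by blast
  have t: "cos al2 = cos al1 + a * sin \<beta>" using tilt by (simp add: al1_def al2_def)
  have sc: "a * (sin \<beta>)\<^sup>2 + a * (cos \<beta>)\<^sup>2 = a" by (metis distrib_left mult.right_neutral sin_cos_squared_add)
  have uv: "unit_vec (2 * pi - (pi/2 + \<beta>)) = (- sin \<beta>, - cos \<beta>)" "unit_vec' (2 * pi - (pi/2 + \<beta>)) = (cos \<beta>, - sin \<beta>)"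
    unfolding unit_vec_def unit_vec'_def cos_2pi_minus sin_2pi_minus by (simp_all add: cos_add sin_add)
  show ?thesis using bottom i t sc unfolding nu uv
    by (simp add: centre_def graze_def shift_def power2_eq_square algebra_simps)
qed

definition side_length :: "nat \<Rightarrow> real" where
  "side_length i = shift i + sin (graze i) + sin (graze (Suc i mod n))"

lemma side_length_pos: "side_length i > 0"
proof -
  have "sin (graze j) > 0" for j using graze_bounds[of j] pi_gt_zero by (intro sin_gt_zero) linarith+
  moreover have "shift i \<ge> 0" using a cos_beta by (simp add: shift_def)
  ultimately show ?thesis by (simp add: side_length_def add_nonneg_pos add_pos_pos add.assoc)
qed

lemma side_bound:
  assumes i: "i < n"
  defines "j \<equiv> Suc i mod n"
  shows "\<exists>\<rho>>0. \<forall>x x'. \<bar>x\<bar> \<le> \<rho> \<longrightarrow> \<bar>x'\<bar> \<le> \<rho> \<longrightarrow>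
    dist (on_circle i (angle i + x)) (on_circle j (angle j + x')) \<le> side_length i - cos (graze i) * x + cos (graze j) * x' \<and>
    (dist (on_circle i (angle i + x)) (on_circle j (angle j + x')) = side_length i - cos (graze i) * x + cos (graze j) * x' \<longrightarrow>
      x = x' \<and> (long_side i \<longrightarrow> x' = 0))"
proof -
  have p: "on_circle i (angle i + x) = centre i + unit_vec (side_normal i - graze i + x)" for x
    by (simp add: on_circle_def side_normal_def)
  have p': "on_circle j (angle j + x) = centre j + unit_vec (side_normal i + graze j + x)" for x
    unfolding on_circle_def j_def unit_vec_next_angle[OF i] ..
  show ?thesis
  proof (cases "long_side i")
    case True
    have "a * cos \<beta> > 0" using a cos_beta by simp
    moreover have "centre j - centre i = (cos (graze i) - cos (graze j)) *\<^sub>R unit_vec (side_normal i) + (a * cos \<beta>) *\<^sub>R unit_vec' (side_normal i)"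
      using centre_next[OF i] True by (simp add: j_def shift_def)
    ultimately show ?thesis
      using long_side_bound[OF graze_bounds graze_bounds, of "a * cos \<beta>" "centre j" "centre i" i j "side_normal i"] True
      unfolding p p' by (simp add: side_length_def shift_def j_def)
  next
    case False
    have eq: "graze j = graze i" "centre j = centre i"
      using i False unfolding j_def by (cases rule: side_cases; simp add: graze_def centre_def)+
    show ?thesis
      using chord_side_bound[OF graze_bounds, of "centre i" "side_normal i" i] False
      unfolding p p' eq by (simp add: side_length_def shift_def j_def[symmetric] eq)
  qed
qed

lemma uniform_side_bound:
  "\<exists>\<rho>>0. \<forall>i<n. \<forall>x x'. \<bar>x\<bar> \<le> \<rho> \<longrightarrow> \<bar>x'\<bar> \<le> \<rho> \<longrightarrow>
    dist (on_circle i (angle i + x)) (on_circle (Suc i mod n) (angle (Suc i mod n) + x'))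
      \<le> side_length i - cos (graze i) * x + cos (graze (Suc i mod n)) * x' \<and>
    (dist (on_circle i (angle i + x)) (on_circle (Suc i mod n) (angle (Suc i mod n) + x'))
      = side_length i - cos (graze i) * x + cos (graze (Suc i mod n)) * x' \<longrightarrow>
      x = x' \<and> (long_side i \<longrightarrow> x' = 0))"
proof -
  obtain r where r: "\<And>i. i < n \<Longrightarrow> r i > 0" "\<And>i x x'. i < n \<Longrightarrow> \<bar>x\<bar> \<le> r i \<Longrightarrow> \<bar>x'\<bar> \<le> r i \<Longrightarrow>
    dist (on_circle i (angle i + x)) (on_circle (Suc i mod n) (angle (Suc i mod n) + x'))
      \<le> side_length i - cos (graze i) * x + cos (graze (Suc i mod n)) * x' \<and>
    (dist (on_circle i (angle i + x)) (on_circle (Suc i mod n) (angle (Suc i mod n) + x'))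
      = side_length i - cos (graze i) * x + cos (graze (Suc i mod n)) * x' \<longrightarrow>
      x = x' \<and> (long_side i \<longrightarrow> x' = 0))"
    using side_bound by metis
  define \<rho> where "\<rho> = Min (r ` {..<n})"
  have ne: "r ` {..<n} \<noteq> {}" "finite (r ` {..<n})" using n_pos by auto
  have "\<rho> > 0" unfolding \<rho>_def using ne r(1) by (subst Min_gr_iff) auto
  moreover have "\<rho> \<le> r i" if "i < n" for i unfolding \<rho>_def using that by (intro Min_le) auto
  ultimately show ?thesis using r(2) by (intro exI[of _ \<rho>]) (meson order_trans)
qed

lemma dist_at_orbit:
  assumes "i < n"
  shows "on_circle (Suc i mod n) (angle (Suc i mod n)) - on_circle i (angle i) = side_length i *\<^sub>R unit_vec' (side_normal i)"
proof -
  define j where "j = Suc i mod n"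
  have "on_circle j (angle j) - on_circle i (angle i) = (centre j - centre i) + (unit_vec (angle j) - unit_vec (angle i))"
    by (simp add: on_circle_def)
  also have "unit_vec (angle j) = unit_vec (side_normal i + graze j)"
    using unit_vec_next_angle[OF assms, of 0] by (simp add: j_def)
  also have "unit_vec (angle i) = unit_vec (side_normal i - graze i)" by (simp add: side_normal_def)
  finally show ?thesis
    unfolding j_def unit_vec_add unit_vec_diff centre_next[OF assms] side_length_def
    by (simp add: scaleR_add_left scaleR_diff_left)
qed

lemma norm_unit_vec: "norm (unit_vec t) = 1" "norm (unit_vec' t) = 1"
  by (simp_all add: unit_vec_def unit_vec'_def norm_Pair)

lemma sgn_at_orbit:
  assumes "i < n"
  shows "sgn (on_circle (Suc i mod n) (angle (Suc i mod n)) - on_circle i (angle i)) = unit_vec' (side_normal i)"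
  using side_length_pos[of i] by (simp add: dist_at_orbit[OF assms] sgn_scaleR sgn_div_norm norm_unit_vec)

lemma perimeter_at_orbit: "perimeter n on_circle angle = (\<Sum>i<n. side_length i)"
  unfolding perimeter_def
proof (intro sum.cong refl)
  fix i assume "i \<in> {..<n}"
  then show "dist (on_circle i (angle i)) (on_circle (Suc i mod n) (angle (Suc i mod n))) = side_length i"
    using dist_at_orbit[of i] side_length_pos[of i]
    unfolding dist_norm norm_minus_commute[of "on_circle i (angle i)"] by (simp add: norm_unit_vec)
qed

text \<open>In the sum of the side bounds the linear terms cancel cyclically, so no nearby polygon
  is longer. Equality makes the displacements of neighbouring vertices equal and those at a long
  side zero, hence all zero.\<close>

lemma orbit_strict_max:
  "\<exists>\<rho>>0. \<forall>c. (\<forall>i<n. \<bar>c i - angle i\<bar> \<le> \<rho>) \<longrightarrow> perimeter n on_circle c \<ge> perimeter n on_circle angle \<longrightarrow>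
     (\<forall>i<n. c i = angle i)"
proof -
  obtain \<rho> where r: "\<rho> > 0" "\<And>i x x'. i < n \<Longrightarrow> \<bar>x\<bar> \<le> \<rho> \<Longrightarrow> \<bar>x'\<bar> \<le> \<rho> \<Longrightarrow>
    dist (on_circle i (angle i + x)) (on_circle (Suc i mod n) (angle (Suc i mod n) + x'))
      \<le> side_length i - cos (graze i) * x + cos (graze (Suc i mod n)) * x' \<and>
    (dist (on_circle i (angle i + x)) (on_circle (Suc i mod n) (angle (Suc i mod n) + x'))
      = side_length i - cos (graze i) * x + cos (graze (Suc i mod n)) * x' \<longrightarrow>
      x = x' \<and> (long_side i \<longrightarrow> x' = 0))"
    using uniform_side_bound by blast
  show ?thesis
  proof (intro exI[of _ \<rho>] conjI allI impI r(1))
    fix c assume c: "\<forall>i<n. \<bar>c i - angle i\<bar> \<le> \<rho>" and P: "perimeter n on_circle c \<ge> perimeter n on_circle angle"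
    define x where "x = (\<lambda>i. c i - angle i)"
    define d where "d = (\<lambda>i. dist (on_circle i (c i)) (on_circle (Suc i mod n) (c (Suc i mod n))))"
    define u where "u = (\<lambda>i. side_length i - cos (graze i) * x i + cos (graze (Suc i mod n)) * x (Suc i mod n))"
    have du: "d i \<le> u i" "d i = u i \<Longrightarrow> x i = x (Suc i mod n) \<and> (long_side i \<longrightarrow> x (Suc i mod n) = 0)" if "i < n" for i
      using r(2)[OF that, of "x i" "x (Suc i mod n)"] c that n_pos(2)[of i] by (auto simp: x_def d_def u_def)
    have "(\<Sum>i<n. u i) = (\<Sum>i<n. side_length i) - (\<Sum>i<n. cos (graze i) * x i) + (\<Sum>i<n. cos (graze (Suc i mod n)) * x (Suc i mod n))"
      by (simp add: u_def sum.distrib sum_subtractf)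
    also have "\<dots> = (\<Sum>i<n. side_length i)" using sum_cyclic_shift[OF n_pos(1), of "\<lambda>i. cos (graze i) * x i"] by simp
    finally have "(\<Sum>i<n. u i) \<le> (\<Sum>i<n. d i)" using P by (simp add: perimeter_at_orbit) (simp add: perimeter_def d_def)
    then have "(\<Sum>i<n. u i - d i) = 0" using sum_mono[of "{..<n}" d u] du(1) by (simp add: sum_subtractf)
    then have "\<forall>i\<in>{..<n}. u i - d i = 0" using du(1) by (subst (asm) sum_nonneg_eq_0_iff) auto
    then have eq: "x i = x (Suc i mod n) \<and> (long_side i \<longrightarrow> x (Suc i mod n) = 0)" if "i < n" for i
      using du(2)[OF that] that by simp
    have "i < n \<longrightarrow> x i = 0" for i
    proof (induction i)
      case 0
      \<comment> \<open>The last side is a long one, which gives x 0 = 0; from there the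
        displacement 0 is passed on from vertex to vertex.\<close>
      have "n - 1 < n" "Suc (n - 1) = n" using n_pos by auto
      then show ?case using eq[of "n - 1"] by (simp add: long_side_def)
    next
      case (Suc i) then show ?case using eq[of i] by auto
    qed
    then show "c i = angle i" if "i < n" for i using that by (simp add: x_def)
  qed
qed

text \<open>The extreme angle on the right is pi/2 + \<beta> - \<open>al2\<close>, below pi/2 by the
  assumption on \<beta>; on the left the tilt helps. All vertices are thus interior to the
  semicircles, where the boundary is smooth.\<close>

lemma angle_range:
  assumes "i < n"
  shows "i < m\<^sub>2 \<Longrightarrow> \<bar>angle i\<bar> < pi/2" "\<not> i < m\<^sub>2 \<Longrightarrow> \<bar>pi - angle i\<bar> < pi/2"
proof -
  assume i: "i < m\<^sub>2"
  have "\<bar>2 * real i + 1 - real m\<^sub>2\<bar> \<le> real m\<^sub>2 - 1" using i by linarith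
  then have "\<bar>2 * real i + 1 - real m\<^sub>2\<bar> * al2 \<le> (real m\<^sub>2 - 1) * al2" using al_bounds by (intro mult_right_mono) auto
  moreover have "\<bar>angle i\<bar> = \<bar>2 * real i + 1 - real m\<^sub>2\<bar> * al2" using i al_bounds by (simp add: angle_def abs_mult)
  moreover have "(real m\<^sub>2 - 1) * al2 < pi/2" using al_mult al_bounds by (simp add: left_diff_distrib)
  ultimately show "\<bar>angle i\<bar> < pi/2" by linarith
next
  assume i: "\<not> i < m\<^sub>2"
  have e: "pi - angle i = (real m\<^sub>1 - 1 - 2 * (real i - real m\<^sub>2)) * al1"
    using i al_mult by (simp add: angle_def algebra_simps)
  have "real m\<^sub>2 \<le> real i" "real i + 1 \<le> real m\<^sub>1 + real m\<^sub>2" using i assms by (auto simp: n_def)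
  then have "\<bar>real m\<^sub>1 - 1 - 2 * (real i - real m\<^sub>2)\<bar> \<le> real m\<^sub>1 - 1"
    unfolding abs_le_iff by (simp add: algebra_simps)
  then have "\<bar>real m\<^sub>1 - 1 - 2 * (real i - real m\<^sub>2)\<bar> * al1 \<le> (real m\<^sub>1 - 1) * al1" using al_bounds by (intro mult_right_mono) auto
  moreover have "\<bar>pi - angle i\<bar> = \<bar>real m\<^sub>1 - 1 - 2 * (real i - real m\<^sub>2)\<bar> * al1" unfolding e using al_bounds by (simp add: abs_mult)
  moreover have "(real m\<^sub>1 - 1) * al1 < pi/2" using al_mult al_bounds beta by (simp add: left_diff_distrib)
  ultimately show "\<bar>pi - angle i\<bar> < pi/2" by linarith
qed

lemma angle_separated:
  assumes "i < k" "k < n" "i < m\<^sub>2 \<longleftrightarrow> k < m\<^sub>2"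
  shows "angle k - angle i \<ge> 2 * min al1 al2"
proof -
  have ik: "1 \<le> real k - real i" using assms by simp
  show ?thesis
  proof (cases "k < m\<^sub>2")
    case True
    have "2 * al2 * 1 \<le> 2 * al2 * (real k - real i)" using al_bounds ik by (intro mult_left_mono) auto
    moreover have "angle k - angle i = 2 * al2 * (real k - real i)" using True assms by (simp add: angle_def algebra_simps)
    ultimately show ?thesis by linarith
  next
    case False
    have "2 * al1 * 1 \<le> 2 * al1 * (real k - real i)" using al_bounds ik by (intro mult_left_mono) auto
    moreover have "angle k - angle i = 2 * al1 * (real k - real i)" using False assms by (simp add: angle_def algebra_simps)
    ultimately show ?thesis by linarith
  qed
qed

text \<open>A chord of one arc has its midpoint at distance cos(graze) < 1 from the centre; a long
  side crosses the vertical axis at a height of absolute value below 1. One interior point per side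
  is the information that survives small perturbations.\<close>

lemma side_meets_stadium:
  assumes i: "i < n"
  shows "\<exists>w\<in>{0<..<1}. (1 - w) *\<^sub>R on_circle i (angle i) + w *\<^sub>R on_circle (Suc i mod n) (angle (Suc i mod n)) \<in> stadium a"
proof (cases "long_side i")
  case False
  define j where "j = Suc i mod n"
  have eq: "centre j = centre i"
    using i False unfolding j_def by (cases rule: side_cases; simp add: centre_def)+
  have gr: "graze j = graze i"
    using i False unfolding j_def by (cases rule: side_cases; simp add: graze_def)+
  have e: "(1 - 1/2) *\<^sub>R on_circle i (angle i) + (1/2::real) *\<^sub>R on_circle j (angle j) = centre i + cos (graze i) *\<^sub>R unit_vec (side_normal i)"
  proof -
    have "unit_vec (angle j) = unit_vec (side_normal i + graze i)"
      using unit_vec_next_angle[OF i, of 0] gr by (simp add: j_def)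
    moreover have "unit_vec (angle i) = unit_vec (side_normal i - graze i)" by (simp add: side_normal_def)
    ultimately have "unit_vec (angle i) + unit_vec (angle j) = (2 * cos (graze i)) *\<^sub>R unit_vec (side_normal i)"
      by (simp add: unit_vec_add unit_vec_diff scaleR_add_left[symmetric])
    moreover have "(1 - 1/2) *\<^sub>R on_circle i (angle i) + (1/2::real) *\<^sub>R on_circle j (angle j) =
      ((1/2::real) *\<^sub>R centre i + (1/2::real) *\<^sub>R centre i) + (1/2::real) *\<^sub>R (unit_vec (angle i) + unit_vec (angle j))"
      unfolding on_circle_def eq by (simp add: scaleR_add_right)
    moreover have "(1/2::real) *\<^sub>R centre i + (1/2::real) *\<^sub>R centre i = centre i"
      unfolding scaleR_add_left[symmetric] by simp
    ultimately show ?thesis by simp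
  qed
  have "0 < cos (graze i)" "cos (graze i) < 1"
    using graze_bounds[of i] cos_monotone_0_pi[of 0 "graze i"] by (auto intro!: cos_gt_zero_pi)
  then have "dist (centre i) (centre i + cos (graze i) *\<^sub>R unit_vec (side_normal i)) < 1"
    by (simp add: dist_norm norm_unit_vec)
  then have "centre i + cos (graze i) *\<^sub>R unit_vec (side_normal i) \<in> stadium a"
    by (auto simp: stadium_def centre_def split: if_splits)
  then show ?thesis using e unfolding j_def by (intro bexI[of _ "1/2"]) auto
next
  case True
  define j where "j = Suc i mod n"
  have jn: "j < n" using n_pos by (simp add: j_def)
  have ij: "(i < m\<^sub>2) \<noteq> (j < m\<^sub>2)"
    using i True m unfolding j_def by (cases rule: side_cases) (auto simp: n_def)
  have pt: "fst (on_circle k (angle k)) > 0 \<and> \<bar>snd (on_circle k (angle k))\<bar> < 1" if "k < m\<^sub>2" "k < n" for k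
  proof -
    have c: "cos (angle k) > 0" using angle_range(1)[OF that(2,1)] by (intro cos_gt_zero_pi) auto
    have "(sin (angle k))\<^sup>2 < 1" using c by (simp add: sin_squared_eq)
    then show ?thesis using c a that by (simp add: on_circle_def centre_def unit_vec_def abs_square_less_1)
  qed
  have pt': "fst (on_circle k (angle k)) < 0 \<and> \<bar>snd (on_circle k (angle k))\<bar> < 1" if "\<not> k < m\<^sub>2" "k < n" for k
  proof -
    have "cos (pi - angle k) > 0" using angle_range(2)[OF that(2,1)] by (intro cos_gt_zero_pi) linarith+
    then have c: "cos (angle k) < 0" by simp
    have "(sin (angle k))\<^sup>2 < 1" using c by (simp add: sin_squared_eq)
    then show ?thesis using c a that by (simp add: on_circle_def centre_def unit_vec_def abs_square_less_1)
  qed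
  define p q where "p = on_circle i (angle i)" and "q = on_circle j (angle j)"
  have opp: "fst p * fst q < 0" using pt pt' ij i jn unfolding p_def q_def
    by (cases "i < m\<^sub>2") (auto intro: mult_pos_neg mult_neg_pos)
  have sn: "\<bar>snd p\<bar> < 1" "\<bar>snd q\<bar> < 1" using pt pt' i jn unfolding p_def q_def by blast+
  define w where "w = fst p / (fst p - fst q)"
  have w: "0 < w" "w < 1" using opp by (auto simp: w_def mult_less_0_iff divide_simps)
  have "fst p \<noteq> fst q" using opp by (auto simp: mult_less_0_iff)
  then have "fst ((1 - w) *\<^sub>R p + w *\<^sub>R q) = 0" by (simp add: w_def field_simps)
  moreover have "\<bar>snd ((1 - w) *\<^sub>R p + w *\<^sub>R q)\<bar> < 1"
  proof -
    have "\<bar>(1 - w) * snd p + w * snd q\<bar> \<le> (1 - w) * \<bar>snd p\<bar> + w * \<bar>snd q\<bar>"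
      using w abs_triangle_ineq[of "(1 - w) * snd p" "w * snd q"] by (simp add: abs_mult)
    also have "\<dots> < (1 - w) * 1 + w * 1" using w sn by (intro add_strict_mono mult_strict_left_mono) auto
    finally show ?thesis by simp
  qed
  ultimately have "(1 - w) *\<^sub>R p + w *\<^sub>R q \<in> stadium a"
    using a by (auto simp: stadium_def mem_Times_iff abs_less_iff)
  then show ?thesis using w unfolding p_def q_def j_def by (intro bexI[of _ w]) auto
qed

end


section \<open>Finitely many modes determine a deformation\<close>

text \<open>The vanishing first variation, expressed through the normal deformation and up to a
  common factor. The premise repeats the conditions of the locale \<open>stadium_orbit\<close>, so
  that the statement can be quantified over all \<beta>; it is linear in the pair of
  functions.\<close>

definition orbit_condition :: "real \<Rightarrow> (real \<Rightarrow> real) \<Rightarrow> (real \<Rightarrow> real) \<Rightarrow> nat \<Rightarrow> nat \<Rightarrow> real \<Rightarrow> bool" where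
  "orbit_condition a h\<^sub>1 h\<^sub>2 m\<^sub>1 m\<^sub>2 \<beta> \<longleftrightarrow>
    (0 \<le> \<beta> \<and> \<beta> < pi/2 \<and> \<beta> < (pi/2 + \<beta>) / real m\<^sub>2 \<and> a * sin \<beta> = cos ((pi/2 + \<beta>) / real m\<^sub>2) - cos ((pi/2 - \<beta>) / real m\<^sub>1) \<longrightarrow>
     sin ((pi/2 - \<beta>) / real m\<^sub>1) * (\<Sum>j<m\<^sub>1. h\<^sub>1 ((2 * real j + 1 - real m\<^sub>1) * ((pi/2 - \<beta>) / real m\<^sub>1))) +
     sin ((pi/2 + \<beta>) / real m\<^sub>2) * (\<Sum>j<m\<^sub>2. h\<^sub>2 ((2 * real j + 1 - real m\<^sub>2) * ((pi/2 + \<beta>) / real m\<^sub>2))) = 0)"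

text \<open>The properties common to all normal deformations: evenness comes from the reflection
  symmetry, the zero value at the junctions from the fixed endpoints, and the zero one-sided
  derivative from the horizontal tangents. All of them pass to linear combinations.\<close>

definition admissible :: "(real \<Rightarrow> real) \<Rightarrow> bool" where
  "admissible h \<longleftrightarrow> diff_times 4 h \<and> (\<forall>s\<in>S_int. h (- s) = h s) \<and> h (pi/2) = 0 \<and>
    (\<forall>s\<in>{-(pi/2), pi/2}. \<forall>h'. (h has_real_derivative h') (at s within S_int) \<longrightarrow> h' = 0)"

lemma fcos_add:
  assumes "continuous_on S_int f" "continuous_on S_int g"
  shows "fcos (\<lambda>s. f s + g s) k = fcos f k + fcos g k"
proof -
  have "integral S_int (\<lambda>s. f s * cos (2 * real k * s) + g s * cos (2 * real k * s)) =
     integral S_int (\<lambda>s. f s * cos (2 * real k * s)) + integral S_int (\<lambda>s. g s * cos (2 * real k * s))"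
    using assms unfolding S_int_eq
    by (intro integral_add) (auto intro!: integrable_continuous_real continuous_intros)
  then show ?thesis by (simp add: fcos_def distrib_left distrib_right)
qed

lemma half_pi_in_S_int: "pi/2 \<in> S_int" "-(pi/2) \<in> S_int"
  by (simp_all add: S_int_eq)

lemma fcos_mult: "fcos (\<lambda>s. c * f s) k = c * fcos f k"
  by (simp add: fcos_def mult.assoc)

lemma summable_of_decay:
  fixes b :: "nat \<Rightarrow> real"
  assumes "\<And>k. real k ^ 4 * \<bar>b k\<bar> \<le> N"
  shows "summable (\<lambda>k. \<bar>b k\<bar>)"
proof (rule summable_comparison_test')
  show "summable (\<lambda>k. N * (1 / real k ^ 2))"
    by (intro summable_mult) (use inverse_power_summable[of 2] in \<open>auto simp: field_simps\<close>)
  fix k :: nat assume k: "k \<ge> 1"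
  have "real k ^ 2 * \<bar>b k\<bar> \<le> real k ^ 4 * \<bar>b k\<bar>" using k by (intro mult_right_mono power_increasing) auto
  then have "real k ^ 2 * \<bar>b k\<bar> \<le> N" using assms[of k] by linarith
  then show "norm \<bar>b k\<bar> \<le> N * (1 / real k ^ 2)" using k by (simp add: field_simps)
qed

context
  fixes h :: "real \<Rightarrow> real"
  assumes h: "admissible h"
begin

lemma admissible_continuous: "continuous_on S_int h"
  using h diff_times_continuous unfolding admissible_def by blast

lemma admissible_decay: "\<exists>N. \<forall>k. real k ^ 4 * \<bar>fcos h k\<bar> \<le> N"
proof (rule fcos_decay)
  show "diff_times 4 h" using h by (simp add: admissible_def)
  show "h' = 0" if "s \<in> {-(pi/2), pi/2}" "(h has_real_derivative h') (at s within S_int)" for s h'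
    using h that by (simp only: admissible_def)
qed

lemma admissible_series:
  assumes "s \<in> S_int"
  shows "(\<lambda>k. fcos h k * cos (2 * real k * s)) sums h s"
proof -
  obtain N where N: "\<And>k. real k ^ 4 * \<bar>fcos h k\<bar> \<le> N" using admissible_decay by blast
  have "h (- t) = h t" if "t \<in> S_int" for t using h that by (simp add: admissible_def)
  then show ?thesis using fcos_series[OF admissible_continuous _ summable_of_decay[OF N] assms] by blast
qed

text \<open>The value of \<open>h\<close> at a junction, where mode k equals (-1)^k. This is the
  extra equation that corrects the rows of the tilted orbits.\<close>

lemma admissible_boundary_series: "(\<lambda>k. fcos h k * (-1) ^ k) sums 0"
proof -
  have "(\<lambda>k. fcos h k * cos (2 * real k * (pi/2))) sums h (pi/2)"
    by (rule admissible_series) (simp add: S_int_mem)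
  then show ?thesis using h unfolding sin_cos_half_pi_multiple admissible_def by simp
qed

lemma admissible_zero:
  assumes "\<And>k. fcos h k = 0" "s \<in> S_int"
  shows "h s = 0"
proof -
  have "(\<lambda>k. 0) sums h s" using admissible_series[OF assms(2)] assms(1) by simp
  then show ?thesis using sums_unique2[OF sums_zero] by metis
qed

lemma admissible_orbit_sum:
  assumes "m > 0" "0 < \<alpha>" "(real m - 1) * \<alpha> \<le> pi/2"
  shows "(\<lambda>k. fcos h k * ker m (2 * real k * \<alpha>)) sums (\<Sum>j<m. h ((2 * real j + 1 - real m) * \<alpha>))"
proof (rule sum_cos_series_eq_ker, rule admissible_series)
  fix j assume "j < m"
  then have "\<bar>2 * real j + 1 - real m\<bar> \<le> real m - 1" by linarith
  then have "\<bar>2 * real j + 1 - real m\<bar> * \<alpha> \<le> (real m - 1) * \<alpha>" using assms by (intro mult_right_mono) auto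
  moreover have "\<bar>(2 * real j + 1 - real m) * \<alpha>\<bar> = \<bar>2 * real j + 1 - real m\<bar> * \<alpha>"
    using assms(2) by (simp add: abs_mult)
  ultimately show "(2 * real j + 1 - real m) * \<alpha> \<in> S_int" using assms(3) unfolding S_int_mem by linarith
qed

end

lemma admissible_add:
  assumes "admissible f" "admissible g"
  shows "admissible (\<lambda>s. f s + g s)"
  unfolding admissible_def
proof (intro conjI ballI allI impI)
  show "diff_times 4 (\<lambda>s. f s + g s)" using assms diff_times_add unfolding admissible_def by blast
  show "f (- s) + g (- s) = f s + g s" if "s \<in> S_int" for s using assms that by (auto simp: admissible_def)
  show "f (pi/2) + g (pi/2) = 0" using assms by (auto simp: admissible_def)
  fix s h' assume s: "s \<in> {-(pi/2), pi/2}" and h': "((\<lambda>s. f s + g s) has_real_derivative h') (at s within S_int)"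
  have sS: "s \<in> S_int" using s half_pi_in_S_int by blast
  have ex: "\<exists>u'. (u has_real_derivative u') (at s within S_int)" if "admissible u" for u
  proof -
    have "diff_times (Suc 3) u" using that by (simp add: admissible_def del: diff_times.simps)
    then show ?thesis unfolding diff_times.simps using sS by blast
  qed
  obtain f' g' where d: "(f has_real_derivative f') (at s within S_int)" "(g has_real_derivative g') (at s within S_int)"
    using ex assms by blast
  have z: "f' = 0" "g' = 0" using d s assms unfolding admissible_def by blast+
  have "((\<lambda>s. f s + g s - f s) has_real_derivative h' - f') (at s within S_int)"
    by (intro derivative_intros h' d)
  then have "(g has_real_derivative h' - f') (at s within S_int)" by simp
  then have "h' - f' = 0" using s assms(2) unfolding admissible_def by blast
  then show "h' = 0" using z by simp
qed

lemma admissible_scale: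
  assumes "admissible f"
  shows "admissible (\<lambda>s. c * f s)"
proof (cases "c = 0")
  case True
  \<comment> \<open>A derivative of the zero function is added to one of \<open>f\<close>; the sum
    is again a derivative of \<open>f\<close>, and both must vanish by admissibility.\<close>
  have "h' = 0" if "s \<in> {-(pi/2), pi/2}" "((\<lambda>s. 0) has_real_derivative h') (at s within S_int)" for s h'
  proof -
    have "(f has_real_derivative f') (at s within S_int) \<Longrightarrow> f' = 0" for f'
      using assms that(1) unfolding admissible_def by blast
    moreover have "diff_times (Suc 3) f" using assms by (simp add: admissible_def del: diff_times.simps)
    moreover have "s \<in> S_int" using that(1) half_pi_in_S_int by blast
    ultimately obtain f' where f': "(f has_real_derivative f') (at s within S_int)"
      and u: "\<And>f'. (f has_real_derivative f') (at s within S_int) \<Longrightarrow> f' = 0"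
      unfolding diff_times.simps by blast
    have "((\<lambda>s. f s + 0) has_real_derivative f' + h') (at s within S_int)"
      by (rule DERIV_add[OF f' that(2)])
    then show ?thesis using u[OF f'] u[of "f' + h'"] by simp
  qed
  then show ?thesis using True diff_times_const[of 4 0] by (simp add: admissible_def)
next
  case False
  show ?thesis
    unfolding admissible_def
  proof (intro conjI ballI allI impI)
    show "diff_times 4 (\<lambda>s. c * f s)"
      using assms diff_times_mult diff_times_const unfolding admissible_def by blast
    show "c * f (- s) = c * f s" if "s \<in> S_int" for s using assms that by (auto simp: admissible_def)
    show "c * f (pi/2) = 0" using assms by (auto simp: admissible_def)
    fix s h' assume s: "s \<in> {-(pi/2), pi/2}" and h': "((\<lambda>s. c * f s) has_real_derivative h') (at s within S_int)"
    have "((\<lambda>s. c * f s / c) has_real_derivative h' / c) (at s within S_int)"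
      by (rule DERIV_cdivide[OF h'])
    then have "(f has_real_derivative h' / c) (at s within S_int)" using False by simp
    then have "h' / c = 0" using assms s unfolding admissible_def by blast
    then show "h' = 0" using False by simp
  qed
qed

text \<open>For \<beta> = 0 the row, divided by \<open>m\<close>, is 0 off the multiples of
  \<open>m\<close>, at most 1 in absolute value on them, and of absolute value 1 at k = m. The ratio
  1/8 bounds the sum of 1/q^4 over q \<ge> 2.\<close>

lemma balanced_rows:
  fixes b :: "nat \<Rightarrow> real"
  assumes N: "\<And>k. real k ^ 4 * \<bar>b k\<bar> \<le> N" and low: "\<And>k. k \<le> K \<Longrightarrow> b k = 0"
    and row: "\<And>m. m > K \<Longrightarrow> (\<lambda>k. b k * ker m (2 * real k * (pi/2 / real m))) sums 0"
  shows "b k = 0"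
proof (rule weighted_diagonal_dominance[where \<theta> = "1/8" and K = K and N = N and b = b, OF N low])
  fix m assume m: "m > K"
  then have mp: "m > 0" by simp
  define R where "R = (\<lambda>k. ker m (2 * real k * (pi/2 / real m)) / real m)"
  have e: "2 * real k * (pi/2 / real m) = real k * pi / real m" for k by simp
  have R1: "\<bar>R k\<bar> \<le> 1" for k
    using abs_ker_le[of m "2 * real k * (pi/2 / real m)"] mp by (simp add: R_def divide_le_eq)
  have R0: "R k = 0" if nd: "\<not> m dvd k" for k
  proof -
    obtain r where r: "r \<ge> 1" "1.5 * r / real m \<le> \<bar>sin (real k * pi / real m)\<bar>"
      using sin_away_from_resonance[OF mp nd] by auto
    have "0 < 1.5 * r / real m" using r mp by (intro divide_pos_pos) auto
    then have "sin (real k * pi / real m) \<noteq> 0" using r by auto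
    moreover have "sin (real k * pi / real m) * ker m (real k * pi / real m) = 0"
      unfolding sin_mult_ker using mp by (simp add: sin_npi)
    ultimately show ?thesis unfolding R_def e by simp
  qed
  have Rm: "\<bar>R m\<bar> = 1"
  proof -
    have "cos ((2 * real j + 1 - real m) * pi) = (-1) ^ (m + 1)" for j
    proof -
      have "(2 * real j + 1 - real m) * pi = real (2 * j + 1) * pi - real m * pi" by (simp add: algebra_simps)
      then show ?thesis by (simp only: cos_diff cos_npi sin_npi) simp
    qed
    then have "ker m pi = real m * (-1) ^ (m + 1)" by (simp add: ker_def)
    then have "\<bar>ker m pi\<bar> = real m" by (simp add: abs_mult power_abs)
    then show ?thesis using mp unfolding R_def e by simp
  qed
  define g where "g = (\<lambda>k. if m dvd k \<and> 2 * m \<le> k then 1 / real k ^ 4 else 0)"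
  show "\<exists>R g. 1 \<le> \<bar>R m\<bar> \<and> (\<lambda>k. b k * R k) sums 0 \<and>
      (\<forall>k. 0 \<le> g k) \<and> (\<forall>k>K. k \<noteq> m \<longrightarrow> \<bar>R k\<bar> \<le> real k ^ 4 * g k) \<and> (\<forall>n. (\<Sum>k<n. g k) \<le> 1/8 / real m ^ 4)"
  proof (rule exI[of _ R], rule exI[of _ g], intro conjI allI impI)
    show "1 \<le> \<bar>R m\<bar>" using Rm by simp
    have "(\<lambda>k. b k * ker m (2 * real k * (pi/2 / real m)) / real m) sums (0 / real m)"
      by (rule sums_divide[OF row[OF m]])
    then show "(\<lambda>k. b k * R k) sums 0" by (simp add: R_def)
    show "0 \<le> g k" for k by (simp add: g_def)
    show "\<bar>R k\<bar> \<le> real k ^ 4 * g k" if k: "k > K" "k \<noteq> m" for k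
    proof (cases "m dvd k")
      case True
      then obtain q where q: "k = m * q" by blast
      with k have "q \<ge> 2" by (cases q rule: nat.exhaust) (auto simp: not_less_eq_eq numeral_2_eq_2 Suc_le_eq)
      then have "2 * m \<le> k" using q by simp
      then have "real k ^ 4 * g k = 1" using True k by (simp add: g_def)
      then show ?thesis using R1 by simp
    qed (simp add: R0 g_def)
    show "(\<Sum>k<n. g k) \<le> 1/8 / real m ^ 4" for n
      using sum_over_multiples[OF mp, of n] by (simp add: g_def)
  qed
qed auto

text \<open>Balanced orbits determine the sum of the two functions, tilted orbits then the first of
  them. One threshold, depending on \<open>a\<close> alone, serves both systems.\<close>

lemma admissible_pair_determined_by_low_modes:
  fixes a :: real
  assumes a: "a > 0"
  shows "\<exists>K. \<forall>h\<^sub>1 h\<^sub>2. admissible h\<^sub>1 \<longrightarrow> admissible h\<^sub>2 \<longrightarrow> (\<forall>m\<^sub>1\<ge>2. \<forall>m\<^sub>2\<ge>2. \<forall>\<beta>. orbit_condition a h\<^sub>1 h\<^sub>2 m\<^sub>1 m\<^sub>2 \<beta>) \<longrightarrow>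
     (\<forall>k\<le>K. fcos h\<^sub>1 k = 0 \<and> fcos h\<^sub>2 k = 0) \<longrightarrow> (\<forall>s\<in>S_int. h\<^sub>1 s = 0 \<and> h\<^sub>2 s = 0)"
proof -
  obtain K where K0: "K > 0" and K: "\<And>m. m > K \<Longrightarrow> \<exists>\<beta> g. 0 \<le> \<beta> \<and> \<beta> < pi/2 \<and>
      a * sin \<beta> = cos ((pi/2 + \<beta>) / real (2 * m)) - cos ((pi/2 - \<beta>) / m) \<and> \<beta> < (pi/2 + \<beta>) / real (2 * m) \<and>
      1 \<le> \<bar>row_entry m \<beta> m + 2 * \<beta> * (-1) ^ m\<bar> \<and> (\<forall>k. 0 \<le> g k) \<and>
      (\<forall>k>K. k \<noteq> m \<longrightarrow> \<bar>row_entry m \<beta> k + 2 * \<beta> * (-1) ^ k\<bar> \<le> real k ^ 4 * g k) \<and>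
      (\<forall>n. (\<Sum>k<n. g k) \<le> (4/5) / real m ^ 4)"
    using exists_dominant_rows[OF a] by blast
  show ?thesis
  proof (intro exI[of _ K] allI impI)
    fix h1 h2 assume h: "admissible h1" "admissible h2"
      and cond: "\<forall>m\<^sub>1\<ge>2. \<forall>m\<^sub>2\<ge>2. \<forall>\<beta>. orbit_condition a h1 h2 m\<^sub>1 m\<^sub>2 \<beta>"
      and low: "\<forall>k\<le>K. fcos h1 k = 0 \<and> fcos h2 k = 0"
    define f where "f = (\<lambda>s. h1 s + h2 s)"
    have f: "admissible f" unfolding f_def by (rule admissible_add[OF h])
    have "fcos f k = 0" for k
    proof -
      obtain N where "\<And>k. real k ^ 4 * \<bar>fcos f k\<bar> \<le> N" using admissible_decay[OF f] by blast
      then show ?thesis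
      proof (rule balanced_rows)
        show "fcos f k = 0" if "k \<le> K" for k
          using low that admissible_continuous[OF h(1)] admissible_continuous[OF h(2)] by (simp add: f_def fcos_add)
        fix m assume m: "m > K"
        define \<alpha> where "\<alpha> = pi/2 / real m"
        have al: "0 < \<alpha>" "\<alpha> \<le> pi/2" "real m * \<alpha> = pi/2" using m by (auto simp: \<alpha>_def field_simps)
        have "sin \<alpha> > 0" using al by (intro sin_gt_zero) (auto intro: le_less_trans)
        \<comment> \<open>With \<beta> = 0 and equal numbers both arcs carry the same nodes and the
          same weight, so only the sum h1 + h2 is seen.\<close>
        have "orbit_condition a h1 h2 m m 0" using cond m K0 by simp
        then have "sin \<alpha> * (\<Sum>j<m. h1 ((2 * real j + 1 - real m) * \<alpha>)) + sin \<alpha> * (\<Sum>j<m. h2 ((2 * real j + 1 - real m) * \<alpha>)) = 0"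
          using al unfolding orbit_condition_def by (simp add: \<alpha>_def)
        then have "sin \<alpha> * (\<Sum>j<m. f ((2 * real j + 1 - real m) * \<alpha>)) = 0"
          by (simp add: f_def sum.distrib distrib_left)
        then have "(\<Sum>j<m. f ((2 * real j + 1 - real m) * \<alpha>)) = 0" using \<open>sin \<alpha> > 0\<close> by simp
        moreover have "(\<lambda>k. fcos f k * ker m (2 * real k * \<alpha>)) sums (\<Sum>j<m. f ((2 * real j + 1 - real m) * \<alpha>))"
          using m al by (intro admissible_orbit_sum[OF f]) (auto simp: left_diff_distrib)
        ultimately show "(\<lambda>k. fcos f k * ker m (2 * real k * (pi/2 / real m))) sums 0" by (simp add: \<alpha>_def)
      qed
    qed
    then have "f s = 0" if "s \<in> S_int" for s using admissible_zero[OF f] that by blast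
    then have h21: "h2 s = - h1 s" if "s \<in> S_int" for s using that by (simp add: f_def eq_neg_iff_add_eq_0 add.commute)
    have "fcos h1 k = 0" for k
    proof -
      obtain N where "\<And>k. real k ^ 4 * \<bar>fcos h1 k\<bar> \<le> N" using admissible_decay[OF h(1)] by blast
      then show ?thesis
      proof (rule weighted_diagonal_dominance[where \<theta> = "4/5" and K = K])
        show "fcos h1 k = 0" if "k \<le> K" for k using low that by simp
        fix m assume m: "m > K"
        obtain \<beta> g where b: "0 \<le> \<beta>" "\<beta> < pi/2"
          "a * sin \<beta> = cos ((pi/2 + \<beta>) / real (2 * m)) - cos ((pi/2 - \<beta>) / m)" "\<beta> < (pi/2 + \<beta>) / real (2 * m)"
          and g: "1 \<le> \<bar>row_entry m \<beta> m + 2 * \<beta> * (-1) ^ m\<bar> \<and> (\<forall>k. 0 \<le> g k) \<and>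
            (\<forall>k>K. k \<noteq> m \<longrightarrow> \<bar>row_entry m \<beta> k + 2 * \<beta> * (-1) ^ k\<bar> \<le> real k ^ 4 * g k) \<and>
            (\<forall>n. (\<Sum>k<n. g k) \<le> (4/5) / real m ^ 4)"
          using K[OF m] by blast
        define \<alpha>\<^sub>1 \<alpha>\<^sub>2 where "\<alpha>\<^sub>1 = (pi/2 - \<beta>) / real m" and "\<alpha>\<^sub>2 = (pi/2 + \<beta>) / real (2 * m)"
        have mp: "m > 0" using m by simp
        have al: "0 < \<alpha>\<^sub>1" "0 < \<alpha>\<^sub>2" using b mp by (auto simp: \<alpha>\<^sub>1_def \<alpha>\<^sub>2_def)
        have mal: "real m * \<alpha>\<^sub>1 = pi/2 - \<beta>" "real (2 * m) * \<alpha>\<^sub>2 = pi/2 + \<beta>"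
          using mp by (auto simp: \<alpha>\<^sub>1_def \<alpha>\<^sub>2_def)
        have le: "(real m - 1) * \<alpha>\<^sub>1 \<le> pi/2" "(real (2 * m) - 1) * \<alpha>\<^sub>2 \<le> pi/2"
          using mal al b(1,2) b(4)[folded \<alpha>\<^sub>2_def] unfolding left_diff_distrib by linarith+
        have s1: "(\<lambda>k. fcos h1 k * ker m (2 * real k * \<alpha>\<^sub>1)) sums (\<Sum>j<m. h1 ((2 * real j + 1 - real m) * \<alpha>\<^sub>1))"
          using mp al le by (intro admissible_orbit_sum[OF h(1)]) auto
        have s2: "(\<lambda>k. fcos h1 k * ker (2 * m) (2 * real k * \<alpha>\<^sub>2)) sums (\<Sum>j<2*m. h1 ((2 * real j + 1 - real (2 * m)) * \<alpha>\<^sub>2))"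
          using mp al le by (intro admissible_orbit_sum[OF h(1)]) auto
        have neg: "(\<Sum>j<2*m. h2 ((2 * real j + 1 - real (2 * m)) * \<alpha>\<^sub>2)) = - (\<Sum>j<2*m. h1 ((2 * real j + 1 - real (2 * m)) * \<alpha>\<^sub>2))"
        proof -
          have "(2 * real j + 1 - real (2 * m)) * \<alpha>\<^sub>2 \<in> S_int" if "j < 2 * m" for j
          proof -
            have "\<bar>2 * real j + 1 - real (2 * m)\<bar> \<le> real (2 * m) - 1" using that by linarith
            then have "\<bar>2 * real j + 1 - real (2 * m)\<bar> * \<alpha>\<^sub>2 \<le> (real (2 * m) - 1) * \<alpha>\<^sub>2" using al by (intro mult_right_mono) auto
            moreover have "\<bar>(2 * real j + 1 - real (2 * m)) * \<alpha>\<^sub>2\<bar> = \<bar>2 * real j + 1 - real (2 * m)\<bar> * \<alpha>\<^sub>2"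
              using al by (simp add: abs_mult)
            ultimately show ?thesis using le unfolding S_int_mem by linarith
          qed
          then show ?thesis unfolding sum_negf[symmetric] by (intro sum.cong h21) auto
        qed
        have "orbit_condition a h1 h2 m (2 * m) \<beta>" using cond m K0 by simp
        then have "sin \<alpha>\<^sub>1 * (\<Sum>j<m. h1 ((2 * real j + 1 - real m) * \<alpha>\<^sub>1)) + sin \<alpha>\<^sub>2 * (\<Sum>j<2*m. h2 ((2 * real j + 1 - real (2 * m)) * \<alpha>\<^sub>2)) = 0"
          using b unfolding orbit_condition_def \<alpha>\<^sub>1_def \<alpha>\<^sub>2_def by blast
        \<comment> \<open>The boundary series will be added with the factor 2 \<beta>; its value 0
          is already written into the sum.\<close>
        then have e0: "sin \<alpha>\<^sub>1 * (\<Sum>j<m. h1 ((2 * real j + 1 - real m) * \<alpha>\<^sub>1)) - sin \<alpha>\<^sub>2 * (\<Sum>j<2*m. h1 ((2 * real j + 1 - real (2 * m)) * \<alpha>\<^sub>2)) + 2 * \<beta> * 0 = 0"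
          unfolding neg by simp
        have "(\<lambda>k. sin \<alpha>\<^sub>1 * (fcos h1 k * ker m (2 * real k * \<alpha>\<^sub>1)) - sin \<alpha>\<^sub>2 * (fcos h1 k * ker (2 * m) (2 * real k * \<alpha>\<^sub>2))
            + 2 * \<beta> * (fcos h1 k * (-1) ^ k)) sums (sin \<alpha>\<^sub>1 * (\<Sum>j<m. h1 ((2 * real j + 1 - real m) * \<alpha>\<^sub>1)) - sin \<alpha>\<^sub>2 * (\<Sum>j<2*m. h1 ((2 * real j + 1 - real (2 * m)) * \<alpha>\<^sub>2)) + 2 * \<beta> * 0)"
          by (intro sums_add sums_diff sums_mult s1 s2 admissible_boundary_series[OF h(1)])
        then have "(\<lambda>k. sin \<alpha>\<^sub>1 * (fcos h1 k * ker m (2 * real k * \<alpha>\<^sub>1)) - sin \<alpha>\<^sub>2 * (fcos h1 k * ker (2 * m) (2 * real k * \<alpha>\<^sub>2))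
            + 2 * \<beta> * (fcos h1 k * (-1) ^ k)) sums 0" unfolding e0 .
        then have sm: "(\<lambda>k. fcos h1 k * (row_entry m \<beta> k + 2 * \<beta> * (-1) ^ k)) sums 0"
          by (simp add: row_entry_def \<alpha>\<^sub>1_def \<alpha>\<^sub>2_def algebra_simps)
        show "\<exists>R g. 1 \<le> \<bar>R m\<bar> \<and> (\<lambda>k. fcos h1 k * R k) sums 0 \<and> (\<forall>k. 0 \<le> g k) \<and>
          (\<forall>k>K. k \<noteq> m \<longrightarrow> \<bar>R k\<bar> \<le> real k ^ 4 * g k) \<and> (\<forall>n. (\<Sum>k<n. g k) \<le> 4 / 5 / real m ^ 4)"
          by (rule exI[of _ "\<lambda>k. row_entry m \<beta> k + 2 * \<beta> * (-1) ^ k"], rule exI[of _ g], use sm g in blast)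
      qed auto
    qed
    then have "h1 s = 0" if "s \<in> S_int" for s using admissible_zero[OF h(1)] that by blast
    then show "\<forall>s\<in>S_int. h1 s = 0 \<and> h2 s = 0" using h21 by auto
  qed
qed


section \<open>Curves of class \<open>C\<^sup>r\<close>\<close>

lemma nderiv_0 [simp]: "nderiv 0 S f = f"
  by (simp add: nderiv_def)

lemma nderiv_Suc: "nderiv (Suc k) S f = (\<lambda>s. vector_derivative (nderiv k S f) (at s within S))"
  by (simp add: nderiv_def)

lemma nderiv_Suc_shift: "nderiv (Suc k) S f = nderiv k S (nderiv 1 S f)"
  by (simp add: nderiv_def funpow_Suc_right del: funpow.simps)

lemma vector_derivative_S_int:
  assumes "(f has_vector_derivative f') (at s within S_int)" "s \<in> S_int"
  shows "vector_derivative f (at s within S_int) = f'"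
  using assms vector_derivative_within_cbox[of "-(pi/2)" "pi/2" s f f'] by (simp add: S_int_eq)

text \<open>The difference quotient is the form in which \<open>C1_into_Cr\<close> speaks of
  derivatives in \<tau>.\<close>

lemma has_vector_derivative_iff_quotient:
  "(f has_vector_derivative f') (at t within S) \<longleftrightarrow> ((\<lambda>\<tau>. (f \<tau> - f t) /\<^sub>R (\<tau> - t)) \<longlongrightarrow> f') (at t within S)"
proof -
  have e: "norm ((f \<tau> - f t - (\<tau> - t) *\<^sub>R f') /\<^sub>R norm (\<tau> - t)) = norm ((f \<tau> - f t) /\<^sub>R (\<tau> - t) - f')" if "\<tau> \<noteq> t" for \<tau>
  proof -
    have "(f \<tau> - f t) /\<^sub>R (\<tau> - t) - f' = (f \<tau> - f t - (\<tau> - t) *\<^sub>R f') /\<^sub>R (\<tau> - t)"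
      using that by (simp add: scaleR_diff_right)
    then show ?thesis by simp
  qed
  have "(f has_vector_derivative f') (at t within S) \<longleftrightarrow>
      ((\<lambda>\<tau>. norm ((f \<tau> - f t - (\<tau> - t) *\<^sub>R f') /\<^sub>R norm (\<tau> - t))) \<longlongrightarrow> 0) (at t within S)"
    unfolding has_vector_derivative_def has_derivative_within tendsto_norm_zero_iff
    by (simp add: bounded_linear_scaleR_left inverse_eq_divide diff_diff_eq)
  also have "\<dots> \<longleftrightarrow> ((\<lambda>\<tau>. norm ((f \<tau> - f t) /\<^sub>R (\<tau> - t) - f')) \<longlongrightarrow> 0) (at t within S)"
    by (rule filterlim_cong) (use e in \<open>auto simp: eventually_at_filter\<close>)
  also have "\<dots> \<longleftrightarrow> ((\<lambda>\<tau>. (f \<tau> - f t) /\<^sub>R (\<tau> - t)) \<longlongrightarrow> f') (at t within S)"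
    unfolding tendsto_norm_zero_iff LIM_zero_iff ..
  finally show ?thesis .
qed

lemma Cr_on_derivative:
  assumes "Cr_on r S f" "k < r" "s \<in> S"
  shows "(nderiv k S f has_vector_derivative nderiv (Suc k) S f s) (at s within S)"
  using assms by (simp add: Cr_on_def)

lemma Cr_on_continuous:
  assumes "Cr_on r S f" "k \<le> r"
  shows "continuous_on S (nderiv k S f)"
proof (cases "k = r")
  case True then show ?thesis using assms by (simp add: Cr_on_def)
next
  case False
  then have "k < r" using assms by simp
  then show ?thesis using Cr_on_derivative[OF assms(1)]
    unfolding continuous_on_eq_continuous_within by (blast intro: has_vector_derivative_continuous)
qed

lemma Cr_on_shift: "Cr_on (Suc r) S f \<Longrightarrow> Cr_on r S (nderiv 1 S f)"
  by (auto simp: Cr_on_def nderiv_Suc_shift[symmetric] simp del: One_nat_def)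

lemma Cr_on_linear_combination:
  assumes "Cr_on r S_int f" "Cr_on r S_int g"
  shows "k \<le> r \<Longrightarrow> s \<in> S_int \<Longrightarrow> nderiv k S_int (\<lambda>s. c *\<^sub>R f s + d *\<^sub>R g s) s = c *\<^sub>R nderiv k S_int f s + d *\<^sub>R nderiv k S_int g s"
    and "Cr_on r S_int (\<lambda>s. c *\<^sub>R f s + d *\<^sub>R g s)"
proof -
  define h where "h = (\<lambda>s. c *\<^sub>R f s + d *\<^sub>R g s)"
  have main: "\<forall>s\<in>S_int. nderiv k S_int h s = c *\<^sub>R nderiv k S_int f s + d *\<^sub>R nderiv k S_int g s" if "k \<le> r" for k
    using that
  proof (induction k)
    case 0 then show ?case by (simp add: h_def)
  next
    case (Suc k)
    have "(nderiv k S_int h has_vector_derivative c *\<^sub>R nderiv (Suc k) S_int f s + d *\<^sub>R nderiv (Suc k) S_int g s) (at s within S_int)"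
      if s: "s \<in> S_int" for s
    proof (rule has_vector_derivative_transform[OF s])
      show "((\<lambda>s. c *\<^sub>R nderiv k S_int f s + d *\<^sub>R nderiv k S_int g s) has_vector_derivative
          c *\<^sub>R nderiv (Suc k) S_int f s + d *\<^sub>R nderiv (Suc k) S_int g s) (at s within S_int)"
        using Suc.prems s assms
        by (intro has_vector_derivative_add bounded_linear.has_vector_derivative[OF bounded_linear_scaleR_right] Cr_on_derivative) auto
    qed (use Suc in auto)
    then show ?case using vector_derivative_S_int by (auto simp: nderiv_Suc[of k S_int h])
  qed
  then show "nderiv k S_int (\<lambda>s. c *\<^sub>R f s + d *\<^sub>R g s) s = c *\<^sub>R nderiv k S_int f s + d *\<^sub>R nderiv k S_int g s"
    if "k \<le> r" "s \<in> S_int" for k s using that by (simp add: h_def)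
  have "Cr_on r S_int h"
    unfolding Cr_on_def
  proof (intro conjI allI impI ballI)
    fix k s assume k: "k < r" and s: "s \<in> S_int"
    show "(nderiv k S_int h has_vector_derivative nderiv (Suc k) S_int h s) (at s within S_int)"
    proof (rule has_vector_derivative_transform[OF s])
      show "((\<lambda>s. c *\<^sub>R nderiv k S_int f s + d *\<^sub>R nderiv k S_int g s) has_vector_derivative nderiv (Suc k) S_int h s) (at s within S_int)"
        using main[of "Suc k"] k s assms
        by (auto intro!: has_vector_derivative_add bounded_linear.has_vector_derivative[OF bounded_linear_scaleR_right] Cr_on_derivative)
    qed (use main[of k] k in auto)
  next
    have "continuous_on S_int (\<lambda>s. c *\<^sub>R nderiv r S_int f s + d *\<^sub>R nderiv r S_int g s)"
      by (intro continuous_intros Cr_on_continuous[OF assms(1)] Cr_on_continuous[OF assms(2)]) auto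
    then show "continuous_on S_int (nderiv r S_int h)" using main[of r] by (simp cong: continuous_on_cong)
  qed
  then show "Cr_on r S_int (\<lambda>s. c *\<^sub>R f s + d *\<^sub>R g s)" by (simp add: h_def)
qed

lemma norm_nderiv_le_Cr_norm:
  assumes "Cr_on r S_int f" "k \<le> r" "s \<in> S_int"
  shows "norm (nderiv k S_int f s) \<le> Cr_norm r S_int f"
proof -
  have bdd: "bdd_above ((\<lambda>s. norm (nderiv j S_int f s)) ` S_int)" if "j \<le> r" for j
  proof -
    have "compact ((\<lambda>s. norm (nderiv j S_int f s)) ` S_int)"
      using Cr_on_continuous[OF assms(1) that] by (intro compact_continuous_image continuous_intros) (auto simp: S_int_eq)
    then show ?thesis by (simp add: bounded_imp_bdd_above compact_imp_bounded)
  qed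
  have le: "norm (nderiv j S_int f s) \<le> (SUP s\<in>S_int. norm (nderiv j S_int f s))" if "j \<le> r" for j
    by (rule cSUP_upper[OF assms(3) bdd[OF that]])
  have "norm (nderiv k S_int f s) \<le> (SUP s\<in>S_int. norm (nderiv k S_int f s))" by (rule le[OF assms(2)])
  also have "\<dots> \<le> Cr_norm r S_int f"
    unfolding Cr_norm_def using le assms(2)
    by (intro member_le_sum) (auto intro: order_trans[OF norm_ge_zero])
  finally show ?thesis .
qed

text \<open>The C^r norm dominates each derivative up to order r at each point. Hence
  differentiation in \<tau> commutes with these derivatives in s, and the curves depend on \<tau>
  continuously, uniformly in s.\<close>

lemma C1_into_Cr_derivative:
  assumes "C1_into_Cr r {-1..1} S_int \<gamma>"
  obtains \<gamma>' where "\<And>t. t \<in> {-1..1} \<Longrightarrow> Cr_on r S_int (\<gamma>' t)"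
    "\<And>t k s. t \<in> {-1..1} \<Longrightarrow> k \<le> r \<Longrightarrow> s \<in> S_int \<Longrightarrow>
      ((\<lambda>\<tau>. nderiv k S_int (\<gamma> \<tau>) s) has_vector_derivative nderiv k S_int (\<gamma>' t) s) (at t within {-1..1})"
    "\<And>t \<epsilon>. t \<in> {-1..1} \<Longrightarrow> \<epsilon> > 0 \<Longrightarrow> \<exists>\<delta>>0. \<forall>\<tau>\<in>{-1..1}. \<bar>\<tau> - t\<bar> < \<delta> \<longrightarrow> (\<forall>s\<in>S_int. dist (\<gamma> \<tau> s) (\<gamma> t s) \<le> \<epsilon>)"
proof -
  define T where "T = {-1..1::real}"
  obtain \<gamma>' where C: "\<And>\<tau>. \<tau> \<in> T \<Longrightarrow> Cr_on r S_int (\<gamma> \<tau>)" "\<And>t. t \<in> T \<Longrightarrow> Cr_on r S_int (\<gamma>' t)"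
    and lim: "\<And>t. t \<in> T \<Longrightarrow> ((\<lambda>\<tau>. Cr_norm r S_int (\<lambda>s. (\<gamma> \<tau> s - \<gamma> t s) /\<^sub>R (\<tau> - t) - \<gamma>' t s)) \<longlongrightarrow> 0) (at t within T)"
    using assms unfolding C1_into_Cr_def T_def by blast
  define Q where "Q = (\<lambda>t \<tau> s. (\<gamma> \<tau> s - \<gamma> t s) /\<^sub>R (\<tau> - t) - \<gamma>' t s)"
  have bound: "norm ((nderiv k S_int (\<gamma> \<tau>) s - nderiv k S_int (\<gamma> t) s) /\<^sub>R (\<tau> - t) - nderiv k S_int (\<gamma>' t) s) \<le> Cr_norm r S_int (Q t \<tau>)"
    if "t \<in> T" "\<tau> \<in> T" "k \<le> r" "s \<in> S_int" for t \<tau> k s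
  proof -
    define D where "D = (\<lambda>s. 1 *\<^sub>R \<gamma> \<tau> s + (-1) *\<^sub>R \<gamma> t s)"
    have D: "Cr_on r S_int D" "nderiv k S_int D s = nderiv k S_int (\<gamma> \<tau>) s - nderiv k S_int (\<gamma> t) s"
      unfolding D_def using Cr_on_linear_combination(1)[OF C(1)[OF that(2)] C(1)[OF that(1)], of k s 1 "-1"]
        Cr_on_linear_combination(2)[OF C(1)[OF that(2)] C(1)[OF that(1)], of 1 "-1"] that by auto
    have Qeq: "Q t \<tau> = (\<lambda>s. inverse (\<tau> - t) *\<^sub>R D s + (-1) *\<^sub>R \<gamma>' t s)" by (simp add: Q_def D_def)
    have "Cr_on r S_int (Q t \<tau>)" unfolding Qeq by (rule Cr_on_linear_combination(2)[OF D(1) C(2)[OF that(1)]])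
    moreover have "nderiv k S_int (Q t \<tau>) s = (nderiv k S_int (\<gamma> \<tau>) s - nderiv k S_int (\<gamma> t) s) /\<^sub>R (\<tau> - t) - nderiv k S_int (\<gamma>' t) s"
      unfolding Qeq using Cr_on_linear_combination(1)[OF D(1) C(2)[OF that(1)] that(3,4), of "inverse (\<tau> - t)" "-1"] D(2) by simp
    ultimately show ?thesis using norm_nderiv_le_Cr_norm[of r "Q t \<tau>" k s] that by simp
  qed
  have lim': "((\<lambda>\<tau>. Cr_norm r S_int (Q t \<tau>)) \<longlongrightarrow> 0) (at t within T)" if "t \<in> T" for t
    using lim[OF that] by (simp add: Q_def)
  show ?thesis
  proof (rule that[of \<gamma>'])
    show "Cr_on r S_int (\<gamma>' t)" if "t \<in> {-1..1}" for t using C(2) that by (simp add: T_def)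
    show "((\<lambda>\<tau>. nderiv k S_int (\<gamma> \<tau>) s) has_vector_derivative nderiv k S_int (\<gamma>' t) s) (at t within {-1..1})"
      if t: "t \<in> {-1..1}" and k: "k \<le> r" and s: "s \<in> S_int" for t k s
    proof -
      have tT: "t \<in> T" using t by (simp add: T_def)
      have "((\<lambda>\<tau>. (nderiv k S_int (\<gamma> \<tau>) s - nderiv k S_int (\<gamma> t) s) /\<^sub>R (\<tau> - t) - nderiv k S_int (\<gamma>' t) s) \<longlongrightarrow> 0) (at t within T)"
      proof (rule Lim_null_comparison[OF _ lim'[OF tT]])
        show "\<forall>\<^sub>F \<tau> in at t within T. norm ((nderiv k S_int (\<gamma> \<tau>) s - nderiv k S_int (\<gamma> t) s) /\<^sub>R (\<tau> - t) - nderiv k S_int (\<gamma>' t) s) \<le> Cr_norm r S_int (Q t \<tau>)"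
          using bound[OF tT _ k s] by (auto simp: eventually_at_filter)
      qed
      then have "((\<lambda>\<tau>. (nderiv k S_int (\<gamma> \<tau>) s - nderiv k S_int (\<gamma> t) s) /\<^sub>R (\<tau> - t)) \<longlongrightarrow> nderiv k S_int (\<gamma>' t) s) (at t within T)"
        by (rule LIM_zero_cancel)
      then show ?thesis
        unfolding has_vector_derivative_iff_quotient T_def .
    qed
    show "\<exists>\<delta>>0. \<forall>\<tau>\<in>{-1..1}. \<bar>\<tau> - t\<bar> < \<delta> \<longrightarrow> (\<forall>s\<in>S_int. dist (\<gamma> \<tau> s) (\<gamma> t s) \<le> \<epsilon>)"
      if t: "t \<in> {-1..1}" and e: "\<epsilon> > 0" for t \<epsilon>
    proof -
      have tT: "t \<in> T" using t by (simp add: T_def)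
      have "\<forall>\<^sub>F \<tau> in at t within T. Cr_norm r S_int (Q t \<tau>) < 1"
        using order_tendstoD(2)[OF lim'[OF tT], of 1] by simp
      then obtain d where d: "d > 0" "\<And>\<tau>. \<tau> \<in> T \<Longrightarrow> \<tau> \<noteq> t \<Longrightarrow> \<bar>\<tau> - t\<bar> < d \<Longrightarrow> Cr_norm r S_int (Q t \<tau>) < 1"
        unfolding eventually_at by (auto simp: dist_real_def)
      define B where "B = Cr_norm r S_int (\<gamma>' t)"
      have B: "norm (\<gamma>' t s) \<le> B" if "s \<in> S_int" for s
        using norm_nderiv_le_Cr_norm[OF C(2)[OF tT], of 0 s] that by (simp add: B_def)
      have "0 \<in> S_int" by (simp add: S_int_mem)
      then have Bp: "B \<ge> 0" using B[of 0] by (auto intro: order_trans[OF norm_ge_zero])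
      \<comment> \<open>Within distance d the difference quotient is less than 1 away from
        \<open>\<gamma>' t\<close>, so its norm is at most B + 1.\<close>
      show ?thesis
      proof (intro exI[of _ "min d (\<epsilon> / (B + 1))"] conjI ballI impI)
        show "min d (\<epsilon> / (B + 1)) > 0" using d(1) e Bp by simp
        fix \<tau> s assume tau: "\<tau> \<in> {-1..1}" "\<bar>\<tau> - t\<bar> < min d (\<epsilon> / (B + 1))" and s: "s \<in> S_int"
        show "dist (\<gamma> \<tau> s) (\<gamma> t s) \<le> \<epsilon>"
        proof (cases "\<tau> = t")
          case False
          define v where "v = (\<gamma> \<tau> s - \<gamma> t s) /\<^sub>R (\<tau> - t)"
          have "norm (v - \<gamma>' t s) \<le> Cr_norm r S_int (Q t \<tau>)"
            using bound[OF tT _ le0 s, of \<tau>] tau by (simp add: T_def v_def)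
          also have "\<dots> < 1" using d(2)[of \<tau>] tau False by (simp add: T_def)
          finally have "norm v \<le> B + 1" using B[OF s] norm_triangle_sub[of v "\<gamma>' t s"] by linarith
          moreover have "dist (\<gamma> \<tau> s) (\<gamma> t s) = \<bar>\<tau> - t\<bar> * norm v" using False by (simp add: v_def dist_norm)
          moreover have "\<bar>\<tau> - t\<bar> \<le> \<epsilon> / (B + 1)" using tau by simp
          ultimately have "dist (\<gamma> \<tau> s) (\<gamma> t s) \<le> (\<epsilon> / (B + 1)) * (B + 1)"
            using Bp e by (simp only:) (intro mult_mono; simp)
          then show ?thesis using Bp by simp
        qed (use e in simp)
      qed
    qed
  qed
qed

lemma Cr_on_diff_times_inner:
  fixes f :: "real \<Rightarrow> 'b::real_inner"
  assumes "Cr_on r S_int f"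
  shows "diff_times r (\<lambda>s. f s \<bullet> v)"
  using assms
proof (induction r arbitrary: f)
  case 0
  then have "continuous_on S_int f" by (simp add: Cr_on_def)
  then show ?case by (auto intro: continuous_intros)
next
  case (Suc r)
  have "diff_times r (\<lambda>s. nderiv 1 S_int f s \<bullet> v)" by (rule Suc.IH[OF Cr_on_shift[OF Suc.prems]])
  moreover have "((\<lambda>s. f s \<bullet> v) has_real_derivative nderiv 1 S_int f s \<bullet> v) (at s within S_int)" if "s \<in> S_int" for s
  proof -
    have "(f has_vector_derivative nderiv 1 S_int f s) (at s within S_int)"
      using Cr_on_derivative[OF Suc.prems _ that, of 0] by simp
    then show ?thesis unfolding has_real_derivative_iff_has_vector_derivative
      by (rule bounded_linear.has_vector_derivative[OF bounded_linear_inner_left])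
  qed
  ultimately show ?case unfolding diff_times.simps
    by (intro exI[of _ "\<lambda>s. nderiv 1 S_int f s \<bullet> v"] conjI ballI)
qed

section \<open>Constant-speed parametrizations\<close>

lemma constant_speed_paramD:
  assumes "constant_speed_param P Q \<Gamma> \<gamma>"
  shows "inj_on \<gamma> S_int" "\<gamma> ` S_int = \<Gamma>" "\<gamma> (-(pi/2)) = P" "\<gamma> (pi/2) = Q" "continuous_on S_int \<gamma>"
    "\<And>s. s \<in> S_int \<Longrightarrow> (\<gamma> has_vector_derivative nderiv 1 S_int \<gamma> s) (at s within S_int)"
    "\<exists>c. \<forall>s\<in>S_int. norm (nderiv 1 S_int \<gamma> s) = c"
proof -
  have C: "Cr_on 1 S_int \<gamma>" using assms by (simp add: constant_speed_param_def)
  show "continuous_on S_int \<gamma>" using Cr_on_continuous[OF C, of 0] by simp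
  show "(\<gamma> has_vector_derivative nderiv 1 S_int \<gamma> s) (at s within S_int)" if "s \<in> S_int" for s
    using Cr_on_derivative[OF C _ that, of 0] by simp
qed (use assms in \<open>simp_all add: constant_speed_param_def\<close>)

lemma nonzero_of_constant_speed:
  assumes "\<And>s. s \<in> S_int \<Longrightarrow> (\<eta> has_vector_derivative D s) (at s within S_int)"
    "\<And>s. s \<in> S_int \<Longrightarrow> norm (D s) = e" "\<eta> (-(pi/2)) \<noteq> \<eta> (pi/2)"
  shows "e \<noteq> 0"
proof
  assume "e = 0"
  then have "(\<eta> has_vector_derivative 0) (at s within S_int)" if "s \<in> S_int" for s
    using assms(1)[OF that] assms(2)[OF that] by simp
  moreover have "convex S_int" by (simp add: S_int_eq)
  ultimately obtain k where k: "\<And>s. s \<in> S_int \<Longrightarrow> \<eta> s = k"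
    using has_vector_derivative_zero_constant[of S_int \<eta>] by blast
  show False using k[of "pi/2"] k[of "-(pi/2)"] assms(3) by (simp add: S_int_eq)
qed

text \<open>The change of parameter \<phi> is strictly increasing. Comparing the norms of difference
  quotients shows that its derivative is the ratio of the two speeds, so \<phi> is affine and,
  fixing both ends, the identity. The parametrization is thereby determined by the arc as a
  set.\<close>

lemma constant_speed_param_unique:
  assumes 1: "constant_speed_param P Q \<Gamma> \<gamma>" and 2: "constant_speed_param P Q \<Gamma> \<delta>" and PQ: "P \<noteq> Q" and s: "s \<in> S_int"
  shows "\<gamma> s = \<delta> s"
proof -
  have S: "compact S_int" "pi/2 \<in> S_int" "-(pi/2) \<in> S_int" by (auto simp: S_int_eq)
  obtain c where cn: "\<forall>s\<in>S_int. norm (nderiv 1 S_int \<gamma> s) = c" using constant_speed_paramD(7)[OF 1] by blast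
  note c = constant_speed_paramD(1-6)[OF 1] bspec[OF cn]
  obtain d where dn: "\<forall>s\<in>S_int. norm (nderiv 1 S_int \<delta> s) = d" using constant_speed_paramD(7)[OF 2] by blast
  note d = constant_speed_paramD(1-6)[OF 2] bspec[OF dn]
  have d0: "d > 0" using nonzero_of_constant_speed[OF d(6,7)] PQ d(3,4) d(7)[OF S(2)] norm_ge_zero[of "nderiv 1 S_int \<delta> (pi/2)"] by (simp del: norm_ge_zero)
  define \<phi> where "\<phi> = (\<lambda>s. the_inv_into S_int \<delta> (\<gamma> s))"
  have phi: "\<phi> s \<in> S_int" "\<delta> (\<phi> s) = \<gamma> s" if "s \<in> S_int" for s
  proof -
    have "\<gamma> s \<in> \<delta> ` S_int" using that c(2) d(2) by blast
    then show "\<phi> s \<in> S_int" "\<delta> (\<phi> s) = \<gamma> s" unfolding \<phi>_def using the_inv_into_into[OF d(1) _ subset_refl] f_the_inv_into_f[OF d(1)] by auto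
  qed
  have "continuous_on \<Gamma> (the_inv_into S_int \<delta>)"
    using continuous_on_inv_into[OF d(5) S(1) d(1)] d(2) by simp
  then have phic: "continuous_on S_int \<phi>"
    unfolding \<phi>_def using c(5,2) by (intro continuous_on_compose2[of \<Gamma> "the_inv_into S_int \<delta>" S_int \<gamma>]) auto
  have inj: "inj_on \<phi> S_int"  proof (rule inj_onI)
    fix x y assume xy: "x \<in> S_int" "y \<in> S_int" "\<phi> x = \<phi> y"
    then have "\<gamma> x = \<gamma> y" using phi(2)[OF xy(1)] phi(2)[OF xy(2)] by simp
    then show "x = y" using inj_onD[OF c(1)] xy by blast
  qed
  have ends: "\<phi> (-(pi/2)) = -(pi/2)" "\<phi> (pi/2) = pi/2"
    using the_inv_into_f_f[OF d(1) S(2)] the_inv_into_f_f[OF d(1) S(3)] c(3,4) d(3,4) by (simp_all add: \<phi>_def)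
  have mono: "\<phi> s < \<phi> t" if st: "s \<in> S_int" "t \<in> S_int" "s < t" for s t
  proof -
    have "strict_mono_on S_int \<phi> \<or> strict_antimono_on S_int \<phi>"
      using injective_eq_monotone_map[of S_int \<phi>] phic inj by (simp add: S_int_eq)
    moreover have "\<not> strict_antimono_on S_int \<phi>"
    proof
      assume "strict_antimono_on S_int \<phi>"
      moreover have "-(pi/2) < pi/2" by simp
      ultimately have "\<phi> (pi/2) < \<phi> (-(pi/2))" using S(2,3) unfolding monotone_on_def by blast
      then show False using ends by simp
    qed
    ultimately show ?thesis using st by (auto simp: monotone_on_def)
  qed
  have deriv: "(\<phi> has_real_derivative c / d) (at s within S_int)" if s: "s \<in> S_int" for s
  proof -
    have g: "((\<lambda>t. norm ((\<gamma> t - \<gamma> s) /\<^sub>R (t - s))) \<longlongrightarrow> c) (at s within S_int)"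
      using tendsto_norm[OF c(6)[OF s, unfolded has_vector_derivative_iff_quotient]] c(7)[OF s] by simp
    have dl: "((\<lambda>x. norm ((\<delta> x - \<delta> (\<phi> s)) /\<^sub>R (x - \<phi> s))) \<longlongrightarrow> d) (at (\<phi> s) within S_int)"
      using tendsto_norm[OF d(6)[OF phi(1)[OF s], unfolded has_vector_derivative_iff_quotient]] d(7)[OF phi(1)[OF s]] by simp
    have "(\<phi> \<longlongrightarrow> \<phi> s) (at s within S_int)" using phic s by (simp add: continuous_on_def)
    then have "filterlim \<phi> (at (\<phi> s) within S_int) (at s within S_int)"
    proof -
      have "\<phi> x \<noteq> \<phi> s" if "x \<noteq> s" "x \<in> S_int" for x using inj_onD[OF inj _ that(2) s] that(1) by blast
      then show ?thesis using \<open>(\<phi> \<longlongrightarrow> \<phi> s) _\<close> phi(1)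
        by (simp add: filterlim_at eventually_at_filter)
    qed
    note dl' = filterlim_compose[OF dl this]
    have q: "((\<lambda>t. norm ((\<gamma> t - \<gamma> s) /\<^sub>R (t - s)) / norm ((\<delta> (\<phi> t) - \<delta> (\<phi> s)) /\<^sub>R (\<phi> t - \<phi> s))) \<longlongrightarrow> c / d) (at s within S_int)"
      by (rule tendsto_divide[OF g dl']) (use d0 in simp)
    \<comment> \<open>Both quotients have the same numerator, since \<delta> composed with \<phi> is
      \<gamma>; the ratio of their norms is the difference quotient of \<phi>, which is positive by
      monotonicity.\<close>
    have "norm ((\<gamma> t - \<gamma> s) /\<^sub>R (t - s)) / norm ((\<delta> (\<phi> t) - \<delta> (\<phi> s)) /\<^sub>R (\<phi> t - \<phi> s)) = (\<phi> t - \<phi> s) /\<^sub>R (t - s)"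
      if t: "t \<in> S_int" "t \<noteq> s" for t
    proof -
      have "\<gamma> t \<noteq> \<gamma> s" using t s inj_onD[OF c(1)] by blast
      then have n: "norm (\<gamma> t - \<gamma> s) > 0" by simp
      have "0 < (\<phi> t - \<phi> s) / (t - s)"
        using mono[OF s t(1)] mono[OF t(1) s] t(2) by (cases "s < t") (auto intro: divide_pos_pos divide_neg_neg)
      then have "(\<phi> t - \<phi> s) / (t - s) = \<bar>\<phi> t - \<phi> s\<bar> / \<bar>t - s\<bar>" by (metis abs_divide abs_of_pos)
      moreover have "norm ((\<gamma> t - \<gamma> s) /\<^sub>R (t - s)) / norm ((\<gamma> t - \<gamma> s) /\<^sub>R (\<phi> t - \<phi> s)) = \<bar>\<phi> t - \<phi> s\<bar> / \<bar>t - s\<bar>"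
      proof -
        define N where "N = norm (\<gamma> t - \<gamma> s)"
        have "\<phi> t \<noteq> \<phi> s" using \<open>0 < (\<phi> t - \<phi> s) / (t - s)\<close> by auto
        then have "(inverse \<bar>t - s\<bar> * N) / (inverse \<bar>\<phi> t - \<phi> s\<bar> * N) = \<bar>\<phi> t - \<phi> s\<bar> / \<bar>t - s\<bar>"
          using n t(2) unfolding N_def[symmetric] by (simp add: field_simps)
        then show ?thesis by (simp add: N_def)
      qed
      ultimately show ?thesis unfolding phi(2)[OF t(1)] phi(2)[OF s] real_scaleR_def by (simp add: divide_inverse_commute)
    qed
    then have "\<forall>\<^sub>F t in at s within S_int. norm ((\<gamma> t - \<gamma> s) /\<^sub>R (t - s)) / norm ((\<delta> (\<phi> t) - \<delta> (\<phi> s)) /\<^sub>R (\<phi> t - \<phi> s)) = (\<phi> t - \<phi> s) /\<^sub>R (t - s)"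
      unfolding eventually_at_filter by (intro always_eventually) blast
    then have "((\<lambda>t. (\<phi> t - \<phi> s) /\<^sub>R (t - s)) \<longlongrightarrow> c / d) (at s within S_int)"
      by (rule Lim_transform_eventually[OF q])
    then show ?thesis
      unfolding has_real_derivative_iff_has_vector_derivative has_vector_derivative_iff_quotient .
  qed
  have "((\<lambda>s. \<phi> s - (c/d) * s) has_real_derivative 0) (at s within S_int)" if "s \<in> S_int" for s
    using deriv[OF that] d0 by (auto intro!: derivative_eq_intros)
  then have "\<exists>k. \<forall>s\<in>S_int. \<phi> s - (c/d) * s = k"
    by (intro has_field_derivative_zero_constant) (auto simp: S_int_eq)
  then obtain k where k: "\<And>s. s \<in> S_int \<Longrightarrow> \<phi> s - (c/d) * s = k" by blast
  have e: "pi/2 - (c/d) * (pi/2) = k" "-(pi/2) - (c/d) * (-(pi/2)) = k"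
    using k[OF S(2)] k[OF S(3)] ends by auto
  then have k0: "k = 0" by simp
  then have "(c/d) * (pi/2) = 1 * (pi/2)" using e(1) by linarith
  then have cd: "c/d = 1" using pi_gt_zero by (simp only: mult_cancel_right) auto
  have "\<phi> s = s" using k[OF s] unfolding k0 cd by simp
  then show ?thesis using phi(2)[OF s] by simp
qed


section \<open>Arcs of domains in the class\<close>

definition mirror :: "point \<Rightarrow> point" where "mirror p = (fst p, - snd p)"

lemma mirror_simps [simp]: "mirror (mirror p) = p" "fst (mirror p) = fst p" "snd (mirror p) = - snd p"
  "norm (mirror p) = norm p"
  by (auto simp: mirror_def norm_prod_def)

lemma linear_mirror: "linear mirror"
  by (rule linearI) (auto simp: mirror_def)

lemma bounded_linear_mirror: "bounded_linear mirror"
  using linear_mirror by (rule linear_conv_bounded_linear[THEN iffD1])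

lemma frontier_mirror:
  assumes "open \<Omega>" "(\<lambda>(x, y). (x, - y)) ` \<Omega> = \<Omega>" "p \<in> frontier \<Omega>"
  shows "mirror p \<in> frontier \<Omega>"
proof -
  have m: "mirror ` \<Omega> = \<Omega>" using assms(2) by (simp add: mirror_def case_prod_beta)
  have "mirror p \<in> closure (mirror ` \<Omega>)"
    using closure_linear_image_subset[OF linear_mirror, of \<Omega>] assms(3) by (auto simp: frontier_def)
  moreover have "mirror p \<notin> \<Omega>"
  proof
    assume "mirror p \<in> \<Omega>"
    then have "mirror (mirror p) \<in> mirror ` \<Omega>" by blast
    then show False using m assms(1,3) by (simp add: frontier_def interior_open)
  qed
  ultimately show ?thesis using m assms(1) by (simp add: frontier_def interior_open)
qed

text \<open>\<open>M_class_arcs\<close> takes the two arcs as separate arguments; this describes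
  them by the domain alone, with one sign for both sides.\<close>

definition side_arc :: "real \<Rightarrow> real \<Rightarrow> point set \<Rightarrow> point set" where
  "side_arc \<sigma> a \<Omega> = {p \<in> frontier \<Omega>. \<sigma> * fst p \<ge> a/2}"

text \<open>Only the top end is recorded; the bottom end follows by reflection.\<close>

definition tangent_at_top :: "(real \<Rightarrow> point) \<Rightarrow> bool" where
  "tangent_at_top \<gamma> \<longleftrightarrow> snd (nderiv 1 S_int \<gamma> (pi/2)) = 0"

lemma uminus_S_int: "s \<in> S_int \<Longrightarrow> - s \<in> S_int" by (simp add: S_int_mem)

lemma constant_speed_param_mirror:
  assumes c: "constant_speed_param P Q \<Gamma> \<gamma>" and G: "mirror ` \<Gamma> = \<Gamma>" and PQ: "mirror P = Q" "mirror Q = P"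
  shows "constant_speed_param P Q \<Gamma> (\<lambda>s. mirror (\<gamma> (- s)))"
proof -
  note d = constant_speed_paramD[OF c]
  define f where "f = (\<lambda>s. mirror (\<gamma> (- s)))"
  have der: "(f has_vector_derivative mirror (- nderiv 1 S_int \<gamma> (- s))) (at s within S_int)" if s: "s \<in> S_int" for s
  proof -
    have "(uminus has_vector_derivative (-1)) (at s within S_int)"
      by (auto intro!: derivative_eq_intros)
    moreover have "uminus ` S_int = S_int" using uminus_S_int by force
    ultimately have "((\<gamma> \<circ> uminus) has_vector_derivative ((-1) *\<^sub>R nderiv 1 S_int \<gamma> (- s))) (at s within S_int)"
      using d(6)[OF uminus_S_int[OF s]] by (intro vector_diff_chain_within) auto
    then have "((\<lambda>s. \<gamma> (- s)) has_vector_derivative (- nderiv 1 S_int \<gamma> (- s))) (at s within S_int)" by (simp add: o_def)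
    then show ?thesis unfolding f_def by (rule bounded_linear.has_vector_derivative[OF bounded_linear_mirror])
  qed
  have nd: "nderiv 1 S_int f s = mirror (- nderiv 1 S_int \<gamma> (- s))" if "s \<in> S_int" for s
    using vector_derivative_S_int[OF der[OF that] that] by (simp add: nderiv_Suc)
  have "Cr_on 1 S_int \<gamma>" using c by (simp add: constant_speed_param_def)
  then have "continuous_on S_int (nderiv 1 S_int \<gamma>)" using Cr_on_continuous by blast
  then have "continuous_on S_int (\<lambda>s. mirror (- nderiv 1 S_int \<gamma> (- s)))"
    using uminus_S_int by (intro bounded_linear.continuous_on[OF bounded_linear_mirror] continuous_on_minus
        continuous_on_compose2[of S_int "nderiv 1 S_int \<gamma>" S_int uminus] continuous_on_id) auto
  then have "continuous_on S_int (nderiv 1 S_int f)" using nd by (simp cong: continuous_on_cong)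
  then have "Cr_on 1 S_int f" unfolding Cr_on_def using der nd by auto
  moreover have "inj_on f S_int"
  proof (rule inj_onI)
    fix x y assume xy: "x \<in> S_int" "y \<in> S_int" "f x = f y"
    then have "mirror (f x) = mirror (f y)" by simp
    then have "\<gamma> (- x) = \<gamma> (- y)" by (simp add: f_def)
    then show "x = y" using inj_onD[OF d(1)] uminus_S_int xy by (metis neg_equal_iff_equal)
  qed
  moreover have "f ` S_int = \<Gamma>"
  proof -
    have "f ` S_int = mirror ` \<gamma> ` uminus ` S_int" by (simp add: f_def image_image)
    also have "uminus ` S_int = S_int" using uminus_S_int by force
    finally show ?thesis using d(2) G by simp
  qed
  moreover have "f (-pi/2) = P" "f (pi/2) = Q" using d(3,4) PQ by (simp_all add: f_def)
  moreover obtain k where "\<forall>s\<in>S_int. norm (nderiv 1 S_int \<gamma> s) = k" using d(7) by blast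
  then have "\<forall>s\<in>S_int. norm (nderiv 1 S_int f s) = k" using nd uminus_S_int by simp
  ultimately show ?thesis unfolding constant_speed_param_def f_def[symmetric] by blast
qed

text \<open>Tangency is given for one parametrization and wanted for another, possibly traversed in
  the opposite direction. The link is a property of the point set: near \<open>P\<close> the height
  differs from that of \<open>P\<close> by at most \<epsilon> times the distance to
  \<open>P\<close>. Continuity of the inverse of \<open>g\<close> ensures that points near
  \<open>P\<close> have parameters near \<open>t0\<close>.\<close>

lemma flat_tangent_transfer:
  fixes g \<gamma> :: "real \<Rightarrow> point"
  assumes g: "continuous_on {0..1} g" "inj_on g {0..1}" "t0 \<in> {0..1}" "g t0 = P"
      "(g has_vector_derivative v) (at t0 within {0..1})" "v \<noteq> 0" "snd v = 0"
    and \<gamma>: "\<gamma> ` S_int \<subseteq> g ` {0..1}" "\<gamma> (pi/2) = P" "(\<gamma> has_vector_derivative u) (at (pi/2) within S_int)"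
  shows "snd u = 0"
proof -
  have S: "pi/2 \<in> S_int" by (simp add: S_int_eq)
  have flat: "\<exists>\<delta>>0. \<forall>t\<in>{0..1}. \<bar>t - t0\<bar> < \<delta> \<longrightarrow> \<bar>snd (g t - P)\<bar> \<le> \<epsilon> * norm (g t - P)" if e: "\<epsilon> > 0" for \<epsilon>
  proof -
    have q: "((\<lambda>t. (g t - g t0) /\<^sub>R (t - t0)) \<longlongrightarrow> v) (at t0 within {0..1})"
      using g(5) by (simp add: has_vector_derivative_iff_quotient)
    have "((\<lambda>t. \<bar>snd ((g t - g t0) /\<^sub>R (t - t0))\<bar> - \<epsilon> * norm ((g t - g t0) /\<^sub>R (t - t0))) \<longlongrightarrow> \<bar>snd v\<bar> - \<epsilon> * norm v) (at t0 within {0..1})"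
      by (intro tendsto_intros q)
    moreover have "\<bar>snd v\<bar> - \<epsilon> * norm v < 0" using g(6,7) e by simp
    ultimately have "\<forall>\<^sub>F t in at t0 within {0..1}. \<bar>snd ((g t - g t0) /\<^sub>R (t - t0))\<bar> - \<epsilon> * norm ((g t - g t0) /\<^sub>R (t - t0)) < 0"
      by (rule order_tendstoD(2))
    then obtain \<delta> where d: "\<delta> > 0" "\<And>t. t \<in> {0..1} \<Longrightarrow> t \<noteq> t0 \<Longrightarrow> \<bar>t - t0\<bar> < \<delta> \<Longrightarrow>
        \<bar>snd ((g t - g t0) /\<^sub>R (t - t0))\<bar> - \<epsilon> * norm ((g t - g t0) /\<^sub>R (t - t0)) < 0"
      unfolding eventually_at by (auto simp: dist_real_def)
    show ?thesis
    proof (intro exI[of _ \<delta>] conjI ballI impI d(1))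
      fix t assume t: "t \<in> {0..1}" "\<bar>t - t0\<bar> < \<delta>"
      show "\<bar>snd (g t - P)\<bar> \<le> \<epsilon> * norm (g t - P)"
      proof (cases "t = t0")
        case False
        have "inverse \<bar>t - t0\<bar> * \<bar>snd (g t - P)\<bar> < inverse \<bar>t - t0\<bar> * (\<epsilon> * norm (g t - P))"
          using d(2)[OF t(1) False t(2)]
          unfolding g(4) snd_scaleR norm_scaleR real_scaleR_def abs_mult abs_inverse
            mult.left_commute[of \<epsilon> "inverse \<bar>t - t0\<bar>"] by linarith
        then show ?thesis using False by (simp add: mult_less_cancel_left_pos)
      qed (use g(4) in simp)
    qed
  qed
  have "\<bar>snd u\<bar> \<le> \<epsilon> * norm u" if e: "\<epsilon> > 0" for \<epsilon>
  proof -
    obtain \<delta> where d: "\<delta> > 0" "\<And>t. t \<in> {0..1} \<Longrightarrow> \<bar>t - t0\<bar> < \<delta> \<Longrightarrow> \<bar>snd (g t - P)\<bar> \<le> \<epsilon> * norm (g t - P)"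
      using flat[OF e] by blast
    have inv: "continuous_on (g ` {0..1}) (the_inv_into {0..1} g)"
      using continuous_on_inv_into[OF g(1) _ g(2)] by simp
    have PG: "P \<in> g ` {0..1}" using g(3,4) by blast
    have iP: "the_inv_into {0..1} g P = t0" using the_inv_into_f_f[OF g(2,3)] g(4) by simp
    obtain \<eta> where eta: "\<eta> > 0" "\<And>q. q \<in> g ` {0..1} \<Longrightarrow> dist q P < \<eta> \<Longrightarrow> dist (the_inv_into {0..1} g q) t0 < \<delta>"
      using inv[unfolded continuous_on_iff, rule_format, OF PG d(1)] unfolding iP by blast
    have near: "\<bar>snd (q - P)\<bar> \<le> \<epsilon> * norm (q - P)" if q: "q \<in> g ` {0..1}" "dist q P < \<eta>" for q
    proof -
      obtain t where t: "t \<in> {0..1}" "q = g t" using q(1) by blast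
      then have "the_inv_into {0..1} g q = t" using the_inv_into_f_f[OF g(2)] by simp
      then show ?thesis using d(2)[OF t(1)] eta(2)[OF q] t by (simp add: dist_real_def)
    qed
    have qu: "((\<lambda>s. (\<gamma> s - \<gamma> (pi/2)) /\<^sub>R (s - pi/2)) \<longlongrightarrow> u) (at (pi/2) within S_int)"
      using \<gamma>(3) by (simp add: has_vector_derivative_iff_quotient)
    have "((\<lambda>s. \<bar>snd ((\<gamma> s - \<gamma> (pi/2)) /\<^sub>R (s - pi/2))\<bar> - \<epsilon> * norm ((\<gamma> s - \<gamma> (pi/2)) /\<^sub>R (s - pi/2))) \<longlongrightarrow> \<bar>snd u\<bar> - \<epsilon> * norm u) (at (pi/2) within S_int)"
      by (intro tendsto_intros qu)
    moreover have "\<forall>\<^sub>F s in at (pi/2) within S_int. \<bar>snd ((\<gamma> s - \<gamma> (pi/2)) /\<^sub>R (s - pi/2))\<bar> - \<epsilon> * norm ((\<gamma> s - \<gamma> (pi/2)) /\<^sub>R (s - pi/2)) \<le> 0"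
    proof -
      have "(\<gamma> \<longlongrightarrow> \<gamma> (pi/2)) (at (pi/2) within S_int)"
        using has_vector_derivative_continuous[OF \<gamma>(3)] by (simp add: continuous_within)
      then have "\<forall>\<^sub>F s in at (pi/2) within S_int. dist (\<gamma> s) P < \<eta>" using eta(1) \<gamma>(2) by (simp add: tendstoD)
      moreover have "\<forall>\<^sub>F s in at (pi/2) within S_int. s \<in> S_int \<and> s \<noteq> pi/2" by (simp add: eventually_at_filter)
      ultimately show ?thesis
      proof eventually_elim
        case (elim s)
        have "\<bar>snd (\<gamma> s - P)\<bar> \<le> \<epsilon> * norm (\<gamma> s - P)" using near elim \<gamma>(1) by blast
        then have "inverse \<bar>s - pi/2\<bar> * \<bar>snd (\<gamma> s - P)\<bar> \<le> inverse \<bar>s - pi/2\<bar> * (\<epsilon> * norm (\<gamma> s - P))"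
          by (intro mult_left_mono) auto
        then show ?case
          unfolding \<gamma>(2) snd_scaleR norm_scaleR real_scaleR_def abs_mult abs_inverse
            mult.left_commute[of \<epsilon> "inverse \<bar>s - pi/2\<bar>"] by linarith
      qed
    qed
    moreover have "at (pi/2) within S_int \<noteq> bot"
      unfolding S_int_eq by (simp add: trivial_limit_within islimpt_Icc)
    ultimately have "\<bar>snd u\<bar> - \<epsilon> * norm u \<le> 0" by (intro tendsto_upperbound) auto
    then show ?thesis by simp
  qed
  note bound = this
  have "\<bar>snd u\<bar> \<le> 0 + e" if "e > 0" for e
  proof -
    have p: "norm u + 1 > 0" by (simp add: add_nonneg_pos)
    then have "\<bar>snd u\<bar> \<le> e / (norm u + 1) * norm u" using that by (intro bound divide_pos_pos)
    also have "\<dots> \<le> e / (norm u + 1) * (norm u + 1)" using that p by (intro mult_left_mono) auto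
    also have "\<dots> = e" using p by simp
    finally show ?thesis by simp
  qed
  then have "\<bar>snd u\<bar> \<le> 0" by (rule field_le_epsilon)
  then show ?thesis by simp
qed

lemma positive_arc_tangent:
  assumes "positive_Cr_arc 4 P u Q v \<Gamma>"
  obtains g where "continuous_on {0..1} g" "inj_on g {0..1}" "g ` {0..1} = \<Gamma>" "g 0 = P" "g 1 = Q"
    "\<And>t. t \<in> {0..1} \<Longrightarrow> (g has_vector_derivative nderiv 1 {0..1} g t) (at t within {0..1})"
    "nderiv 1 {0..1} g 0 \<noteq> 0" "nderiv 1 {0..1} g 1 \<noteq> 0"
    "sgn (nderiv 1 {0..1} g 0) = u" "sgn (nderiv 1 {0..1} g 1) = v"
proof -
  obtain g where g: "arc g" "path_image g = \<Gamma>" "pathstart g = P" "pathfinish g = Q" "Cr_on 4 {0..1} g"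
    "\<forall>s\<in>{0..1}. nderiv 1 {0..1} g s \<noteq> 0 \<and> curvature g s > 0"
    "sgn (nderiv 1 {0..1} g 0) = u" "sgn (nderiv 1 {0..1} g 1) = v"
    using assms unfolding positive_Cr_arc_def by blast
  have "(g has_vector_derivative nderiv 1 {0..1} g t) (at t within {0..1})" if "t \<in> {0..1}" for t
    using Cr_on_derivative[OF g(5) _ that, of 0] by simp
  then show ?thesis using that[of g] g
    by (auto simp: arc_def path_def path_image_def pathstart_def pathfinish_def)
qed

definition is_arc_of :: "real \<Rightarrow> real \<Rightarrow> point set \<Rightarrow> (real \<Rightarrow> point) \<Rightarrow> bool" where
  "is_arc_of \<sigma> a \<Omega> \<gamma> \<longleftrightarrow> constant_speed_param (\<sigma> * a/2, -1) (\<sigma> * a/2, 1) (side_arc \<sigma> a \<Omega>) \<gamma> \<and>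
     (\<forall>s\<in>S_int. \<gamma> (- s) = mirror (\<gamma> s)) \<and> tangent_at_top \<gamma>"

text \<open>The given arcs are recovered as \<open>side_arc\<close>. Symmetry of the domain then
  maps each arc to itself, and uniqueness of the constant-speed parametrization turns this into the
  symmetry of \<gamma>.\<close>

lemma M_class_arc_facts:
  assumes a: "a > 0" and M: "M_class_arcs 4 a \<Omega> \<Gamma>1 \<Gamma>2"
    and c: "constant_speed_param (-a/2, -1) (-a/2, 1) \<Gamma>1 \<gamma>1" "constant_speed_param (a/2, -1) (a/2, 1) \<Gamma>2 \<gamma>2"
  shows "is_arc_of (-1) a \<Omega> \<gamma>1" "is_arc_of 1 a \<Omega> \<gamma>2"
    "frontier \<Omega> = E_top a \<union> E_bot a \<union> side_arc (-1) a \<Omega> \<union> side_arc 1 a \<Omega>"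
proof -
  have op: "open \<Omega>" and fr: "frontier \<Omega> = E_top a \<union> E_bot a \<union> \<Gamma>1 \<union> \<Gamma>2"
    and arcs: "positive_Cr_arc 4 (-a/2, 1) (-1, 0) (-a/2, -1) (1, 0) \<Gamma>1" "positive_Cr_arc 4 (a/2, -1) (1, 0) (a/2, 1) (-1, 0) \<Gamma>2"
    and side: "\<forall>p\<in>\<Gamma>1. fst p \<le> -a/2" "\<forall>p\<in>\<Gamma>2. fst p \<ge> a/2" and sym: "(\<lambda>(x, y). (x, - y)) ` \<Omega> = \<Omega>"
    using M unfolding M_class_arcs_def by blast+
  note d1 = constant_speed_paramD[OF c(1)] note d2 = constant_speed_paramD[OF c(2)]
  have S: "pi/2 \<in> S_int" "-(pi/2) \<in> S_int" by (auto simp: S_int_eq)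
  have e1: "(-a/2, -1) \<in> \<Gamma>1" "(-a/2, 1) \<in> \<Gamma>1" using d1(2,3,4) S by force+
  have e2: "(a/2, -1) \<in> \<Gamma>2" "(a/2, 1) \<in> \<Gamma>2" using d2(2,3,4) S by force+
  have corner: "p = (-a/2, snd p) \<and> \<bar>snd p\<bar> = 1" if "p \<in> E_top a \<union> E_bot a" "fst p \<le> -a/2" for p
    using that by (cases p) (auto simp: E_top_def E_bot_def)
  have corner': "p = (a/2, snd p) \<and> \<bar>snd p\<bar> = 1" if "p \<in> E_top a \<union> E_bot a" "fst p \<ge> a/2" for p
    using that by (cases p) (auto simp: E_top_def E_bot_def)
  have pm: "y = 1 \<or> y = -1" if "\<bar>y\<bar> = 1" for y :: real using that by linarith
  have G1: "side_arc (-1) a \<Omega> = \<Gamma>1"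
  proof (intro set_eqI iffI)
    fix p assume "p \<in> side_arc (-1) a \<Omega>"
    then have p: "p \<in> frontier \<Omega>" "fst p \<le> -a/2" by (auto simp: side_arc_def)
    then consider "p \<in> E_top a \<union> E_bot a" | "p \<in> \<Gamma>1" | "p \<in> \<Gamma>2" unfolding fr by blast
    then show "p \<in> \<Gamma>1"
    proof cases
      case 1 then show ?thesis using corner[OF 1 p(2)] pm[of "snd p"] e1 by metis
    next
      case 3 then show ?thesis using side(2) p(2) a by force
    qed
  next
    fix p assume "p \<in> \<Gamma>1" then show "p \<in> side_arc (-1) a \<Omega>" using side(1) fr by (force simp: side_arc_def)
  qed
  have G2: "side_arc 1 a \<Omega> = \<Gamma>2"
  proof (intro set_eqI iffI)
    fix p assume "p \<in> side_arc 1 a \<Omega>"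
    then have p: "p \<in> frontier \<Omega>" "fst p \<ge> a/2" by (auto simp: side_arc_def)
    then consider "p \<in> E_top a \<union> E_bot a" | "p \<in> \<Gamma>1" | "p \<in> \<Gamma>2" unfolding fr by blast
    then show "p \<in> \<Gamma>2"
    proof cases
      case 1 then show ?thesis using corner'[OF 1 p(2)] pm[of "snd p"] e2 by metis
    next
      case 2 then show ?thesis using side(1) p(2) a by force
    qed
  next
    fix p assume "p \<in> \<Gamma>2" then show "p \<in> side_arc 1 a \<Omega>" using side(2) fr by (force simp: side_arc_def)
  qed
  show "frontier \<Omega> = E_top a \<union> E_bot a \<union> side_arc (-1) a \<Omega> \<union> side_arc 1 a \<Omega>" using fr G1 G2 by simp
  have msub: "mirror ` side_arc \<sigma> a \<Omega> \<subseteq> side_arc \<sigma> a \<Omega>" for \<sigma>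
    using frontier_mirror[OF op sym] by (auto simp: side_arc_def)
  have mir: "mirror ` side_arc \<sigma> a \<Omega> = side_arc \<sigma> a \<Omega>" for \<sigma>
  proof
    show "side_arc \<sigma> a \<Omega> \<subseteq> mirror ` side_arc \<sigma> a \<Omega>"
    proof
      fix p assume "p \<in> side_arc \<sigma> a \<Omega>"
      then have "mirror p \<in> side_arc \<sigma> a \<Omega>" using msub by blast
      then show "p \<in> mirror ` side_arc \<sigma> a \<Omega>" by (metis image_eqI mirror_simps(1))
    qed
  qed (rule msub)
  have refl: "\<gamma> (- s) = mirror (\<gamma> s)" if c: "constant_speed_param (x, -1) (x, 1) (side_arc \<sigma> a \<Omega>) \<gamma>" and s: "s \<in> S_int" for x \<sigma> \<gamma> s
  proof -
    have "constant_speed_param (x, -1) (x, 1) (side_arc \<sigma> a \<Omega>) (\<lambda>s. mirror (\<gamma> (- s)))"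
      by (rule constant_speed_param_mirror[OF c mir]) (simp_all add: mirror_def)
    from constant_speed_param_unique[OF c this _ uminus_S_int[OF s]] show ?thesis by simp
  qed
  have "tangent_at_top \<gamma>1"
  proof -
    obtain g where g: "continuous_on {0..1} g" "inj_on g {0..1}" "g ` {0..1} = \<Gamma>1" "g 0 = (-a/2, 1)"
      "\<And>t. t \<in> {0..1} \<Longrightarrow> (g has_vector_derivative nderiv 1 {0..1} g t) (at t within {0..1})"
      "nderiv 1 {0..1} g 0 \<noteq> 0" "sgn (nderiv 1 {0..1} g 0) = (-1, 0)"
      using positive_arc_tangent[OF arcs(1)] by metis
    have z: "snd (nderiv 1 {0..1} g 0) = 0"
    proof -
      have "snd (sgn (nderiv 1 {0..1} g 0)) = 0" using g(7) by simp
      then show ?thesis using g(6) by (simp add: sgn_div_norm)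
    qed
    show ?thesis unfolding tangent_at_top_def
      by (rule flat_tangent_transfer[OF g(1,2) _ g(4) g(5) g(6) z _ d1(4) d1(6)[OF S(1)]]) (use g(3) d1(2) in auto)
  qed
  then show "is_arc_of (-1) a \<Omega> \<gamma>1" unfolding is_arc_of_def using c(1) refl[of "-a/2" "-1" \<gamma>1] G1 by simp
  have "tangent_at_top \<gamma>2"
  proof -
    obtain g where g: "continuous_on {0..1} g" "inj_on g {0..1}" "g ` {0..1} = \<Gamma>2" "g 1 = (a/2, 1)"
      "\<And>t. t \<in> {0..1} \<Longrightarrow> (g has_vector_derivative nderiv 1 {0..1} g t) (at t within {0..1})"
      "nderiv 1 {0..1} g 1 \<noteq> 0" "sgn (nderiv 1 {0..1} g 1) = (-1, 0)"
      using positive_arc_tangent[OF arcs(2)] by metis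
    have z: "snd (nderiv 1 {0..1} g 1) = 0"
    proof -
      have "snd (sgn (nderiv 1 {0..1} g 1)) = 0" using g(7) by simp
      then show ?thesis using g(6) by (simp add: sgn_div_norm)
    qed
    show ?thesis unfolding tangent_at_top_def
      by (rule flat_tangent_transfer[OF g(1,2) _ g(4) g(5) g(6) z _ d2(4) d2(6)[OF S(1)]]) (use g(3) d2(2) in auto)
  qed
  then show "is_arc_of 1 a \<Omega> \<gamma>2" unfolding is_arc_of_def using c(2) refl[of "a/2" 1 \<gamma>2] G2 by simp
qed

text \<open>The angular parametrization has speed 1 and runs from the bottom edge to the top edge;
  by uniqueness the curves of a family at \<tau> = 0 coincide with it.\<close>

lemma stadium_side_arc:
  assumes a: "a > 0" and \<sigma>: "\<sigma> = 1 \<or> \<sigma> = -1"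
  shows "constant_speed_param (\<sigma> * a/2, -1) (\<sigma> * a/2, 1) (side_arc \<sigma> a (stadium a)) (\<lambda>s. (\<sigma> * (a/2 + cos s), sin s))"
    "s \<in> S_int \<Longrightarrow> nderiv 1 S_int (\<lambda>s. (\<sigma> * (a/2 + cos s), sin s)) s = (- \<sigma> * sin s, cos s)"
proof -
  define f where "f = (\<lambda>s. (\<sigma> * (a/2 + cos s), sin s))"
  have der: "(f has_vector_derivative (- \<sigma> * sin s, cos s)) (at s within S_int)" for s
    unfolding f_def by (auto intro!: derivative_eq_intros has_vector_derivative_Pair
        simp: has_real_derivative_iff_has_vector_derivative[symmetric])
  have nd: "nderiv 1 S_int f s = (- \<sigma> * sin s, cos s)" if "s \<in> S_int" for s
    using vector_derivative_S_int[OF der that] by (simp add: nderiv_Suc)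
  then show "s \<in> S_int \<Longrightarrow> nderiv 1 S_int (\<lambda>s. (\<sigma> * (a/2 + cos s), sin s)) s = (- \<sigma> * sin s, cos s)" by (simp add: f_def)
  have "continuous_on S_int (\<lambda>s. (- \<sigma> * sin s, cos s))" by (intro continuous_intros)
  then have "continuous_on S_int (nderiv 1 S_int f)" using nd by (simp cong: continuous_on_cong)
  then have "Cr_on 1 S_int f" unfolding Cr_on_def using der nd by auto
  moreover have "inj_on f S_int"
  proof (rule inj_onI)
    fix x y assume xy: "x \<in> S_int" "y \<in> S_int" "f x = f y"
    then have "sin x = sin y" by (simp add: f_def)
    moreover have "arcsin (sin x) = x" "arcsin (sin y) = y"
      using xy by (auto intro!: arcsin_sin simp: S_int_eq)
    ultimately show "x = y" by metis
  qed
  moreover have "f ` S_int = side_arc \<sigma> a (stadium a)"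
  proof (intro set_eqI iffI)
    fix p assume "p \<in> f ` S_int"
    then obtain s where s: "s \<in> S_int" "p = f s" by blast
    have "cos s \<ge> 0" using s by (intro cos_ge_zero) (auto simp: S_int_eq)
    moreover have "\<bar>sin s\<bar> = 1" if "cos s = 0"
      using that by (metis abs_square_eq_1 add.right_neutral sin_cos_squared_add zero_power2)
    moreover have "(cos s)\<^sup>2 + (sin s)\<^sup>2 = 1" by simp
    ultimately show "p \<in> side_arc \<sigma> a (stadium a)"
      using a \<sigma> s(2) unfolding side_arc_def f_def
      by (cases "cos s = 0") (auto simp: frontier_stadium_cases algebra_simps simp del: sin_cos_squared_add sin_cos_squared_add2)
  next
    fix p assume p: "p \<in> side_arc \<sigma> a (stadium a)"
    obtain x y where xy: "p = (x, y)" by (cases p)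
    have fr: "(x, y) \<in> frontier (stadium a)" and x: "\<sigma> * x \<ge> a/2" using p by (auto simp: side_arc_def xy)
    have eq: "(\<sigma> * x - a/2)\<^sup>2 + y\<^sup>2 = 1"
    proof -
      have sq: "(- x - a/2)\<^sup>2 = (x + a/2)\<^sup>2" by (simp add: power2_eq_square algebra_simps)
      have "y\<^sup>2 = 1" if "\<bar>y\<bar> = 1" using that by (metis power2_abs power_one)
      then show ?thesis using fr x \<sigma> a sq unfolding frontier_stadium_cases[OF a] by auto
    qed
    then have "y\<^sup>2 \<le> 1" by (smt (verit) zero_le_power2)
    then have y: "-1 \<le> y" "y \<le> 1" using abs_square_le_1[of y] by auto
    define s where "s = arcsin y"
    have s: "s \<in> S_int" "sin s = y" using y arcsin_bounded[of y] by (auto simp: s_def S_int_eq)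
    have "(cos s)\<^sup>2 = (\<sigma> * x - a/2)\<^sup>2" using eq s by (simp add: cos_squared_eq)
    moreover have "cos s \<ge> 0" using s by (intro cos_ge_zero) (auto simp: S_int_eq)
    ultimately have "cos s = \<sigma> * x - a/2" using x by (simp add: power2_eq_iff_nonneg)
    then have "f s = p" using \<sigma> s by (auto simp: f_def xy)
    then show "p \<in> f ` S_int" using s by blast
  qed
  moreover have "f (-pi/2) = (\<sigma> * a/2, -1)" "f (pi/2) = (\<sigma> * a/2, 1)" by (simp_all add: f_def)
  moreover have "\<forall>s\<in>S_int. norm (nderiv 1 S_int f s) = 1"
    using nd \<sigma> by (auto simp: norm_Pair power_mult_distrib)
  ultimately show "constant_speed_param (\<sigma> * a/2, -1) (\<sigma> * a/2, 1) (side_arc \<sigma> a (stadium a)) (\<lambda>s. (\<sigma> * (a/2 + cos s), sin s))"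
    unfolding constant_speed_param_def f_def[symmetric] by blast
qed

lemma stadium_arc_eq:
  assumes "a > 0" "\<sigma> = 1 \<or> \<sigma> = -1" "is_arc_of \<sigma> a (stadium a) \<gamma>" "s \<in> S_int"
  shows "\<gamma> s = (\<sigma> * (a/2 + cos s), sin s)"
proof -
  have "constant_speed_param (\<sigma> * a/2, -1) (\<sigma> * a/2, 1) (side_arc \<sigma> a (stadium a)) \<gamma>"
    using assms(3) unfolding is_arc_of_def by (rule conjunct1)
  from constant_speed_param_unique[OF this stadium_side_arc(1)[OF assms(1,2)] _ assms(4)] show ?thesis by simp
qed

lemma stadium_arc_nderiv:
  assumes "a > 0" "\<sigma> = 1 \<or> \<sigma> = -1" "is_arc_of \<sigma> a (stadium a) \<gamma>" "s \<in> S_int"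
  shows "nderiv 1 S_int \<gamma> s = (- \<sigma> * sin s, cos s)"
proof -
  have c: "constant_speed_param (\<sigma> * a/2, -1) (\<sigma> * a/2, 1) (side_arc \<sigma> a (stadium a)) \<gamma>"
    using assms(3) unfolding is_arc_of_def by (rule conjunct1)
  have "((\<lambda>s. (\<sigma> * (a/2 + cos s), sin s)) has_vector_derivative nderiv 1 S_int \<gamma> s) (at s within S_int)"
    by (rule has_vector_derivative_transform[OF assms(4) _ constant_speed_paramD(6)[OF c assms(4)]])
       (rule stadium_arc_eq[OF assms(1,2,3), symmetric])
  from vector_derivative_S_int[OF this assms(4)] show ?thesis
    using stadium_side_arc(2)[OF assms(1,2,4)] by (simp add: nderiv_Suc)
qed

text \<open>Orthogonality leaves two unit vectors, one of them the outward radius, along which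
  \<open>stadium_fn\<close> exceeds 1 at once. The ends of the arcs are covered as well.\<close>

lemma stadium_inward_normal:
  assumes a: "a > 0" and \<sigma>: "\<sigma> = 1 \<or> \<sigma> = -1" and g: "is_arc_of \<sigma> a (stadium a) \<gamma>" and s: "s \<in> S_int"
  shows "inward_normal (stadium a) \<gamma> s = (- \<sigma> * cos s, - sin s)"
  unfolding inward_normal_def stadium_arc_nderiv[OF a \<sigma> g s] stadium_arc_eq[OF a \<sigma> g s]
proof (rule the_equality)
  have c: "cos s \<ge> 0" using s by (intro cos_ge_zero) (auto simp: S_int_eq)
  have s2: "\<sigma> * \<sigma> = 1" using \<sigma> by auto
  have inw: "(\<sigma> * (a/2 + cos s), sin s) + t *\<^sub>R (- \<sigma> * cos s, - sin s) \<in> stadium a" if "t \<in> {0<..<1}" for t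
  proof -
    have "dist (\<sigma> * (a/2), 0) ((\<sigma> * (a/2 + cos s), sin s) + t *\<^sub>R (- \<sigma> * cos s, - sin s)) < 1"
    proof -
      have "(\<sigma> * (a/2 + cos s) + t * (- \<sigma> * cos s) - \<sigma> * (a/2))\<^sup>2 + (sin s + t * - sin s)\<^sup>2
          = (\<sigma> * \<sigma>) * (1 - t)\<^sup>2 * (cos s)\<^sup>2 + (1 - t)\<^sup>2 * (sin s)\<^sup>2"
        by (simp add: power2_eq_square algebra_simps del: sin_cos_squared_add3)
      also have "\<dots> = (1 - t)\<^sup>2 * ((sin s)\<^sup>2 + (cos s)\<^sup>2)" unfolding s2 by (simp add: algebra_simps del: sin_cos_squared_add sin_cos_squared_add2)
      also have "\<dots> < 1" using that by (simp add: abs_square_less_1)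
      finally show ?thesis unfolding scaleR_Pair add_Pair dist_less_1_iff by simp
    qed
    then show ?thesis using \<sigma> by (auto simp: stadium_def mem_ball)
  qed
  show "norm (- \<sigma> * cos s, - sin s) = 1 \<and> (- \<sigma> * cos s, - sin s) \<bullet> (- \<sigma> * sin s, cos s) = 0 \<and>
    (\<exists>\<epsilon>>0. \<forall>t\<in>{0<..<\<epsilon>}. (\<sigma> * (a/2 + cos s), sin s) + t *\<^sub>R (- \<sigma> * cos s, - sin s) \<in> stadium a)"
    using inw \<sigma> by (auto simp: norm_Pair power_mult_distrib inner_prod_def intro!: exI[of _ 1])
  fix n assume n: "norm n = 1 \<and> n \<bullet> (- \<sigma> * sin s, cos s) = 0 \<and>
    (\<exists>\<epsilon>>0. \<forall>t\<in>{0<..<\<epsilon>}. (\<sigma> * (a/2 + cos s), sin s) + t *\<^sub>R n \<in> stadium a)"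
  obtain x y where xy: "n = (x, y)" by (cases n)
  define k where "k = \<sigma> * x * cos s + y * sin s"
  have orth: "\<sigma> * x * sin s = y * cos s" using n by (simp add: xy inner_prod_def)
  have sc: "cos s * cos s + sin s * sin s = 1" by (metis power2_eq_square sin_cos_squared_add2)
  have xk: "x = \<sigma> * k * cos s" "y = k * sin s"
  proof -
    have "\<sigma> * k * cos s = (\<sigma> * \<sigma>) * x * (cos s * cos s) + \<sigma> * (y * cos s) * sin s" by (simp add: k_def algebra_simps del: sin_cos_squared_add3)
    also have "\<dots> = (\<sigma> * \<sigma>) * x * (cos s * cos s + sin s * sin s)" unfolding orth[symmetric] by (simp add: algebra_simps del: sin_cos_squared_add3)
    finally show "x = \<sigma> * k * cos s" unfolding s2 sc by simp
    have "k * sin s = (\<sigma> * x * sin s) * cos s + y * (sin s * sin s)" by (simp add: k_def algebra_simps del: sin_cos_squared_add3)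
    also have "\<dots> = y * (cos s * cos s + sin s * sin s)" unfolding orth by (simp add: algebra_simps del: sin_cos_squared_add3)
    finally show "y = k * sin s" unfolding sc by simp
  qed
  have "x * x + y * y = 1" using n by (simp add: xy norm_Pair power2_eq_square)
  moreover have "x * x + y * y = (\<sigma> * \<sigma>) * (k * k) * (cos s * cos s) + (k * k) * (sin s * sin s)"
    unfolding xk by (simp add: algebra_simps del: sin_cos_squared_add3)
  then have "x * x + y * y = k * k * (cos s * cos s + sin s * sin s)" unfolding s2 by (simp add: algebra_simps del: sin_cos_squared_add3)
  ultimately have "k * k = 1" unfolding sc by simp
  then have "k = 1 \<or> k = -1" by (metis power2_eq_1_iff power2_eq_square)
  moreover have "k \<noteq> 1"
  proof
    assume k: "k = 1"
    obtain \<epsilon> where e: "\<epsilon> > 0" "\<forall>t\<in>{0<..<\<epsilon>}. (\<sigma> * (a/2 + cos s), sin s) + t *\<^sub>R n \<in> stadium a" using n by blast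
    define t where "t = \<epsilon> / 2"
    have t: "t \<in> {0<..<\<epsilon>}" "t > 0" using e by (auto simp: t_def)
    have "(\<sigma> * (a/2 + cos s), sin s) + t *\<^sub>R n = (\<sigma> * (a/2 + (1 + t) * cos s), (1 + t) * sin s)"
      unfolding xy xk k by (simp add: algebra_simps del: sin_cos_squared_add3)
    then have mem: "stadium_fn a (\<sigma> * (a/2 + (1 + t) * cos s), (1 + t) * sin s) < 1"
      using e(2) t(1) stadium_eq[OF a] by (metis mem_Collect_eq)
    have "0 \<le> (1 + t) * cos s" using c t by simp
    then have "\<bar>\<sigma> * (a/2 + (1 + t) * cos s)\<bar> = a/2 + (1 + t) * cos s" using \<sigma> a by (auto simp: abs_mult)
    then have "stadium_fn a (\<sigma> * (a/2 + (1 + t) * cos s), (1 + t) * sin s) = ((1 + t) * cos s)\<^sup>2 + ((1 + t) * sin s)\<^sup>2"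
      using \<open>0 \<le> (1 + t) * cos s\<close> by (simp add: stadium_fn_def)
    also have "\<dots> = (1 + t)\<^sup>2 * (cos s * cos s + sin s * sin s)" by (simp add: power2_eq_square algebra_simps del: sin_cos_squared_add3)
    also have "\<dots> > 1" unfolding sc using t by (simp add: power2_eq_square algebra_simps add_pos_pos)
    finally show False using mem by simp
  qed
  ultimately have "k = -1" by blast
  then show "n = (- \<sigma> * cos s, - sin s)" unfolding xy xk by simp
qed


section \<open>Maximal polygons are billiard trajectories\<close>

text \<open>Tangent vectors come from arbitrary curves in the frontier. Away from the junctions such
  a curve must follow the arc for a short time, because the edges, the other arc and the remaining
  part of the same arc form a closed set that misses the point.\<close>

lemma frontier_near_arc:
  assumes a: "a > 0" and \<sigma>: "\<sigma> = 1 \<or> \<sigma> = -1" and arc: "is_arc_of \<sigma> a \<Omega> \<gamma>"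
    and fr: "frontier \<Omega> = E_top a \<union> E_bot a \<union> side_arc (-1) a \<Omega> \<union> side_arc 1 a \<Omega>"
    and s: "\<bar>s\<bar> < pi/2" and d: "\<delta> > 0"
  shows "\<exists>\<epsilon>>0. \<forall>q\<in>frontier \<Omega>. dist q (\<gamma> s) < \<epsilon> \<longrightarrow> (\<exists>s'\<in>S_int. \<bar>s' - s\<bar> < \<delta> \<and> q = \<gamma> s')"
proof -
  have cs: "constant_speed_param (\<sigma> * a/2, -1) (\<sigma> * a/2, 1) (side_arc \<sigma> a \<Omega>) \<gamma>"
    using arc unfolding is_arc_of_def by (rule conjunct1)
  note D = constant_speed_paramD[OF cs]
  have sS: "s \<in> S_int" using s by (simp add: S_int_mem)
  have S: "pi/2 \<in> S_int" "-(pi/2) \<in> S_int" by (auto simp: S_int_eq)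
  define K where "K = E_top a \<union> E_bot a \<union> side_arc (- \<sigma>) a \<Omega> \<union> \<gamma> ` (S_int - {s - \<delta><..<s + \<delta>})"
  have "closed K"
    unfolding K_def
  proof (intro closed_Un)
    show "closed (E_top a)" "closed (E_bot a)" unfolding E_top_def E_bot_def by (auto intro: closed_Times)
    have "side_arc (- \<sigma>) a \<Omega> = frontier \<Omega> \<inter> {p. a/2 \<le> - \<sigma> * fst p}" by (auto simp: side_arc_def)
    moreover have "closed {p::point. a/2 \<le> - \<sigma> * fst p}" by (intro closed_Collect_le continuous_intros)
    ultimately show "closed (side_arc (- \<sigma>) a \<Omega>)" by (simp add: closed_Int)
    have "compact (S_int - {s - \<delta><..<s + \<delta>})" unfolding S_int_eq by (intro compact_diff) auto
    then show "closed (\<gamma> ` (S_int - {s - \<delta><..<s + \<delta>}))"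
      by (intro compact_imp_closed compact_continuous_image continuous_on_subset[OF D(5)]) auto
  qed
  moreover have "\<gamma> s \<notin> K"
  proof
    assume "\<gamma> s \<in> K"
    have p: "\<gamma> s \<in> side_arc \<sigma> a \<Omega>" using D(2) sS by blast
    then have x: "\<sigma> * fst (\<gamma> s) \<ge> a/2" by (simp add: side_arc_def)
    from \<open>\<gamma> s \<in> K\<close> consider "\<gamma> s \<in> E_top a \<union> E_bot a" | "\<gamma> s \<in> side_arc (- \<sigma>) a \<Omega>" | t where "t \<in> S_int" "t \<notin> {s - \<delta><..<s + \<delta>}" "\<gamma> s = \<gamma> t"
      unfolding K_def by blast
    then show False
    proof cases
      case 1
      then have "\<bar>fst (\<gamma> s)\<bar> \<le> a/2" and y: "snd (\<gamma> s) = 1 \<or> snd (\<gamma> s) = -1" by (auto simp: E_top_def E_bot_def)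
      then have "fst (\<gamma> s) = \<sigma> * a/2" using x \<sigma> by auto
      then have "\<gamma> s = \<gamma> (pi/2) \<or> \<gamma> s = \<gamma> (-(pi/2))" using y D(3,4) by (auto simp: prod_eq_iff)
      then have "s = pi/2 \<or> s = -(pi/2)" using inj_onD[OF D(1) _ sS] S by blast
      then show False using s by auto
    next
      case 2 then show False using x a by (auto simp: side_arc_def)
    next
      case 3
      then have "s = t" using inj_onD[OF D(1) _ sS] by blast
      then show False using 3 d by auto
    qed
  qed
  ultimately obtain \<epsilon> where e: "\<epsilon> > 0" "ball (\<gamma> s) \<epsilon> \<subseteq> - K"
    using open_contains_ball[of "- K"] by (auto simp: open_Compl)
  show ?thesis
  proof (intro exI[of _ \<epsilon>] conjI ballI impI e(1))
    fix q assume q: "q \<in> frontier \<Omega>" "dist q (\<gamma> s) < \<epsilon>"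
    then have "q \<notin> K" using e(2) by (auto simp: dist_commute)
    moreover have "frontier \<Omega> \<subseteq> E_top a \<union> E_bot a \<union> side_arc (- \<sigma>) a \<Omega> \<union> \<gamma> ` S_int"
      using fr D(2) \<sigma> by auto
    ultimately obtain t where "t \<in> S_int" "t \<in> {s - \<delta><..<s + \<delta>}" "q = \<gamma> t" using q(1) unfolding K_def by blast
    then show "\<exists>s'\<in>S_int. \<bar>s' - s\<bar> < \<delta> \<and> q = \<gamma> s'" by (intro bexI[of _ t]) auto
  qed
qed

lemma Suc_mod_inj: "l < n \<Longrightarrow> i < n \<Longrightarrow> Suc l mod n = Suc i mod n \<Longrightarrow> l = i"
  by (auto simp: mod_Suc split: if_splits)

text \<open>Only the two sides at vertex \<open>j\<close> change. For n = 2 they join the same two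
  vertices but still count as two sides.\<close>

lemma perimeter_update:
  assumes n: "n \<ge> 2" and i: "i < n"
  defines "j \<equiv> Suc i mod n"
  defines "k \<equiv> Suc j mod n"
  shows "perimeter n V (c(j := s)) = perimeter n V c + (dist (V i (c i)) (V j s) + dist (V j s) (V k (c k)))
     - (dist (V i (c i)) (V j (c j)) + dist (V j (c j)) (V k (c k)))"
proof -
  have j: "j < n" "j \<noteq> i" "k \<noteq> j" using n i by (auto simp: j_def k_def mod_Suc)
  define f where "f = (\<lambda>d l. dist (V l (d l)) (V (Suc l mod n) (d (Suc l mod n))))"
  have split: "perimeter n V d = f d i + f d j + (\<Sum>l\<in>{..<n}-{i,j}. f d l)" for d
  proof -
    have "{..<n} = insert i (insert j ({..<n}-{i,j}))" using i j by auto
    then have "perimeter n V d = (\<Sum>l\<in>insert i (insert j ({..<n}-{i,j})). f d l)" by (simp add: perimeter_def f_def)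
    then show ?thesis using j by simp
  qed
  have "f (c(j := s)) l = f c l" if "l \<in> {..<n} - {i, j}" for l
  proof -
    have "Suc l mod n \<noteq> j" using that i Suc_mod_inj[of l n i] by (auto simp: j_def)
    then show ?thesis using that by (simp add: f_def)
  qed
  then have r: "(\<Sum>l\<in>{..<n}-{i,j}. f (c(j := s)) l) = (\<Sum>l\<in>{..<n}-{i,j}. f c l)" by (intro sum.cong) auto
  have "f (c(j := s)) i = dist (V i (c i)) (V j s)" "f (c(j := s)) j = dist (V j s) (V k (c k))"
    "f c i = dist (V i (c i)) (V j (c j))" "f c j = dist (V j (c j)) (V k (c k))"
    using j by (auto simp: f_def j_def[symmetric] k_def[symmetric])
  then show ?thesis using split[of c] split[of "c(j := s)"] r by simp
qed

text \<open>The vertex differs from both neighbours, so the sum of the two distances is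
  differentiable along the curve; its vanishing derivative is the law of reflection.\<close>

lemma reflection_at_maximum:
  fixes x :: "real \<Rightarrow> point"
  assumes x: "(x has_vector_derivative u) (at 0)" "x 0 = p" "q \<noteq> p" "q' \<noteq> p" and d: "d > 0"
    and max: "\<And>t. \<bar>t\<bar> < d \<Longrightarrow> dist q (x t) + dist (x t) q' \<le> dist q p + dist p q'"
  shows "sgn (q - p) \<bullet> (- u) = sgn (q' - p) \<bullet> u"
proof -
  have "((\<lambda>t. dist q (x t)) has_real_derivative sgn (q - x 0) \<bullet> (0 - u)) (at 0)"
    using x by (intro has_derivative_dist_moving) auto
  moreover have "((\<lambda>t. dist (x t) q') has_real_derivative sgn (x 0 - q') \<bullet> (u - 0)) (at 0)"
    using x by (intro has_derivative_dist_moving) auto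
  ultimately have "((\<lambda>t. dist q (x t) + dist (x t) q') has_real_derivative sgn (q - x 0) \<bullet> (0 - u) + sgn (x 0 - q') \<bullet> (u - 0)) (at 0)"
    by (rule DERIV_add)
  then have "sgn (q - x 0) \<bullet> (0 - u) + sgn (x 0 - q') \<bullet> (u - 0) = 0"
    by (rule DERIV_local_max[OF _ d]) (use max x(2) in auto)
  moreover have "sgn (p - q') = - sgn (q' - p)" by (simp add: sgn_minus[symmetric])
  ultimately show ?thesis using x(2) by simp
qed

text \<open>A point of the segment off the frontier is an interior point, and in a convex set the
  open segment from an interior point to a point of the closure is interior. Two such segments and
  the point itself cover everything.\<close>

lemma open_segment_in_convex:
  fixes p q :: point
  assumes "open \<Omega>" "convex \<Omega>" "p \<in> closure \<Omega>" "q \<in> closure \<Omega>" "p \<noteq> q" and w: "0 < w" "w < 1"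
    and z: "(1 - w) *\<^sub>R p + w *\<^sub>R q \<notin> frontier \<Omega>"
  shows "open_segment p q \<subseteq> \<Omega>"
proof
  define z where "z = (1 - w) *\<^sub>R p + w *\<^sub>R q"
  have "z \<in> closure \<Omega>" unfolding z_def using assms by (intro convexD convex_closure) auto
  then have zi: "z \<in> interior \<Omega>" using z by (simp add: frontier_def z_def)
  have seg: "open_segment z b \<subseteq> \<Omega>" if "b \<in> closure \<Omega>" for b
    using in_interior_closure_convex_segment[OF assms(2) zi that] interior_subset by blast
  have zp: "z - p = w *\<^sub>R (q - p)" "z - q = (1 - w) *\<^sub>R (p - q)" by (simp_all add: z_def algebra_simps)
  have ne: "z \<noteq> p" "z \<noteq> q" using zp assms(5) w by (metis cancel_comm_monoid_add_class.diff_cancel scaleR_eq_0_iff eq_iff_diff_eq_0 less_irrefl)+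
  fix y assume "y \<in> open_segment p q"
  then obtain t where t: "0 < t" "t < 1" "y = (1 - t) *\<^sub>R p + t *\<^sub>R q" by (auto simp: in_segment)
  consider "t = w" | "t < w" | "t > w" by linarith
  then show "y \<in> \<Omega>"
  proof cases
    case 1 then show ?thesis using t zi interior_subset by (auto simp: z_def)
  next
    case 2
    have "y = (1 - (1 - t / w)) *\<^sub>R z + (1 - t / w) *\<^sub>R p"
    proof -
      have "y = p + t *\<^sub>R (q - p)" by (simp add: t(3) algebra_simps)
      also have "t *\<^sub>R (q - p) = (t / w) *\<^sub>R (z - p)" using w by (simp add: zp)
      finally show ?thesis by (simp add: algebra_simps)
    qed
    then have "y \<in> open_segment z p" using 2 t w ne unfolding in_segment by (intro conjI exI[of _ "1 - t / w"]) (auto simp: divide_simps)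
    then show ?thesis using seg assms(3) by blast
  next
    case 3
    define v where "v = (1 - t) / (1 - w)"
    have "y = (1 - (1 - v)) *\<^sub>R z + (1 - v) *\<^sub>R q"
    proof -
      have "y = q + (1 - t) *\<^sub>R (p - q)" by (simp add: t(3) algebra_simps)
      also have "(1 - t) *\<^sub>R (p - q) = v *\<^sub>R (z - q)" using w by (simp add: zp v_def)
      finally show ?thesis by (simp add: algebra_simps)
    qed
    then have "y \<in> open_segment z q" using 3 t w ne unfolding in_segment v_def by (intro conjI exI[of _ "1 - (1 - t) / (1 - w)"]) (auto simp: divide_simps)
    then show ?thesis using seg assms(4) by blast
  qed
qed

section \<open>Local maxima near the orbit\<close>

context stadium_orbit
begin

text \<open>The arcs of a family are parametrized upwards on both sides, while the angles of the
  orbit turn counterclockwise; on the left the two are related by pi - s.\<close>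

definition vertex :: "(real \<Rightarrow> point) \<Rightarrow> (real \<Rightarrow> point) \<Rightarrow> nat \<Rightarrow> real \<Rightarrow> point" where
  "vertex g1 g2 i s = (if i < m\<^sub>2 then g2 s else g1 (pi - s))"

text \<open>Within such a box no vertex reaches a junction, and since \<rho> is less than half the
  least spacing, vertices on one arc cannot meet.\<close>

definition small :: "real \<Rightarrow> bool" where
  "small \<rho> \<longleftrightarrow> 0 < \<rho> \<and> \<rho> < min al1 al2 \<and> (\<forall>i<n. \<forall>s. \<bar>s - angle i\<bar> \<le> \<rho> \<longrightarrow>
     (i < m\<^sub>2 \<longrightarrow> \<bar>s\<bar> < pi/2) \<and> (\<not> i < m\<^sub>2 \<longrightarrow> \<bar>pi - s\<bar> < pi/2))"

text \<open>The maximum lies inside the box, so each vertex may move along any boundary curve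
  through it, which gives the law of reflection. Distinctness of the vertices makes \<open>n\<close>
  the least period, and \<open>z\<close> with convexity puts the open sides inside the
  domain.\<close>

lemma trajectory_in_spectrum:
  assumes om: "open \<Omega>" "convex \<Omega>" and arcs: "is_arc_of (-1) a \<Omega> g1" "is_arc_of 1 a \<Omega> g2"
    and fr: "frontier \<Omega> = E_top a \<union> E_bot a \<union> side_arc (-1) a \<Omega> \<union> side_arc 1 a \<Omega>"
    and sm: "small \<rho>" and c: "\<And>i. i < n \<Longrightarrow> \<bar>c i - angle i\<bar> < \<rho>"
    and max: "\<And>d. (\<And>i. i < n \<Longrightarrow> \<bar>d i - angle i\<bar> \<le> \<rho>) \<Longrightarrow> perimeter n (vertex g1 g2) d \<le> perimeter n (vertex g1 g2) c"
    and z: "\<And>i. i < n \<Longrightarrow> \<exists>w. 0 < w \<and> w < 1 \<and>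
      (1 - w) *\<^sub>R vertex g1 g2 i (c i) + w *\<^sub>R vertex g1 g2 (Suc i mod n) (c (Suc i mod n)) \<notin> frontier \<Omega>"
  shows "perimeter n (vertex g1 g2) c \<in> length_spectrum \<Omega>"
proof -
  define V where "V = vertex g1 g2"
  define p where "p = (\<lambda>i. V (i mod n) (c (i mod n)))"
  have n2: "n \<ge> 2" "n > 0" using m by (auto simp: n_def)
  have cs: "constant_speed_param (-1 * a/2, -1) (-1 * a/2, 1) (side_arc (-1) a \<Omega>) g1"
    "constant_speed_param (1 * a/2, -1) (1 * a/2, 1) (side_arc 1 a \<Omega>) g2"
    using arcs unfolding is_arc_of_def by blast+
  note D1 = constant_speed_paramD[OF cs(1)] note D2 = constant_speed_paramD[OF cs(2)]
  have cr: "i < m\<^sub>2 \<Longrightarrow> \<bar>c i\<bar> < pi/2" "\<not> i < m\<^sub>2 \<Longrightarrow> \<bar>pi - c i\<bar> < pi/2" if "i < n" for i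
    using sm c[OF that] that unfolding small_def by (meson less_imp_le)+
  have mem: "i < m\<^sub>2 \<Longrightarrow> V i (c i) \<in> side_arc 1 a \<Omega>" "\<not> i < m\<^sub>2 \<Longrightarrow> V i (c i) \<in> side_arc (-1) a \<Omega>" if "i < n" for i
  proof -
    show "V i (c i) \<in> side_arc 1 a \<Omega>" if "i < m\<^sub>2"
      using cr(1)[OF \<open>i < n\<close> that] D2(2) that by (auto simp: V_def vertex_def S_int_mem)
    show "V i (c i) \<in> side_arc (-1) a \<Omega>" if "\<not> i < m\<^sub>2"
      using cr(2)[OF \<open>i < n\<close> that] D1(2) that by (auto simp: V_def vertex_def S_int_mem)
  qed
  have vfr: "V i (c i) \<in> frontier \<Omega>" if "i < n" for i using mem[OF that] unfolding side_arc_def by blast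
  have distinct: "V i (c i) \<noteq> V k (c k)" if ik: "i < k" "k < n" for i k
  proof
    assume eq: "V i (c i) = V k (c k)"
    have i: "i < n" using ik by simp
    show False
    proof (cases "i < m\<^sub>2 \<longleftrightarrow> k < m\<^sub>2")
      case True
      have "c i \<noteq> c k" using angle_separated[OF ik True] c[OF i] c[OF ik(2)] sm unfolding small_def by linarith
      moreover have "c i = c k"
      proof (cases "k < m\<^sub>2")
        case True
        then have "c i \<in> S_int" "c k \<in> S_int" "g2 (c i) = g2 (c k)"
          using cr(1)[OF i] cr(1)[OF ik(2)] ik eq by (auto simp: V_def vertex_def S_int_mem)
        then show ?thesis using inj_onD[OF D2(1)] by blast
      next
        case False
        then have f: "\<not> i < m\<^sub>2" using True by simp
        then have "pi - c i \<in> S_int" "pi - c k \<in> S_int" "g1 (pi - c i) = g1 (pi - c k)"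
          using cr(2)[OF i f] cr(2)[OF ik(2) False] False eq by (auto simp: V_def vertex_def S_int_mem)
        then have "pi - c i = pi - c k" using inj_onD[OF D1(1)] by blast
        then show ?thesis by simp
      qed
      ultimately show False by simp
    next
      case False
      then have "V i (c i) \<in> side_arc 1 a \<Omega>" "V k (c k) \<in> side_arc (-1) a \<Omega>" using mem[OF i] mem[OF ik(2)] ik by auto
      then show False using eq a by (auto simp: side_arc_def)
    qed
  qed
  have ne: "V i (c i) \<noteq> V k (c k)" if "i \<noteq> k" "i < n" "k < n" for i k
    using distinct[of i k] distinct[of k i] that by (metis linorder_neqE_nat)
  have refl: "reflection_law \<Omega> (V i (c i)) (V j (c j)) (V k (c k))"
    if i: "i < n" and jk: "j = Suc i mod n" "k = Suc j mod n" for i j k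
    unfolding reflection_law_def
  proof
    have jn: "j < n" "k < n" "i \<noteq> j" "k \<noteq> j" using n2 i jk by (auto simp: mod_Suc)
    fix u assume "u \<in> tangent_space (frontier \<Omega>) (V j (c j))"
    then obtain x where x: "x ` {-1<..<1} \<subseteq> frontier \<Omega>" "x 0 = V j (c j)" "(x has_vector_derivative u) (at 0)"
      unfolding tangent_space_def by blast
    \<comment> \<open>The room that vertex \<open>j\<close> has before it leaves the box.\<close>
    define \<delta> where "\<delta> = \<rho> - \<bar>c j - angle j\<bar>"
    have d: "\<delta> > 0" using c[OF jn(1)] by (simp add: \<delta>_def)
    have "\<exists>\<epsilon>>0. \<forall>q\<in>frontier \<Omega>. dist q (V j (c j)) < \<epsilon> \<longrightarrow> (\<exists>s. \<bar>s - c j\<bar> < \<delta> \<and> q = V j s)"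
    proof (cases "j < m\<^sub>2")
      case True
      have "\<exists>\<epsilon>>0. \<forall>q\<in>frontier \<Omega>. dist q (g2 (c j)) < \<epsilon> \<longrightarrow> (\<exists>s'\<in>S_int. \<bar>s' - c j\<bar> < \<delta> \<and> q = g2 s')"
        by (rule frontier_near_arc[OF a _ arcs(2) fr cr(1)[OF jn(1) True] d]) simp
      then show ?thesis using True unfolding V_def vertex_def by (simp only: if_True) blast
    next
      case False
      have "\<exists>\<epsilon>>0. \<forall>q\<in>frontier \<Omega>. dist q (g1 (pi - c j)) < \<epsilon> \<longrightarrow> (\<exists>s'\<in>S_int. \<bar>s' - (pi - c j)\<bar> < \<delta> \<and> q = g1 s')"
        by (rule frontier_near_arc[OF a _ arcs(1) fr cr(2)[OF jn(1) False] d]) simp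
      then obtain \<epsilon> where e: "\<epsilon> > 0" "\<And>q. q \<in> frontier \<Omega> \<Longrightarrow> dist q (g1 (pi - c j)) < \<epsilon> \<Longrightarrow> \<exists>s'\<in>S_int. \<bar>s' - (pi - c j)\<bar> < \<delta> \<and> q = g1 s'"
        by blast
      have "\<exists>s. \<bar>s - c j\<bar> < \<delta> \<and> q = g1 (pi - s)" if q: "q \<in> frontier \<Omega>" "dist q (g1 (pi - c j)) < \<epsilon>" for q
      proof -
        obtain s' where s': "\<bar>s' - (pi - c j)\<bar> < \<delta>" "q = g1 s'" using e(2)[OF q] by blast
        then show ?thesis by (intro exI[of _ "pi - s'"]) auto
      qed
      then show ?thesis using e(1) False unfolding V_def vertex_def by (simp only: if_False) blast
    qed
    then obtain \<epsilon> where e: "\<epsilon> > 0" "\<And>q. q \<in> frontier \<Omega> \<Longrightarrow> dist q (V j (c j)) < \<epsilon> \<Longrightarrow> \<exists>s. \<bar>s - c j\<bar> < \<delta> \<and> q = V j s"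
      by blast
    have "isCont x 0" using has_vector_derivative_continuous[OF x(3)] by simp
    then obtain d where d: "d > 0" "\<And>t. \<bar>t\<bar> < d \<Longrightarrow> dist (x t) (x 0) < \<epsilon>"
      using e(1) unfolding continuous_at_eps_delta by (auto simp: dist_real_def)
    show "sgn (V i (c i) - V j (c j)) \<bullet> (- u) = sgn (V k (c k) - V j (c j)) \<bullet> u"
    proof (rule reflection_at_maximum[OF x(3) x(2)])
      show "V i (c i) \<noteq> V j (c j)" "V k (c k) \<noteq> V j (c j)" using ne i jn by auto
      show "min d 1 > 0" using d(1) by simp
      fix t :: real assume t: "\<bar>t\<bar> < min d 1"
      then have "x t \<in> frontier \<Omega>" using x(1) by (auto simp: image_subset_iff abs_less_iff)
      moreover have "dist (x t) (V j (c j)) < \<epsilon>" using d(2)[of t] t x(2) by simp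
      ultimately obtain s where s: "\<bar>s - c j\<bar> < \<delta>" "x t = V j s" using e(2) by blast
      have "\<bar>(c(j := s)) l - angle l\<bar> \<le> \<rho>" if "l < n" for l
        using c[OF that] s(1) by (auto simp: \<delta>_def)
      then have "perimeter n V (c(j := s)) \<le> perimeter n V c" unfolding V_def by (intro max) auto
      then show "dist (V i (c i)) (x t) + dist (x t) (V k (c k)) \<le> dist (V i (c i)) (V j (c j)) + dist (V j (c j)) (V k (c k))"
        using perimeter_update[OF n2(1) i, of V c s] unfolding jk s(2) by linarith
    qed
  qed
  have "closed_billiard_trajectory \<Omega> n p"
    unfolding closed_billiard_trajectory_def
  proof (intro conjI allI impI)
    show "2 \<le> n" by (rule n2)
    show "p (i + n) = p i" for i by (simp add: p_def)
    show "\<exists>i. p (i + d) \<noteq> p i" if "0 < d \<and> d < n" for d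
      using ne[of d 0] that by (intro exI[of _ 0]) (simp add: p_def)
    fix i
    define i' where "i' = i mod n"
    have i': "i' < n" using n2 by (simp add: i'_def)
    have S: "Suc i mod n = Suc i' mod n" "Suc (Suc i) mod n = Suc (Suc i' mod n) mod n"
      by (simp_all add: i'_def mod_Suc_eq)
    show "p i \<in> frontier \<Omega>" using vfr[OF i'] by (simp add: p_def i'_def)
    show pne: "p i \<noteq> p (Suc i)" using ne[of i' "Suc i' mod n"] i' n2 unfolding p_def S i'_def[symmetric] by (auto simp: mod_Suc)
    show "open_segment (p i) (p (Suc i)) \<subseteq> \<Omega>"
    proof -
      obtain w where w: "0 < w" "w < 1" "(1 - w) *\<^sub>R p i + w *\<^sub>R p (Suc i) \<notin> frontier \<Omega>"
        using z[OF i'] unfolding p_def S i'_def[symmetric] V_def by blast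
      have "p i \<in> closure \<Omega>" "p (Suc i) \<in> closure \<Omega>"
        using vfr[OF i'] vfr[of "Suc i' mod n"] n2 unfolding p_def S i'_def[symmetric] by (auto simp: frontier_def)
      then show ?thesis using open_segment_in_convex[OF om _ _ pne w] by blast
    qed
    show "reflection_law \<Omega> (p i) (p (Suc i)) (p (Suc (Suc i)))"
      unfolding p_def S i'_def[symmetric] by (rule refl[OF i' HOL.refl HOL.refl])
  qed
  moreover have "(\<Sum>i<n. dist (p i) (p (Suc i))) = perimeter n V c"
    unfolding perimeter_def p_def by (intro sum.cong) auto
  ultimately show ?thesis unfolding length_spectrum_def V_def by (metis (mono_tags, lifting) mem_Collect_eq)
qed

end


section \<open>Isospectral families\<close>

lemma common_radius:
  fixes P :: "nat \<Rightarrow> real \<Rightarrow> bool"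
  assumes "\<And>i. i < k \<Longrightarrow> \<exists>r>0. P i r" "\<And>i r r'. P i r \<Longrightarrow> 0 < r' \<Longrightarrow> r' \<le> r \<Longrightarrow> P i r'"
  shows "\<exists>r>0. \<forall>i<k. P i r"
  using assms(1)
proof (induction k)
  case 0 then show ?case by (intro exI[of _ 1]) auto
next
  case (Suc k)
  have "\<exists>r>0. \<forall>i<k. P i r" by (rule Suc.IH) (use Suc.prems in auto)
  then obtain r where r: "r > 0" "\<And>i. i < k \<Longrightarrow> P i r" by blast
  obtain r' where r': "r' > 0" "P k r'" using Suc.prems[of k] by auto
  have "P i (min r r')" if "i < Suc k" for i
  proof (cases "i = k")
    case True then show ?thesis using assms(2)[OF r'(2)] r(1) r'(1) by simp
  next
    case False then show ?thesis using assms(2)[OF r(2)] that r(1) r'(1) by simp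
  qed
  then show ?case using r(1) r'(1) by (intro exI[of _ "min r r'"]) auto
qed

lemma dist_unit_vec_le: "dist (unit_vec s) (unit_vec t) \<le> 2 * \<bar>s - t\<bar>"
proof -
  have "\<bar>cos s - cos t\<bar> = 2 * \<bar>sin ((s + t) / 2)\<bar> * \<bar>sin ((t - s) / 2)\<bar>" by (simp add: cos_diff_cos abs_mult)
  also have "\<dots> \<le> 2 * 1 * \<bar>(t - s) / 2\<bar>" by (intro mult_mono abs_sin_x_le_abs_x) auto
  finally have 1: "\<bar>cos s - cos t\<bar> \<le> \<bar>s - t\<bar>" by simp
  have "\<bar>sin s - sin t\<bar> = 2 * \<bar>sin ((s - t) / 2)\<bar> * \<bar>cos ((s + t) / 2)\<bar>" by (simp add: sin_diff_sin abs_mult)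
  also have "\<dots> \<le> 2 * \<bar>(s - t) / 2\<bar> * 1" by (intro mult_mono abs_sin_x_le_abs_x) auto
  finally have 2: "\<bar>sin s - sin t\<bar> \<le> \<bar>s - t\<bar>" by simp
  have "dist (unit_vec s) (unit_vec t) \<le> \<bar>cos s - cos t\<bar> + \<bar>sin s - sin t\<bar>"
    unfolding unit_vec_def dist_norm by (simp add: norm_Pair sqrt_sum_squares_le_sum_abs)
  also have "\<dots> \<le> \<bar>s - t\<bar> + \<bar>s - t\<bar>" by (rule add_mono[OF 1 2])
  finally show ?thesis by simp
qed

lemma sum_lessThan_add:
  fixes f :: "nat \<Rightarrow> 'b::comm_monoid_add"
  shows "(\<Sum>i<m + k. f i) = (\<Sum>i<m. f i) + (\<Sum>j<k. f (m + j))"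
  by (induction k) (auto simp: add.assoc)

context stadium_orbit
begin

lemma small_mono: "small r \<Longrightarrow> 0 < r' \<Longrightarrow> r' \<le> r \<Longrightarrow> small r'"
  unfolding small_def by (meson le_less_trans order.trans)

lemma small_exists: "\<exists>r. small r"
proof -
  define P where "P = (\<lambda>i r. \<forall>s. \<bar>s - angle i\<bar> \<le> r \<longrightarrow>
     (i < m\<^sub>2 \<longrightarrow> \<bar>s\<bar> < pi/2) \<and> (\<not> i < m\<^sub>2 \<longrightarrow> \<bar>pi - s\<bar> < pi/2))"
  have "\<exists>r>0. P i r" if i: "i < n" for i
  proof (cases "i < m\<^sub>2")
    case True
    have "\<bar>s\<bar> < pi/2" if "\<bar>s - angle i\<bar> \<le> (pi/2 - \<bar>angle i\<bar>) / 2" for s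
      using angle_range(1)[OF i True] that abs_triangle_ineq[of "angle i" "s - angle i"] by simp
    then show ?thesis using angle_range(1)[OF i True] True unfolding P_def
      by (intro exI[of _ "(pi/2 - \<bar>angle i\<bar>) / 2"]) auto
  next
    case False
    have "\<bar>pi - s\<bar> < pi/2" if "\<bar>s - angle i\<bar> \<le> (pi/2 - \<bar>pi - angle i\<bar>) / 2" for s
      using angle_range(2)[OF i False] that abs_triangle_ineq[of "pi - angle i" "angle i - s"] by (simp add: abs_minus_commute)
    then show ?thesis using angle_range(2)[OF i False] False unfolding P_def
      by (intro exI[of _ "(pi/2 - \<bar>pi - angle i\<bar>) / 2"]) auto
  qed
  moreover have "P i r \<Longrightarrow> 0 < r' \<Longrightarrow> r' \<le> r \<Longrightarrow> P i r'" for i r r' unfolding P_def by (meson order.trans)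
  ultimately have "\<exists>r>0. \<forall>i<n. P i r" by (rule common_radius)
  then obtain r where r: "r > 0" "\<forall>i<n. P i r" by blast
  have "small (min r (min al1 al2 / 2))"
    unfolding small_def
  proof (intro conjI allI impI)
    show "0 < min r (min al1 al2 / 2)" "min r (min al1 al2 / 2) < min al1 al2" using r(1) al_bounds by auto
    fix i s assume i: "i < n" "\<bar>s - angle i\<bar> \<le> min r (min al1 al2 / 2)"
    then have "\<bar>s - angle i\<bar> \<le> r" by simp
    then have *: "(i < m\<^sub>2 \<longrightarrow> \<bar>s\<bar> < pi/2) \<and> (\<not> i < m\<^sub>2 \<longrightarrow> \<bar>pi - s\<bar> < pi/2)" using r(2) i(1) unfolding P_def by blast
    show "\<bar>s\<bar> < pi/2" if "i < m\<^sub>2" using * that by blast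
    show "\<bar>pi - s\<bar> < pi/2" if "\<not> i < m\<^sub>2" using * that by blast
  qed
  then show ?thesis by blast
qed

lemma small_range:
  assumes "small r" "i < n" "\<bar>s - angle i\<bar> \<le> r"
  shows "i < m\<^sub>2 \<Longrightarrow> s \<in> S_int" "\<not> i < m\<^sub>2 \<Longrightarrow> pi - s \<in> S_int"
proof -
  have "(i < m\<^sub>2 \<longrightarrow> \<bar>s\<bar> < pi/2) \<and> (\<not> i < m\<^sub>2 \<longrightarrow> \<bar>pi - s\<bar> < pi/2)"
    using assms unfolding small_def by blast
  then show "i < m\<^sub>2 \<Longrightarrow> s \<in> S_int" "\<not> i < m\<^sub>2 \<Longrightarrow> pi - s \<in> S_int" by (auto simp: S_int_mem)
qed

lemma vertex_stadium:
  assumes arcs: "is_arc_of (-1) a (stadium a) g1" "is_arc_of 1 a (stadium a) g2"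
    and s: "small r" "i < n" "\<bar>s - angle i\<bar> \<le> r"
  shows "vertex g1 g2 i s = on_circle i s"
proof (cases "i < m\<^sub>2")
  case True
  have "g2 s = (1 * (a/2 + cos s), sin s)"
    by (rule stadium_arc_eq[OF a _ arcs(2) small_range(1)[OF s True]]) simp
  then show ?thesis using True by (simp add: vertex_def on_circle_def centre_def unit_vec_def)
next
  case False
  have "g1 (pi - s) = (-1 * (a/2 + cos (pi - s)), sin (pi - s))"
    by (rule stadium_arc_eq[OF a _ arcs(1) small_range(2)[OF s False]]) simp
  then show ?thesis using False by (simp add: vertex_def on_circle_def centre_def unit_vec_def)
qed

lemma perimeter_stadium:
  assumes arcs: "is_arc_of (-1) a (stadium a) g1" "is_arc_of 1 a (stadium a) g2"
    and s: "small r" "\<And>i. i < n \<Longrightarrow> \<bar>c i - angle i\<bar> \<le> r"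
  shows "perimeter n (vertex g1 g2) c = perimeter n on_circle c"
  unfolding perimeter_def
proof (intro sum.cong refl)
  fix i assume "i \<in> {..<n}"
  then have i: "i < n" by simp
  show "dist (vertex g1 g2 i (c i)) (vertex g1 g2 (Suc i mod n) (c (Suc i mod n))) =
      dist (on_circle i (c i)) (on_circle (Suc i mod n) (c (Suc i mod n)))"
    unfolding vertex_stadium[OF arcs s(1) i s(2)[OF i]] vertex_stadium[OF arcs s(1) n_pos(2) s(2)[OF n_pos(2)]] ..
qed

lemma sides_deep_in_stadium:
  "\<exists>\<eta>>0. \<forall>i<n. \<exists>w\<in>{0<..<1}.
     ball ((1 - w) *\<^sub>R on_circle i (angle i) + w *\<^sub>R on_circle (Suc i mod n) (angle (Suc i mod n))) \<eta> \<subseteq> stadium a"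
proof (rule common_radius)
  fix i assume "i < n"
  then obtain w where w: "w \<in> {0<..<1}"
    "(1 - w) *\<^sub>R on_circle i (angle i) + w *\<^sub>R on_circle (Suc i mod n) (angle (Suc i mod n)) \<in> stadium a"
    using side_meets_stadium[of i] by blast
  then show "\<exists>r>0. \<exists>w\<in>{0<..<1}.
     ball ((1 - w) *\<^sub>R on_circle i (angle i) + w *\<^sub>R on_circle (Suc i mod n) (angle (Suc i mod n))) r \<subseteq> stadium a"
    using open_contains_ball[THEN iffD1, OF open_stadium[OF a]] by blast
next
  fix i and r r' :: real
  assume A: "\<exists>w\<in>{0<..<1}.
     ball ((1 - w) *\<^sub>R on_circle i (angle i) + w *\<^sub>R on_circle (Suc i mod n) (angle (Suc i mod n))) r \<subseteq> stadium a"
    and r: "0 < r'" "r' \<le> r"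
  show "\<exists>w\<in>{0<..<1}.
     ball ((1 - w) *\<^sub>R on_circle i (angle i) + w *\<^sub>R on_circle (Suc i mod n) (angle (Suc i mod n))) r' \<subseteq> stadium a"
    using A subset_ball[OF r(2)] by (meson order.trans)
qed

text \<open>The marked point of the side moves by at most \<eta>/2: \<eta>/4 from the deformation of
  the arcs and 2 (\<eta>/8) from the change of parameters. A point of the new frontier is within
  \<eta>/4 of the old one. Since 3/4 \<eta> < \<eta>, a point of the old frontier would lie in the
  open stadium.\<close>

lemma side_avoids_frontier:
  assumes arcs0: "is_arc_of (-1) a (stadium a) h1" "is_arc_of 1 a (stadium a) h2"
    and arcs: "is_arc_of (-1) a \<Omega> g1" "is_arc_of 1 a \<Omega> g2"
    and fr0: "frontier (stadium a) = E_top a \<union> E_bot a \<union> side_arc (-1) a (stadium a) \<union> side_arc 1 a (stadium a)"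
    and fr: "frontier \<Omega> = E_top a \<union> E_bot a \<union> side_arc (-1) a \<Omega> \<union> side_arc 1 a \<Omega>"
    and r: "small r" "r \<le> \<eta> / 8" "\<eta> > 0" and near: "\<And>s. s \<in> S_int \<Longrightarrow> dist (g1 s) (h1 s) \<le> \<eta> / 4" "\<And>s. s \<in> S_int \<Longrightarrow> dist (g2 s) (h2 s) \<le> \<eta> / 4"
    and c: "\<And>i. i < n \<Longrightarrow> \<bar>c i - angle i\<bar> \<le> r" and i: "i < n" and w: "w \<in> {0<..<1}"
    and deep: "ball ((1 - w) *\<^sub>R on_circle i (angle i) + w *\<^sub>R on_circle (Suc i mod n) (angle (Suc i mod n))) \<eta> \<subseteq> stadium a"
  shows "(1 - w) *\<^sub>R vertex g1 g2 i (c i) + w *\<^sub>R vertex g1 g2 (Suc i mod n) (c (Suc i mod n)) \<notin> frontier \<Omega>"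
proof
  define z where "z = (1 - w) *\<^sub>R on_circle i (angle i) + w *\<^sub>R on_circle (Suc i mod n) (angle (Suc i mod n))"
  define z' where "z' = (1 - w) *\<^sub>R vertex g1 g2 i (c i) + w *\<^sub>R vertex g1 g2 (Suc i mod n) (c (Suc i mod n))"
  assume "(1 - w) *\<^sub>R vertex g1 g2 i (c i) + w *\<^sub>R vertex g1 g2 (Suc i mod n) (c (Suc i mod n)) \<in> frontier \<Omega>"
  then have zf: "z' \<in> frontier \<Omega>" by (simp add: z'_def)
  have close: "dist (vertex g1 g2 j (c j)) (on_circle j (angle j)) \<le> \<eta> / 2" if j: "j < n" for j
  proof -
    have "dist (vertex g1 g2 j (c j)) (vertex h1 h2 j (c j)) \<le> \<eta> / 4"
    proof (cases "j < m\<^sub>2")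
      case True
      show ?thesis using near(2)[OF small_range(1)[OF r(1) j c[OF j] True]] True by (simp add: vertex_def)
    next
      case False
      show ?thesis using near(1)[OF small_range(2)[OF r(1) j c[OF j] False]] False by (simp add: vertex_def)
    qed
    moreover have "vertex h1 h2 j (c j) = on_circle j (c j)" by (rule vertex_stadium[OF arcs0 r(1) j c[OF j]])
    moreover have "dist (on_circle j (c j)) (on_circle j (angle j)) \<le> 2 * \<bar>c j - angle j\<bar>"
      using dist_unit_vec_le[of "c j" "angle j"] by (simp add: on_circle_def dist_norm)
    moreover have "\<bar>c j - angle j\<bar> \<le> \<eta> / 8" using c[OF j] r(2) by linarith
    ultimately show ?thesis
      using dist_triangle[of "vertex g1 g2 j (c j)" "on_circle j (angle j)" "on_circle j (c j)"] by simp
  qed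
  have w01: "0 \<le> w" "0 \<le> 1 - w" using w by auto
  define x where "x = vertex g1 g2 i (c i) - on_circle i (angle i)"
  define y where "y = vertex g1 g2 (Suc i mod n) (c (Suc i mod n)) - on_circle (Suc i mod n) (angle (Suc i mod n))"
  have "z' - z = (1 - w) *\<^sub>R x + w *\<^sub>R y" by (simp add: z_def z'_def x_def y_def algebra_simps)
  then have "dist z z' \<le> (1 - w) * norm x + w * norm y"
    using norm_triangle_ineq[of "(1 - w) *\<^sub>R x" "w *\<^sub>R y"] w01 by (simp add: dist_norm norm_minus_commute)
  also have "\<dots> \<le> (1 - w) * (\<eta> / 2) + w * (\<eta> / 2)"
    using close[OF i] close[OF n_pos(2)[of i]] w01 unfolding dist_norm x_def y_def by (intro add_mono mult_left_mono)
  also have "\<dots> = \<eta> / 2" by (simp add: field_simps)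
  finally have zz: "dist z z' \<le> \<eta> / 2" .
  have "\<exists>q\<in>frontier (stadium a). dist z' q \<le> \<eta> / 4"
  proof -
    have side: "\<exists>q\<in>side_arc \<sigma> a (stadium a). dist z' q \<le> \<eta> / 4"
      if H: "is_arc_of \<sigma> a \<Omega> g" "is_arc_of \<sigma> a (stadium a) h" "\<And>s. s \<in> S_int \<Longrightarrow> dist (g s) (h s) \<le> \<eta> / 4" "z' \<in> side_arc \<sigma> a \<Omega>" for g h \<sigma>
    proof -
      have "g ` S_int = side_arc \<sigma> a \<Omega>" "h ` S_int = side_arc \<sigma> a (stadium a)"
        using H(1,2) unfolding is_arc_of_def constant_speed_param_def by blast+
      then obtain s where "s \<in> S_int" "z' = g s" "h s \<in> side_arc \<sigma> a (stadium a)" using H(4) by blast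
      then show ?thesis using H(3) by blast
    qed
    consider "z' \<in> E_top a \<union> E_bot a" | "z' \<in> side_arc (-1) a \<Omega>" | "z' \<in> side_arc 1 a \<Omega>" using zf fr by blast
    then show ?thesis
    proof cases
      case 1
      then have "z' \<in> frontier (stadium a)" using fr0 by blast
      moreover have "dist z' z' \<le> \<eta> / 4" using r(3) by simp
      ultimately show ?thesis by blast
    next
      case 2
      from side[OF arcs(1) arcs0(1) near(1) 2] show ?thesis using fr0 by blast
    next
      case 3
      from side[OF arcs(2) arcs0(2) near(2) 3] show ?thesis using fr0 by blast
    qed
  qed
  then obtain q where q: "q \<in> frontier (stadium a)" "dist z' q \<le> \<eta> / 4" by blast
  have "dist z q < \<eta>" using dist_triangle[of z q z'] zz q(2) r(3) by linarith
  then have "q \<in> stadium a" using subsetD[OF deep, of q] by (simp add: z_def)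
  then show False using q(1) open_stadium[OF a] by (simp add: frontier_def interior_open)
qed


text \<open>Persistence is applied with \<open>L\<close> the length spectrum of the stadium, which
  by isospectrality is that of every deformed domain and contains no interval. The resulting first
  variation is rewritten with inward normals.\<close>

lemma orbit_condition_of_isospectral_family:
  fixes \<gamma>1 \<gamma>2 :: "real \<Rightarrow> real \<Rightarrow> point"
  assumes om: "\<And>\<tau>. \<tau> \<in> {-1..1} \<Longrightarrow> open (\<Omega> \<tau>)" "\<And>\<tau>. \<tau> \<in> {-1..1} \<Longrightarrow> convex (\<Omega> \<tau>)"
    and fr: "\<And>\<tau>. \<tau> \<in> {-1..1} \<Longrightarrow> frontier (\<Omega> \<tau>) = E_top a \<union> E_bot a \<union> side_arc (-1) a (\<Omega> \<tau>) \<union> side_arc 1 a (\<Omega> \<tau>)"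
    and arc1: "\<And>\<tau>. \<tau> \<in> {-1..1} \<Longrightarrow> is_arc_of (-1) a (\<Omega> \<tau>) (\<gamma>1 \<tau>)"
    and arc2: "\<And>\<tau>. \<tau> \<in> {-1..1} \<Longrightarrow> is_arc_of 1 a (\<Omega> \<tau>) (\<gamma>2 \<tau>)"
    and om0: "\<Omega> 0 = stadium a" and iso: "dynamically_isospectral \<Omega>"
    and unif1: "\<And>t \<epsilon>. t \<in> {-1..1} \<Longrightarrow> \<epsilon> > 0 \<Longrightarrow> \<exists>\<delta>>0. \<forall>\<tau>\<in>{-1..1}. \<bar>\<tau> - t\<bar> < \<delta> \<longrightarrow> (\<forall>s\<in>S_int. dist (\<gamma>1 \<tau> s) (\<gamma>1 t s) \<le> \<epsilon>)"
    and unif2: "\<And>t \<epsilon>. t \<in> {-1..1} \<Longrightarrow> \<epsilon> > 0 \<Longrightarrow> \<exists>\<delta>>0. \<forall>\<tau>\<in>{-1..1}. \<bar>\<tau> - t\<bar> < \<delta> \<longrightarrow> (\<forall>s\<in>S_int. dist (\<gamma>2 \<tau> s) (\<gamma>2 t s) \<le> \<epsilon>)"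
    and w1: "\<And>s. s \<in> S_int \<Longrightarrow> ((\<lambda>\<tau>. \<gamma>1 \<tau> s) has_vector_derivative w1 s) (at 0)"
    and w2: "\<And>s. s \<in> S_int \<Longrightarrow> ((\<lambda>\<tau>. \<gamma>2 \<tau> s) has_vector_derivative w2 s) (at 0)"
    and h1: "\<And>s. s \<in> S_int \<Longrightarrow> h1 s = w1 s \<bullet> (cos s, - sin s)"
    and h2: "\<And>s. s \<in> S_int \<Longrightarrow> h2 s = w2 s \<bullet> (- cos s, - sin s)"
    and even: "\<And>s. s \<in> S_int \<Longrightarrow> h1 (- s) = h1 s"
  shows "sin al1 * (\<Sum>j<m\<^sub>1. h1 ((2 * real j + 1 - real m\<^sub>1) * al1)) + sin al2 * (\<Sum>j<m\<^sub>2. h2 ((2 * real j + 1 - real m\<^sub>2) * al2)) = 0"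
proof -
  define V where "V = (\<lambda>\<tau>. vertex (\<gamma>1 \<tau>) (\<gamma>2 \<tau>))"
  have z0: "(0::real) \<in> {-1..1}" by simp
  have arcs0: "is_arc_of (-1) a (stadium a) (\<gamma>1 0)" "is_arc_of 1 a (stadium a) (\<gamma>2 0)"
    using arc1[OF z0] arc2[OF z0] by (simp_all add: om0)
  have fr0: "frontier (stadium a) = E_top a \<union> E_bot a \<union> side_arc (-1) a (stadium a) \<union> side_arc 1 a (stadium a)"
    using fr[OF z0] by (simp only: om0)
  obtain \<eta> where eta: "\<eta> > 0" "\<And>i. i < n \<Longrightarrow> \<exists>w\<in>{0<..<1}.
     ball ((1 - w) *\<^sub>R on_circle i (angle i) + w *\<^sub>R on_circle (Suc i mod n) (angle (Suc i mod n))) \<eta> \<subseteq> stadium a"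
    using sides_deep_in_stadium by blast
  obtain r1 where r1: "small r1" using small_exists by blast
  obtain r2 where r2: "r2 > 0" "\<And>c. (\<And>i. i < n \<Longrightarrow> \<bar>c i - angle i\<bar> \<le> r2) \<Longrightarrow>
      perimeter n on_circle c \<ge> perimeter n on_circle angle \<Longrightarrow> (\<forall>i<n. c i = angle i)"
    using orbit_strict_max by blast
  \<comment> \<open>Three demands on the box: vertices distinct and off the junctions
    (\<open>r1\<close>), strictness of the maximum (\<open>r2\<close>), and sides that keep their
    marked points away from the frontier (\<eta>/8).\<close>
  define \<rho> where "\<rho> = min (min r1 r2) (\<eta> / 8)"
  have rho: "\<rho> > 0" "\<rho> \<le> r1" "\<rho> \<le> r2" "\<rho> \<le> \<eta> / 8" using r1 r2(1) eta(1) by (auto simp: \<rho>_def small_def)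
  have sm: "small \<rho>" by (rule small_mono[OF r1 rho(1,2)])
  have V0: "V 0 i s = on_circle i s" if "i < n" "\<bar>s - angle i\<bar> \<le> \<rho>" for i s
    unfolding V_def by (rule vertex_stadium[OF arcs0 sm that])
  have per0: "perimeter n (V 0) c = perimeter n on_circle c" if "\<And>i. i < n \<Longrightarrow> \<bar>c i - angle i\<bar> \<le> \<rho>" for c
    unfolding V_def using that by (rule perimeter_stadium[OF arcs0 sm])
  have per_angle: "perimeter n (V 0) angle = perimeter n on_circle angle" by (rule per0) (use rho in simp)
  have box: "i < m\<^sub>2 \<Longrightarrow> s \<in> S_int" "\<not> i < m\<^sub>2 \<Longrightarrow> pi - s \<in> S_int"
    if H: "i < n" "s \<in> {angle i - \<rho>..angle i + \<rho>}" for i s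
  proof -
    have "\<bar>s - angle i\<bar> \<le> \<rho>" using H(2) by auto
    from small_range[OF sm H(1) this] show "i < m\<^sub>2 \<Longrightarrow> s \<in> S_int" "\<not> i < m\<^sub>2 \<Longrightarrow> pi - s \<in> S_int" by blast+
  qed
  have unifV: "\<exists>\<delta>>0. \<forall>\<tau>. \<bar>\<tau>\<bar> \<le> 1 \<longrightarrow> \<bar>\<tau> - t\<bar> < \<delta> \<longrightarrow>
      (\<forall>s\<in>S_int. dist (\<gamma>1 \<tau> s) (\<gamma>1 t s) \<le> \<epsilon> \<and> dist (\<gamma>2 \<tau> s) (\<gamma>2 t s) \<le> \<epsilon>)" if H: "\<bar>t\<bar> \<le> 1" "\<epsilon> > 0" for t \<epsilon>
  proof -
    have t: "t \<in> {-1..1}" using H(1) by auto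
    obtain d1 where d1: "d1 > 0" "\<forall>\<tau>\<in>{-1..1}. \<bar>\<tau> - t\<bar> < d1 \<longrightarrow> (\<forall>s\<in>S_int. dist (\<gamma>1 \<tau> s) (\<gamma>1 t s) \<le> \<epsilon>)"
      using unif1[OF t H(2)] by blast
    obtain d2 where d2: "d2 > 0" "\<forall>\<tau>\<in>{-1..1}. \<bar>\<tau> - t\<bar> < d2 \<longrightarrow> (\<forall>s\<in>S_int. dist (\<gamma>2 \<tau> s) (\<gamma>2 t s) \<le> \<epsilon>)"
      using unif2[OF t H(2)] by blast
    show ?thesis
    proof (intro exI[of _ "min d1 d2"] conjI allI impI ballI)
      show "min d1 d2 > 0" using d1(1) d2(1) by simp
      fix \<tau> s assume A: "\<bar>\<tau>\<bar> \<le> 1" "\<bar>\<tau> - t\<bar> < min d1 d2" "s \<in> S_int"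
      have T: "\<tau> \<in> {-1..1}" using A(1) by auto
      show "dist (\<gamma>1 \<tau> s) (\<gamma>1 t s) \<le> \<epsilon>" using d1(2) T A(2,3) by simp
      show "dist (\<gamma>2 \<tau> s) (\<gamma>2 t s) \<le> \<epsilon>" using d2(2) T A(2,3) by simp
    qed
  qed
  obtain \<delta> where delta: "\<delta> > 0" "\<And>\<tau> s. \<bar>\<tau>\<bar> \<le> 1 \<Longrightarrow> \<bar>\<tau> - 0\<bar> < \<delta> \<Longrightarrow> s \<in> S_int \<Longrightarrow>
      dist (\<gamma>1 \<tau> s) (\<gamma>1 0 s) \<le> \<eta> / 4 \<and> dist (\<gamma>2 \<tau> s) (\<gamma>2 0 s) \<le> \<eta> / 4"
    using unifV[of 0 "\<eta> / 4"] eta(1) by fastforce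
  have "\<exists>\<tau>\<^sub>0>0. \<forall>\<tau>. \<bar>\<tau>\<bar> \<le> \<tau>\<^sub>0 \<longrightarrow> perimeter n (V \<tau>) angle \<le> perimeter n (V 0) angle"
  proof (rule strict_max_persists[OF n_pos(1) rho(1), where L = "length_spectrum (stadium a)"])
    fix \<tau> :: real and i assume A: "\<bar>\<tau>\<bar> \<le> 1" "i < n"
    have T: "\<tau> \<in> {-1..1}" using A(1) by auto
    have ct: "continuous_on S_int (\<gamma>1 \<tau>)" "continuous_on S_int (\<gamma>2 \<tau>)"
      using arc1[OF T] arc2[OF T] constant_speed_paramD(5) unfolding is_arc_of_def by blast+
    show "continuous_on {angle i - \<rho>..angle i + \<rho>} (V \<tau> i)"
    proof (cases "i < m\<^sub>2")
      case True
      have "continuous_on {angle i - \<rho>..angle i + \<rho>} (\<gamma>2 \<tau>)"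
        by (rule continuous_on_subset[OF ct(2)]) (use box(1)[OF A(2) _ True] in blast)
      then show ?thesis using True unfolding V_def vertex_def by simp
    next
      case False
      have "continuous_on {angle i - \<rho>..angle i + \<rho>} (\<lambda>s. \<gamma>1 \<tau> (pi - s))"
      proof (rule continuous_on_compose2[OF ct(1)])
        show "continuous_on {angle i - \<rho>..angle i + \<rho>} (\<lambda>s. pi - s)" by (intro continuous_intros)
        show "(\<lambda>s. pi - s) ` {angle i - \<rho>..angle i + \<rho>} \<subseteq> S_int" using box(2)[OF A(2) _ False] by blast
      qed
      then show ?thesis using False unfolding V_def vertex_def by simp
    qed
  next
    fix t \<epsilon> :: real assume A: "\<bar>t\<bar> \<le> 1" "\<epsilon> > 0"
    obtain d where d: "d > 0" "\<forall>\<tau>. \<bar>\<tau>\<bar> \<le> 1 \<longrightarrow> \<bar>\<tau> - t\<bar> < d \<longrightarrow>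
      (\<forall>s\<in>S_int. dist (\<gamma>1 \<tau> s) (\<gamma>1 t s) \<le> \<epsilon> \<and> dist (\<gamma>2 \<tau> s) (\<gamma>2 t s) \<le> \<epsilon>)" using unifV[OF A] by blast
    show "\<exists>\<delta>>0. \<forall>\<tau>. \<bar>\<tau>\<bar> \<le> 1 \<longrightarrow> \<bar>\<tau> - t\<bar> < \<delta> \<longrightarrow> (\<forall>i<n. \<forall>s\<in>{angle i - \<rho>..angle i + \<rho>}. dist (V \<tau> i s) (V t i s) \<le> \<epsilon>)"
    proof (intro exI[of _ d] conjI allI impI ballI d(1))
      fix \<tau> i s assume B: "\<bar>\<tau>\<bar> \<le> 1" "\<bar>\<tau> - t\<bar> < d" "i < n" "s \<in> {angle i - \<rho>..angle i + \<rho>}"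
      show "dist (V \<tau> i s) (V t i s) \<le> \<epsilon>"
      proof (cases "i < m\<^sub>2")
        case True
        show ?thesis using d(2) B(1,2) box(1)[OF B(3,4) True] True unfolding V_def vertex_def by simp
      next
        case False
        show ?thesis using d(2) B(1,2) box(2)[OF B(3,4) False] False unfolding V_def vertex_def by simp
      qed
    qed
  next
    fix c :: "nat \<Rightarrow> real" assume A: "\<And>i. i < n \<Longrightarrow> \<bar>c i - angle i\<bar> \<le> \<rho>" "perimeter n (V 0) c \<ge> perimeter n (V 0) angle"
    show "\<forall>i<n. c i = angle i"
    proof (rule r2(2))
      show "\<bar>c i - angle i\<bar> \<le> r2" if "i < n" for i using A(1)[OF that] rho(3) by linarith
      show "perimeter n on_circle angle \<le> perimeter n on_circle c" using A(2) per0[of c] A(1) per_angle by simp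
    qed
  next
    show "min 1 (\<delta> / 2) > 0" using delta(1) by simp
  next
    fix \<tau> :: real and c :: "nat \<Rightarrow> real"
    assume A: "\<bar>\<tau>\<bar> \<le> min 1 (\<delta> / 2)" "\<And>i. i < n \<Longrightarrow> \<bar>c i - angle i\<bar> < \<rho>"
      "\<And>d. (\<And>i. i < n \<Longrightarrow> \<bar>d i - angle i\<bar> \<le> \<rho>) \<Longrightarrow> perimeter n (V \<tau>) d \<le> perimeter n (V \<tau>) c"
    have t: "\<bar>\<tau>\<bar> \<le> 1" "\<bar>\<tau> - 0\<bar> < \<delta>" using A(1) delta(1) by auto
    then have T: "\<tau> \<in> {-1..1}" by auto
    have c: "\<bar>c i - angle i\<bar> \<le> \<rho>" if "i < n" for i using A(2)[OF that] by simp
    have "perimeter n (V \<tau>) c \<in> length_spectrum (\<Omega> \<tau>)"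
      unfolding V_def
    proof (rule trajectory_in_spectrum[OF om(1)[OF T] om(2)[OF T] arc1[OF T] arc2[OF T] fr[OF T] sm A(2) A(3)[unfolded V_def]])
      fix i assume i: "i < n"
      obtain w where w: "w \<in> {0<..<1}"
        "ball ((1 - w) *\<^sub>R on_circle i (angle i) + w *\<^sub>R on_circle (Suc i mod n) (angle (Suc i mod n))) \<eta> \<subseteq> stadium a"
        using eta(2)[OF i] by blast
      have "(1 - w) *\<^sub>R vertex (\<gamma>1 \<tau>) (\<gamma>2 \<tau>) i (c i) + w *\<^sub>R vertex (\<gamma>1 \<tau>) (\<gamma>2 \<tau>) (Suc i mod n) (c (Suc i mod n)) \<notin> frontier (\<Omega> \<tau>)"
        by (rule side_avoids_frontier[OF arcs0 arc1[OF T] arc2[OF T] fr0 fr[OF T] sm rho(4) eta(1) _ _ c i w])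
           (use delta(2)[OF t] in blast)+
      then show "\<exists>w. 0 < w \<and> w < 1 \<and> (1 - w) *\<^sub>R vertex (\<gamma>1 \<tau>) (\<gamma>2 \<tau>) i (c i) +
          w *\<^sub>R vertex (\<gamma>1 \<tau>) (\<gamma>2 \<tau>) (Suc i mod n) (c (Suc i mod n)) \<notin> frontier (\<Omega> \<tau>)"
        using w(1) by (intro exI[of _ w]) simp
    qed
    moreover have "length_spectrum (\<Omega> \<tau>) = length_spectrum (stadium a)"
      using iso T unfolding dynamically_isospectral_def om0 by blast
    ultimately show "perimeter n (V \<tau>) c \<in> length_spectrum (stadium a)" by simp
  next
    show "\<not> {l..r} \<subseteq> length_spectrum (stadium a)" if "l < r" for l r
      using length_spectrum_no_interval[OF a that] by blast
  qed
  then obtain \<tau>\<^sub>0 where t0: "\<tau>\<^sub>0 > 0" "\<And>\<tau>. \<bar>\<tau>\<bar> \<le> \<tau>\<^sub>0 \<Longrightarrow> perimeter n (V \<tau>) angle \<le> perimeter n (V 0) angle" by blast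
  have Va: "V 0 i (angle i) = on_circle i (angle i)" if "i < n" for i by (rule V0[OF that]) (use rho(1) in simp)
  define w where "w = (\<lambda>i. if i < m\<^sub>2 then w2 (angle i) else w1 (pi - angle i))"
  have aS: "i < m\<^sub>2 \<Longrightarrow> angle i \<in> S_int" "\<not> i < m\<^sub>2 \<Longrightarrow> pi - angle i \<in> S_int" if "i < n" for i
    by (rule box[OF that], use rho(1) in simp_all)+
  have "(\<Sum>i<n. w i \<bullet> ((2 * sin (graze i)) *\<^sub>R unit_vec (angle i))) = 0"
  proof (rule first_variation_zero[OF n_pos(1) t0(1), where V = V and c = angle])
    show "perimeter n (V \<tau>) angle \<le> perimeter n (V 0) angle" if "\<bar>\<tau>\<bar> \<le> \<tau>\<^sub>0" for \<tau> by (rule t0(2)[OF that])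
    show "((\<lambda>\<tau>. V \<tau> i (angle i)) has_vector_derivative w i) (at 0)" if "i < n" for i
      using w2[OF aS(1)[OF that]] w1[OF aS(2)[OF that]] unfolding V_def vertex_def w_def by simp
    show "V 0 i (angle i) \<noteq> V 0 (Suc i mod n) (angle (Suc i mod n))" if "i < n" for i
    proof
      assume "V 0 i (angle i) = V 0 (Suc i mod n) (angle (Suc i mod n))"
      then have "side_length i *\<^sub>R unit_vec' (side_normal i) = 0"
        using dist_at_orbit[OF that] unfolding Va[OF that] Va[OF n_pos(2)] by simp
      then have "side_length i = 0 \<or> norm (unit_vec' (side_normal i)) = 0" by simp
      then show False using side_length_pos[of i] norm_unit_vec(2)[of "side_normal i"] by simp
    qed
    show "sgn (V 0 (Suc i mod n) (angle (Suc i mod n)) - V 0 i (angle i)) = unit_vec' (side_normal i)" if "i < n" for i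
      unfolding Va[OF that] Va[OF n_pos(2)] by (rule sgn_at_orbit[OF that])
    show "unit_vec' (side_normal i) - unit_vec' (side_normal (Suc i mod n)) =
      (2 * sin (graze (Suc i mod n))) *\<^sub>R unit_vec (angle (Suc i mod n))" if "i < n" for i
      by (rule unit_vec'_turn[OF that])
  qed
  moreover have "n = m\<^sub>2 + m\<^sub>1" by (simp add: n_def)
  ultimately have sum0: "(\<Sum>i<m\<^sub>2. w i \<bullet> ((2 * sin (graze i)) *\<^sub>R unit_vec (angle i))) +
      (\<Sum>j<m\<^sub>1. w (m\<^sub>2 + j) \<bullet> ((2 * sin (graze (m\<^sub>2 + j))) *\<^sub>R unit_vec (angle (m\<^sub>2 + j)))) = 0"
    by (simp only: sum_lessThan_add)
  \<comment> \<open>The jump vector points outward and the deformation is measured inward, hence the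
    minus sign; the common factor -2 disappears at the end.\<close>
  have right: "w i \<bullet> ((2 * sin (graze i)) *\<^sub>R unit_vec (angle i)) = - 2 * sin al2 * h2 ((2 * real i + 1 - real m\<^sub>2) * al2)"
    if "i < m\<^sub>2" for i
  proof -
    have "unit_vec (angle i) = - (- cos (angle i), - sin (angle i))" by (simp add: unit_vec_def)
    then have "w2 (angle i) \<bullet> unit_vec (angle i) = - h2 (angle i)" using that aS(1)[of i]
      by (simp only: h2 inner_minus_right n_def trans_less_add2)
    then show ?thesis using that by (simp add: w_def graze_def angle_def)
  qed
  have left: "w (m\<^sub>2 + j) \<bullet> ((2 * sin (graze (m\<^sub>2 + j))) *\<^sub>R unit_vec (angle (m\<^sub>2 + j))) = - 2 * sin al1 * h1 ((2 * real j + 1 - real m\<^sub>1) * al1)"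
    if "j < m\<^sub>1" for j
  proof -
    define s where "s = pi - angle (m\<^sub>2 + j)"
    have "unit_vec (angle (m\<^sub>2 + j)) = unit_vec (pi - s)" by (simp add: s_def)
    also have "\<dots> = - (cos s, - sin s)" by (simp add: unit_vec_def)
    finally have 0: "unit_vec (angle (m\<^sub>2 + j)) = - (cos s, - sin s)" .
    \<comment> \<open>On the left the parameters come in reverse order; evenness of
      \<open>h1\<close> repairs the sign.\<close>
    have "s = real m\<^sub>1 * al1 - (2 * real j + 1) * al1" unfolding al_mult by (simp add: s_def angle_def)
    then have 2: "s = - ((2 * real j + 1 - real m\<^sub>1) * al1)" by (simp add: algebra_simps)
    have sS: "s \<in> S_int" using aS(2)[of "m\<^sub>2 + j"] that by (simp add: s_def n_def)
    have 1: "w1 s \<bullet> unit_vec (angle (m\<^sub>2 + j)) = - h1 s" unfolding 0 h1[OF sS] by (rule inner_minus_right)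
    from sS have "h1 s = h1 ((2 * real j + 1 - real m\<^sub>1) * al1)" using even[of s] by (simp add: 2)
    then show ?thesis using 1 by (simp add: w_def graze_def s_def)
  qed
  have "(\<Sum>i<m\<^sub>2. - 2 * sin al2 * h2 ((2 * real i + 1 - real m\<^sub>2) * al2)) + (\<Sum>j<m\<^sub>1. - 2 * sin al1 * h1 ((2 * real j + 1 - real m\<^sub>1) * al1)) = 0"
  proof -
    have "(\<Sum>i<m\<^sub>2. w i \<bullet> ((2 * sin (graze i)) *\<^sub>R unit_vec (angle i))) = (\<Sum>i<m\<^sub>2. - 2 * sin al2 * h2 ((2 * real i + 1 - real m\<^sub>2) * al2))"
      by (rule sum.cong[OF HOL.refl]) (rule right, simp)
    moreover have "(\<Sum>j<m\<^sub>1. w (m\<^sub>2 + j) \<bullet> ((2 * sin (graze (m\<^sub>2 + j))) *\<^sub>R unit_vec (angle (m\<^sub>2 + j)))) = (\<Sum>j<m\<^sub>1. - 2 * sin al1 * h1 ((2 * real j + 1 - real m\<^sub>1) * al1))"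
      by (rule sum.cong[OF HOL.refl]) (rule left, simp)
    ultimately show ?thesis using sum0 by (simp only:)
  qed
  then have "- 2 * sin al2 * (\<Sum>i<m\<^sub>2. h2 ((2 * real i + 1 - real m\<^sub>2) * al2)) + - 2 * sin al1 * (\<Sum>j<m\<^sub>1. h1 ((2 * real j + 1 - real m\<^sub>1) * al1)) = 0"
    by (simp only: sum_distrib_left)
  then show ?thesis by linarith
qed

end

section \<open>Normal variations of isospectral families\<close>

lemma real_derivative_unique_S_int:
  assumes "(f has_real_derivative x) (at s within S_int)" "(f has_real_derivative y) (at s within S_int)" "s \<in> S_int"
  shows "x = y"
  using vector_derivative_S_int[of f x s] vector_derivative_S_int[of f y s] assms
  by (simp add: has_real_derivative_iff_has_vector_derivative)

lemma family_derivative_unique: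
  assumes "(f has_vector_derivative x) (at 0 within {-1..1})" "(g has_vector_derivative y) (at 0 within {-1..1})"
    "\<And>t. t \<in> {-1..1} \<Longrightarrow> f t = g t"
  shows "x = y"
proof -
  have "(f has_vector_derivative y) (at 0 within {-1..1})"
    by (rule has_vector_derivative_transform[OF _ _ assms(2)]) (use assms(3) in auto)
  then show ?thesis
    using vector_derivative_within_cbox[of "-1" 1 0 f x] vector_derivative_within_cbox[of "-1" 1 0 f y] assms(1) by simp
qed

lemma admissible_cong:
  assumes "admissible f" "\<And>s. s \<in> S_int \<Longrightarrow> f s = g s"
  shows "admissible g"
  unfolding admissible_def
proof (intro conjI ballI allI impI)
  show "diff_times 4 g" using assms diff_times_cong unfolding admissible_def by blast
  show "g (- s) = g s" if "s \<in> S_int" for s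
    using assms(1) assms(2)[OF that] assms(2)[OF uminus_S_int[OF that]] that by (simp add: admissible_def)
  show "g (pi/2) = 0" using assms(1) assms(2)[OF half_pi_in_S_int(1)] by (simp add: admissible_def)
  fix s h' assume s: "s \<in> {- (pi/2), pi/2}" and h: "(g has_real_derivative h') (at s within S_int)"
  have sS: "s \<in> S_int" using s half_pi_in_S_int by blast
  have "(f has_real_derivative h') (at s within S_int)"
    by (rule has_field_derivative_transform_within[OF h zero_less_one sS]) (simp add: assms(2))
  then show "h' = 0" using assms(1) s unfolding admissible_def by blast
qed

lemma admissible_zero_function: "admissible (\<lambda>s. 0)"
  unfolding admissible_def
proof (intro conjI ballI allI impI diff_times_const)
  fix s h' :: real assume "s \<in> {- (pi/2), pi/2}" "((\<lambda>s. 0) has_real_derivative h') (at s within S_int)"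
  then show "h' = 0" using real_derivative_unique_S_int[of "\<lambda>s. 0" h' s 0] half_pi_in_S_int by (metis DERIV_const empty_iff insert_iff)
qed auto

text \<open>The derivative of the product at the top end involves the value of \<open>w\<close>,
  which is 0, its vertical derivative, which is 0 by tangency, and its horizontal derivative times
  cos(pi/2) = 0. Evenness carries this to the bottom end.\<close>

lemma admissible_normal_variation:
  assumes C: "Cr_on 4 S_int w" and sym: "\<And>s. s \<in> S_int \<Longrightarrow> w (- s) = mirror (w s)"
    and e: "w (pi/2) = 0" "tangent_at_top w"
  shows "admissible (\<lambda>s. w s \<bullet> (- \<sigma> * cos s, - sin s))"
proof -
  define h where "h = (\<lambda>s. w s \<bullet> (- \<sigma> * cos s, - sin s))"
  have heq: "h s = fst (w s) * (- \<sigma> * cos s) + snd (w s) * (- sin s)" for s by (simp add: h_def inner_prod_def)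
  have even: "h (- s) = h s" if "s \<in> S_int" for s using sym[OF that] by (simp add: heq)
  have top: "h' = 0" if h': "(h has_real_derivative h') (at (pi/2) within S_int)" for h'
  proof -
    have S: "pi/2 \<in> S_int" by (simp add: S_int_mem)
    have dw: "(w has_vector_derivative nderiv 1 S_int w (pi/2)) (at (pi/2) within S_int)"
      using Cr_on_derivative[OF C _ S, of 0] by simp
    have d1: "((\<lambda>s. fst (w s)) has_real_derivative fst (nderiv 1 S_int w (pi/2))) (at (pi/2) within S_int)"
      unfolding has_real_derivative_iff_has_vector_derivative by (rule bounded_linear.has_vector_derivative[OF bounded_linear_fst dw])
    have d2: "((\<lambda>s. snd (w s)) has_real_derivative snd (nderiv 1 S_int w (pi/2))) (at (pi/2) within S_int)"
      unfolding has_real_derivative_iff_has_vector_derivative by (rule bounded_linear.has_vector_derivative[OF bounded_linear_snd dw])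
    have "((\<lambda>s. fst (w s) * (- \<sigma> * cos s) + snd (w s) * (- sin s)) has_real_derivative 0) (at (pi/2) within S_int)"
      using e unfolding tangent_at_top_def by (auto intro!: derivative_eq_intros d1 d2)
    then have "(h has_real_derivative 0) (at (pi/2) within S_int)" by (simp add: heq[abs_def])
    then show ?thesis using real_derivative_unique_S_int[OF h'] S by blast
  qed
  have "admissible h"
    unfolding admissible_def
  proof (intro conjI ballI allI impI)
    have "diff_times 4 (\<lambda>s. (w s \<bullet> (1, 0)) * (0 * sin s + (- \<sigma>) * cos s) + (w s \<bullet> (0, 1)) * ((-1) * sin s + 0 * cos s))"
      by (intro diff_times_add diff_times_mult Cr_on_diff_times_inner[OF C] diff_times_sin_cos)
    then show "diff_times 4 h" by (rule diff_times_cong[rotated]) (simp add: heq inner_prod_def)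
    show "h (- s) = h s" if "s \<in> S_int" for s by (rule even[OF that])
    show "h (pi/2) = 0" using e(1) by (simp add: h_def)
    fix s h' assume s: "s \<in> {- (pi/2), pi/2}" and h': "(h has_real_derivative h') (at s within S_int)"
    show "h' = 0"
    proof (cases "s = pi/2")
      case True then show ?thesis using top h' by blast
    next
      case False
      then have s: "s = - (pi/2)" using s by blast
      have im: "uminus ` S_int = S_int" using uminus_S_int by force
      have "(h has_real_derivative h') (at (- (pi/2)) within uminus ` S_int)" using h' unfolding s im .
      moreover have "(uminus has_real_derivative (-1)) (at (pi/2) within S_int)" by (auto intro!: derivative_eq_intros)
      ultimately have "((h \<circ> uminus) has_real_derivative h' * (-1)) (at (pi/2) within S_int)" by (rule DERIV_image_chain)
      then have "(h has_real_derivative h' * (-1)) (at (pi/2) within S_int)"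
        by (rule has_field_derivative_transform_within[OF _ zero_less_one]) (auto simp: even S_int_mem)
      from top[OF this] show ?thesis by simp
    qed
  qed
  then show ?thesis by (simp add: h_def)
qed

text \<open>Mirror symmetry, the fixed end and the horizontal tangent hold for every \<tau> and
  survive differentiation at \<tau> = 0; for the tangent this uses that derivatives in \<tau> and s
  commute.\<close>

lemma arc_family_variation:
  assumes C: "C1_into_Cr 4 {-1..1} S_int \<gamma>" and arc: "\<And>\<tau>. \<tau> \<in> {-1..1} \<Longrightarrow> is_arc_of \<sigma> a (\<Omega> \<tau>) (\<gamma> \<tau>)"
  shows "\<exists>w. (\<forall>s\<in>S_int. ((\<lambda>\<tau>. \<gamma> \<tau> s) has_vector_derivative w s) (at 0)) \<and>
    (\<forall>t\<in>{-1..1}. \<forall>\<epsilon>>0. \<exists>\<delta>>0. \<forall>\<tau>\<in>{-1..1}. \<bar>\<tau> - t\<bar> < \<delta> \<longrightarrow> (\<forall>s\<in>S_int. dist (\<gamma> \<tau> s) (\<gamma> t s) \<le> \<epsilon>)) \<and>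
    admissible (\<lambda>s. w s \<bullet> (- \<sigma> * cos s, - sin s))"
proof (rule C1_into_Cr_derivative[OF C])
  fix \<gamma>' assume g: "\<And>t. t \<in> {-1..1} \<Longrightarrow> Cr_on 4 S_int (\<gamma>' t)"
    "\<And>t k s. t \<in> {-1..1} \<Longrightarrow> k \<le> 4 \<Longrightarrow> s \<in> S_int \<Longrightarrow>
      ((\<lambda>\<tau>. nderiv k S_int (\<gamma> \<tau>) s) has_vector_derivative nderiv k S_int (\<gamma>' t) s) (at t within {-1..1})"
    "\<And>t \<epsilon>. t \<in> {-1..1} \<Longrightarrow> \<epsilon> > 0 \<Longrightarrow> \<exists>\<delta>>0. \<forall>\<tau>\<in>{-1..1}. \<bar>\<tau> - t\<bar> < \<delta> \<longrightarrow> (\<forall>s\<in>S_int. dist (\<gamma> \<tau> s) (\<gamma> t s) \<le> \<epsilon>)"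
  define w where "w = \<gamma>' 0"
  have z: "(0::real) \<in> {-1..1}" by simp
  have S: "pi/2 \<in> S_int" by (simp add: S_int_mem)
  have cs: "constant_speed_param (\<sigma> * a/2, -1) (\<sigma> * a/2, 1) (side_arc \<sigma> a (\<Omega> \<tau>)) (\<gamma> \<tau>)"
    and sym: "s \<in> S_int \<Longrightarrow> \<gamma> \<tau> (- s) = mirror (\<gamma> \<tau> s)" and tan: "tangent_at_top (\<gamma> \<tau>)" if "\<tau> \<in> {-1..1}" for \<tau> s
    using arc[OF that] unfolding is_arc_of_def by blast+
  have d0: "((\<lambda>\<tau>. \<gamma> \<tau> s) has_vector_derivative w s) (at 0 within {-1..1})" if "s \<in> S_int" for s
    using g(2)[OF z _ that, of 0] by (simp add: w_def)
  have "w (- s) = mirror (w s)" if s: "s \<in> S_int" for s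
    by (rule family_derivative_unique[OF d0[OF uminus_S_int[OF s]]
          bounded_linear.has_vector_derivative[OF bounded_linear_mirror d0[OF s]]]) (rule sym[OF _ s])
  moreover have "w (pi/2) = 0"
    by (rule family_derivative_unique[OF d0[OF S] has_vector_derivative_const]) (rule constant_speed_paramD(4)[OF cs])
  moreover have "snd (nderiv 1 S_int w (pi/2)) = 0"
  proof (rule family_derivative_unique[OF bounded_linear.has_vector_derivative[OF bounded_linear_snd] has_vector_derivative_const])
    show "((\<lambda>\<tau>. nderiv 1 S_int (\<gamma> \<tau>) (pi/2)) has_vector_derivative nderiv 1 S_int w (pi/2)) (at 0 within {-1..1})"
      using g(2)[OF z _ S, of 1] by (simp add: w_def)
    show "snd (nderiv 1 S_int (\<gamma> \<tau>) (pi/2)) = 0" if "\<tau> \<in> {-1..1}" for \<tau>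
      using tan[OF that] by (simp add: tangent_at_top_def)
  qed
  ultimately have "admissible (\<lambda>s. w s \<bullet> (- \<sigma> * cos s, - sin s))"
    using g(1)[OF z] by (intro admissible_normal_variation) (auto simp: w_def tangent_at_top_def)
  moreover have "((\<lambda>\<tau>. \<gamma> \<tau> s) has_vector_derivative w s) (at 0)" if "s \<in> S_int" for s
    using d0[OF that] by (simp add: at_within_Icc_at)
  ultimately show "\<exists>w. (\<forall>s\<in>S_int. ((\<lambda>\<tau>. \<gamma> \<tau> s) has_vector_derivative w s) (at 0)) \<and>
    (\<forall>t\<in>{-1..1}. \<forall>\<epsilon>>0. \<exists>\<delta>>0. \<forall>\<tau>\<in>{-1..1}. \<bar>\<tau> - t\<bar> < \<delta> \<longrightarrow> (\<forall>s\<in>S_int. dist (\<gamma> \<tau> s) (\<gamma> t s) \<le> \<epsilon>)) \<and>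
    admissible (\<lambda>s. w s \<bullet> (- \<sigma> * cos s, - sin s))"
    by (intro exI[of _ w] conjI ballI allI impI g(3))
qed

text \<open>At \<tau> = 0 the arcs are the semicircles and the inward normals are radial, so the
  abstract \<open>deformation\<close> becomes the explicit product studied above, and all linear
  constraints on it are available.\<close>

lemma deformation_of_isospectral_family:
  assumes a: "a > 0" and fam: "C1_family 4 a \<Omega> \<gamma>1 \<gamma>2" and om0: "\<Omega> 0 = stadium a" and iso: "dynamically_isospectral \<Omega>"
  defines "h1 \<equiv> \<lambda>s. deformation \<Omega> \<gamma>1 \<gamma>2 (Inl s)" and "h2 \<equiv> \<lambda>s. deformation \<Omega> \<gamma>1 \<gamma>2 (Inr s)"
  shows "admissible h1" "admissible h2" "m\<^sub>1 \<ge> 2 \<Longrightarrow> m\<^sub>2 \<ge> 2 \<Longrightarrow> orbit_condition a h1 h2 m\<^sub>1 m\<^sub>2 \<beta>"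
proof -
  have z: "(0::real) \<in> {-1..1}" by simp
  have F: "open (\<Omega> \<tau>)" "convex (\<Omega> \<tau>)" "is_arc_of (-1) a (\<Omega> \<tau>) (\<gamma>1 \<tau>)" "is_arc_of 1 a (\<Omega> \<tau>) (\<gamma>2 \<tau>)"
    "frontier (\<Omega> \<tau>) = E_top a \<union> E_bot a \<union> side_arc (-1) a (\<Omega> \<tau>) \<union> side_arc 1 a (\<Omega> \<tau>)"
    if T: "\<tau> \<in> {-1..1}" for \<tau>
  proof -
    have "\<exists>\<Gamma>1 \<Gamma>2. M_class_arcs 4 a (\<Omega> \<tau>) \<Gamma>1 \<Gamma>2 \<and>
           constant_speed_param (-a/2, -1) (-a/2, 1) \<Gamma>1 (\<gamma>1 \<tau>) \<and>
           constant_speed_param (a/2, -1) (a/2, 1) \<Gamma>2 (\<gamma>2 \<tau>)"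
      by (rule fam[unfolded C1_family_def, THEN conjunct1, THEN bspec, OF T, THEN conjunct2])
    then obtain \<Gamma>1 \<Gamma>2 where M: "M_class_arcs 4 a (\<Omega> \<tau>) \<Gamma>1 \<Gamma>2"
      "constant_speed_param (-a/2, -1) (-a/2, 1) \<Gamma>1 (\<gamma>1 \<tau>)" "constant_speed_param (a/2, -1) (a/2, 1) \<Gamma>2 (\<gamma>2 \<tau>)"
      by (elim exE conjE) (rule that)
    show "open (\<Omega> \<tau>)" "convex (\<Omega> \<tau>)" using M(1) by (simp_all add: M_class_arcs_def)
    show "is_arc_of (-1) a (\<Omega> \<tau>) (\<gamma>1 \<tau>)" "is_arc_of 1 a (\<Omega> \<tau>) (\<gamma>2 \<tau>)"
      "frontier (\<Omega> \<tau>) = E_top a \<union> E_bot a \<union> side_arc (-1) a (\<Omega> \<tau>) \<union> side_arc 1 a (\<Omega> \<tau>)"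
      by (rule M_class_arc_facts[OF a M])+
  qed
  have C: "C1_into_Cr 4 {-1..1} S_int \<gamma>1" "C1_into_Cr 4 {-1..1} S_int \<gamma>2"     using fam by (simp_all add: C1_family_def)
  have "\<exists>w. (\<forall>s\<in>S_int. ((\<lambda>\<tau>. \<gamma>1 \<tau> s) has_vector_derivative w s) (at 0)) \<and>
    (\<forall>t\<in>{-1..1}. \<forall>\<epsilon>>0. \<exists>\<delta>>0. \<forall>\<tau>\<in>{-1..1}. \<bar>\<tau> - t\<bar> < \<delta> \<longrightarrow> (\<forall>s\<in>S_int. dist (\<gamma>1 \<tau> s) (\<gamma>1 t s) \<le> \<epsilon>)) \<and>
    admissible (\<lambda>s. w s \<bullet> (- (-1) * cos s, - sin s))"
    by (rule arc_family_variation[OF C(1)]) (rule F(3))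
  then obtain w1 where w1': "(\<forall>s\<in>S_int. ((\<lambda>\<tau>. \<gamma>1 \<tau> s) has_vector_derivative w1 s) (at 0)) \<and>
    (\<forall>t\<in>{-1..1}. \<forall>\<epsilon>>0. \<exists>\<delta>>0. \<forall>\<tau>\<in>{-1..1}. \<bar>\<tau> - t\<bar> < \<delta> \<longrightarrow> (\<forall>s\<in>S_int. dist (\<gamma>1 \<tau> s) (\<gamma>1 t s) \<le> \<epsilon>)) \<and>
    admissible (\<lambda>s. w1 s \<bullet> (- (-1) * cos s, - sin s))" by (rule exE)
  note w1 = conjunct1[OF w1', rule_format] conjunct1[OF conjunct2[OF w1'], rule_format] conjunct2[OF conjunct2[OF w1']]
  have "\<exists>w. (\<forall>s\<in>S_int. ((\<lambda>\<tau>. \<gamma>2 \<tau> s) has_vector_derivative w s) (at 0)) \<and>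
    (\<forall>t\<in>{-1..1}. \<forall>\<epsilon>>0. \<exists>\<delta>>0. \<forall>\<tau>\<in>{-1..1}. \<bar>\<tau> - t\<bar> < \<delta> \<longrightarrow> (\<forall>s\<in>S_int. dist (\<gamma>2 \<tau> s) (\<gamma>2 t s) \<le> \<epsilon>)) \<and>
    admissible (\<lambda>s. w s \<bullet> (- 1 * cos s, - sin s))"
    by (rule arc_family_variation[OF C(2)]) (rule F(4))
  then obtain w2 where w2': "(\<forall>s\<in>S_int. ((\<lambda>\<tau>. \<gamma>2 \<tau> s) has_vector_derivative w2 s) (at 0)) \<and>
    (\<forall>t\<in>{-1..1}. \<forall>\<epsilon>>0. \<exists>\<delta>>0. \<forall>\<tau>\<in>{-1..1}. \<bar>\<tau> - t\<bar> < \<delta> \<longrightarrow> (\<forall>s\<in>S_int. dist (\<gamma>2 \<tau> s) (\<gamma>2 t s) \<le> \<epsilon>)) \<and>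
    admissible (\<lambda>s. w2 s \<bullet> (- 1 * cos s, - sin s))" by (rule exE)
  note w2 = conjunct1[OF w2', rule_format] conjunct1[OF conjunct2[OF w2'], rule_format] conjunct2[OF conjunct2[OF w2']]
  have arcs0: "is_arc_of (-1) a (stadium a) (\<gamma>1 0)" "is_arc_of 1 a (stadium a) (\<gamma>2 0)"
    using F(3,4)[OF z] by (simp_all add: om0)
  have h1: "h1 s = w1 s \<bullet> (cos s, - sin s)" if s: "s \<in> S_int" for s
    using s stadium_inward_normal[OF a _ arcs0(1) s] vector_derivative_at[OF w1(1)[OF s]]
    by (simp add: h1_def deformation_def om0 InlI)
  have h2: "h2 s = w2 s \<bullet> (- cos s, - sin s)" if s: "s \<in> S_int" for s
    using s stadium_inward_normal[OF a _ arcs0(2) s] vector_derivative_at[OF w2(1)[OF s]]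
    by (simp add: h2_def deformation_def om0 InrI)
  show ad1: "admissible h1" by (rule admissible_cong[OF w1(3)]) (simp add: h1)
  show "admissible h2" by (rule admissible_cong[OF w2(3)]) (simp add: h2)
  assume m: "m\<^sub>1 \<ge> 2" "m\<^sub>2 \<ge> 2"
  show "orbit_condition a h1 h2 m\<^sub>1 m\<^sub>2 \<beta>"
    unfolding orbit_condition_def
  proof
    assume "0 \<le> \<beta> \<and> \<beta> < pi/2 \<and> \<beta> < (pi/2 + \<beta>) / real m\<^sub>2 \<and> a * sin \<beta> = cos ((pi/2 + \<beta>) / real m\<^sub>2) - cos ((pi/2 - \<beta>) / real m\<^sub>1)"
    then interpret stadium_orbit a \<beta> m\<^sub>1 m\<^sub>2 using a m by unfold_locales auto
    show "sin ((pi/2 - \<beta>) / real m\<^sub>1) * (\<Sum>j<m\<^sub>1. h1 ((2 * real j + 1 - real m\<^sub>1) * ((pi/2 - \<beta>) / real m\<^sub>1))) +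
     sin ((pi/2 + \<beta>) / real m\<^sub>2) * (\<Sum>j<m\<^sub>2. h2 ((2 * real j + 1 - real m\<^sub>2) * ((pi/2 + \<beta>) / real m\<^sub>2))) = 0"
      unfolding al1_def[symmetric] al2_def[symmetric]
    proof (rule orbit_condition_of_isospectral_family[OF F(1,2,5,3,4) om0 iso w1(2) w2(2) w1(1) w2(1) h1 h2])
      show "h1 (- s) = h1 s" if "s \<in> S_int" for s using ad1 that unfolding admissible_def by blast
    qed
  qed
qed

lemma orbit_condition_add:
  assumes "orbit_condition a f1 f2 m\<^sub>1 m\<^sub>2 \<beta>" "orbit_condition a g1 g2 m\<^sub>1 m\<^sub>2 \<beta>"
  shows "orbit_condition a (\<lambda>s. f1 s + g1 s) (\<lambda>s. f2 s + g2 s) m\<^sub>1 m\<^sub>2 \<beta>"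
  using assms unfolding orbit_condition_def sum.distrib distrib_left by linarith

lemma orbit_condition_scale:
  assumes "orbit_condition a f1 f2 m\<^sub>1 m\<^sub>2 \<beta>"
  shows "orbit_condition a (\<lambda>s. c * f1 s) (\<lambda>s. c * f2 s) m\<^sub>1 m\<^sub>2 \<beta>"
proof -
  have "x * (c * y) + x' * (c * y') = c * (x * y + x' * y')" for x x' y y' :: real by (simp add: algebra_simps)
  then show ?thesis using assms unfolding orbit_condition_def sum_distrib_left[symmetric] by simp
qed

theorem theorem1p2:
  fixes a :: real
  assumes "a > 0"
  shows "\<exists>B. finite B \<and>
    span {deformation \<Omega> \<gamma>1 \<gamma>2 | \<Omega> \<gamma>1 \<gamma>2.
            C1_family 4 a \<Omega> \<gamma>1 \<gamma>2 \<and> \<Omega> 0 = stadium a \<and> dynamically_isospectral \<Omega>}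
    = span B"
proof -
  \<comment> \<open>\<open>V\<close> collects the linear constraints that isospectrality imposes. It
    is a subspace, although the set of isospectral deformations is not shown to be one.\<close>
  define V :: "(real + real \<Rightarrow> real) set" where
    "V = {z. (\<forall>x. x \<notin> S_int <+> S_int \<longrightarrow> z x = 0) \<and> admissible (\<lambda>s. z (Inl s)) \<and> admissible (\<lambda>s. z (Inr s)) \<and>
       (\<forall>m\<^sub>1\<ge>2. \<forall>m\<^sub>2\<ge>2. \<forall>\<beta>. orbit_condition a (\<lambda>s. z (Inl s)) (\<lambda>s. z (Inr s)) m\<^sub>1 m\<^sub>2 \<beta>)}"
  have sub: "subspace V"
    unfolding subspace_def
  proof (intro conjI ballI allI)
    show "0 \<in> V" using admissible_zero_function by (simp add: V_def orbit_condition_def)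
    show "x + y \<in> V" if "x \<in> V" "y \<in> V" for x y
      using that unfolding V_def mem_Collect_eq plus_fun_apply
      by (elim conjE, intro conjI allI impI) (simp_all add: admissible_add orbit_condition_add)
    show "c *\<^sub>R x \<in> V" if "x \<in> V" for c x
      using that unfolding V_def mem_Collect_eq scaleR_fun_def real_scaleR_def
      by (elim conjE, intro conjI allI impI) (simp_all add: admissible_scale orbit_condition_scale)
  qed
  obtain K where K: "\<And>h1 h2. admissible h1 \<Longrightarrow> admissible h2 \<Longrightarrow> (\<forall>m\<^sub>1\<ge>2. \<forall>m\<^sub>2\<ge>2. \<forall>\<beta>. orbit_condition a h1 h2 m\<^sub>1 m\<^sub>2 \<beta>) \<Longrightarrow>
     (\<forall>k\<le>K. fcos h1 k = 0 \<and> fcos h2 k = 0) \<Longrightarrow> (\<forall>s\<in>S_int. h1 s = 0 \<and> h2 s = 0)"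
    using admissible_pair_determined_by_low_modes[OF assms] by blast
  \<comment> \<open>These are 2 (K + 1) functionals: indices up to \<open>K\<close> read the modes
    of the left arc, the next K + 1 those of the right arc.\<close>
  define \<phi> :: "nat \<Rightarrow> (real + real \<Rightarrow> real) \<Rightarrow> real" where
    "\<phi> k z = (if k \<le> K then fcos (\<lambda>s. z (Inl s)) k else fcos (\<lambda>s. z (Inr s)) (k - (K + 1)))" for k z
  have "\<exists>B. finite B \<and> V \<subseteq> span B"
  proof (rule finite_spanning_set_of_separating_functionals[OF sub, of "2 * K + 2" \<phi>])
    fix k x y c assume x: "x \<in> V"
    show "\<phi> k (c *\<^sub>R x) = c * \<phi> k x" by (simp add: \<phi>_def scaleR_fun_def fcos_mult)
    assume "y \<in> V"
    then show "\<phi> k (x + y) = \<phi> k x + \<phi> k y"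
      using x by (simp add: \<phi>_def V_def fcos_add admissible_continuous)
  next
    fix z assume z: "z \<in> V" and 0: "\<And>k. k < 2 * K + 2 \<Longrightarrow> \<phi> k z = 0"
    have "fcos (\<lambda>s. z (Inl s)) k = 0 \<and> fcos (\<lambda>s. z (Inr s)) k = 0" if "k \<le> K" for k
      using 0[of k] 0[of "k + (K + 1)"] that by (simp add: \<phi>_def)
    moreover have "admissible (\<lambda>s. z (Inl s))" "admissible (\<lambda>s. z (Inr s))"
      "\<forall>m\<^sub>1\<ge>2. \<forall>m\<^sub>2\<ge>2. \<forall>\<beta>. orbit_condition a (\<lambda>s. z (Inl s)) (\<lambda>s. z (Inr s)) m\<^sub>1 m\<^sub>2 \<beta>"
      and supp: "\<And>x. x \<notin> S_int <+> S_int \<Longrightarrow> z x = 0"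
      using z by (simp_all add: V_def)
    ultimately have "\<forall>s\<in>S_int. z (Inl s) = 0 \<and> z (Inr s) = 0" by (intro K) simp_all
    then have "z x = 0" for x using supp[of x] by (cases "x \<in> S_int <+> S_int") auto
    then show "z = 0" by (simp add: fun_eq_iff)
  qed
  then obtain B where B: "finite B" "V \<subseteq> span B" by blast
  have "{deformation \<Omega> \<gamma>1 \<gamma>2 | \<Omega> \<gamma>1 \<gamma>2. C1_family 4 a \<Omega> \<gamma>1 \<gamma>2 \<and> \<Omega> 0 = stadium a \<and> dynamically_isospectral \<Omega>} \<subseteq> V"
  proof
    fix z assume "z \<in> {deformation \<Omega> \<gamma>1 \<gamma>2 | \<Omega> \<gamma>1 \<gamma>2. C1_family 4 a \<Omega> \<gamma>1 \<gamma>2 \<and> \<Omega> 0 = stadium a \<and> dynamically_isospectral \<Omega>}"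
    then obtain \<Omega> \<gamma>1 \<gamma>2 where z: "z = deformation \<Omega> \<gamma>1 \<gamma>2"
      and fam: "C1_family 4 a \<Omega> \<gamma>1 \<gamma>2" "\<Omega> 0 = stadium a" "dynamically_isospectral \<Omega>"
      by blast
    show "z \<in> V"
      unfolding V_def mem_Collect_eq z
    proof (intro conjI allI impI)
      show "deformation \<Omega> \<gamma>1 \<gamma>2 x = 0" if "x \<notin> S_int <+> S_int" for x using that by (simp add: deformation_def)
    qed (use deformation_of_isospectral_family[OF assms fam] in blast)+
  qed
  then show ?thesis using span_subset_finite_span[OF B(1)] B(2) by (meson order.trans)
qed

end
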